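(* Let $M$ be a manifold of dimension $n$ endowed with a transversely holomorphic foliation $\mathcal{F}$ of complex codimension $q$. Assume that the basic Dolbeault cohomology of $\mathcal{F}$ is finite dimensional. Then for every $k\in\mathbb{N}$ the following inequality holds: $$\sum_{r+s=k}\Big(\dim_{\mathbb{C}}H^{r,s}_{BC}(M/\mathcal{F})+\dim_{\mathbb{C}}H^{r,s}_{A}(M/\mathcal{F})\Big)\ \geq\ 2\dim_{\mathbb{C}}H^k(M/\mathcal{F},\mathbb{C}).$$ Furthermore, equality holds for every $k\in\mathbb{N}$ if and only if $\mathcal{F}$ satisfies the $\partial\bar\partial$-lemma.
   Context: A foliation $\mathcal{F}$ on $M$ is given by an open cover $\{U_i\}$ of $M$, submersions $f_i:U_i\to T_0$ with connected fibres, and local diffeomorphisms $\gamma_{ij}$ of $T_0$ with $f_j=\gamma_{ij}\circ f_i$ on $U_i\cap U_j$. Put $T=\coprod_i f_i(U_i)$ (the transverse manifold), and let $\Gamma$ be the pseudogroup on $T$ generated by the $\gamma_{ij}$. $\mathcal{F}$ is transversely holomorphic if $T$ admits a complex structure making all $\gamma_{ij}$ holomorphic; its complex codimension is $\dim_{\mathbb{C}}T$. A (complex valued) form $\alpha$ on $M$ is basic if $i_X\alpha=i_Xd\alpha=0$ for every vector field $X$ tangent to the leaves; basic forms correspond to $\Gamma$-invariant forms on $T$. The complex of basic complex valued forms is $\Omega^{\bullet}(M/\mathcal{F},\mathbb{C})$ with differential $d$, and its cohomology is the basic cohomology $H^{\bullet}(M/\mathcal{F},\mathbb{C})$. The transverse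 complex structure gives a decomposition into basic forms $\Omega^{r,s}(M/\mathcal{F},\mathbb{C})$ of type $(r,s)$ and $d=\partial+\bar\partial$ with $\partial,\bar\partial$ of bidegree $(1,0)$, $(0,1)$; this is the basic Dolbeault double complex. The basic Dolbeault cohomology is $H^{\bullet,\bullet}_{\bar\partial}(M/\mathcal{F})=\mathrm{Ker}(\bar\partial)/\mathrm{Im}(\bar\partial)$. The basic Bott–Chern and Aeppli cohomologies are $$H^{\bullet,\bullet}_{BC}(M/\mathcal{F})=\frac{\mathrm{Ker}(\partial)\cap\mathrm{Ker}(\bar\partial)}{\mathrm{Im}(\partial\bar\partial)},\qquad H^{\bullet,\bullet}_{A}(M/\mathcal{F})=\frac{\mathrm{Ker}(\partial\bar\partial)}{\mathrm{Im}(\partial)+\mathrm{Im}(\bar\partial)}.$$ $\mathcal{F}$ satisfies the $\partial\bar\partial$-lemma if, on basic complex valued forms, $\mathrm{Ker}(\partial)\cap\mathrm{Ker}(\bar\partial)\cap\mathrm{Im}(d)=\mathrm{Im}(\partial\bar\partial)$. *)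

theory Defs
  imports
    "HOL-Analysis.Analysis"
    "HOL-Library.Function_Algebras"
    "HOL-Library.Extended_Nat"
    "HOL-Combinatorics.Permutations"
begin

section \<open>Smooth manifolds\<close>

text \<open>
  Euclidean spaces are represented by finite-dimensional types of class \<open>real_inner\<close>; unlike
  \<open>euclidean_space\<close> this class has types of dimension 0, so that manifolds of dimension 0 and
  foliations of codimension 0 are included.
\<close>

definition has_dimension :: "'v::real_vector itself \<Rightarrow> nat \<Rightarrow> bool" where
  "has_dimension _ n \<longleftrightarrow>
     (\<exists>B::'v set. finite B \<and> independent B \<and> span B = UNIV \<and> card B = n)"

primrec C_k_on :: "nat \<Rightarrow> ('a::real_normed_vector \<Rightarrow> 'b::real_normed_vector) \<Rightarrow> 'a set \<Rightarrow> bool" where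
  "C_k_on 0 f S \<longleftrightarrow> continuous_on S f"
| "C_k_on (Suc k) f S \<longleftrightarrow>
     (\<forall>x\<in>S. f differentiable (at x)) \<and> (\<forall>v. C_k_on k (\<lambda>x. frechet_derivative f (at x) v) S)"

definition smooth_on :: "('a::real_normed_vector \<Rightarrow> 'b::real_normed_vector) \<Rightarrow> 'a set \<Rightarrow> bool" where
  "smooth_on f S \<longleftrightarrow> (\<forall>k. C_k_on k f S)"

text \<open>A chart is a pair of its domain and its coordinate map.\<close>

type_synonym ('m, 'v) chart = "'m set \<times> ('m \<Rightarrow> 'v)"

definition in_charts ::
  "('m, 'v) chart \<Rightarrow> ('n, 'w) chart \<Rightarrow> ('m \<Rightarrow> 'n) \<Rightarrow> 'v \<Rightarrow> 'w" where
  "in_charts c c' f = snd c' \<circ> f \<circ> inv_into (fst c) (snd c)"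

abbreviation transition :: "('m, 'v) chart \<Rightarrow> ('m, 'w) chart \<Rightarrow> 'v \<Rightarrow> 'w" where
  "transition c c' \<equiv> in_charts c c' id"

definition is_chart :: "'m topology \<Rightarrow> ('m, 'v::real_normed_vector) chart \<Rightarrow> bool" where
  "is_chart X c \<longleftrightarrow> openin X (fst c) \<and> open (snd c ` fst c) \<and>
     homeomorphic_map (subtopology X (fst c)) (top_of_set (snd c ` fst c)) (snd c)"

definition smooth_atlas :: "'m topology \<Rightarrow> ('m, 'v::real_normed_vector) chart set \<Rightarrow> bool" where
  "smooth_atlas X A \<longleftrightarrow>
     (\<forall>c\<in>A. is_chart X c) \<and> (\<Union>c\<in>A. fst c) = topspace X \<and>
     (\<forall>c\<in>A. \<forall>c'\<in>A. smooth_on (transition c c') (snd c ` (fst c \<inter> fst c')))"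

definition smooth_manifold ::
  "nat \<Rightarrow> 'm topology \<Rightarrow> ('m, 'v::real_inner) chart set \<Rightarrow> bool" where
  "smooth_manifold n X A \<longleftrightarrow>
     has_dimension TYPE('v) n \<and> Hausdorff_space X \<and> second_countable X \<and> smooth_atlas X A"

definition smooth_map_on ::
  "'m topology \<Rightarrow> ('m, 'v::real_normed_vector) chart set \<Rightarrow>
   'n topology \<Rightarrow> ('n, 'w::real_normed_vector) chart set \<Rightarrow> 'm set \<Rightarrow> ('m \<Rightarrow> 'n) \<Rightarrow> bool" where
  "smooth_map_on X A Y B S f \<longleftrightarrow>
     openin X S \<and> continuous_map (subtopology X S) Y f \<and>
     (\<forall>c\<in>A. \<forall>c'\<in>B. smooth_on (in_charts c c' f) (snd c ` {x \<in> S \<inter> fst c. f x \<in> fst c'}))"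

definition submersion_on ::
  "'m topology \<Rightarrow> ('m, 'v::real_normed_vector) chart set \<Rightarrow>
   'n topology \<Rightarrow> ('n, 'w::real_normed_vector) chart set \<Rightarrow> 'm set \<Rightarrow> ('m \<Rightarrow> 'n) \<Rightarrow> bool" where
  "submersion_on X A Y B S f \<longleftrightarrow>
     smooth_map_on X A Y B S f \<and>
     (\<forall>c\<in>A. \<forall>c'\<in>B. \<forall>x \<in> S \<inter> fst c. f x \<in> fst c' \<longrightarrow>
        surj (frechet_derivative (in_charts c c' f) (at (snd c x))))"

definition diffeomorphism_on ::
  "'n topology \<Rightarrow> ('n, 'w::real_normed_vector) chart set \<Rightarrow> 'n set \<Rightarrow> 'n set \<Rightarrow> ('n \<Rightarrow> 'n) \<Rightarrow> bool" where
  "diffeomorphism_on Y B S S' g \<longleftrightarrow>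
     bij_betw g S S' \<and> smooth_map_on Y B Y B S g \<and> smooth_map_on Y B Y B S' (inv_into S g)"


section \<open>Complex structures\<close>

text \<open>
  \<open>J\<close> is multiplication by the imaginary unit, which makes \<open>'w\<close> a complex vector space of
  complex dimension \<open>q\<close>.
\<close>

definition complex_space :: "nat \<Rightarrow> ('w::real_inner \<Rightarrow> 'w) \<Rightarrow> bool" where
  "complex_space q J \<longleftrightarrow>
     has_dimension TYPE('w) (2 * q) \<and> linear J \<and> (\<forall>w. J (J w) = - w)"

definition holomorphic_wrt ::
  "('w::real_normed_vector \<Rightarrow> 'w) \<Rightarrow> ('w \<Rightarrow> 'w) \<Rightarrow> 'w set \<Rightarrow> bool" where
  "holomorphic_wrt J h S \<longleftrightarrow>
     (\<forall>z\<in>S. \<exists>D. (h has_derivative D) (at z) \<and> (\<forall>w. D (J w) = J (D w)))"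

text \<open>A complex structure on the open submanifold \<open>S\<close> of \<open>(Y, B)\<close>, inducing its smooth structure.\<close>

definition complex_structure_on ::
  "('w::real_inner \<Rightarrow> 'w) \<Rightarrow> 'n topology \<Rightarrow> ('n, 'w) chart set \<Rightarrow> 'n set \<Rightarrow>
   ('n, 'w) chart set \<Rightarrow> bool" where
  "complex_structure_on J Y B S C \<longleftrightarrow>
     smooth_atlas Y (B \<union> C) \<and> (\<Union>c\<in>C. fst c) = S \<and>
     (\<forall>c\<in>C. \<forall>c'\<in>C. holomorphic_wrt J (transition c c') (snd c ` (fst c \<inter> fst c')))"


section \<open>Transversely holomorphic foliations\<close>

text \<open>
  The data of a foliated manifold: the manifold \<open>man\<close>, the open cover \<open>cov\<close> indexed by \<open>indices\<close>,
  the submersions \<open>subm i\<close> to \<open>tman\<close> and the maps \<open>gam i j\<close> between open subsets of \<open>tman\<close>.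
  The transverse manifold is the disjoint union of the images \<open>subm i ` cov i\<close>, so a complex
  structure on it is a family \<open>hol_atlas i\<close> of complex structures on these images, with charts
  in the complex vector space \<open>('w, cmult_i)\<close>.
\<close>

record ('m, 'v, 't, 'w, 'i) foliation_data =
  man :: "'m topology"
  man_atlas :: "('m, 'v) chart set"
  tman :: "'t topology"
  tman_atlas :: "('t, 'w) chart set"
  indices :: "'i set"
  cov :: "'i \<Rightarrow> 'm set"
  subm :: "'i \<Rightarrow> 'm \<Rightarrow> 't"
  gam :: "'i \<Rightarrow> 'i \<Rightarrow> 't \<Rightarrow> 't"
  cmult_i :: "'w \<Rightarrow> 'w"
  hol_atlas :: "'i \<Rightarrow> ('t, 'w) chart set"

text \<open>\<open>d\<close> is the real codimension.\<close>

definition foliation ::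
  "nat \<Rightarrow> nat \<Rightarrow> ('m, 'v::real_inner, 't, 'w::real_inner, 'i) foliation_data \<Rightarrow> bool" where
  "foliation n d F \<longleftrightarrow>
     smooth_manifold n (man F) (man_atlas F) \<and>
     smooth_manifold d (tman F) (tman_atlas F) \<and>
     (\<Union>i\<in>indices F. cov F i) = topspace (man F) \<and>
     (\<forall>i\<in>indices F.
        openin (man F) (cov F i) \<and>
        submersion_on (man F) (man_atlas F) (tman F) (tman_atlas F) (cov F i) (subm F i) \<and>
        (\<forall>t. connectedin (man F) {x \<in> cov F i. subm F i x = t})) \<and>
     (\<forall>i\<in>indices F. \<forall>j\<in>indices F.
        diffeomorphism_on (tman F) (tman_atlas F)
          (subm F i ` (cov F i \<inter> cov F j)) (subm F j ` (cov F i \<inter> cov F j)) (gam F i j) \<and>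
        (\<forall>x \<in> cov F i \<inter> cov F j. subm F j x = gam F i j (subm F i x)))"

definition transversely_holomorphic_foliation ::
  "nat \<Rightarrow> nat \<Rightarrow> ('m, 'v::real_inner, 't, 'w::real_inner, 'i) foliation_data \<Rightarrow> bool" where
  "transversely_holomorphic_foliation n q F \<longleftrightarrow>
     foliation n (2 * q) F \<and>
     complex_space q (cmult_i F) \<and>
     (\<forall>i\<in>indices F.
        complex_structure_on (cmult_i F) (tman F) (tman_atlas F)
          (subm F i ` cov F i) (hol_atlas F i)) \<and>
     (\<forall>i\<in>indices F. \<forall>j\<in>indices F. \<forall>c\<in>hol_atlas F i. \<forall>c'\<in>hol_atlas F j.
        holomorphic_wrt (cmult_i F) (in_charts c c' (gam F i j))
          (snd c ` {t \<in> subm F i ` (cov F i \<inter> cov F j) \<inter> fst c. gam F i j t \<in> fst c'}))"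


section \<open>Complex valued differential forms\<close>

text \<open>
  A form \<open>\<alpha>\<close>, not necessarily homogeneous, is given by its coordinate expressions:
  \<open>\<alpha> c y [v\<^sub>1, \<dots>, v\<^sub>k]\<close> is the value on \<open>v\<^sub>1, \<dots>, v\<^sub>k\<close> of the component of degree \<open>k\<close>, in the chart
  \<open>c\<close> at the point with coordinates \<open>y\<close>. Where this makes no sense the value is 0, so that
  equality of forms is equality of functions. The group structure of forms is the pointwise one.
\<close>

type_synonym ('m, 'v) form = "('m, 'v) chart \<Rightarrow> 'v \<Rightarrow> 'v list \<Rightarrow> complex"

definition alternating_form :: "('v::real_vector list \<Rightarrow> complex) \<Rightarrow> bool" where
  "alternating_form a \<longleftrightarrow>
     (\<forall>vs. \<forall>i < length vs. linear (\<lambda>w. a (vs[i := w]))) \<and>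
     (\<forall>vs. \<forall>j < length vs. \<forall>i < j. vs ! i = vs ! j \<longrightarrow> a vs = 0)"

definition forms :: "('m, 'v::real_normed_vector) chart set \<Rightarrow> ('m, 'v) form set" where
  "forms A = {\<alpha>.
     (\<forall>c y. c \<notin> A \<or> y \<notin> snd c ` fst c \<longrightarrow> \<alpha> c y = 0) \<and>
     (\<forall>c y. alternating_form (\<alpha> c y)) \<and>
     (\<forall>c\<in>A. \<forall>vs. smooth_on (\<lambda>y. \<alpha> c y vs) (snd c ` fst c)) \<and>
     (\<forall>c\<in>A. \<forall>c'\<in>A. \<forall>x \<in> fst c \<inter> fst c'. \<forall>vs.
        \<alpha> c (snd c x) vs =
        \<alpha> c' (snd c' x) (map (frechet_derivative (transition c c') (at (snd c x))) vs))}"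

definition homogeneous :: "nat \<Rightarrow> ('m, 'v) form set" where
  "homogeneous k = {\<alpha>. \<forall>c y vs. length vs \<noteq> k \<longrightarrow> \<alpha> c y vs = 0}"

definition cscale :: "complex \<Rightarrow> ('m, 'v) form \<Rightarrow> ('m, 'v) form" where
  "cscale z \<alpha> = (\<lambda>c y vs. z * \<alpha> c y vs)"

text \<open>
  The invariant formula for the exterior derivative, on vector fields which are constant in the
  chart (so that their Lie brackets vanish).
\<close>

definition ext_d :: "('m, 'v::real_normed_vector) chart set \<Rightarrow> ('m, 'v) form \<Rightarrow> ('m, 'v) form" where
  "ext_d A \<alpha> = (\<lambda>c y vs.
     if c \<in> A \<and> y \<in> snd c ` fst c then
       \<Sum>i<length vs. (-1) ^ i *
         frechet_derivative (\<lambda>z. \<alpha> c z (take i vs @ drop (Suc i) vs)) (at y) (vs ! i)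
     else 0)"

type_synonym ('m, 'v) vector_field = "('m, 'v) chart \<Rightarrow> 'v \<Rightarrow> 'v"

definition vector_fields ::
  "('m, 'v::real_normed_vector) chart set \<Rightarrow> ('m, 'v) vector_field set" where
  "vector_fields A = {X.
     (\<forall>c\<in>A. smooth_on (X c) (snd c ` fst c)) \<and>
     (\<forall>c\<in>A. \<forall>c'\<in>A. \<forall>x \<in> fst c \<inter> fst c'.
        X c' (snd c' x) = frechet_derivative (transition c c') (at (snd c x)) (X c (snd c x)))}"

definition interior_product :: "('m, 'v) vector_field \<Rightarrow> ('m, 'v) form \<Rightarrow> ('m, 'v) form" where
  "interior_product X \<alpha> = (\<lambda>c y vs. \<alpha> c y (X c y # vs))"


section \<open>Basic forms\<close>

text \<open>The leaves are locally the fibres of the submersions.\<close>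

definition tangent_fields ::
  "('m, 'v::real_inner, 't, 'w::real_inner, 'i) foliation_data \<Rightarrow> ('m, 'v) vector_field set" where
  "tangent_fields F = {X \<in> vector_fields (man_atlas F).
     \<forall>i\<in>indices F. \<forall>c\<in>man_atlas F. \<forall>c'\<in>tman_atlas F. \<forall>x \<in> cov F i \<inter> fst c.
       subm F i x \<in> fst c' \<longrightarrow>
       frechet_derivative (in_charts c c' (subm F i)) (at (snd c x)) (X c (snd c x)) = 0}"

definition basic_forms ::
  "('m, 'v::real_inner, 't, 'w::real_inner, 'i) foliation_data \<Rightarrow> ('m, 'v) form set" where
  "basic_forms F = {\<alpha> \<in> forms (man_atlas F).
     \<forall>X\<in>tangent_fields F. interior_product X \<alpha> = 0 \<and> interior_product X (ext_d (man_atlas F) \<alpha>) = 0}"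

definition wedge :: "('w \<Rightarrow> complex) list \<Rightarrow> 'w list \<Rightarrow> complex" where
  "wedge ls vs = (if length vs = length ls then
     \<Sum>p | p permutes {..<length ls}. of_int (sign p) * (\<Prod>i<length ls. (ls ! i) (vs ! p i))
   else 0)"

text \<open>
  The space of alternating forms of type \<open>(r, s)\<close> on \<open>('w, J)\<close>, spanned by the exterior products of
  \<open>r\<close> complex linear and \<open>s\<close> complex antilinear functionals.
\<close>

definition type_forms :: "('w::real_vector \<Rightarrow> 'w) \<Rightarrow> nat \<Rightarrow> nat \<Rightarrow> ('w list \<Rightarrow> complex) set" where
  "type_forms J r s = module.span (\<lambda>(z::complex) b vs. z * b vs)
     {wedge (ls @ ms) | ls ms. length ls = r \<and> length ms = s \<and>
        (\<forall>l \<in> set ls. linear l \<and> (\<forall>w. l (J w) = \<i> * l w)) \<and>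
        (\<forall>m \<in> set ms. linear m \<and> (\<forall>w. m (J w) = - \<i> * m w))}"

text \<open>
  A basic form has type \<open>(r, s)\<close> if the form on the transverse manifold of which it is the pullback
  has type \<open>(r, s)\<close> at each point.
\<close>

definition basic_type_forms ::
  "('m, 'v::real_inner, 't, 'w::real_inner, 'i) foliation_data \<Rightarrow> nat \<Rightarrow> nat \<Rightarrow> ('m, 'v) form set" where
  "basic_type_forms F r s = {\<alpha> \<in> basic_forms F.
     \<forall>i\<in>indices F. \<forall>c\<in>man_atlas F. \<forall>c'\<in>hol_atlas F i. \<forall>x \<in> cov F i \<inter> fst c.
       subm F i x \<in> fst c' \<longrightarrow>
       (\<exists>b \<in> type_forms (cmult_i F) r s. \<forall>vs.
          \<alpha> c (snd c x) vs =
          b (map (frechet_derivative (in_charts c c' (subm F i)) (at (snd c x))) vs))}"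


section \<open>The basic Dolbeault double complex\<close>

text \<open>
  The component of type \<open>(r, s)\<close> in the decomposition of a basic form. On a foliation of complex
  codimension \<open>q\<close> there are no nonzero basic forms of type \<open>(r, s)\<close> with \<open>r > q\<close> or \<open>s > q\<close>.
\<close>

definition type_component ::
  "nat \<Rightarrow> ('m, 'v::real_inner, 't, 'w::real_inner, 'i) foliation_data \<Rightarrow>
   nat \<Rightarrow> nat \<Rightarrow> ('m, 'v) form \<Rightarrow> ('m, 'v) form" where
  "type_component q F r s \<alpha> = (THE \<beta>. \<exists>b. (\<forall>r s. b r s \<in> basic_type_forms F r s) \<and>
     \<alpha> = (\<Sum>r\<le>q. \<Sum>s\<le>q. b r s) \<and> \<beta> = b r s)"

abbreviation basic_d ::
  "('m, 'v::real_inner, 't, 'w::real_inner, 'i) foliation_data \<Rightarrow> ('m, 'v) form \<Rightarrow> ('m, 'v) form" where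
  "basic_d F \<equiv> ext_d (man_atlas F)"

definition del ::
  "nat \<Rightarrow> ('m, 'v::real_inner, 't, 'w::real_inner, 'i) foliation_data \<Rightarrow>
   ('m, 'v) form \<Rightarrow> ('m, 'v) form" where
  "del q F \<alpha> =
     (\<Sum>r\<le>q. \<Sum>s\<le>q. type_component q F (Suc r) s (basic_d F (type_component q F r s \<alpha>)))"

definition delbar ::
  "nat \<Rightarrow> ('m, 'v::real_inner, 't, 'w::real_inner, 'i) foliation_data \<Rightarrow>
   ('m, 'v) form \<Rightarrow> ('m, 'v) form" where
  "delbar q F \<alpha> =
     (\<Sum>r\<le>q. \<Sum>s\<le>q. type_component q F r (Suc s) (basic_d F (type_component q F r s \<alpha>)))"

definition basic_Ker ::
  "('m, 'v::real_inner, 't, 'w::real_inner, 'i) foliation_data \<Rightarrow>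
   (('m, 'v) form \<Rightarrow> ('m, 'v) form) \<Rightarrow> ('m, 'v) form set" where
  "basic_Ker F D = {\<alpha> \<in> basic_forms F. D \<alpha> = 0}"

definition basic_Im ::
  "('m, 'v::real_inner, 't, 'w::real_inner, 'i) foliation_data \<Rightarrow>
   (('m, 'v) form \<Rightarrow> ('m, 'v) form) \<Rightarrow> ('m, 'v) form set" where
  "basic_Im F D = D ` basic_forms F"

text \<open>
  The dimension of the complex vector space \<open>A / B\<close>: the supremum of the lengths of the sequences in
  \<open>A\<close> whose classes modulo \<open>B\<close> are linearly independent.
\<close>

definition quotient_dim :: "('m, 'v) form set \<Rightarrow> ('m, 'v) form set \<Rightarrow> enat" where
  "quotient_dim A B = Sup {enat n | n. \<exists>\<alpha> :: nat \<Rightarrow> ('m, 'v) form. (\<forall>i<n. \<alpha> i \<in> A) \<and>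
     (\<forall>z. (\<Sum>i<n. cscale (z i) (\<alpha> i)) \<in> B \<longrightarrow> (\<forall>i<n. z i = 0))}"

definition dim_basic ::
  "('m, 'v::real_inner, 't, 'w::real_inner, 'i) foliation_data \<Rightarrow> nat \<Rightarrow> enat" where
  "dim_basic F k =
     quotient_dim (basic_Ker F (basic_d F) \<inter> homogeneous k) (basic_Im F (basic_d F) \<inter> homogeneous k)"

definition dim_Dolbeault ::
  "nat \<Rightarrow> ('m, 'v::real_inner, 't, 'w::real_inner, 'i) foliation_data \<Rightarrow> nat \<Rightarrow> nat \<Rightarrow> enat" where
  "dim_Dolbeault q F r s =
     quotient_dim (basic_Ker F (delbar q F) \<inter> basic_type_forms F r s)
       (basic_Im F (delbar q F) \<inter> basic_type_forms F r s)"

definition dim_Bott_Chern ::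
  "nat \<Rightarrow> ('m, 'v::real_inner, 't, 'w::real_inner, 'i) foliation_data \<Rightarrow> nat \<Rightarrow> nat \<Rightarrow> enat" where
  "dim_Bott_Chern q F r s =
     quotient_dim (basic_Ker F (del q F) \<inter> basic_Ker F (delbar q F) \<inter> basic_type_forms F r s)
       (basic_Im F (del q F \<circ> delbar q F) \<inter> basic_type_forms F r s)"

definition dim_Aeppli ::
  "nat \<Rightarrow> ('m, 'v::real_inner, 't, 'w::real_inner, 'i) foliation_data \<Rightarrow> nat \<Rightarrow> nat \<Rightarrow> enat" where
  "dim_Aeppli q F r s =
     quotient_dim (basic_Ker F (del q F \<circ> delbar q F) \<inter> basic_type_forms F r s)
       ({\<alpha> + \<beta> | \<alpha> \<beta>. \<alpha> \<in> basic_Im F (del q F) \<and> \<beta> \<in> basic_Im F (delbar q F)} \<inter> basic_type_forms F r s)"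

definition deldelbar_lemma ::
  "nat \<Rightarrow> ('m, 'v::real_inner, 't, 'w::real_inner, 'i) foliation_data \<Rightarrow> bool" where
  "deldelbar_lemma q F \<longleftrightarrow>
     basic_Ker F (del q F) \<inter> basic_Ker F (delbar q F) \<inter> basic_Im F (basic_d F) = basic_Im F (del q F \<circ> delbar q F)"

end

(*
  Forms: multiplication by cis t on the transverse complex structure acts on the (r, s)-component
  of a transverse form by a character, so each type component is a finite Fourier average of
  rotated forms. Bump functions turn the global condition i_X a = i_X (d a) = 0 into pointwise
  horizontality together with constancy along the leaves. Hence type components of basic forms are
  again basic, basic forms vanish above the complex dimension, and d splits into parts of
  bidegree (1, 0) and (0, 1).

  Double complex: in each bidegree, the Bott-Chern and Aeppli dimensions add up to those of the two
  Dolbeault cohomologies plus the dimensions of (the intersection of Im del and Im delbar) / Im (del delbar) and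
  Ker (del delbar) / (Ker del + Ker delbar). The Froelicher inequality holds for both Dolbeault
  cohomologies, which gives the bound. Equality in all degrees means that the two extra quotients
  vanish and both Froelicher spectral sequences degenerate, and this is the del-delbar-lemma.
*)

theory Submission
  imports Defs
begin

section \<open>Dimensions of quotients\<close>

text \<open>Dimensions are extended naturals, so exact sequences are used additively, along flags of
  subspaces, and nothing is cancelled before finiteness allows it. The \<open>delbar\<close>
  cohomology bounds the Betti numbers; in the case of equality this makes the remaining terms
  finite. The \<open>del\<close> cohomology is treated by exchanging the two gradings, not by
  conjugating forms. On the foliation, the obstacle is that a basic form lives on the manifold while
  its type is read off transversely. No form on the transverse manifold is built. In a chart, a
  basic form is a family, parametrised by points of the manifold, of alternating forms on the fixed
  complex vector space of transverse coordinates. Changes of these coordinates are complex linear on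
  tangent vectors, so they commute with the rotations, and \<open>J\<close> is constant, which is
  where integrability enters the splitting of \<open>d\<close>. The model spaces are inner product
  types whose dimension is a predicate. Frames, compactness of balls, smooth sections and bump
  functions are therefore derived from that predicate.\<close>

interpretation fs: vector_space cscale
  by unfold_locales (auto simp: cscale_def fun_eq_iff algebra_simps)

definition ecard :: "'a set \<Rightarrow> enat" where
  "ecard S = (if finite S then enat (card S) else \<infinity>)"

lemma ecard_Un: "S \<inter> S' = {} \<Longrightarrow> ecard (S \<union> S') = ecard S + ecard S'"
  by (auto simp: ecard_def card_Un_disjoint)

definition indep_mod :: "nat \<Rightarrow> (nat \<Rightarrow> ('m, 'v) form) \<Rightarrow> ('m, 'v) form set \<Rightarrow> bool" where
  "indep_mod n \<alpha> W \<longleftrightarrow> (\<forall>z. (\<Sum>i<n. cscale (z i) (\<alpha> i)) \<in> W \<longrightarrow> (\<forall>i<n. z i = 0))"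

lemma quotient_dim_alt: "quotient_dim U W = Sup {enat n | n. \<exists>\<alpha>. (\<forall>i<n. \<alpha> i \<in> U) \<and> indep_mod n \<alpha> W}"
  by (simp add: quotient_dim_def indep_mod_def)

lemma quotient_dim_geI: "(\<And>i. i < n \<Longrightarrow> \<alpha> i \<in> U) \<Longrightarrow> indep_mod n \<alpha> W \<Longrightarrow> enat n \<le> quotient_dim U W"
  unfolding quotient_dim_alt by (rule Sup_upper) blast

lemma quotient_dim_leI:
  "(\<And>n \<alpha>. (\<And>i. i < n \<Longrightarrow> \<alpha> i \<in> U) \<Longrightarrow> indep_mod n \<alpha> W \<Longrightarrow> enat n \<le> m) \<Longrightarrow> quotient_dim U W \<le> m"
  unfolding quotient_dim_alt by (rule Sup_least) blast

text \<open>In a basis adapted to the subspace, the classes of \<open>BU - BW\<close> form a basis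
  of the quotient. For the upper bound, modulo \<open>span BW\<close> a sequence may be replaced by
  its components in \<open>span (BU - BW)\<close>, which stay independent. For the lower bound,
  every finite subset of \<open>BU - BW\<close> is independent modulo \<open>span BW\<close>; this
  also settles the infinite case, where such subsets have every size.\<close>

lemma quotient_dim_basis:
  assumes ind: "fs.independent BU" and sub: "BW \<subseteq> BU"
  shows "quotient_dim (fs.span BU) (fs.span BW) = ecard (BU - BW)"
proof (rule antisym)
  show "quotient_dim (fs.span BU) (fs.span BW) \<le> ecard (BU - BW)"
  proof (rule quotient_dim_leI)
    fix n \<alpha> assume \<alpha>: "\<And>i. i < n \<Longrightarrow> \<alpha> i \<in> fs.span BU" and im: "indep_mod n \<alpha> (fs.span BW)"
    show "enat n \<le> ecard (BU - BW)"
    proof (cases "finite (BU - BW)")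
      case True
      have "\<exists>\<delta> w. \<delta> \<in> fs.span (BU - BW) \<and> w \<in> fs.span BW \<and> \<alpha> i = w + \<delta>" if "i < n" for i
      proof -
        have "BU = BW \<union> (BU - BW)" using sub by blast
        then have "\<alpha> i \<in> fs.span (BW \<union> (BU - BW))" using \<alpha>[OF that] by simp
        then show ?thesis unfolding fs.span_Un by blast
      qed
      then obtain \<delta> w where \<delta>: "\<And>i. i < n \<Longrightarrow> \<delta> i \<in> fs.span (BU - BW)"
        and w: "\<And>i. i < n \<Longrightarrow> w i \<in> fs.span BW" and eq: "\<And>i. i < n \<Longrightarrow> \<alpha> i = w i + \<delta> i" by metis
      have z: "z i = 0" if s: "(\<Sum>i<n. cscale (z i) (\<delta> i)) = 0" and i: "i < n" for z i
      proof -
        have "(\<Sum>i<n. cscale (z i) (\<alpha> i)) = (\<Sum>i<n. cscale (z i) (w i)) + (\<Sum>i<n. cscale (z i) (\<delta> i))"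
          by (simp add: eq fs.scale_right_distrib sum.distrib)
        also have "\<dots> \<in> fs.span BW" unfolding s by (auto intro!: fs.span_sum fs.span_scale w)
        finally show ?thesis using im i unfolding indep_mod_def by blast
      qed
      have inj: "inj_on \<delta> {..<n}"
      proof (rule inj_onI, rule ccontr)
        fix i j assume ij: "i \<in> {..<n}" "j \<in> {..<n}" "\<delta> i = \<delta> j" "i \<noteq> j"
        \<comment> \<open>The coefficients 1 at \<open>i\<close> and -1 at \<open>j\<close> turn a
          coincidence of two components into a nontrivial relation.\<close>
        have "(\<Sum>k<n. cscale ((if k = i then 1 else 0) + (if k = j then -1 else 0)) (\<delta> k))
          = (\<Sum>k<n. if k = i then \<delta> k else 0) + (\<Sum>k<n. if k = j then - \<delta> k else 0)"
          unfolding fs.scale_left_distrib sum.distrib by (intro arg_cong2[where f="(+)"] sum.cong) auto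
        also have "\<dots> = 0" using ij by simp
        finally show False using z[of "\<lambda>k. (if k = i then 1 else 0) + (if k = j then -1 else 0)" i] ij by auto
      qed
      have "fs.independent (\<delta> ` {..<n})"
      proof (rule fs.independent_if_scalars_zero)
        fix f x assume s: "(\<Sum>x\<in>\<delta> ` {..<n}. cscale (f x) x) = 0" and x: "x \<in> \<delta> ` {..<n}"
        have "(\<Sum>i<n. cscale (f (\<delta> i)) (\<delta> i)) = 0" using s by (simp add: sum.reindex[OF inj])
        then show "f x = 0" using z[of "\<lambda>i. f (\<delta> i)"] x by auto
      qed simp
      then have "card (\<delta> ` {..<n}) \<le> card (BU - BW)"
        using fs.independent_span_bound[OF True, of "\<delta> ` {..<n}"] \<delta> by auto
      then show ?thesis using True card_image[OF inj] by (simp add: ecard_def)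
    next
      case False
      then show ?thesis by (simp add: ecard_def)
    qed
  qed
next
  have ge: "enat (card E) \<le> quotient_dim (fs.span BU) (fs.span BW)" if E: "E \<subseteq> BU - BW" "finite E" for E
  proof -
    obtain \<alpha> where \<alpha>: "bij_betw \<alpha> {..<card E} E"
      using ex_bij_betw_nat_finite[OF E(2)] by (auto simp: lessThan_atLeast0)
    have mem: "\<alpha> i \<in> E" if "i < card E" for i using \<alpha> that by (auto simp: bij_betw_def)
    show ?thesis
    proof (rule quotient_dim_geI)
      show "\<alpha> i \<in> fs.span BU" if "i < card E" for i using mem[OF that] E(1) fs.span_base by blast
      show "indep_mod (card E) \<alpha> (fs.span BW)"
        unfolding indep_mod_def
      proof (intro allI impI, rule ccontr)
        fix z i assume s: "(\<Sum>i<card E. cscale (z i) (\<alpha> i)) \<in> fs.span BW" and i: "i < card E" and nz: "z i \<noteq> 0"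
        let ?S = "BU - {\<alpha> i}"
        have neq: "\<alpha> j \<noteq> \<alpha> i" if "j < card E" "j \<noteq> i" for j
          using \<alpha> that i unfolding bij_betw_def inj_on_def by auto
        have "(\<Sum>j\<in>{..<card E} - {i}. cscale (z j) (\<alpha> j)) \<in> fs.span ?S"
          by (intro fs.span_sum fs.span_scale fs.span_base) (use mem neq E(1) in auto)
        note B = this
        have "BW \<subseteq> ?S" using sub mem[OF i] E(1) by blast
        then have A: "(\<Sum>i<card E. cscale (z i) (\<alpha> i)) \<in> fs.span ?S" using s fs.span_mono by blast
        have "(\<Sum>i<card E. cscale (z i) (\<alpha> i)) = cscale (z i) (\<alpha> i) + (\<Sum>j\<in>{..<card E} - {i}. cscale (z j) (\<alpha> j))"
          by (rule sum.remove) (use i in auto)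
        with fs.span_diff[OF A B] have "cscale (z i) (\<alpha> i) \<in> fs.span ?S"
          by (simp only: add_diff_cancel_right')
        then have "cscale (inverse (z i)) (cscale (z i) (\<alpha> i)) \<in> fs.span ?S" by (rule fs.span_scale)
        then have "\<alpha> i \<in> fs.span ?S" using nz by simp
        then show False using ind mem[OF i] E(1) unfolding fs.dependent_def by blast
      qed
    qed
  qed
  show "ecard (BU - BW) \<le> quotient_dim (fs.span BU) (fs.span BW)"
  proof (cases "finite (BU - BW)")
    case True
    then show ?thesis using ge[of "BU - BW"] by (simp add: ecard_def)
  next
    case False
    have "enat n \<le> quotient_dim (fs.span BU) (fs.span BW)" for n
    proof -
      obtain E where "E \<subseteq> BU - BW" "finite E" "card E = n" using infinite_arbitrarily_large[OF False] by blast
      then show ?thesis using ge by blast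
    qed
    then have "quotient_dim (fs.span BU) (fs.span BW) = \<infinity>"
      by (cases "quotient_dim (fs.span BU) (fs.span BW)") (auto, metis Suc_n_not_le_n enat_ord_simps(1))
    then show ?thesis by simp
  qed
qed

text \<open>Nested bases of the three spaces split \<open>BV - BW\<close> into two disjoint pieces.
  This additivity, valid for infinite dimensions as well, replaces every use of the rank formula
  below.\<close>

lemma quotient_dim_chain:
  assumes s: "fs.subspace W" "fs.subspace U" "fs.subspace V" and sub: "W \<subseteq> U" "U \<subseteq> V"
  shows "quotient_dim V W = quotient_dim V U + quotient_dim U W"
proof -
  obtain BW where BW: "BW \<subseteq> W" "fs.independent BW" "W \<subseteq> fs.span BW"
    using fs.maximal_independent_subset by blast
  obtain BU where BU: "BW \<subseteq> BU" "BU \<subseteq> U" "fs.independent BU" "U \<subseteq> fs.span BU"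
    using fs.maximal_independent_subset_extend[of BW U] BW sub by blast
  obtain BV where BV: "BU \<subseteq> BV" "BV \<subseteq> V" "fs.independent BV" "V \<subseteq> fs.span BV"
    using fs.maximal_independent_subset_extend[of BU V] BU sub by blast
  have e: "fs.span BW = W" "fs.span BU = U" "fs.span BV = V"
    using BW BU BV s by (auto simp: fs.span_minimal subset_antisym)
  have "BV - BW = (BV - BU) \<union> (BU - BW)" "(BV - BU) \<inter> (BU - BW) = {}" using BU BV by auto
  then show ?thesis
    using quotient_dim_basis[OF BV(3), of BW] quotient_dim_basis[OF BV(3,1)] quotient_dim_basis[OF BU(3,1)] BU(1) BV(1)
    unfolding e by (simp add: ecard_Un)
qed

text \<open>Linearity is asked for on a subspace only: the derivative in \<open>ext_d\<close> is an
  arbitrary choice where a coefficient is not differentiable, so additivity is at hand only for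
  genuine forms.\<close>

definition lin_on :: "('m, 'v) form set \<Rightarrow> (('m, 'v) form \<Rightarrow> ('m, 'v) form) \<Rightarrow> bool" where
  "lin_on U f \<longleftrightarrow> fs.subspace U \<and> (\<forall>x\<in>U. \<forall>y\<in>U. f (x + y) = f x + f y) \<and> (\<forall>c. \<forall>x\<in>U. f (cscale c x) = cscale c (f x))"

lemma lin_on_subset: "lin_on U f \<Longrightarrow> fs.subspace U' \<Longrightarrow> U' \<subseteq> U \<Longrightarrow> lin_on U' f"
  unfolding lin_on_def by blast

lemma lin_on_zero: "lin_on U f \<Longrightarrow> f 0 = 0"
  unfolding lin_on_def using fs.subspace_0[of U] fs.scale_zero_left by metis

lemma lin_on_image:
  assumes l: "lin_on U f"
  shows "fs.subspace (f ` U)"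
proof (rule fs.subspaceI)
  have U: "fs.subspace U" using l by (simp add: lin_on_def)
  show "0 \<in> f ` U" using imageI[OF fs.subspace_0[OF U], of f] lin_on_zero[OF l] by simp
  fix x assume "x \<in> f ` U"
  then obtain u where u: "u \<in> U" "x = f u" by blast
  show "cscale c x \<in> f ` U" for c
    by (rule image_eqI[of _ _ "cscale c u"]) (use u l fs.subspace_scale[OF U] in \<open>auto simp: lin_on_def\<close>)
  fix y assume "y \<in> f ` U"
  then obtain v where v: "v \<in> U" "y = f v" by blast
  show "x + y \<in> f ` U"
    by (rule image_eqI[of _ _ "u + v"]) (use u v l fs.subspace_add[OF U] in \<open>auto simp: lin_on_def\<close>)
qed

lemma lin_on_sum:
  assumes l: "lin_on U f" and x: "\<And>i. i \<in> S \<Longrightarrow> x i \<in> U"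
  shows "f (\<Sum>i\<in>S. cscale (z i) (x i)) = (\<Sum>i\<in>S. cscale (z i) (f (x i)))"
  using x
proof (induction S rule: infinite_finite_induct)
  case (insert i S)
  have "cscale (z i) (x i) \<in> U" "(\<Sum>i\<in>S. cscale (z i) (x i)) \<in> U" "x i \<in> U"
    using l insert.prems unfolding lin_on_def by (auto intro!: fs.subspace_scale fs.subspace_sum)
  moreover have "f (\<Sum>i\<in>S. cscale (z i) (x i)) = (\<Sum>i\<in>S. cscale (z i) (f (x i)))"
    using insert by blast
  ultimately show ?case using insert.hyps l unfolding lin_on_def by (simp only: sum.insert not_False_eq_True)
qed (use lin_on_zero[OF l] in \<open>simp_all only: sum.empty sum.infinite not_False_eq_True\<close>)

lemma lin_on_sum': "lin_on U f \<Longrightarrow> (\<And>i. i \<in> S \<Longrightarrow> x i \<in> U) \<Longrightarrow> f (\<Sum>i\<in>S. x i) = (\<Sum>i\<in>S. f (x i))"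
  using lin_on_sum[of U f S x "\<lambda>_. 1"] by simp

lemma lin_on_id: "fs.subspace U \<Longrightarrow> lin_on U (\<lambda>x. x)"
  by (simp add: lin_on_def)

text \<open>Only the injectivity of the induced map is needed: the preimage of \<open>W'\<close>
  lies in \<open>W\<close>, so an independent sequence modulo \<open>W\<close> keeps its
  independence modulo \<open>W'\<close>.\<close>

lemma quotient_dim_map_le:
  assumes l: "lin_on U f" and V: "\<And>x. x \<in> U \<Longrightarrow> f x \<in> V" and W: "\<And>x. x \<in> U \<Longrightarrow> f x \<in> W' \<Longrightarrow> x \<in> W"
  shows "quotient_dim U W \<le> quotient_dim V W'"
proof (rule quotient_dim_leI)
  fix n \<alpha> assume \<alpha>: "\<And>i. i < n \<Longrightarrow> \<alpha> i \<in> U" and im: "indep_mod n \<alpha> W"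
  show "enat n \<le> quotient_dim V W'"
  proof (rule quotient_dim_geI)
    show "f (\<alpha> i) \<in> V" if "i < n" for i using V \<alpha> that by blast
    show "indep_mod n (\<lambda>i. f (\<alpha> i)) W'"
      unfolding indep_mod_def
    proof (intro allI impI)
      fix z i assume "(\<Sum>i<n. cscale (z i) (f (\<alpha> i))) \<in> W'" and i: "i < n"
      then have "f (\<Sum>i<n. cscale (z i) (\<alpha> i)) \<in> W'" using lin_on_sum[OF l, of "{..<n}" \<alpha> z] \<alpha> by simp
      moreover have "(\<Sum>i<n. cscale (z i) (\<alpha> i)) \<in> U"
        using l \<alpha> unfolding lin_on_def by (auto intro!: fs.subspace_sum fs.subspace_scale)
      ultimately show "z i = 0" using W im i unfolding indep_mod_def by blast
    qed
  qed
qed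

text \<open>The dual criterion, for a surjective induced map: elements of \<open>V\<close> are
  lifted modulo \<open>W'\<close>, and a relation among the lifts is pushed forward again.\<close>

lemma quotient_dim_map_ge:
  assumes l: "lin_on U f" and W': "fs.subspace W'" and W: "\<And>x. x \<in> U \<Longrightarrow> x \<in> W \<Longrightarrow> f x \<in> W'"
    and V: "\<And>y. y \<in> V \<Longrightarrow> \<exists>x\<in>U. \<exists>w\<in>W'. y = f x + w"
  shows "quotient_dim V W' \<le> quotient_dim U W"
proof (rule quotient_dim_leI)
  fix n \<beta> assume \<beta>: "\<And>i. i < n \<Longrightarrow> \<beta> i \<in> V" and im: "indep_mod n \<beta> W'"
  have "\<forall>i<n. \<exists>x w. x \<in> U \<and> w \<in> W' \<and> \<beta> i = f x + w" using V \<beta> by blast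
  then obtain x w where x: "\<And>i. i < n \<Longrightarrow> x i \<in> U" and w: "\<And>i. i < n \<Longrightarrow> w i \<in> W'"
    and eq: "\<And>i. i < n \<Longrightarrow> \<beta> i = f (x i) + w i" by metis
  show "enat n \<le> quotient_dim U W"
  proof (rule quotient_dim_geI[of n x])
    show "indep_mod n x W"
      unfolding indep_mod_def
    proof (intro allI impI)
      fix z i assume s: "(\<Sum>i<n. cscale (z i) (x i)) \<in> W" and i: "i < n"
      have "(\<Sum>i<n. cscale (z i) (x i)) \<in> U"
        using l x unfolding lin_on_def by (auto intro!: fs.subspace_sum fs.subspace_scale)
      then have "f (\<Sum>i<n. cscale (z i) (x i)) \<in> W'" using W s by blast
      then have A: "(\<Sum>i<n. cscale (z i) (f (x i))) \<in> W'" using lin_on_sum[OF l, of "{..<n}" x z] x by simp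
      have B: "(\<Sum>i<n. cscale (z i) (w i)) \<in> W'" using w W' by (auto intro!: fs.subspace_sum fs.subspace_scale)
      have "(\<Sum>i<n. cscale (z i) (\<beta> i)) = (\<Sum>i<n. cscale (z i) (f (x i))) + (\<Sum>i<n. cscale (z i) (w i))"
        by (simp add: eq fs.scale_right_distrib sum.distrib)
      then have "(\<Sum>i<n. cscale (z i) (\<beta> i)) \<in> W'" using fs.subspace_add[OF W' A B] by (simp only:)
      then show "z i = 0" using im i unfolding indep_mod_def by blast
    qed
  qed (rule x)
qed

lemma quotient_dim_zero:
  assumes "U \<subseteq> W"
  shows "quotient_dim U W = 0"
proof -
  have "quotient_dim U W \<le> 0"
  proof (rule quotient_dim_leI)
    fix n \<alpha> assume \<alpha>: "\<And>i. i < n \<Longrightarrow> \<alpha> i \<in> U" and im: "indep_mod n \<alpha> W"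
    have "n = 0"
    proof (rule ccontr)
      assume "n \<noteq> 0"
      have "(\<Sum>i<n. cscale (if i = 0 then 1 else 0) (\<alpha> i)) = (\<Sum>i<n. if i = 0 then \<alpha> 0 else 0)"
        by (intro sum.cong) auto
      also have "\<dots> = \<alpha> 0" using \<open>n \<noteq> 0\<close> by simp
      finally have "(\<Sum>i<n. cscale (if i = 0 then 1 else 0) (\<alpha> i)) \<in> W" using assms \<alpha>[of 0] \<open>n \<noteq> 0\<close> by auto
      then have "\<forall>i<n. (if i = 0 then 1 else 0 :: complex) = 0"
        using im[unfolded indep_mod_def, rule_format, of "\<lambda>i. if i = 0 then 1 else 0"] by blast
      then show False using \<open>n \<noteq> 0\<close> by auto
    qed
    then show "enat n \<le> 0" by (simp add: zero_enat_def)
  qed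
  then show ?thesis by simp
qed

lemma quotient_dim_eq_0D:
  assumes W: "fs.subspace W" and "quotient_dim U W = 0"
  shows "U \<subseteq> W"
proof
  fix x assume x: "x \<in> U"
  show "x \<in> W"
  proof (rule ccontr)
    assume nx: "x \<notin> W"
    have "enat 1 \<le> quotient_dim U W"
    proof (rule quotient_dim_geI[of 1 "\<lambda>_. x"])
      show "indep_mod 1 (\<lambda>_. x) W" unfolding indep_mod_def
      proof (intro allI impI, rule ccontr)
        fix z :: "nat \<Rightarrow> complex" and i assume s: "(\<Sum>i<1. cscale (z i) x) \<in> W" and i: "i < (1::nat)" and "z i \<noteq> 0"
        then have z0: "z 0 \<noteq> 0" by simp
        have "cscale (inverse (z 0)) (cscale (z 0) x) \<in> W" by (rule fs.subspace_scale[OF W]) (use s in simp)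
        then show False using nx z0 by simp
      qed
    qed (rule x)
    then show False using assms(2) by (simp add: zero_enat_def)
  qed
qed

section \<open>Sums of subspaces and the square of kernels and images\<close>

definition ssum :: "('m, 'v) form set \<Rightarrow> ('m, 'v) form set \<Rightarrow> ('m, 'v) form set" where
  "ssum S S' = {x + y | x y. x \<in> S \<and> y \<in> S'}"

lemma subspace_ssum: "fs.subspace S \<Longrightarrow> fs.subspace S' \<Longrightarrow> fs.subspace (ssum S S')"
  unfolding ssum_def by (rule fs.subspace_sums)

lemma ssum_left: "fs.subspace S' \<Longrightarrow> S \<subseteq> ssum S S'"
  unfolding ssum_def using fs.subspace_0 by (metis (mono_tags, lifting) add.right_neutral mem_Collect_eq subsetI)

lemma ssum_right: "fs.subspace S \<Longrightarrow> S' \<subseteq> ssum S S'"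
  unfolding ssum_def using fs.subspace_0 by (metis (mono_tags, lifting) add.left_neutral mem_Collect_eq subsetI)

lemma ssum_least: "fs.subspace V \<Longrightarrow> S \<subseteq> V \<Longrightarrow> S' \<subseteq> V \<Longrightarrow> ssum S S' \<subseteq> V"
  unfolding ssum_def using fs.subspace_add by blast

lemma ssum_mono: "S \<subseteq> V \<Longrightarrow> S' \<subseteq> V' \<Longrightarrow> ssum S S' \<subseteq> ssum V V'"
  unfolding ssum_def by blast

text \<open>The second isomorphism theorem; both inequalities come from the inclusion of
  \<open>U\<close> in \<open>ssum U W\<close>.\<close>

lemma quotient_dim_sum:
  assumes "fs.subspace U" "fs.subspace W"
  shows "quotient_dim (ssum U W) W = quotient_dim U (U \<inter> W)"
proof (rule antisym)
  show "quotient_dim (ssum U W) W \<le> quotient_dim U (U \<inter> W)"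
    by (rule quotient_dim_map_ge[OF lin_on_id[OF assms(1)] assms(2)]) (auto simp: ssum_def)
  show "quotient_dim U (U \<inter> W) \<le> quotient_dim (ssum U W) W"
    by (rule quotient_dim_map_le[OF lin_on_id[OF assms(1)]]) (use ssum_left[OF assms(2)] in auto)
qed

text \<open>
  The bookkeeping of the exact sequences relating Bott--Chern, Aeppli and the two Dolbeault
  cohomologies, without any finiteness assumption.
\<close>

lemma quotient_dim_square:
  assumes s: "fs.subspace K1" "fs.subspace K2" "fs.subspace K12" "fs.subspace I1" "fs.subspace I2" "fs.subspace I12"
    and i: "I12 \<subseteq> I1" "I12 \<subseteq> I2" "I1 \<subseteq> K1" "I2 \<subseteq> K2" "K1 \<subseteq> K12" "K2 \<subseteq> K12"
  shows "quotient_dim (K1 \<inter> K2) I12 + quotient_dim K12 (ssum I1 I2)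
    = quotient_dim K1 I1 + quotient_dim K2 I2 + (quotient_dim (I1 \<inter> I2) I12 + quotient_dim K12 (ssum K1 K2))"
proof -
  note si = fs.subspace_inter subspace_ssum s
  \<comment> \<open>The letters are steps in two flags. From \<open>I12\<close> through
    \<open>I1 \<inter> I2\<close> and \<open>K2 \<inter> I1\<close> up to
    \<open>K1 \<inter> K2\<close> the steps are \<open>a\<close>, \<open>t\<close>,
    \<open>g\<close>, with \<open>b = t + a\<close>. From \<open>ssum I1 I2\<close> through
    \<open>ssum I1 K2\<close> and \<open>ssum K1 K2\<close> up to \<open>K12\<close> they are
    \<open>u\<close>, \<open>e\<close>, \<open>f\<close>, with \<open>c = f + e\<close>. The two
    Dolbeault quotients are \<open>e + g\<close> and \<open>u + t\<close>, so both sides of the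
    claim are the sum of all six steps. The spaces behind \<open>a\<close>, \<open>b\<close>,
    \<open>c\<close> and \<open>f\<close> are among those of Varouchas' exact sequences.\<close>
  define b where "b = quotient_dim (K2 \<inter> I1) I12"
  define g where "g = quotient_dim (K1 \<inter> K2) (K2 \<inter> I1)"
  define e where "e = quotient_dim K1 (ssum (K1 \<inter> K2) I1)"
  define c where "c = quotient_dim K12 (ssum I1 K2)"
  define u where "u = quotient_dim K2 (ssum (K2 \<inter> I1) I2)"
  define t where "t = quotient_dim (K2 \<inter> I1) (I1 \<inter> I2)"
  define a where "a = quotient_dim (I1 \<inter> I2) I12"
  define f where "f = quotient_dim K12 (ssum K1 K2)"
  have 1: "quotient_dim (K1 \<inter> K2) I12 = g + b" unfolding g_def b_def
    by (rule quotient_dim_chain) (use i in \<open>auto intro!: si\<close>)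
  have 2: "quotient_dim K1 I1 = e + g"
  proof -
    have "quotient_dim K1 I1 = e + quotient_dim (ssum (K1 \<inter> K2) I1) I1" unfolding e_def
      by (rule quotient_dim_chain) (use i ssum_right[OF fs.subspace_inter[OF s(1,2)], of I1] ssum_least[OF s(1), of "K1 \<inter> K2" I1] in \<open>auto intro!: si\<close>)
    moreover have "quotient_dim (ssum (K1 \<inter> K2) I1) I1 = quotient_dim (K1 \<inter> K2) (K1 \<inter> K2 \<inter> I1)"
      by (rule quotient_dim_sum) (auto intro!: si)
    moreover have "K1 \<inter> K2 \<inter> I1 = K2 \<inter> I1" using i by auto
    ultimately show ?thesis by (simp add: g_def)
  qed
  have 3: "c = f + e"
  proof -
    have sub: "ssum I1 K2 \<subseteq> ssum K1 K2" using i by (intro ssum_mono) auto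
    have "c = f + quotient_dim (ssum K1 K2) (ssum I1 K2)" unfolding c_def f_def
      by (rule quotient_dim_chain) (use i sub ssum_least[OF s(3)] in \<open>auto intro!: si\<close>)
    moreover have "ssum K1 (ssum I1 K2) = ssum K1 K2"
    proof
      show "ssum K1 (ssum I1 K2) \<subseteq> ssum K1 K2"
        by (rule ssum_least) (use sub ssum_left[OF s(2)] in \<open>auto intro!: si\<close>)
      show "ssum K1 K2 \<subseteq> ssum K1 (ssum I1 K2)" using ssum_right[OF s(4), of K2] by (intro ssum_mono) auto
    qed
    moreover have "quotient_dim (ssum K1 (ssum I1 K2)) (ssum I1 K2) = quotient_dim K1 (K1 \<inter> ssum I1 K2)"
      by (rule quotient_dim_sum) (auto intro!: si)
    \<comment> \<open>The modular law for subspaces, applicable because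
      \<open>I1 \<subseteq> K1\<close>.\<close>
    moreover have "K1 \<inter> ssum I1 K2 = ssum (K1 \<inter> K2) I1"
    proof
      show "K1 \<inter> ssum I1 K2 \<subseteq> ssum (K1 \<inter> K2) I1"
      proof
        fix x assume "x \<in> K1 \<inter> ssum I1 K2"
        then obtain y z where x: "x \<in> K1" "x = y + z" "y \<in> I1" "z \<in> K2" by (auto simp: ssum_def)
        then have "z = x - y" "y \<in> K1" using i by auto
        then have "z \<in> K1" using x fs.subspace_diff[OF s(1)] by metis
        then have "x = z + y \<and> z \<in> K1 \<inter> K2" using x by (simp add: add.commute)
        then show "x \<in> ssum (K1 \<inter> K2) I1" using x(3) unfolding ssum_def by blast
      qed
      show "ssum (K1 \<inter> K2) I1 \<subseteq> K1 \<inter> ssum I1 K2"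
        by (rule ssum_least) (use i ssum_left[OF s(2), of I1] ssum_right[OF s(4), of K2] in \<open>auto intro!: si\<close>)
    qed
    ultimately show ?thesis by (simp add: e_def)
  qed
  have 4: "quotient_dim K12 (ssum I1 I2) = c + u"
  proof -
    have sub: "ssum I1 I2 \<subseteq> ssum I1 K2" using i by (intro ssum_mono) auto
    have "quotient_dim K12 (ssum I1 I2) = c + quotient_dim (ssum I1 K2) (ssum I1 I2)" unfolding c_def
      by (rule quotient_dim_chain) (use i sub ssum_least[OF s(3)] in \<open>auto intro!: si\<close>)
    moreover have "ssum K2 (ssum I1 I2) = ssum I1 K2"
    proof
      show "ssum K2 (ssum I1 I2) \<subseteq> ssum I1 K2"
        by (rule ssum_least) (use sub ssum_right[OF s(4)] in \<open>auto intro!: si\<close>)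
      show "ssum I1 K2 \<subseteq> ssum K2 (ssum I1 I2)"
        by (rule ssum_least)
          (use ssum_left[OF s(5), of I1] ssum_right[OF s(2), of "ssum I1 I2"] ssum_left[of "ssum I1 I2" K2] in \<open>auto intro!: si\<close>)
    qed
    moreover have "quotient_dim (ssum K2 (ssum I1 I2)) (ssum I1 I2) = quotient_dim K2 (K2 \<inter> ssum I1 I2)"
      by (rule quotient_dim_sum) (auto intro!: si)
    moreover have "K2 \<inter> ssum I1 I2 = ssum (K2 \<inter> I1) I2"
    proof
      show "K2 \<inter> ssum I1 I2 \<subseteq> ssum (K2 \<inter> I1) I2"
      proof
        fix x assume "x \<in> K2 \<inter> ssum I1 I2"
        then obtain y z where x: "x \<in> K2" "x = y + z" "y \<in> I1" "z \<in> I2" by (auto simp: ssum_def)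
        then have "y = x - z" "z \<in> K2" using i by auto
        then have "y \<in> K2" using x fs.subspace_diff[OF s(2)] by metis
        then show "x \<in> ssum (K2 \<inter> I1) I2" using x unfolding ssum_def by blast
      qed
      show "ssum (K2 \<inter> I1) I2 \<subseteq> K2 \<inter> ssum I1 I2"
        by (rule ssum_least) (use i ssum_left[OF s(5), of I1] ssum_right[OF s(4), of I2] in \<open>auto intro!: si\<close>)
    qed
    ultimately show ?thesis by (simp add: u_def)
  qed
  have 5: "quotient_dim K2 I2 = u + t"
  proof -
    have "quotient_dim K2 I2 = u + quotient_dim (ssum (K2 \<inter> I1) I2) I2" unfolding u_def
      by (rule quotient_dim_chain) (use i ssum_right[OF fs.subspace_inter[OF s(2,4)], of I2] ssum_least[OF s(2), of "K2 \<inter> I1" I2] in \<open>auto intro!: si\<close>)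
    moreover have "quotient_dim (ssum (K2 \<inter> I1) I2) I2 = quotient_dim (K2 \<inter> I1) (K2 \<inter> I1 \<inter> I2)"
      by (rule quotient_dim_sum) (auto intro!: si)
    moreover have "K2 \<inter> I1 \<inter> I2 = I1 \<inter> I2" using i by auto
    ultimately show ?thesis by (simp add: t_def)
  qed
  have 6: "b = t + a" unfolding b_def t_def a_def
    by (rule quotient_dim_chain) (use i in \<open>auto intro!: si\<close>)
  show ?thesis unfolding 1 2 3 4 5 6 a_def[symmetric] f_def[symmetric] by (simp add: ac_simps)
qed

section \<open>Double complexes\<close>

text \<open>The direct sum is recorded by projections \<open>pr r s\<close> on one ambient space of
  forms, and the operators are constrained on \<open>V\<close> only. The assumption
  \<open>dec\<close>, with sums up to \<open>q\<close>, forces all pieces outside the square of side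
  \<open>q\<close> to vanish.\<close>

locale double_complex =
  fixes V :: "('m, 'v) form set" and T :: "nat \<Rightarrow> nat \<Rightarrow> ('m, 'v) form set"
    and pr :: "nat \<Rightarrow> nat \<Rightarrow> ('m, 'v) form \<Rightarrow> ('m, 'v) form"
    and d1 d2 :: "('m, 'v) form \<Rightarrow> ('m, 'v) form" and q :: nat
  assumes subspace_V: "fs.subspace V" and subspace_T: "fs.subspace (T r s)" and TV: "T r s \<subseteq> V"
    and pr_T: "x \<in> V \<Longrightarrow> pr r s x \<in> T r s" and pr_lin: "lin_on V (pr r s)"
    and pr_id: "x \<in> T r' s' \<Longrightarrow> pr r s x = (if r = r' \<and> s = s' then x else 0)"
    and dec: "x \<in> V \<Longrightarrow> x = (\<Sum>r\<le>q. \<Sum>s\<le>q. pr r s x)"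
    and d1_lin: "lin_on V d1" and d2_lin: "lin_on V d2"
    and d1_T: "x \<in> T r s \<Longrightarrow> d1 x \<in> T (Suc r) s" and d2_T: "x \<in> T r s \<Longrightarrow> d2 x \<in> T r (Suc s)"
    and d1_d1: "x \<in> V \<Longrightarrow> d1 (d1 x) = 0" and d2_d2: "x \<in> V \<Longrightarrow> d2 (d2 x) = 0"
    and d12: "x \<in> V \<Longrightarrow> d1 (d2 x) + d2 (d1 x) = 0"
begin

text \<open>Exchanging the two gradings and the two differentials gives a double complex again.
  Everything proved for \<open>d2\<close> thereby holds for \<open>d1\<close> with transposed
  bidegrees.\<close>

lemma swap: "double_complex V (\<lambda>r s. T s r) (\<lambda>r s. pr s r) d2 d1 q"
proof
  show "x = (\<Sum>r\<le>q. \<Sum>s\<le>q. pr s r x)" if "x \<in> V" for x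
    using dec[OF that] by (subst sum.swap)
  show "d2 (d1 x) + d1 (d2 x) = 0" if "x \<in> V" for x using d12[OF that] by (simp add: add.commute)
  show "pr s r x = (if r = r' \<and> s = s' then x else 0)" if "x \<in> T s' r'" for x r s r' s'
    using pr_id[OF that] by auto
qed (use subspace_V subspace_T TV pr_T pr_lin d1_lin d2_lin d1_T d2_T d1_d1 d2_d2 in auto)

lemmas V_zero = fs.subspace_0[OF subspace_V]
  and V_add = fs.subspace_add[OF subspace_V]
  and V_diff = fs.subspace_diff[OF subspace_V]
  and V_scale = fs.subspace_scale[OF subspace_V]
  and V_sum = fs.subspace_sum[OF subspace_V]
  and T_zero = fs.subspace_0[OF subspace_T]

lemma T_V: "x \<in> T r s \<Longrightarrow> x \<in> V"
  using TV by blast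

lemma lin_add: "lin_on V f \<Longrightarrow> x \<in> V \<Longrightarrow> y \<in> V \<Longrightarrow> f (x + y) = f x + f y"
  and lin_scale: "lin_on V f \<Longrightarrow> x \<in> V \<Longrightarrow> f (cscale c x) = cscale c (f x)"
  by (simp_all add: lin_on_def)

lemma lin_diff:
  assumes f: "lin_on V f" and x: "x \<in> V" and y: "y \<in> V"
  shows "f (x - y) = f x - f y"
  using lin_add[OF f V_diff[OF x y] y] by (simp only: diff_add_cancel eq_diff_eq)

lemmas lin_zero = lin_on_zero[of V]

lemma d_sum:
  assumes f: "lin_on V f" and x: "x \<in> V"
  shows "f x = (\<Sum>r\<le>q. \<Sum>s\<le>q. f (pr r s x))"
proof -
  have "f x = f (\<Sum>r\<le>q. \<Sum>s\<le>q. pr r s x)" using dec[OF x] by simp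
  also have "\<dots> = (\<Sum>r\<le>q. f (\<Sum>s\<le>q. pr r s x))"
    by (rule lin_on_sum'[OF f]) (intro V_sum T_V[OF pr_T] x)
  also have "\<dots> = (\<Sum>r\<le>q. \<Sum>s\<le>q. f (pr r s x))"
    by (intro sum.cong refl lin_on_sum'[OF f] T_V[OF pr_T] x)
  finally show ?thesis .
qed

lemma d1_V:
  assumes x: "x \<in> V"
  shows "d1 x \<in> V"
  by (subst d_sum[OF d1_lin x]) (intro V_sum T_V[OF d1_T[OF pr_T[OF x]]])

lemma d2_V:
  assumes x: "x \<in> V"
  shows "d2 x \<in> V"
  by (subst d_sum[OF d2_lin x]) (intro V_sum T_V[OF d2_T[OF pr_T[OF x]]])

lemma T_out:
  assumes "q < r \<or> q < s" "x \<in> T r s"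
  shows "x = 0"
proof -
  have "(\<Sum>r'\<le>q. \<Sum>s'\<le>q. pr r' s' x) = 0"
    by (intro sum.neutral ballI) (use pr_id[OF assms(2)] assms(1) in auto)
  then show ?thesis using dec[OF T_V[OF assms(2)]] by simp
qed

lemma pr_out: "q < r \<or> q < s \<Longrightarrow> x \<in> V \<Longrightarrow> pr r s x = 0"
  using T_out pr_T by blast

lemma pr_f_sum:
  assumes f: "lin_on V f" and fT: "\<And>x r s. x \<in> T r s \<Longrightarrow> f x \<in> T (g r) (h s)" and x: "x \<in> V"
  shows "pr r' s' (f x) = (\<Sum>r\<le>q. \<Sum>s\<le>q. if r' = g r \<and> s' = h s then f (pr r s x) else 0)"
proof -
  have m: "f (pr r s x) \<in> V" for r s by (rule T_V[OF fT[OF pr_T[OF x]]])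
  have "pr r' s' (f x) = pr r' s' (\<Sum>r\<le>q. \<Sum>s\<le>q. f (pr r s x))" using d_sum[OF f x] by simp
  also have "\<dots> = (\<Sum>r\<le>q. pr r' s' (\<Sum>s\<le>q. f (pr r s x)))"
    by (rule lin_on_sum'[OF pr_lin]) (intro V_sum m)
  also have "\<dots> = (\<Sum>r\<le>q. \<Sum>s\<le>q. pr r' s' (f (pr r s x)))"
    by (intro sum.cong refl lin_on_sum'[OF pr_lin] m)
  also have "\<dots> = (\<Sum>r\<le>q. \<Sum>s\<le>q. if r' = g r \<and> s' = h s then f (pr r s x) else 0)"
    by (intro sum.cong refl pr_id[OF fT[OF pr_T[OF x]]])
  finally show ?thesis .
qed

lemma pr_d1_Suc:
  assumes x: "x \<in> V"
  shows "pr (Suc r) s (d1 x) = d1 (pr r s x)"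
proof -
  have "pr (Suc r) s (d1 x) = (\<Sum>r'\<le>q. \<Sum>s'\<le>q. if Suc r = Suc r' \<and> s = s' then d1 (pr r' s' x) else 0)"
    by (rule pr_f_sum[OF d1_lin d1_T x])
  also have "\<dots> = (\<Sum>r'\<le>q. \<Sum>s'\<le>q. if s' = s then (if r' = r then d1 (pr r s x) else 0) else 0)"
    by (intro sum.cong refl) auto
  also have "\<dots> = (if r \<le> q \<and> s \<le> q then d1 (pr r s x) else 0)"
    by (cases "s \<le> q"; cases "r \<le> q") simp_all
  also have "\<dots> = d1 (pr r s x)" using pr_out[OF _ x, of r s] lin_zero[OF d1_lin] by auto
  finally show ?thesis .
qed

lemma pr_d1_0: "x \<in> V \<Longrightarrow> pr 0 s (d1 x) = 0"
  using pr_f_sum[OF d1_lin d1_T, where x=x and r'=0 and s'=s] by (simp add: sum.neutral)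

lemma pr_d1: "x \<in> V \<Longrightarrow> pr r s (d1 x) = (case r of 0 \<Rightarrow> 0 | Suc r' \<Rightarrow> d1 (pr r' s x))"
  by (cases r) (simp_all only: pr_d1_0 pr_d1_Suc nat.case)

lemma pr_d2: "x \<in> V \<Longrightarrow> pr r s (d2 x) = (case s of 0 \<Rightarrow> 0 | Suc s' \<Rightarrow> d2 (pr r s' x))"
  by (rule double_complex.pr_d1[OF swap])

section \<open>The total differential, kernels and images\<close>

definition d :: "('m, 'v) form \<Rightarrow> ('m, 'v) form" where "d x = d1 x + d2 x"

lemma d_lin: "lin_on V d"
  using d1_lin d2_lin unfolding lin_on_def d_def by (auto simp: fs.scale_right_distrib ac_simps)

lemma d_V: "x \<in> V \<Longrightarrow> d x \<in> V"
  unfolding d_def by (intro V_add d1_V d2_V)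

lemma d_d: "x \<in> V \<Longrightarrow> d (d x) = 0"
  using lin_add[OF d1_lin d1_V d2_V, of x x] lin_add[OF d2_lin d1_V d2_V, of x x] d1_d1[of x] d2_d2[of x] d12[of x]
  unfolding d_def by (simp only: add_0_left add_0_right)

lemma pr_d: "x \<in> V \<Longrightarrow> pr r s (d x) = pr r s (d1 x) + pr r s (d2 x)"
  unfolding d_def by (rule lin_add[OF pr_lin d1_V d2_V])

definition K1 :: "('m, 'v) form set" where "K1 = {x \<in> V. d1 x = 0}"
definition K2 :: "('m, 'v) form set" where "K2 = {x \<in> V. d2 x = 0}"
definition K12 :: "('m, 'v) form set" where "K12 = {x \<in> V. d1 (d2 x) = 0}"
definition I1 :: "('m, 'v) form set" where "I1 = d1 ` V"
definition I2 :: "('m, 'v) form set" where "I2 = d2 ` V"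
definition I12 :: "('m, 'v) form set" where "I12 = (\<lambda>x. d1 (d2 x)) ` V"
definition Z :: "('m, 'v) form set" where "Z = {x \<in> V. d x = 0}"
definition Bd :: "('m, 'v) form set" where "Bd = d ` V"

lemma kernel_subspace:
  assumes "lin_on V f"
  shows "fs.subspace {x \<in> V. f x = 0}"
  by (rule fs.subspaceI)
    (use lin_zero[OF assms] lin_add[OF assms] lin_scale[OF assms] V_zero V_add V_scale in auto)

lemma d1d2_lin: "lin_on V (\<lambda>x. d1 (d2 x))"
  using d1_lin d2_lin d2_V unfolding lin_on_def by simp

lemma subspaces: "fs.subspace K1" "fs.subspace K2" "fs.subspace K12" "fs.subspace I1" "fs.subspace I2"
  "fs.subspace I12" "fs.subspace Z" "fs.subspace Bd"
  unfolding K1_def K2_def K12_def I1_def I2_def I12_def Z_def Bd_def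
  by (intro kernel_subspace lin_on_image d1_lin d2_lin d1d2_lin d_lin)+

text \<open>The sign in this rule is the reason why the inclusions and the exchange of the gradings
  below have to pass through negatives.\<close>

lemma d2_d1: "x \<in> V \<Longrightarrow> d2 (d1 x) = - d1 (d2 x)"
  using d12[of x] by (simp only: eq_neg_iff_add_eq_0 add.commute)

lemma inclusions: "I12 \<subseteq> I1" "I12 \<subseteq> I2" "I1 \<subseteq> K1" "I2 \<subseteq> K2" "K1 \<subseteq> K12" "K2 \<subseteq> K12" "I1 \<subseteq> V" "I2 \<subseteq> V"
proof -
  have n: "f (- x) = - f x" if "lin_on V f" "x \<in> V" for f x
    using lin_diff[OF that(1) V_zero that(2)] lin_zero[OF that(1)] by (simp only: diff_0)
  show "I12 \<subseteq> I1" "I1 \<subseteq> V" "I2 \<subseteq> V" unfolding I12_def I1_def I2_def using d1_V d2_V by auto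
  show "I12 \<subseteq> I2"
  proof
    fix y assume "y \<in> I12"
    then obtain x where x: "x \<in> V" "y = d1 (d2 x)" by (auto simp: I12_def)
    have "y = d2 (- d1 x)" using n[OF d2_lin d1_V[OF x(1)]] d2_d1[OF x(1)] x(2) by (simp only: minus_minus)
    moreover have "- d1 x \<in> V" using fs.subspace_neg[OF subspace_V d1_V[OF x(1)]] .
    ultimately show "y \<in> I2" unfolding I2_def by blast
  qed
  show "I1 \<subseteq> K1" "I2 \<subseteq> K2" unfolding I1_def I2_def K1_def K2_def using d1_V d2_V d1_d1 d2_d2 by auto
  show "K2 \<subseteq> K12" unfolding K2_def K12_def using lin_zero[OF d1_lin] by auto
  show "K1 \<subseteq> K12"
  proof
    fix x assume "x \<in> K1"
    then have "x \<in> V" "d1 x = 0" by (auto simp: K1_def)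
    then have "- d1 (d2 x) = 0" using d2_d1[of x] lin_zero[OF d2_lin] by (simp only:)
    then show "x \<in> K12" using \<open>x \<in> V\<close> by (simp only: K12_def neg_equal_0_iff_equal mem_Collect_eq simp_thms)
  qed
qed

lemma graded: "x \<in> K1 \<Longrightarrow> pr r s x \<in> K1" "x \<in> K2 \<Longrightarrow> pr r s x \<in> K2" "x \<in> K12 \<Longrightarrow> pr r s x \<in> K12"
proof -
  have z: "pr r s 0 = 0" for r s by (rule lin_zero[OF pr_lin])
  show "pr r s x \<in> K1" if "x \<in> K1"
    using that pr_d1_Suc[of x r s] z T_V[OF pr_T] unfolding K1_def by auto
  show "pr r s x \<in> K2" if "x \<in> K2"
    using that pr_d2[of x r "Suc s"] z T_V[OF pr_T] unfolding K2_def by auto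
  show "pr r s x \<in> K12" if "x \<in> K12"
    using that pr_d2[of x r "Suc s"] pr_d1_Suc[of "d2 x" r "Suc s"] d2_V z T_V[OF pr_T] unfolding K12_def by auto
qed

text \<open>Projecting a primitive to the bidegree below makes it homogeneous; for
  \<open>s = 0\<close> there is no such bidegree and the element vanishes.\<close>

lemma I2_T:
  assumes "x \<in> I2" "x \<in> T r s"
  shows "(s = 0 \<and> x = 0) \<or> (\<exists>s' y. s = Suc s' \<and> y \<in> T r s' \<and> x = d2 y)"
proof -
  obtain y where y: "y \<in> V" "x = d2 y" using assms(1) by (auto simp: I2_def)
  have "x = pr r s (d2 y)" using pr_id[OF assms(2)] y by simp
  show ?thesis
  proof (cases s)
    case 0
    then show ?thesis using \<open>x = pr r s (d2 y)\<close> pr_d2[OF y(1), of r 0] by simp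
  next
    case (Suc s')
    then have "x = d2 (pr r s' y)" using \<open>x = pr r s (d2 y)\<close> pr_d2[OF y(1), of r s] by simp
    then show ?thesis using Suc pr_T[OF y(1)] by blast
  qed
qed

lemma I1_T:
  assumes "x \<in> I1" "x \<in> T r s"
  shows "(r = 0 \<and> x = 0) \<or> (\<exists>r' y. r = Suc r' \<and> y \<in> T r' s \<and> x = d1 y)"
  using double_complex.I2_T[OF swap, where x=x and r=s and s=r] assms
  unfolding I1_def double_complex.I2_def[OF swap] by blast

lemma I12_T:
  assumes "x \<in> I12" "x \<in> T r s"
  shows "x = 0 \<or> (\<exists>r' s' y. r = Suc r' \<and> s = Suc s' \<and> y \<in> T r' s' \<and> x = d1 (d2 y))"
proof -
  obtain y where y: "y \<in> V" "x = d1 (d2 y)" using assms(1) by (auto simp: I12_def)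
  have e: "x = pr r s (d1 (d2 y))" using pr_id[OF assms(2)] y by simp
  show ?thesis
  proof (cases r)
    case 0
    then show ?thesis using e pr_d1_0[OF d2_V[OF y(1)]] by simp
  next
    case (Suc r')
    then have e': "x = d1 (pr r' s (d2 y))" using e pr_d1_Suc[OF d2_V[OF y(1)]] by simp
    show ?thesis
    proof (cases s)
      case 0
      then have "pr r' s (d2 y) = 0" using pr_d2[OF y(1), of r' 0] by simp
      then show ?thesis using e' lin_zero[OF d1_lin] by simp
    next
      case (Suc s')
      then have "pr r' s (d2 y) = d2 (pr r' s' y)" using pr_d2[OF y(1), of r' s] by simp
      with e' have "x = d1 (d2 (pr r' s' y))" by (simp only:)
      moreover have "pr r' s' y \<in> T r' s'" by (rule pr_T[OF y(1)])
      ultimately show ?thesis using \<open>r = Suc r'\<close> Suc by (intro disjI2 exI conjI)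
    qed
  qed
qed

section \<open>Dimensions of the cohomologies in each bidegree\<close>

definition bc :: "nat \<Rightarrow> nat \<Rightarrow> enat" where "bc r s = quotient_dim (K1 \<inter> K2 \<inter> T r s) (I12 \<inter> T r s)"
definition ae :: "nat \<Rightarrow> nat \<Rightarrow> enat" where "ae r s = quotient_dim (K12 \<inter> T r s) (ssum I1 I2 \<inter> T r s)"
definition h1 :: "nat \<Rightarrow> nat \<Rightarrow> enat" where "h1 r s = quotient_dim (K1 \<inter> T r s) (I1 \<inter> T r s)"
definition h2 :: "nat \<Rightarrow> nat \<Rightarrow> enat" where "h2 r s = quotient_dim (K2 \<inter> T r s) (I2 \<inter> T r s)"
text \<open>\<open>aq\<close> and \<open>fq\<close> measure by how much the Bott-Chern and Aeppli
  dimensions together exceed the two Dolbeault dimensions.\<close>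

definition aq :: "nat \<Rightarrow> nat \<Rightarrow> enat" where "aq r s = quotient_dim (I1 \<inter> I2 \<inter> T r s) (I12 \<inter> T r s)"
definition fq :: "nat \<Rightarrow> nat \<Rightarrow> enat" where
  "fq r s = quotient_dim (K12 \<inter> T r s) (ssum (K1 \<inter> T r s) (K2 \<inter> T r s))"

text \<open>Intersection does not distribute over sums of arbitrary subspaces. It does here because
  both images are graded: projecting the two summands of a homogeneous element keeps each of them in
  its image.\<close>

lemma ssum_I_T: "ssum I1 I2 \<inter> T r s = ssum (I1 \<inter> T r s) (I2 \<inter> T r s)"
proof
  show "ssum (I1 \<inter> T r s) (I2 \<inter> T r s) \<subseteq> ssum I1 I2 \<inter> T r s"
    using ssum_mono[of "I1 \<inter> T r s" I1 "I2 \<inter> T r s" I2] ssum_least[OF subspace_T, of "I1 \<inter> T r s" r s "I2 \<inter> T r s"] by blast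
  show "ssum I1 I2 \<inter> T r s \<subseteq> ssum (I1 \<inter> T r s) (I2 \<inter> T r s)"
  proof
    fix x assume "x \<in> ssum I1 I2 \<inter> T r s"
    then obtain u v where x: "x \<in> T r s" "u \<in> V" "v \<in> V" "x = d1 u + d2 v" by (auto simp: ssum_def I1_def I2_def)
    have "x = pr r s (d1 u + d2 v)" using pr_id[OF x(1)] x(4) by simp
    then have e: "x = pr r s (d1 u) + pr r s (d2 v)" using lin_add[OF pr_lin d1_V[OF x(2)] d2_V[OF x(3)]] by simp
    have "pr r s (d1 u) \<in> I1" using pr_d1[OF x(2)] T_V[OF pr_T[OF x(2)]] fs.subspace_0[OF subspaces(4)]
      by (cases r) (auto simp: I1_def)
    moreover have "pr r s (d2 v) \<in> I2" using pr_d2[OF x(3)] T_V[OF pr_T[OF x(3)]] fs.subspace_0[OF subspaces(5)]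
      by (cases s) (auto simp: I2_def)
    ultimately show "x \<in> ssum (I1 \<inter> T r s) (I2 \<inter> T r s)"
      using e pr_T[OF d1_V[OF x(2)]] pr_T[OF d2_V[OF x(3)]] unfolding ssum_def by blast
  qed
qed

lemma bc_ae: "bc r s + ae r s = h1 r s + h2 r s + (aq r s + fq r s)"
proof -
  have "quotient_dim ((K1 \<inter> T r s) \<inter> (K2 \<inter> T r s)) (I12 \<inter> T r s) + quotient_dim (K12 \<inter> T r s) (ssum (I1 \<inter> T r s) (I2 \<inter> T r s))
    = quotient_dim (K1 \<inter> T r s) (I1 \<inter> T r s) + quotient_dim (K2 \<inter> T r s) (I2 \<inter> T r s)
      + (quotient_dim ((I1 \<inter> T r s) \<inter> (I2 \<inter> T r s)) (I12 \<inter> T r s) + quotient_dim (K12 \<inter> T r s) (ssum (K1 \<inter> T r s) (K2 \<inter> T r s)))"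
    by (rule quotient_dim_square) (use inclusions in \<open>auto intro!: fs.subspace_inter subspaces subspace_T\<close>)
  moreover have "(K1 \<inter> T r s) \<inter> (K2 \<inter> T r s) = K1 \<inter> K2 \<inter> T r s" "(I1 \<inter> T r s) \<inter> (I2 \<inter> T r s) = I1 \<inter> I2 \<inter> T r s" by auto
  ultimately show ?thesis unfolding bc_def ae_def h1_def h2_def aq_def fq_def ssum_I_T by simp
qed

section \<open>Total degree and the Hodge filtration\<close>

definition Hm :: "nat \<Rightarrow> ('m, 'v) form set" where
  "Hm k = {x \<in> V. \<forall>r s. r + s \<noteq> k \<longrightarrow> pr r s x = 0}"

text \<open>The \<open>p\<close>-th step of the Hodge filtration in total degree \<open>k\<close>:
  only components with first index at least \<open>p\<close> survive. It is all of
  \<open>Hm k\<close> for \<open>p = 0\<close> and trivial for \<open>p = Suc k\<close>.\<close>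

definition Fp :: "nat \<Rightarrow> nat \<Rightarrow> ('m, 'v) form set" where
  "Fp p k = {x \<in> Hm k. \<forall>r s. r < p \<longrightarrow> pr r s x = 0}"

lemma Hm_V: "x \<in> Hm k \<Longrightarrow> x \<in> V"
  by (simp add: Hm_def)

lemma Fp_V: "x \<in> Fp p k \<Longrightarrow> x \<in> V"
  by (simp add: Fp_def Hm_def)

lemma Fp_pr: "x \<in> Fp p k \<Longrightarrow> r < p \<or> r + s \<noteq> k \<Longrightarrow> pr r s x = 0"
  by (auto simp: Fp_def Hm_def)

lemma FpI: "x \<in> V \<Longrightarrow> (\<And>r s. r < p \<or> r + s \<noteq> k \<Longrightarrow> pr r s x = 0) \<Longrightarrow> x \<in> Fp p k"
  by (simp add: Fp_def Hm_def)

lemma Fp_0: "Fp 0 k = Hm k"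
  by (simp add: Fp_def)

lemma Fp_subspace: "fs.subspace (Fp p k)"
  by (rule fs.subspaceI; rule FpI)
    (use V_zero V_add V_scale Fp_V Fp_pr lin_zero[OF pr_lin] lin_add[OF pr_lin] lin_scale[OF pr_lin] in auto)

lemma Hm_subspace: "fs.subspace (Hm k)"
  using Fp_subspace[of 0 k] by (simp only: Fp_0)

lemma V_eq_zero: "x \<in> V \<Longrightarrow> (\<And>r s. pr r s x = 0) \<Longrightarrow> x = 0"
  using dec[of x] by (simp add: sum.neutral)

lemma Fp_top: "x \<in> Fp (Suc k) k \<Longrightarrow> x = 0"
  by (rule V_eq_zero[OF Fp_V]) (auto intro: Fp_pr)

lemma Fp_mono: "Fp (Suc p) k \<subseteq> Fp p k"
  by (auto simp: Fp_def)

lemma T_Fp: "x \<in> T r s \<Longrightarrow> x \<in> Fp r (r + s)"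
  by (rule FpI) (auto simp: T_V pr_id)

lemma d_Fp:
  assumes "x \<in> Fp p k"
  shows "d x \<in> Fp p (Suc k)"
proof (rule FpI[OF d_V[OF Fp_V[OF assms]]])
  fix r s assume rs: "r < p \<or> r + s \<noteq> Suc k"
  note x = Fp_V[OF assms]
  have "pr r s (d1 x) = 0"
    using pr_d1[OF x, of r s] Fp_pr[OF assms] rs lin_zero[OF d1_lin] by (cases r) auto
  moreover have "pr r s (d2 x) = 0"
    using pr_d2[OF x, of r s] Fp_pr[OF assms] rs lin_zero[OF d2_lin] by (cases s) auto
  ultimately show "pr r s (d x) = 0" using pr_d[OF x] by simp
qed

lemma d_Hm: "x \<in> Hm k \<Longrightarrow> d x \<in> Hm (Suc k)"
  using d_Fp[of x 0 k] by (simp only: Fp_0)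

text \<open>On leading components the total differential acts as \<open>d2\<close>, since the
  \<open>d1\<close> contribution would have to come from first index \<open>p - 1\<close>, which is
  absent in \<open>Fp p k\<close>.\<close>

lemma pr_d_Fp:
  assumes "x \<in> Fp p k" "p + s = Suc k"
  shows "pr p s (d x) = (case s of 0 \<Rightarrow> 0 | Suc s' \<Rightarrow> d2 (pr p s' x))"
proof -
  note x = Fp_V[OF assms(1)]
  have "pr p s (d1 x) = 0"
    using pr_d1[OF x, of p s] Fp_pr[OF assms(1)] lin_zero[OF d1_lin] by (cases p) auto
  then show ?thesis using pr_d[OF x] pr_d2[OF x] by simp
qed

lemma homogeneous_part:
  assumes x: "x \<in> V"
  obtains y where "y \<in> Hm k" "\<And>r s. r + s = k \<Longrightarrow> pr r s y = pr r s x"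
proof -
  define y where "y = (\<Sum>r\<le>q. \<Sum>s\<le>q. if r + s = k then pr r s x else 0)"
  have m: "(if r + s = k then pr r s x else 0) \<in> V" for r s using T_V[OF pr_T[OF x]] V_zero by simp
  have y: "y \<in> V" unfolding y_def by (intro V_sum m)
  have "pr r' s' y = (\<Sum>r\<le>q. pr r' s' (\<Sum>s\<le>q. if r + s = k then pr r s x else 0))" for r' s'
    unfolding y_def by (rule lin_on_sum'[OF pr_lin]) (intro V_sum m)
  also have "\<dots> r' s' = (\<Sum>r\<le>q. \<Sum>s\<le>q. pr r' s' (if r + s = k then pr r s x else 0))" for r' s'
    by (intro sum.cong refl lin_on_sum'[OF pr_lin] m)
  also have "\<dots> r' s' = (\<Sum>r\<le>q. \<Sum>s\<le>q. if s = s' then (if r = r' then (if r' + s' = k then pr r' s' x else 0) else 0) else 0)" for r' s'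
    by (intro sum.cong refl) (auto simp: pr_id[OF pr_T[OF x]] lin_zero[OF pr_lin])
  also have "\<dots> r' s' = (if r' \<le> q \<and> s' \<le> q then (if r' + s' = k then pr r' s' x else 0) else 0)" for r' s'
    by (cases "s' \<le> q"; cases "r' \<le> q") simp_all
  finally have e: "pr r' s' y = (if r' \<le> q \<and> s' \<le> q then (if r' + s' = k then pr r' s' x else 0) else 0)" for r' s' .
  show ?thesis
  proof (rule that)
    show "y \<in> Hm k" using y e by (simp add: Hm_def)
    show "pr r s y = pr r s x" if "r + s = k" for r s
      using e[of r s] that pr_out[OF _ x, of r s] by auto
  qed
qed

text \<open>A homogeneous exact element has a homogeneous primitive: truncate any primitive to the
  degree below and compare components. In degree 0 there is nothing below, so the element is
  zero.\<close>

lemma Bd_Hm: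
  assumes "x \<in> Bd" "x \<in> Hm k"
  shows "(k = 0 \<and> x = 0) \<or> (\<exists>k' y. k = Suc k' \<and> y \<in> Hm k' \<and> x = d y)"
proof -
  obtain y where y: "y \<in> V" "x = d y" using assms(1) by (auto simp: Bd_def)
  show ?thesis
  proof (cases k)
    case 0
    \<comment> \<open>A component of bidegree (0, 0) of a differential would come from a negative
      bidegree.\<close>
    have "pr r s x = 0" for r s
    proof (cases "r + s = 0")
      case True
      then show ?thesis using y pr_d[OF y(1), of r s] pr_d1[OF y(1), of r s] pr_d2[OF y(1), of r s] by simp
    next
      case False
      then show ?thesis using assms(2) 0 unfolding Hm_def by blast
    qed
    then show ?thesis using V_eq_zero[OF Hm_V[OF assms(2)]] 0 by simp
  next
    case (Suc k')
    obtain y' where y': "y' \<in> Hm k'" "\<And>r s. r + s = k' \<Longrightarrow> pr r s y' = pr r s y"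
      using homogeneous_part[OF y(1)] by blast
    have "pr r s (x - d y') = 0" for r s
    proof (cases "r + s = k")
      case True
      have "pr r s (d1 y') = pr r s (d1 y)" using pr_d1[OF y(1)] pr_d1[OF Hm_V[OF y'(1)]] y'(2) True Suc by (cases r) auto
      moreover have "pr r s (d2 y') = pr r s (d2 y)" using pr_d2[OF y(1)] pr_d2[OF Hm_V[OF y'(1)]] y'(2) True Suc by (cases s) auto
      ultimately show ?thesis
        using pr_d[OF y(1)] pr_d[OF Hm_V[OF y'(1)]] y(2) lin_diff[OF pr_lin d_V[OF y(1)] d_V[OF Hm_V[OF y'(1)]]] by simp
    next
      case False
      then show ?thesis using assms(2) d_Hm[OF y'(1)] Suc
          lin_diff[OF pr_lin Hm_V[OF assms(2)] d_V[OF Hm_V[OF y'(1)]]] by (simp add: Hm_def)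
    qed
    from V_eq_zero[OF V_diff[OF Hm_V[OF assms(2)] d_V[OF Hm_V[OF y'(1)]]] this]
    have "x = d y'" by (simp only: right_minus_eq)
    then show ?thesis using Suc y'(1) by blast
  qed
qed

subsection \<open>The Froelicher inequality\<close>

definition Zp :: "nat \<Rightarrow> nat \<Rightarrow> ('m, 'v) form set" where "Zp p k = Z \<inter> Fp p k"
text \<open>Modulo the boundaries of degree \<open>k\<close> this is the filtration induced on total
  cohomology: classes with a closed representative in \<open>Fp p k\<close>.\<close>

definition Sp :: "nat \<Rightarrow> nat \<Rightarrow> ('m, 'v) form set" where "Sp p k = ssum (Zp p k) (Bd \<inter> Hm k)"
definition betti :: "nat \<Rightarrow> enat" where "betti k = quotient_dim (Z \<inter> Hm k) (Bd \<inter> Hm k)"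

text \<open>\<open>E\<^sub>1\<close>-degeneration of the Froelicher spectral sequence at \<open>(r, s)\<close>.\<close>

definition lifts :: "nat \<Rightarrow> nat \<Rightarrow> bool" where
  "lifts r s \<longleftrightarrow> (\<forall>x \<in> K2 \<inter> T r s. \<exists>z \<in> Zp r (r + s). \<exists>w \<in> I2 \<inter> T r s. x = pr r s z + w)"

lemma Zp_subspace: "fs.subspace (Zp p k)"
  unfolding Zp_def by (intro fs.subspace_inter subspaces Fp_subspace)

lemma BH_subspace: "fs.subspace (Bd \<inter> Hm k)"
  by (intro fs.subspace_inter subspaces Hm_subspace)

lemma Sp_subspace: "fs.subspace (Sp p k)"
  unfolding Sp_def by (intro subspace_ssum Zp_subspace BH_subspace)

lemma Bd_Z: "Bd \<subseteq> Z"
  by (auto simp: Bd_def Z_def d_V d_d)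

lemma Sp_mono: "Sp (Suc p) k \<subseteq> Sp p k"
  unfolding Sp_def Zp_def using Fp_mono by (intro ssum_mono) auto

text \<open>The induced filtration runs from all cycles at step 0 to the boundaries at step
  \<open>Suc k\<close>, so the Betti number is the sum of the dimensions of the graded
  pieces.\<close>

lemma betti_sum: "betti k = (\<Sum>p<Suc k. quotient_dim (Sp p k) (Sp (Suc p) k))"
proof -
  have S0: "Sp 0 k = Z \<inter> Hm k"
  proof
    show "Sp 0 k \<subseteq> Z \<inter> Hm k" unfolding Sp_def Zp_def Fp_0
      by (rule ssum_least) (use Bd_Z in \<open>auto intro!: fs.subspace_inter subspaces Hm_subspace\<close>)
    show "Z \<inter> Hm k \<subseteq> Sp 0 k" unfolding Sp_def Zp_def Fp_0 by (rule ssum_left[OF BH_subspace])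
  qed
  have S1: "Sp (Suc k) k = Bd \<inter> Hm k"
  proof
    show "Sp (Suc k) k \<subseteq> Bd \<inter> Hm k" unfolding Sp_def Zp_def
      by (rule ssum_least[OF BH_subspace]) (use Fp_top fs.subspace_0[OF BH_subspace] in auto)
    show "Bd \<inter> Hm k \<subseteq> Sp (Suc k) k" unfolding Sp_def by (rule ssum_right[OF Zp_subspace])
  qed
  have "Sp n k \<subseteq> Sp 0 k \<and> quotient_dim (Sp 0 k) (Sp n k) = (\<Sum>p<n. quotient_dim (Sp p k) (Sp (Suc p) k))" for n
  proof (induction n)
    case 0
    then show ?case by (simp add: quotient_dim_zero)
  next
    case (Suc n)
    have "quotient_dim (Sp 0 k) (Sp (Suc n) k) = quotient_dim (Sp 0 k) (Sp n k) + quotient_dim (Sp n k) (Sp (Suc n) k)"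
      by (rule quotient_dim_chain) (use Suc Sp_mono Sp_subspace in auto)
    then show ?case using Suc Sp_mono[of n k] by auto
  qed
  from this[of "Suc k"] show ?thesis unfolding betti_def S0 S1 by blast
qed

lemma Zp_pr_K2:
  assumes "x \<in> Zp p k" "p + s = k"
  shows "pr p s x \<in> K2 \<inter> T p s"
proof -
  have x: "x \<in> Fp p k" "d x = 0" using assms by (auto simp: Zp_def Z_def)
  have "d2 (pr p s x) = pr p (Suc s) (d x)" using pr_d_Fp[OF x(1), of "Suc s"] assms(2) by simp
  also have "\<dots> = 0" using x lin_zero[OF pr_lin] by simp
  finally show ?thesis using pr_T[OF Fp_V[OF x(1)], of p s] T_V[of "pr p s x" p s] by (simp add: K2_def)
qed

text \<open>If the leading component is \<open>d2 y\<close> with \<open>y\<close> of bidegree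
  \<open>(p, s - 1)\<close>, then \<open>d y\<close> has the same leading component, and subtracting
  this boundary moves \<open>x\<close> one step up the filtration. If it is zero, \<open>x\<close>
  is there already.\<close>

lemma Zp_pr_I2:
  assumes x: "x \<in> Zp p k" and ps: "p + s = k" and i: "pr p s x \<in> I2"
  shows "x \<in> Sp (Suc p) k"
proof -
  have xF: "x \<in> Fp p k" "x \<in> Z" using x by (auto simp: Zp_def)
  note xV = Fp_V[OF xF(1)]
  have "\<exists>b \<in> Bd \<inter> Fp p k. pr p s b = pr p s x"
  proof -
    consider "pr p s x = 0" | s' y where "s = Suc s'" "y \<in> T p s'" "pr p s x = d2 y"
      using I2_T[OF i pr_T[OF xV]] by blast
    then show ?thesis
    proof cases
      case 1
      then show ?thesis using lin_zero[OF pr_lin] fs.subspace_0[OF subspaces(8)] fs.subspace_0[OF Fp_subspace, of p k]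
        by (intro bexI[of _ 0]) simp_all
    next
      case 2
      have yF: "y \<in> Fp p (p + s')" by (rule T_Fp[OF 2(2)])
      have "pr p s (d y) = d2 (pr p s' y)" using pr_d_Fp[OF yF, of s] 2(1) by simp
      also have "\<dots> = pr p s x" using pr_id[OF 2(2)] 2(3) by simp
      finally show ?thesis using d_Fp[OF yF] 2(1) ps T_V[OF 2(2)] by (auto simp: Bd_def)
    qed
  qed
  then obtain b where b: "b \<in> Bd" "b \<in> Fp p k" "pr p s b = pr p s x" by blast
  have "x - b \<in> Fp (Suc p) k"
  proof (rule FpI[OF V_diff[OF xV Fp_V[OF b(2)]]])
    fix r t assume rt: "r < Suc p \<or> r + t \<noteq> k"
    show "pr r t (x - b) = 0"
    proof (cases "r = p \<and> t = s")
      case True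
      then show ?thesis using b(3) lin_diff[OF pr_lin xV Fp_V[OF b(2)]] by simp
    next
      case False
      then have "r < p \<or> r + t \<noteq> k" using rt ps by auto
      then show ?thesis using Fp_pr[OF xF(1)] Fp_pr[OF b(2)] lin_diff[OF pr_lin xV Fp_V[OF b(2)]] by simp
    qed
  qed
  moreover have "x - b \<in> Z" using xF(2) b(1) Bd_Z fs.subspace_diff[OF subspaces(7)] by blast
  moreover have "b \<in> Bd \<inter> Hm k" using b by (auto simp: Fp_def)
  moreover have "x = (x - b) + b" by (simp only: diff_add_cancel)
  ultimately show ?thesis unfolding Sp_def Zp_def ssum_def by blast
qed

lemma Sp_Zp:
  "quotient_dim (Sp p k) (Sp (Suc p) k) = quotient_dim (Zp p k) (Zp p k \<inter> Sp (Suc p) k)"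
proof (rule antisym)
  show "quotient_dim (Sp p k) (Sp (Suc p) k) \<le> quotient_dim (Zp p k) (Zp p k \<inter> Sp (Suc p) k)"
  proof (rule quotient_dim_map_ge[OF lin_on_id[OF Zp_subspace] Sp_subspace])
    show "\<exists>x\<in>Zp p k. \<exists>w\<in>Sp (Suc p) k. y = x + w" if "y \<in> Sp p k" for y
      using that ssum_right[OF Zp_subspace[of "Suc p" k], of "Bd \<inter> Hm k"] unfolding Sp_def ssum_def[of "Zp p k"] by blast
  qed blast
  show "quotient_dim (Zp p k) (Zp p k \<inter> Sp (Suc p) k) \<le> quotient_dim (Sp p k) (Sp (Suc p) k)"
    by (rule quotient_dim_map_le[OF lin_on_id[OF Zp_subspace]])
      (use ssum_left[OF BH_subspace, of "Zp p k" k] in \<open>auto simp: Sp_def\<close>)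
qed

lemma pr_lin_Zp: "lin_on (Zp p k) (pr r s)"
  by (rule lin_on_subset[OF pr_lin Zp_subspace]) (auto simp: Zp_def Z_def)

text \<open>Taking leading components embeds the graded piece of total cohomology into the
  \<open>d2\<close>-cohomology; summed over \<open>p\<close> this is the Froelicher inequality. The
  target \<open>V'\<close> is left open so that the same bound can be applied to the subspace which
  the leading components actually fill.\<close>

lemma graded_le:
  assumes ps: "p + s = k" and V': "\<And>x. x \<in> Zp p k \<Longrightarrow> pr p s x \<in> V'"
  shows "quotient_dim (Sp p k) (Sp (Suc p) k) \<le> quotient_dim V' (I2 \<inter> T p s)"
  unfolding Sp_Zp by (rule quotient_dim_map_le[OF pr_lin_Zp V']) (use Zp_pr_I2[OF _ ps] in auto)

lemma betti_le: "betti k \<le> (\<Sum>p<Suc k. h2 p (k - p))"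
  unfolding betti_sum h2_def by (intro sum_mono graded_le) (use Zp_pr_K2 in auto)

text \<open>Degeneration makes \<open>d\<close> strict for the filtration. A primitive is improved
  step by step: as long as its filtration level is below that of its differential, its leading
  component is \<open>d2\<close>-closed, hence the leading component of a closed element by
  \<open>lifts\<close>, and subtracting that element does not change the differential.\<close>

lemma strict:
  assumes l: "\<And>r s. lifts r s" and y: "y \<in> Hm k" and dy: "d y \<in> Fp p (Suc k)"
  shows "\<exists>y' \<in> Fp p k. d y' = d y"
proof -
  have "m \<le> p \<Longrightarrow> \<exists>y' \<in> Fp m k. d y' = d y" for m
  proof (induction m)
    case 0
    then show ?case using y Fp_0 by auto
  next
    case (Suc m)
    then obtain y' where y': "y' \<in> Fp m k" "d y' = d y" by auto
    note y'V = Fp_V[OF y'(1)]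
    show ?case
    proof (cases "m \<le> k")
      case False
      have "y' \<in> Fp (Suc m) k"
      proof (rule FpI[OF y'V])
        show "pr r s y' = 0" if "r < Suc m \<or> r + s \<noteq> k" for r s
          by (rule Fp_pr[OF y'(1)]) (use that False in auto)
      qed
      then show ?thesis using y'(2) by blast
    next
      case True
      define s where "s = k - m"
      have ms: "m + s = k" using True by (simp add: s_def)
      \<comment> \<open>This is the component of \<open>d y\<close> with first index
        \<open>m < p\<close>, which vanishes by assumption on \<open>d y\<close>.\<close>
      have "d2 (pr m s y') = pr m (Suc s) (d y')" using pr_d_Fp[OF y'(1), of "Suc s"] ms by simp
      also have "\<dots> = 0" using Fp_pr[OF dy, of m "Suc s"] y'(2) Suc.prems by simp
      finally have "pr m s y' \<in> K2 \<inter> T m s"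
        using pr_T[OF y'V, of m s] T_V[of "pr m s y'" m s] by (simp add: K2_def)
      then obtain z w where z: "z \<in> Zp m k" and w: "w \<in> I2" "w \<in> T m s" and e: "pr m s y' = pr m s z + w"
        using l[of m s] ms unfolding lifts_def by blast
      have zF: "z \<in> Fp m k" "d z = 0" using z by (auto simp: Zp_def Z_def)
      \<comment> \<open>The error \<open>w = d2 u\<close> allowed in \<open>lifts\<close> is itself
        the leading component of the closed element \<open>d u\<close>.\<close>
      have "\<exists>g \<in> Fp m k. pr m s g = w \<and> d g = 0"
      proof -
        consider "w = 0" | s' u where "s = Suc s'" "u \<in> T m s'" "w = d2 u" using I2_T[OF w] by blast
        then show ?thesis
        proof cases
          case 1
          then show ?thesis using lin_zero[OF pr_lin] lin_zero[OF d_lin] fs.subspace_0[OF Fp_subspace] by blast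
        next
          case 2
          have uF: "u \<in> Fp m (m + s')" by (rule T_Fp[OF 2(2)])
          have "pr m s (d u) = w" using pr_d_Fp[OF uF, of s] 2 pr_id[OF 2(2)] by simp
          then show ?thesis using d_Fp[OF uF] d_d[OF T_V[OF 2(2)]] 2(1) ms by auto
        qed
      qed
      then obtain g where g: "g \<in> Fp m k" "pr m s g = w" "d g = 0" by blast
      define y'' where "y'' = y' - (z + g)"
      have zg: "z + g \<in> Fp m k" by (rule fs.subspace_add[OF Fp_subspace zF(1) g(1)])
      have F: "y'' \<in> Fp m k" unfolding y''_def by (rule fs.subspace_diff[OF Fp_subspace y'(1) zg])
      have "pr m s y'' = pr m s y' - (pr m s z + pr m s g)" unfolding y''_def
        using lin_diff[OF pr_lin y'V Fp_V[OF zg]] lin_add[OF pr_lin Fp_V[OF zF(1)] Fp_V[OF g(1)]] by simp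
      then have p0: "pr m s y'' = 0" using e g(2) by simp
      have "y'' \<in> Fp (Suc m) k"
      proof (rule FpI[OF Fp_V[OF F]])
        fix r t assume rt: "r < Suc m \<or> r + t \<noteq> k"
        show "pr r t y'' = 0"
        proof (cases "r = m \<and> t = s")
          case True
          then show ?thesis using p0 by simp
        next
          case False
          then have "r < m \<or> r + t \<noteq> k" using rt ms by auto
          then show ?thesis by (rule Fp_pr[OF F])
        qed
      qed
      moreover have "d y'' = d y" unfolding y''_def
        using lin_diff[OF d_lin y'V Fp_V[OF zg]] lin_add[OF d_lin Fp_V[OF zF(1)] Fp_V[OF g(1)]] zF(2) g(3) y'(2) by simp
      ultimately show ?thesis by blast
    qed
  qed
  then show ?thesis by simp
qed

text \<open>Under degeneration the leading component gives an isomorphism from the graded piece to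
  the \<open>d2\<close>-cohomology. Surjectivity is \<open>lifts\<close>. That the inverse is well
  defined needs \<open>strict\<close>: a boundary in \<open>Fp p k\<close> has a primitive at the
  same level, so its leading component is \<open>d2\<close>-exact.\<close>

lemma betti_eq:
  assumes l: "\<And>r s. lifts r s"
  shows "betti k = (\<Sum>p<Suc k. h2 p (k - p))"
proof (rule antisym[OF betti_le])
  show "(\<Sum>p<Suc k. h2 p (k - p)) \<le> betti k"
    unfolding betti_sum Sp_Zp
  proof (rule sum_mono)
    fix p assume "p \<in> {..<Suc k}"
    then have ps: "p + (k - p) = k" by simp
    define s where "s = k - p"
    have ps: "p + s = k" using ps by (simp add: s_def)
    show "h2 p (k - p) \<le> quotient_dim (Zp p k) (Zp p k \<inter> Sp (Suc p) k)"
      unfolding h2_def s_def[symmetric]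
    proof (rule quotient_dim_map_ge[OF pr_lin_Zp])
      show "fs.subspace (I2 \<inter> T p s)" by (intro fs.subspace_inter subspaces subspace_T)
      show "\<exists>x\<in>Zp p k. \<exists>w\<in>I2 \<inter> T p s. y = pr p s x + w" if "y \<in> K2 \<inter> T p s" for y
        using l[of p s] that ps unfolding lifts_def by blast
      fix x assume x: "x \<in> Zp p k" "x \<in> Zp p k \<inter> Sp (Suc p) k"
      then obtain z b where zb: "z \<in> Zp (Suc p) k" "b \<in> Bd" "b \<in> Hm k" "x = z + b" by (auto simp: Sp_def ssum_def)
      have zF: "z \<in> Fp (Suc p) k" and xF: "x \<in> Fp p k" using zb x by (auto simp: Zp_def)
      have "b = x - z" using zb(4) by (simp only: add_diff_cancel_left')
      then have bF: "b \<in> Fp p k" using fs.subspace_diff[OF Fp_subspace xF] zF Fp_mono by blast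
      have "pr p s z = 0" by (rule Fp_pr[OF zF]) simp
      then have e: "pr p s x = pr p s b" using zb(4) lin_add[OF pr_lin Fp_V[OF zF] Fp_V[OF bF]] by simp
      have "pr p s b \<in> I2"
      proof -
        consider "b = 0" | k' y where "k = Suc k'" "y \<in> Hm k'" "b = d y" using Bd_Hm[OF zb(2,3)] by blast
        then show ?thesis
        proof cases
          case 1
          then show ?thesis using lin_zero[OF pr_lin] fs.subspace_0[OF subspaces(5)] by simp
        next
          case 2
          then obtain y' where y': "y' \<in> Fp p k'" "d y' = d y" using strict[OF l 2(2), of p] bF by auto
          then have "pr p s b = (case s of 0 \<Rightarrow> 0 | Suc s' \<Rightarrow> d2 (pr p s' y'))"
            using pr_d_Fp[OF y'(1), of s] 2 ps by simp
          then show ?thesis using fs.subspace_0[OF subspaces(5)] T_V[OF pr_T[OF Fp_V[OF y'(1)]]]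
            by (cases s) (auto simp: I2_def)
        qed
      qed
      then show "pr p s x \<in> I2 \<inter> T p s" using e pr_T[OF Fp_V[OF bF], of p s] by simp
    qed
  qed
qed

text \<open>Cancellation in the extended naturals; the finite total rules out that a strict
  inequality is hidden by an infinite summand.\<close>

lemma enat_sum_eq:
  fixes a b :: "'i \<Rightarrow> enat"
  assumes "finite S" "\<And>i. i \<in> S \<Longrightarrow> a i \<le> b i" "sum b S < \<infinity>" "sum a S = sum b S" "j \<in> S"
  shows "a j = b j"
proof -
  have s: "sum a S = a j + sum a (S - {j})" "sum b S = b j + sum b (S - {j})"
    using assms by (simp_all add: sum.remove)
  have "sum a (S - {j}) \<le> sum b (S - {j})" using assms by (intro sum_mono) auto
  moreover have "a j \<le> b j" using assms by blast
  ultimately show ?thesis using s assms(3,4)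
    by (cases "a j"; cases "b j"; cases "sum a (S - {j})"; cases "sum b (S - {j})") auto
qed

text \<open>Equality of the sums forces equality at each \<open>p\<close>, as all summands are
  bounded and the total is finite. The leading components then leave no room for further
  \<open>d2\<close>-classes.\<close>

lemma lifts_of_betti:
  assumes eq: "\<And>k. betti k = (\<Sum>p<Suc k. h2 p (k - p))" and fin: "\<And>k. (\<Sum>p<Suc k. h2 p (k - p)) < \<infinity>"
  shows "lifts r s"
proof -
  define k where "k = r + s"
  have rs: "r + s = k" and ks: "k - r = s" by (simp_all add: k_def)
  have le: "quotient_dim (Sp p k) (Sp (Suc p) k) \<le> h2 p (k - p)" if "p \<in> {..<Suc k}" for p
    unfolding h2_def by (intro graded_le) (use Zp_pr_K2 that in auto)
  have e: "quotient_dim (Sp r k) (Sp (Suc r) k) = h2 r s"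
    using enat_sum_eq[OF finite_lessThan le fin, of r] eq[of k] unfolding betti_sum ks k_def by simp
  define M where "M = ssum ((pr r s) ` Zp r k) (I2 \<inter> T r s)"
  have IT: "fs.subspace (I2 \<inter> T r s)" and KT: "fs.subspace (K2 \<inter> T r s)"
    by (intro fs.subspace_inter subspaces subspace_T)+
  have img: "fs.subspace (pr r s ` Zp r k)" by (rule lin_on_image[OF pr_lin_Zp])
  have M: "fs.subspace M" unfolding M_def by (rule subspace_ssum[OF img IT])
  have MK: "M \<subseteq> K2 \<inter> T r s" unfolding M_def
    by (rule ssum_least[OF KT]) (use Zp_pr_K2[OF _ rs] inclusions in auto)
  have IM: "I2 \<inter> T r s \<subseteq> M" unfolding M_def by (rule ssum_right[OF img])
  have c: "h2 r s = quotient_dim (K2 \<inter> T r s) M + quotient_dim M (I2 \<inter> T r s)"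
    unfolding h2_def by (rule quotient_dim_chain[OF IT M KT IM MK])
  have "h2 r s \<le> quotient_dim M (I2 \<inter> T r s)" unfolding e[symmetric]
  proof (rule graded_le[OF rs])
    show "pr r s x \<in> M" if "x \<in> Zp r k" for x
      using ssum_left[OF IT, of "pr r s ` Zp r k"] that unfolding M_def by blast
  qed
  moreover have "h2 r s < \<infinity>"
  proof -
    have "h2 r (k - r) \<le> (\<Sum>p<Suc k. h2 p (k - p))" by (rule member_le_sum) (auto simp: k_def)
    then show ?thesis using fin[of k] ks by (metis order_le_less_trans)
  qed
  ultimately have "quotient_dim (K2 \<inter> T r s) M = 0" using c
    by (cases "h2 r s"; cases "quotient_dim (K2 \<inter> T r s) M"; cases "quotient_dim M (I2 \<inter> T r s)") (auto simp: zero_enat_def)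
  then have "K2 \<inter> T r s \<subseteq> M" by (rule quotient_dim_eq_0D[OF M])
  then show ?thesis unfolding lifts_def M_def ssum_def k_def by blast
qed

end

context double_complex
begin

subsection \<open>The \<open>\<partial>\<partial>\<close>-lemma and degeneration\<close>

lemma swap_simps:
  "double_complex.K1 V d2 = K2" "double_complex.K2 V d1 = K1" "double_complex.I1 V d2 = I1'" if "I1' = I2" for I1'
  using that unfolding double_complex.K1_def[OF swap] double_complex.K2_def[OF swap] double_complex.I1_def[OF swap]
    K1_def K2_def I2_def by simp_all

lemma swap_d: "double_complex.d d2 d1 = d"
  by (rule ext) (simp only: double_complex.d_def[OF swap] d_def add.commute)

lemma swap_Z: "double_complex.Z V d2 d1 = Z" and swap_Bd: "double_complex.Bd V d2 d1 = Bd"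
  unfolding double_complex.Z_def[OF swap] double_complex.Bd_def[OF swap] Z_def Bd_def swap_d by simp_all

text \<open>The two composites differ by a sign only, and the sign is absorbed by negating the
  argument.\<close>

lemma swap_I12: "double_complex.I12 V d2 d1 = I12"
proof -
  have n: "f (- x) = - f x" if "lin_on V f" "x \<in> V" for f x
    using lin_diff[OF that(1) V_zero that(2)] lin_zero[OF that(1)] by (simp only: diff_0)
  have neg: "- x \<in> V" if "x \<in> V" for x using fs.subspace_neg[OF subspace_V that] .
  have e: "d2 (d1 x) = d1 (d2 (- x))" if "x \<in> V" for x
    using d2_d1[OF that] n[OF d2_lin that] n[OF d1_lin d2_V[OF that]] by simp
  show ?thesis unfolding double_complex.I12_def[OF swap] I12_def
  proof (intro set_eqI iffI)
    fix y assume "y \<in> (\<lambda>x. d2 (d1 x)) ` V"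
    then show "y \<in> (\<lambda>x. d1 (d2 x)) ` V" using e neg by auto
  next
    fix y assume "y \<in> (\<lambda>x. d1 (d2 x)) ` V"
    then obtain x where x: "x \<in> V" "y = d1 (d2 x)" by blast
    then have "y = d2 (d1 (- x))" using e[OF neg[OF x(1)]] by simp
    then show "y \<in> (\<lambda>x. d2 (d1 x)) ` V" using neg[OF x(1)] by blast
  qed
qed

lemma swap_Hm: "double_complex.Hm V (\<lambda>r s. pr s r) k = Hm k"
  unfolding double_complex.Hm_def[OF swap] Hm_def by (auto simp: add.commute)

lemma swap_h2: "double_complex.h2 V (\<lambda>r s. T s r) d1 r s = h1 s r"
  unfolding double_complex.h2_def[OF swap] double_complex.K2_def[OF swap] double_complex.I2_def[OF swap]
    h1_def K1_def I1_def ..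

lemma swap_betti: "double_complex.betti V (\<lambda>r s. pr s r) d2 d1 k = betti k"
  unfolding double_complex.betti_def[OF swap] swap_Z swap_Bd swap_Hm betti_def ..

lemma sum_h1: "(\<Sum>p<Suc k. double_complex.h2 V (\<lambda>r s. T s r) d1 p (k - p)) = (\<Sum>p<Suc k. h1 p (k - p))"
  unfolding swap_h2 using sum.nat_diff_reindex[of "\<lambda>p. h1 p (k - p)" "Suc k"]
  by (simp del: sum.lessThan_Suc cong: sum.cong_simp)

text \<open>Degeneration for the filtration by the second index. The indices are transposed:
  \<open>colifts r s\<close> is about elements of \<open>T s r\<close>.\<close>

definition colifts :: "nat \<Rightarrow> nat \<Rightarrow> bool" where
  "colifts = double_complex.lifts V (\<lambda>r s. T s r) (\<lambda>r s. pr s r) d2 d1"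

lemma betti_le': "betti k \<le> (\<Sum>p<Suc k. h1 p (k - p))"
  using double_complex.betti_le[OF swap, of k] unfolding sum_h1 swap_betti .

lemma betti_eq': "(\<And>r s. colifts r s) \<Longrightarrow> betti k = (\<Sum>p<Suc k. h1 p (k - p))"
  using double_complex.betti_eq[OF swap, of k] unfolding sum_h1 swap_betti colifts_def by blast

lemma colifts_of_betti:
  "(\<And>k. betti k = (\<Sum>p<Suc k. h1 p (k - p))) \<Longrightarrow> (\<And>k. (\<Sum>p<Suc k. h1 p (k - p)) < \<infinity>) \<Longrightarrow> colifts r s"
  unfolding colifts_def
  by (rule double_complex.lifts_of_betti[OF swap]) (simp_all only: sum_h1 swap_betti)

lemma subspace_pr:
  assumes "fs.subspace S" "x \<in> V" "\<And>r s. pr r s x \<in> S"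
  shows "x \<in> S"
  by (subst dec[OF assms(2)]) (intro fs.subspace_sum[OF assms(1)] assms(3))

lemma Bd_part:
  assumes "x \<in> Bd"
  shows "\<exists>x' \<in> Bd \<inter> Hm k. \<forall>r s. r + s = k \<longrightarrow> pr r s x' = pr r s x"
proof -
  obtain y where y: "y \<in> V" "x = d y" using assms by (auto simp: Bd_def)
  show ?thesis
  proof (cases k)
    case 0
    have "pr 0 0 x = 0" using y pr_d[OF y(1), of 0 0] pr_d1[OF y(1), of 0 0] pr_d2[OF y(1), of 0 0] by simp
    then show ?thesis using 0 lin_zero[OF pr_lin] fs.subspace_0[OF BH_subspace, of k]
      by (intro bexI[of _ 0]) simp_all
  next
    case (Suc k')
    obtain y' where y': "y' \<in> Hm k'" "\<And>r s. r + s = k' \<Longrightarrow> pr r s y' = pr r s y"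
      using homogeneous_part[OF y(1)] by blast
    have "pr r s (d y') = pr r s x" if "r + s = k" for r s
    proof -
      have "pr r s (d1 y') = pr r s (d1 y)"
        using pr_d1[OF y(1)] pr_d1[OF Hm_V[OF y'(1)]] y'(2) that Suc by (cases r) auto
      moreover have "pr r s (d2 y') = pr r s (d2 y)"
        using pr_d2[OF y(1)] pr_d2[OF Hm_V[OF y'(1)]] y'(2) that Suc by (cases s) auto
      ultimately show ?thesis using pr_d[OF y(1)] pr_d[OF Hm_V[OF y'(1)]] y(2) by simp
    qed
    moreover have "d y' \<in> Bd \<inter> Hm k" using d_Hm[OF y'(1)] Suc Hm_V[OF y'(1)] by (simp add: Bd_def)
    ultimately show ?thesis by blast
  qed
qed

lemma I12_graded: "x \<in> I12 \<Longrightarrow> pr r s x \<in> I12"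
proof -
  assume "x \<in> I12"
  then obtain y where y: "y \<in> V" "x = d1 (d2 y)" by (auto simp: I12_def)
  show "pr r s x \<in> I12"
  proof (cases "r = 0 \<or> s = 0")
    case True
    have z: "pr 0 s x = 0" for s using y pr_d1_0[OF d2_V[OF y(1)]] by simp
    have "pr r 0 x = 0"
    proof (cases r)
      case (Suc r')
      have "pr r' 0 (d2 y) = 0" using pr_d2[OF y(1), of r' 0] by simp
      then show ?thesis using y(2) pr_d1_Suc[OF d2_V[OF y(1)], of r' 0] Suc lin_zero[OF d1_lin] by simp
    qed (simp add: z)
    then show ?thesis using True z fs.subspace_0[OF subspaces(6)] by auto
  next
    case False
    then obtain r' s' where rs: "r = Suc r'" "s = Suc s'" by (metis not0_implies_Suc)
    have "pr r s x = d1 (d2 (pr r' s' y))"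
      using y(2) pr_d1_Suc[OF d2_V[OF y(1)], of r' s] pr_d2[OF y(1), of r' s] rs by simp
    then show ?thesis using T_V[OF pr_T[OF y(1)]] by (simp add: I12_def)
  qed
qed

lemma I12_subset: "I12 \<subseteq> K1 \<inter> K2 \<inter> Bd"
proof -
  have "I12 \<subseteq> Bd"
  proof
    fix y assume "y \<in> I12"
    then obtain x where x: "x \<in> V" "y = d1 (d2 x)" by (auto simp: I12_def)
    then have "y = d (d2 x)" using d2_d2[OF x(1)] unfolding d_def by (simp only: add_0_right)
    then show "y \<in> Bd" unfolding Bd_def using d2_V[OF x(1)] by blast
  qed
  then show ?thesis using inclusions by blast
qed

text \<open>A closed and exact homogeneous \<open>x\<close> is reduced by descending induction on
  its filtration level. Its leading component is shown to be \<open>d1\<close>-exact and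
  \<open>d2\<close>-exact at once, hence in \<open>I12\<close> by the vanishing of the first defect,
  and may be subtracted. Each hypothesis has its place: \<open>lifts\<close> makes the leading
  component \<open>d2\<close>-exact, the second defect makes its primitive \<open>d1\<close>-closed,
  and \<open>colifts\<close> turns it into a \<open>d1\<close>-exact element. Inhomogeneous
  \<open>x\<close> are treated degree by degree.\<close>

lemma lemma_of_degeneration:
  assumes a: "\<And>r s. I1 \<inter> I2 \<inter> T r s \<subseteq> I12"
    and f: "\<And>r s. K12 \<inter> T r s \<subseteq> ssum (K1 \<inter> T r s) (K2 \<inter> T r s)"
    and l: "\<And>r s. lifts r s" and l': "\<And>r s. colifts r s"
  shows "K1 \<inter> K2 \<inter> Bd = I12"
proof
  interpret sw: double_complex V "\<lambda>r s. T s r" "\<lambda>r s. pr s r" d2 d1 q by (rule swap)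
  have hom: "x \<in> Fp p k \<Longrightarrow> x \<in> K1 \<inter> K2 \<inter> Bd \<Longrightarrow> x \<in> I12" for x p k
  proof (induction "Suc k - p" arbitrary: p x)
    case 0
    have "x \<in> Fp (Suc k) k"
      by (rule FpI[OF Fp_V[OF 0(2)]], rule Fp_pr[OF 0(2)]) (use 0(1) in auto)
    then show ?case using Fp_top fs.subspace_0[OF subspaces(6)] by blast
  next
    case (Suc m)
    then have pk: "p \<le> k" by simp
    define s where "s = k - p"
    have ps: "p + s = k" using pk by (simp add: s_def)
    have IH: "z \<in> I12" if "z \<in> Fp (Suc p) k" "z \<in> K1 \<inter> K2 \<inter> Bd" for z
      by (rule Suc.hyps(1)[OF _ that]) (use Suc.hyps(2) in simp)
    note xF = Suc.prems(1)
    note xV = Fp_V[OF xF]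
    define xp where "xp = pr p s x"
    have step: "z \<in> Fp (Suc p) k" if "z \<in> Fp p k" "pr p s z = 0" for z
    proof (rule FpI[OF Fp_V[OF that(1)]])
      fix r t assume rt: "r < Suc p \<or> r + t \<noteq> k"
      show "pr r t z = 0"
      proof (cases "r = p \<and> t = s")
        case True
        then show ?thesis using that by simp
      next
        case False
        then have "r < p \<or> r + t \<noteq> k" using rt ps by auto
        then show ?thesis by (rule Fp_pr[OF that(1)])
      qed
    qed
    consider "x = 0" | k' y where "k = Suc k'" "y \<in> Hm k'" "x = d y"
      using Bd_Hm[of x k] Suc.prems by (auto simp: Fp_def)
    then show ?case
    proof cases
      case 1
      then show ?thesis using fs.subspace_0[OF subspaces(6)] by simp
    next
      case 2
      obtain y' where y': "y' \<in> Fp p k'" "d y' = x" using strict[OF l 2(2), of p] xF 2 by auto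
      have xpe: "xp = (case s of 0 \<Rightarrow> 0 | Suc s' \<Rightarrow> d2 (pr p s' y'))"
        using pr_d_Fp[OF y'(1), of s] y'(2) 2(1) ps by (simp add: xp_def)
      show ?thesis
      proof (cases s)
        case 0
        then show ?thesis using IH[OF step[OF xF]] xpe Suc.prems(2) by (simp add: xp_def)
      next
        case (Suc s')
        define yp where "yp = pr p s' y'"
        have yT: "yp \<in> T p s'" unfolding yp_def by (rule pr_T[OF Fp_V[OF y'(1)]])
        have xpd: "xp = d2 yp" using xpe Suc by (simp add: yp_def)
        have xpK: "xp \<in> K1" "xp \<in> K2" unfolding xp_def using graded(1,2) Suc.prems(2) by auto
        \<comment> \<open>Since \<open>d1 xp = 0\<close>, the primitive lies in the kernel of the
          composite. Splitting off its \<open>d2\<close>-closed part leaves a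
          \<open>d1\<close>-closed primitive \<open>u\<close>, so that \<open>xp\<close> is even the
          total differential of \<open>u\<close>.\<close>
        have "yp \<in> K12" using xpK(1) xpd T_V[OF yT] by (simp add: K1_def K12_def)
        then obtain u v where uv: "u \<in> K1" "u \<in> T p s'" "v \<in> K2" "v \<in> T p s'" "yp = u + v"
          using f[of p s'] yT unfolding ssum_def by blast
        have uV: "u \<in> V" by (rule T_V[OF uv(2)])
        have "xp = d2 u" using xpd uv(3,5) lin_add[OF d2_lin uV T_V[OF uv(4)]] by (simp add: K2_def)
        then have xpu: "xp = d u" using uv(1) by (simp add: d_def K1_def)
        have xpT: "xp \<in> T p s" unfolding xp_def by (rule pr_T[OF xV])
        have "u \<in> sw.Fp s' (s' + p)" by (rule sw.T_Fp[OF uv(2)])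
        moreover have k': "s' + p = k'" using ps Suc 2(1) by simp
        ultimately have uH: "u \<in> sw.Hm k'" by (simp add: sw.Fp_def)
        \<comment> \<open>In the transposed filtration \<open>xp\<close> has level \<open>s\<close>
          while \<open>u\<close> only has level \<open>s - 1\<close>. Strictness supplies a
          primitive of level \<open>s\<close>, whose differential has a leading component of the
          form \<open>d1\<close> of something.\<close>
        have "sw.d u \<in> sw.Fp s (Suc k')"
          using sw.T_Fp[OF xpT] k' Suc xpu unfolding swap_d by simp
        then obtain u' where u': "u' \<in> sw.Fp s k'" "sw.d u' = sw.d u"
          using sw.strict[OF l'[unfolded colifts_def] uH] by blast
        have "pr p s (sw.d u') = (case p of 0 \<Rightarrow> 0 | Suc p' \<Rightarrow> d1 (pr p' s u'))"
          using sw.pr_d_Fp[OF u'(1), of p] k' Suc by simp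
        moreover have "pr p s (sw.d u') = xp" using u'(2) xpu pr_id[OF xpT] unfolding swap_d by simp
        ultimately have "xp = (case p of 0 \<Rightarrow> 0 | Suc p' \<Rightarrow> d1 (pr p' s u'))" by simp
        moreover have "d1 (pr p' s u') \<in> I1" for p'
          unfolding I1_def by (rule imageI[OF T_V[OF pr_T[OF sw.Fp_V[OF u'(1)]]]])
        ultimately have "xp \<in> I1" using fs.subspace_0[OF subspaces(4)] by (cases p) simp_all
        moreover have "xp \<in> I2" unfolding I2_def using \<open>xp = d2 u\<close> uV by blast
        ultimately have xpI: "xp \<in> I12" using a[of p s] xpT by blast
        have xpF: "xp \<in> Fp p k" using T_Fp[OF xpT] ps by simp
        have "x - xp \<in> Fp (Suc p) k"
        proof (rule step[OF fs.subspace_diff[OF Fp_subspace xF xpF]])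
          show "pr p s (x - xp) = 0"
            using lin_diff[OF pr_lin xV Fp_V[OF xpF]] pr_id[OF xpT] by (simp add: xp_def)
        qed
        moreover have "x - xp \<in> K1 \<inter> K2 \<inter> Bd"
          using Suc.prems(2) I12_subset xpI fs.subspace_diff subspaces by blast
        ultimately have "x - xp \<in> I12" by (rule IH)
        then have "(x - xp) + xp \<in> I12" by (rule fs.subspace_add[OF subspaces(6) _ xpI])
        then show ?thesis by (simp only: diff_add_cancel)
      qed
    qed
  qed
  show "K1 \<inter> K2 \<inter> Bd \<subseteq> I12"
  proof
    fix x assume x: "x \<in> K1 \<inter> K2 \<inter> Bd"
    then have xV: "x \<in> V" by (simp add: K1_def)
    show "x \<in> I12"
    proof (rule subspace_pr[OF subspaces(6) xV])
      fix r s
      obtain x' where x': "x' \<in> Bd" "x' \<in> Hm (r + s)" "\<And>r' s'. r' + s' = r + s \<Longrightarrow> pr r' s' x' = pr r' s' x"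
        using Bd_part[of x "r + s"] x by blast
      have "pr r' s' x' \<in> K1 \<inter> K2" for r' s'
      proof (cases "r' + s' = r + s")
        case True
        then show ?thesis using x'(3)[OF True] graded(1,2) x by auto
      next
        case False
        then have "pr r' s' x' = 0" using x'(2) unfolding Hm_def by blast
        then show ?thesis using fs.subspace_0[OF subspaces(1)] fs.subspace_0[OF subspaces(2)] by simp
      qed
      then have "x' \<in> K1 \<inter> K2"
        by (rule subspace_pr[OF fs.subspace_inter[OF subspaces(1,2)] Hm_V[OF x'(2)]])
      then have "x' \<in> I12" using hom[of x' 0 "r + s"] x' unfolding Fp_0 by blast
      then show "pr r s x \<in> I12" using I12_graded[of x' r s] x'(3)[of r s] by simp
    qed
  qed
qed (rule I12_subset)

text \<open>If \<open>x = d1 u\<close> is \<open>d2\<close>-closed, then the whole of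
  \<open>d u\<close> is closed for both operators and exact, hence in \<open>I12\<close>. Its
  component of bidegree \<open>(r, s)\<close> is \<open>x\<close>, and \<open>I12\<close> is
  graded.\<close>

lemma lemma_K2_I1:
  assumes L: "K1 \<inter> K2 \<inter> Bd \<subseteq> I12" and x: "x \<in> K2" "x \<in> I1" "x \<in> T r s"
  shows "x \<in> I12"
proof -
  consider "x = 0" | r' u where "r = Suc r'" "u \<in> T r' s" "x = d1 u" using I1_T[OF x(2,3)] by blast
  then show ?thesis
  proof cases
    case 1
    then show ?thesis using fs.subspace_0[OF subspaces(6)] by simp
  next
    case 2
    have uV: "u \<in> V" by (rule T_V[OF 2(2)])
    have d2x: "d2 x = 0" using x(1) by (simp add: K2_def)
    have d12u: "d1 (d2 u) = 0" using d12[OF uV] d2x 2(3) by simp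
    have "d1 (d u) = 0" unfolding d_def using lin_add[OF d1_lin d1_V[OF uV] d2_V[OF uV]] d1_d1[OF uV] d12u by simp
    moreover have "d2 (d u) = 0" unfolding d_def
      using lin_add[OF d2_lin d1_V[OF uV] d2_V[OF uV]] d2_d2[OF uV] d2x 2(3) by simp
    ultimately have "d u \<in> K1 \<inter> K2 \<inter> Bd" using d_V[OF uV] uV by (auto simp: K1_def K2_def Bd_def)
    then have "pr r s (d u) \<in> I12" using L I12_graded by blast
    moreover have "pr r s (d u) = x"
      using pr_d[OF uV, of r s] pr_id[OF x(3), of r s] pr_id[OF d2_T[OF 2(2)], of r s] 2 by simp
    ultimately show ?thesis by simp
  qed
qed

lemma lemma_K1_I2:
  assumes L: "K1 \<inter> K2 \<inter> Bd \<subseteq> I12" and x: "x \<in> K1" "x \<in> I2" "x \<in> T r s"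
  shows "x \<in> I12"
proof -
  have e: "double_complex.K1 V d2 = K2" "double_complex.K2 V d1 = K1" "double_complex.I1 V d2 = I2"
    using swap_simps[OF refl] by simp_all
  show ?thesis
    using double_complex.lemma_K2_I1[OF swap, where x=x and r=s and s=r] L x
    unfolding e swap_Bd swap_I12 by blast
qed

text \<open>For \<open>d2\<close>-closed \<open>x\<close> the element \<open>d1 x\<close> is
  \<open>d1\<close>-exact and \<open>d2\<close>-closed, so \<open>d1 x = d1 (d2 y)\<close> unless it
  vanishes. Then \<open>x - d2 y\<close> is closed and represents the same
  \<open>d2\<close>-class.\<close>

lemma lifts_of_lemma:
  assumes L: "K1 \<inter> K2 \<inter> Bd \<subseteq> I12"
  shows "lifts r s"
  unfolding lifts_def
proof
  fix x assume x: "x \<in> K2 \<inter> T r s"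
  then have xV: "x \<in> V" and xT: "x \<in> T r s" and d2x: "d2 x = 0" by (auto simp: K2_def)
  have "d2 (d1 x) = 0" using d2_d1[OF xV] d2x lin_zero[OF d1_lin] by simp
  then have "d1 x \<in> I12"
    by (intro lemma_K2_I1[OF L _ _ d1_T[OF xT]]) (use xV d1_V[OF xV] in \<open>auto simp: K2_def I1_def\<close>)
  then consider "d1 x = 0" | s' y where "s = Suc s'" "y \<in> T r s'" "d1 x = d1 (d2 y)"
    using I12_T[OF _ d1_T[OF xT]] by blast
  then show "\<exists>z\<in>Zp r (r + s). \<exists>w\<in>I2 \<inter> T r s. x = pr r s z + w"
  proof cases
    case 1
    then have "x \<in> Zp r (r + s)" using T_Fp[OF xT] d2x xV by (simp add: Zp_def Z_def d_def)
    moreover have "0 \<in> I2 \<inter> T r s" using fs.subspace_0[OF subspaces(5)] T_zero by blast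
    moreover have "x = pr r s x + 0" using pr_id[OF xT, of r s] by simp
    ultimately show ?thesis by blast
  next
    case 2
    have yV: "y \<in> V" by (rule T_V[OF 2(2)])
    have d2y: "d2 y \<in> T r s" using d2_T[OF 2(2)] 2(1) by simp
    define z where "z = x - d2 y"
    have zT: "z \<in> T r s" unfolding z_def by (rule fs.subspace_diff[OF subspace_T xT d2y])
    have "d1 z = 0" unfolding z_def using lin_diff[OF d1_lin xV T_V[OF d2y]] 2(3) by simp
    moreover have "d2 z = 0" unfolding z_def using lin_diff[OF d2_lin xV T_V[OF d2y]] d2x d2_d2[OF yV] by simp
    ultimately have "z \<in> Zp r (r + s)" using T_Fp[OF zT] T_V[OF zT] by (simp add: Zp_def Z_def d_def)
    moreover have "d2 y \<in> I2 \<inter> T r s" using d2y yV by (simp add: I2_def)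
    moreover have "x = pr r s z + d2 y" using pr_id[OF zT, of r s] by (simp add: z_def)
    ultimately show ?thesis by blast
  qed
qed

lemma colifts_of_lemma:
  assumes L: "K1 \<inter> K2 \<inter> Bd \<subseteq> I12"
  shows "colifts r s"
proof -
  have e: "double_complex.K1 V d2 = K2" "double_complex.K2 V d1 = K1"
    using swap_simps[OF refl] by simp_all
  show ?thesis unfolding colifts_def
    using double_complex.lifts_of_lemma[OF swap, of r s] L unfolding e swap_Bd swap_I12 by blast
qed

lemma aq_of_lemma:
  assumes L: "K1 \<inter> K2 \<inter> Bd \<subseteq> I12"
  shows "aq r s = 0"
  unfolding aq_def by (rule quotient_dim_zero) (use lemma_K2_I1[OF L] inclusions in blast)

text \<open>For \<open>x\<close> in \<open>K12\<close> the element \<open>d2 x\<close> is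
  \<open>d1\<close>-closed and \<open>d2\<close>-exact. If it is nonzero it equals
  \<open>d1 (d2 y) = - d2 (d1 y)\<close>, so \<open>x + d1 y\<close> is \<open>d2\<close>-closed
  while \<open>d1 y\<close> is \<open>d1\<close>-closed.\<close>

lemma fq_of_lemma:
  assumes L: "K1 \<inter> K2 \<inter> Bd \<subseteq> I12"
  shows "fq r s = 0"
  unfolding fq_def
proof (rule quotient_dim_zero, rule subsetI)
  fix x assume x: "x \<in> K12 \<inter> T r s"
  then have xV: "x \<in> V" and xT: "x \<in> T r s" and d: "d1 (d2 x) = 0" by (auto simp: K12_def)
  have "d2 x \<in> I12"
    by (intro lemma_K1_I2[OF L _ _ d2_T[OF xT]]) (use xV d d2_V[OF xV] in \<open>auto simp: K1_def I2_def\<close>)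
  then consider "d2 x = 0" | r' y where "r = Suc r'" "y \<in> T r' s" "d2 x = d1 (d2 y)"
    using I12_T[OF _ d2_T[OF xT]] by blast
  then show "x \<in> ssum (K1 \<inter> T r s) (K2 \<inter> T r s)"
  proof cases
    case 1
    then have "x \<in> K2 \<inter> T r s" using xV xT by (simp add: K2_def)
    moreover have "fs.subspace (K1 \<inter> T r s)" by (intro fs.subspace_inter subspaces subspace_T)
    ultimately show ?thesis using ssum_right by blast
  next
    case 2
    have yV: "y \<in> V" by (rule T_V[OF 2(2)])
    have d1y: "d1 y \<in> T r s" using d1_T[OF 2(2)] 2(1) by simp
    define u where "u = x + d1 y"
    have uT: "u \<in> T r s" unfolding u_def by (rule fs.subspace_add[OF subspace_T xT d1y])
    have "d2 u = 0" unfolding u_def using lin_add[OF d2_lin xV T_V[OF d1y]] 2(3) d2_d1[OF yV] by simp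
    then have u: "u \<in> K2 \<inter> T r s" using uT T_V[OF uT] by (simp add: K2_def)
    have "d1 y \<in> K1 \<inter> T r s" using d1y d1_d1[OF yV] d1_V[OF yV] by (simp add: K1_def)
    then have "- d1 y \<in> K1 \<inter> T r s"
      by (intro fs.subspace_neg fs.subspace_inter subspaces subspace_T)
    moreover have "x = - d1 y + u" by (simp add: u_def)
    ultimately show ?thesis using u unfolding ssum_def by blast
  qed
qed

section \<open>The inequality and the equality criterion for a double complex\<close>

theorem bott_chern_inequality: "2 * betti k \<le> (\<Sum>p<Suc k. bc p (k - p) + ae p (k - p))"
proof -
  have "2 * betti k = betti k + betti k" by (simp add: mult_2)
  also have "\<dots> \<le> (\<Sum>p<Suc k. h1 p (k - p)) + (\<Sum>p<Suc k. h2 p (k - p))"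
    by (intro add_mono betti_le betti_le')
  also have "\<dots> \<le> (\<Sum>p<Suc k. bc p (k - p) + ae p (k - p))"
    unfolding sum.distrib[symmetric] bc_ae by (intro sum_mono) simp
  finally show ?thesis .
qed

theorem bott_chern_equality:
  assumes fin: "\<And>r s. h2 r s < \<infinity>"
  shows "(\<forall>k. (\<Sum>p<Suc k. bc p (k - p) + ae p (k - p)) = 2 * betti k) \<longleftrightarrow> K1 \<inter> K2 \<inter> Bd = I12"
proof
  assume L: "K1 \<inter> K2 \<inter> Bd = I12"
  then have L': "K1 \<inter> K2 \<inter> Bd \<subseteq> I12" by simp
  show "\<forall>k. (\<Sum>p<Suc k. bc p (k - p) + ae p (k - p)) = 2 * betti k"
  proof
    fix k
    have "(\<Sum>p<Suc k. bc p (k - p) + ae p (k - p)) = (\<Sum>p<Suc k. h1 p (k - p) + h2 p (k - p))"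
      unfolding bc_ae aq_of_lemma[OF L'] fq_of_lemma[OF L'] by simp
    also have "\<dots> = betti k + betti k" unfolding sum.distrib
      using betti_eq[OF lifts_of_lemma[OF L'], of k] betti_eq'[OF colifts_of_lemma[OF L'], of k] by simp
    finally show "(\<Sum>p<Suc k. bc p (k - p) + ae p (k - p)) = 2 * betti k" by (simp add: mult_2)
  qed
next
  assume eq: "\<forall>k. (\<Sum>p<Suc k. bc p (k - p) + ae p (k - p)) = 2 * betti k"
  define X1 where "X1 k = (\<Sum>p<Suc k. h1 p (k - p))" for k
  define X2 where "X2 k = (\<Sum>p<Suc k. h2 p (k - p))" for k
  define Y where "Y k = (\<Sum>p<Suc k. aq p (k - p) + fq p (k - p))" for k
  have fin2: "X2 k < \<infinity>" for k
  proof -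
    have sum_fin: "sum f S < (\<infinity>::enat)" if "finite S" "\<And>i. f i < \<infinity>" for f :: "nat \<Rightarrow> enat" and S
      using that by (induction S rule: finite_induct) (auto simp: plus_eq_infty_iff_enat less_top[symmetric])
    show ?thesis unfolding X2_def by (rule sum_fin[OF finite_lessThan fin])
  qed
  have all: "X1 k + X2 k + Y k = betti k + betti k" for k
    using eq unfolding bc_ae X1_def X2_def Y_def sum.distrib[symmetric] by (simp add: mult_2)
  have le: "betti k \<le> X1 k" "betti k \<le> X2 k" for k
    unfolding X1_def X2_def by (rule betti_le', rule betti_le)
  \<comment> \<open>The finite \<open>X2 k\<close> bounds the Betti number, which makes the
    right-hand side of \<open>all\<close>, and with it \<open>X1 k\<close> and \<open>Y k\<close>,
    finite. Only then can the inequalities be cancelled.\<close>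
  have res: "X1 k = betti k \<and> X2 k = betti k \<and> Y k = 0" for k
    using all[of k] le[of k] fin2[of k]
    by (cases "X1 k"; cases "X2 k"; cases "Y k"; cases "betti k") (auto simp: zero_enat_def)
  have z: "aq r s = 0 \<and> fq r s = 0" for r s
  proof -
    have "aq r s + fq r s \<le> (\<Sum>p<Suc (r + s). aq p (r + s - p) + fq p (r + s - p))"
      using member_le_sum[of r "{..<Suc (r + s)}" "\<lambda>p. aq p (r + s - p) + fq p (r + s - p)"] by simp
    also have "\<dots> = 0" using res[of "r + s"] by (simp only: Y_def)
    finally show ?thesis by simp
  qed
  have "I1 \<inter> I2 \<inter> T r s \<subseteq> I12" for r s
    using quotient_dim_eq_0D[OF fs.subspace_inter[OF subspaces(6) subspace_T], of "I1 \<inter> I2 \<inter> T r s" r s] z[of r s]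
    by (simp add: aq_def)
  moreover have "K12 \<inter> T r s \<subseteq> ssum (K1 \<inter> T r s) (K2 \<inter> T r s)" for r s
    using z[of r s] unfolding fq_def
    by (intro quotient_dim_eq_0D subspace_ssum fs.subspace_inter subspaces subspace_T) simp
  moreover have "lifts r s" for r s
    by (rule lifts_of_betti) (use res fin2 in \<open>simp_all only: X2_def\<close>)
  moreover have "colifts r s" for r s
    by (rule colifts_of_betti) (use res fin2 in \<open>simp_all only: X1_def X2_def\<close>)
  ultimately show "K1 \<inter> K2 \<inter> Bd = I12" by (intro lemma_of_degeneration)
qed

end

section \<open>Frames and iterated differentiability in finite-dimensional inner product
  spaces\<close>

abbreviation fd :: "('a::real_normed_vector \<Rightarrow> 'b::real_normed_vector) \<Rightarrow> 'a \<Rightarrow> 'a \<Rightarrow> 'b" where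
  "fd f x \<equiv> frechet_derivative f (at x)"

text \<open>A finite Parseval frame, for instance an orthonormal basis. The expansion formula is the
  only property used, so neither independence nor unit length is recorded. Dimension 0 is covered by
  the empty set.\<close>

definition frame :: "'a::real_inner set \<Rightarrow> bool" where
  "frame B \<longleftrightarrow> finite B \<and> (\<forall>x. x = (\<Sum>b\<in>B. (x \<bullet> b) *\<^sub>R b))"

text \<open>Gram-Schmidt: the residual of the new vector after subtracting its expansion is
  orthogonal to the old span; it is normalised and added unless it is zero.\<close>

lemma parseval_frame_span:
  fixes S :: "'a::real_inner set"
  assumes "finite S"
  shows "\<exists>C. finite C \<and> C \<subseteq> span S \<and> (\<forall>x\<in>span S. x = (\<Sum>c\<in>C. (x \<bullet> c) *\<^sub>R c))"
  using assms
proof (induction S rule: finite_induct)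
  case empty
  show ?case by (rule exI[of _ "{}"]) auto
next
  case (insert b S)
  then obtain C where C: "finite C" "C \<subseteq> span S" "\<And>x. x \<in> span S \<Longrightarrow> x = (\<Sum>c\<in>C. (x \<bullet> c) *\<^sub>R c)"
    by blast
  define p where "p = (\<Sum>c\<in>C. (b \<bullet> c) *\<^sub>R c)"
  define b' where "b' = b - p"
  have p: "p \<in> span S" unfolding p_def using C(2) by (auto intro!: span_sum span_scale)
  have orth: "b' \<bullet> x = 0" if "x \<in> span S" for x
  proof -
    have "p \<bullet> x = (\<Sum>c\<in>C. (b \<bullet> c) * (c \<bullet> x))" by (simp add: p_def inner_sum_left)
    also have "\<dots> = b \<bullet> (\<Sum>c\<in>C. (x \<bullet> c) *\<^sub>R c)" by (simp add: inner_sum_right inner_commute mult.commute)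
    also have "\<dots> = b \<bullet> x" using C(3)[OF that] by simp
    finally show ?thesis by (simp add: b'_def inner_diff_left)
  qed
  show ?case
  proof (cases "b' = 0")
    case True
    then have "b \<in> span S" using p by (simp add: b'_def)
    then have "span (insert b S) = span S" by (rule span_redundant)
    then show ?thesis using C by auto
  next
    case False
    define u where "u = b' /\<^sub>R norm b'"
    have uu: "u \<bullet> u = 1" using False by (simp add: u_def norm_eq_sqrt_inner[symmetric] dot_square_norm power2_eq_square)
    have uo: "u \<bullet> x = 0" if "x \<in> span S" for x using orth[OF that] by (simp add: u_def)
    have "u \<notin> C" using uu uo C(2) by force
    have usp: "u \<in> span (insert b S)"
      unfolding u_def b'_def
      using p span_mono[of S "insert b S"] by (intro span_scale span_diff) (auto intro: span_base)
    have "x = (\<Sum>c\<in>insert u C. (x \<bullet> c) *\<^sub>R c)" if x: "x \<in> span (insert b S)" for x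
    proof -
      from x obtain k where k: "x - k *\<^sub>R b \<in> span S" by (auto simp: span_insert)
      define s where "s = x - k *\<^sub>R b + k *\<^sub>R p"
      have s: "s \<in> span S" unfolding s_def using k p by (intro span_add span_scale)
      have xs: "x = (k * norm b') *\<^sub>R u + s" using False
        by (simp add: u_def s_def b'_def algebra_simps)
      have xu: "x \<bullet> u = k * norm b'" unfolding xs using uo[OF s] uu
        by (simp add: inner_add_left inner_commute[of s])
      have xc: "x \<bullet> c = s \<bullet> c" if "c \<in> C" for c unfolding xs using uo C(2) that
        by (auto simp: inner_add_left)
      have "(\<Sum>c\<in>insert u C. (x \<bullet> c) *\<^sub>R c) = (k * norm b') *\<^sub>R u + (\<Sum>c\<in>C. (s \<bullet> c) *\<^sub>R c)"
        using \<open>u \<notin> C\<close> C(1) xu xc by simp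
      also have "\<dots> = x" using C(3)[OF s] xs by simp
      finally show ?thesis by simp
    qed
    moreover have "insert u C \<subseteq> span (insert b S)"
      using usp C(2) span_mono[of S "insert b S"] by blast
    ultimately show ?thesis using C(1) by (intro exI[of _ "insert u C"]) auto
  qed
qed

lemma has_dimension_frame:
  assumes "has_dimension TYPE('a::real_inner) n"
  obtains B :: "'a::real_inner set" where "frame B"
  using assms parseval_frame_span unfolding has_dimension_def frame_def by (metis UNIV_I)

lemma frame_finite: "frame B \<Longrightarrow> finite B"
  by (simp add: frame_def)

lemma frame_expand: "frame B \<Longrightarrow> (\<Sum>b\<in>B. (x \<bullet> b) *\<^sub>R b) = x"
  unfolding frame_def by metis

lemma frame_linear:
  assumes "frame B" "linear f"
  shows "f x = (\<Sum>b\<in>B. (x \<bullet> b) *\<^sub>R f b)"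
proof -
  have "f x = f (\<Sum>b\<in>B. (x \<bullet> b) *\<^sub>R b)" using frame_expand[OF assms(1)] by simp
  also have "\<dots> = (\<Sum>b\<in>B. (x \<bullet> b) *\<^sub>R f b)"
    using assms(2) by (simp add: linear_sum linear_cmul)
  finally show ?thesis .
qed

lemma linear_bounded_linear:
  fixes f :: "'a::real_inner \<Rightarrow> 'b::real_normed_vector"
  assumes "has_dimension TYPE('a) n" "linear f"
  shows "bounded_linear f"
proof -
  obtain B :: "'a set" where B: "frame B" using has_dimension_frame[OF assms(1)] .
  have "f = (\<lambda>x. \<Sum>b\<in>B. (x \<bullet> b) *\<^sub>R f b)" using frame_linear[OF B assms(2)] by blast
  moreover have "bounded_linear (\<lambda>x. \<Sum>b\<in>B. (x \<bullet> b) *\<^sub>R f b)"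
    by (intro bounded_linear_sum bounded_linear_compose[OF bounded_linear_scaleR_left] bounded_linear_inner_left)
  ultimately show ?thesis by simp
qed

lemma C_k_on_cong:
  assumes "open S" "\<And>x. x \<in> S \<Longrightarrow> f x = g x"
  shows "C_k_on k f S \<longleftrightarrow> C_k_on k g S"
  using assms(2)
proof (induction k arbitrary: f g)
  case 0
  then show ?case by (simp cong: continuous_on_cong)
next
  case (Suc k)
  have d: "f differentiable at x \<longleftrightarrow> g differentiable at x" if "x \<in> S" for x
    using Suc.prems that has_derivative_transform_within_open[OF _ assms(1) that]
    unfolding differentiable_def by metis
  have "fd f x = fd g x" if "f differentiable at x" "x \<in> S" for x
    using frechet_derivative_transform_within_open[OF that(1) assms(1) that(2)] Suc.prems by simp
  then have "C_k_on k (\<lambda>x. fd f x v) S \<longleftrightarrow> C_k_on k (\<lambda>x. fd g x v) S" if "\<forall>x\<in>S. f differentiable at x" for v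
    using that by (intro Suc.IH) simp
  then show ?case using d by auto
qed

lemma smooth_on_cong:
  assumes "open S" "\<And>x. x \<in> S \<Longrightarrow> f x = g x"
  shows "smooth_on f S \<longleftrightarrow> smooth_on g S"
  unfolding smooth_on_def using C_k_on_cong[OF assms(1), of f g] assms(2) by simp

lemma C_k_on_subset: "C_k_on k f S \<Longrightarrow> T \<subseteq> S \<Longrightarrow> C_k_on k f T"
  by (induction k arbitrary: f) (auto intro: continuous_on_subset)

lemma smooth_on_subset: "smooth_on f S \<Longrightarrow> T \<subseteq> S \<Longrightarrow> smooth_on f T"
  unfolding smooth_on_def using C_k_on_subset by blast

lemma C_k_on_local:
  assumes "\<And>x. x \<in> S \<Longrightarrow> \<exists>N. open N \<and> x \<in> N \<and> C_k_on k f N"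
  shows "C_k_on k f S"
  using assms
proof (induction k arbitrary: f)
  case 0
  then show ?case
    by (simp add: continuous_on_eq_continuous_within)
      (metis at_within_open continuous_on_eq_continuous_within continuous_at_imp_continuous_at_within)
next
  case (Suc k)
  show ?case
  proof (simp, intro conjI ballI allI)
    fix x assume "x \<in> S"
    then show "f differentiable at x" using Suc.prems by force
  next
    fix v
    show "C_k_on k (\<lambda>x. fd f x v) S" by (rule Suc.IH) (use Suc.prems in force)
  qed
qed

lemma smooth_on_local:
  assumes "\<And>x. x \<in> S \<Longrightarrow> \<exists>N. open N \<and> x \<in> N \<and> smooth_on f N"
  shows "smooth_on f S"
  unfolding smooth_on_def using assms unfolding smooth_on_def by (intro allI C_k_on_local) blast

lemma C_k_on_continuous: "C_k_on k f S \<Longrightarrow> continuous_on S f"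
  by (cases k) (auto simp: continuous_on_eq_continuous_within
      intro: continuous_at_imp_continuous_at_within differentiable_imp_continuous_within)

lemma C_k_on_SucD: "C_k_on (Suc k) f S \<Longrightarrow> C_k_on k f S"
proof (induction k arbitrary: f)
  case 0
  then show ?case using C_k_on_continuous[OF 0] by simp
next
  case (Suc k)
  then show ?case by (metis C_k_on.simps(2))
qed

lemma C_k_on_Suc_I:
  assumes "open S" "\<And>x. x \<in> S \<Longrightarrow> (f has_derivative f' x) (at x)" "\<And>v. C_k_on k (\<lambda>x. f' x v) S"
  shows "C_k_on (Suc k) f S"
proof -
  have "fd f x = f' x" if "x \<in> S" for x using frechet_derivative_at[OF assms(2)[OF that]] by simp
  then have "C_k_on k (\<lambda>x. fd f x v) S" for v
    using C_k_on_cong[OF assms(1), of "\<lambda>x. fd f x v" "\<lambda>x. f' x v"] assms(3) by simp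
  then show ?thesis using assms(2) by (auto simp: differentiable_def)
qed

lemma C_k_on_Suc_D:
  assumes "C_k_on (Suc k) f S"
  shows "\<And>x. x \<in> S \<Longrightarrow> (f has_derivative fd f x) (at x)" "\<And>v. C_k_on k (\<lambda>x. fd f x v) S"
  using assms by (auto simp: frechet_derivative_works)

lemma C_k_on_const: "C_k_on k (\<lambda>x. c) S"
  by (induction k arbitrary: c) auto

lemma C_k_on_add:
  assumes "open S" "C_k_on k f S" "C_k_on k g S"
  shows "C_k_on k (\<lambda>x. f x + g x) S"
  using assms(2,3)
proof (induction k arbitrary: f g)
  case 0
  then show ?case by (simp add: continuous_on_add)
next
  case (Suc k)
  show ?case
    by (rule C_k_on_Suc_I[OF assms(1) has_derivative_add[OF C_k_on_Suc_D(1)[OF Suc.prems(1)] C_k_on_Suc_D(1)[OF Suc.prems(2)]]])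
      (use Suc.IH C_k_on_Suc_D(2) Suc.prems in blast)+
qed

lemma C_k_on_bounded_linear:
  assumes "open S" "bounded_linear L" "C_k_on k f S"
  shows "C_k_on k (\<lambda>x. L (f x)) S"
  using assms(3)
proof (induction k arbitrary: f)
  case 0
  then show ?case using bounded_linear.continuous_on[OF assms(2)] by simp
next
  case (Suc k)
  show ?case
    by (rule C_k_on_Suc_I[OF assms(1) bounded_linear.has_derivative[OF assms(2) C_k_on_Suc_D(1)[OF Suc.prems]]])
      (use Suc.IH C_k_on_Suc_D(2) Suc.prems in blast)+
qed

lemma C_k_on_bilinear:
  assumes "open S" "bounded_bilinear pr" "C_k_on k f S" "C_k_on k g S"
  shows "C_k_on k (\<lambda>x. pr (f x) (g x)) S"
  using assms(3,4)
proof (induction k arbitrary: f g)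
  case 0
  then show ?case using bounded_bilinear.continuous_on[OF assms(2)] by simp
next
  case (Suc k)
  show ?case
    by (rule C_k_on_Suc_I[OF assms(1) bounded_bilinear.FDERIV[OF assms(2) C_k_on_Suc_D(1)[OF Suc.prems(1)] C_k_on_Suc_D(1)[OF Suc.prems(2)]]])
      (assumption | intro C_k_on_add[OF assms(1)] Suc.IH C_k_on_SucD[OF Suc.prems(1)] C_k_on_SucD[OF Suc.prems(2)]
        C_k_on_Suc_D(2)[OF Suc.prems(1)] C_k_on_Suc_D(2)[OF Suc.prems(2)])+
qed

lemma C_k_on_sum:
  assumes "open S" "\<And>i. i \<in> I \<Longrightarrow> C_k_on k (f i) S"
  shows "C_k_on k (\<lambda>x. \<Sum>i\<in>I. f i x) S"
  using assms(2)
  by (induction I rule: infinite_finite_induct) (auto intro: C_k_on_const C_k_on_add[OF assms(1)])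

text \<open>Expanding \<open>u x\<close> in a frame turns the application of a moving linear map to
  a moving vector into a finite sum of scalar products, so it suffices to know each
  \<open>M x b\<close>.\<close>

lemma C_k_on_linear_family:
  fixes M :: "'x::real_normed_vector \<Rightarrow> 'a::real_inner \<Rightarrow> 'b::real_normed_vector"
  assumes "has_dimension TYPE('a) n" "open S" "\<And>x. x \<in> S \<Longrightarrow> linear (M x)"
    "\<And>v. C_k_on k (\<lambda>x. M x v) S" "C_k_on k u S"
  shows "C_k_on k (\<lambda>x. M x (u x)) S"
proof -
  obtain B :: "'a set" where B: "frame B" using has_dimension_frame[OF assms(1)] .
  have eq: "M x (u x) = (\<Sum>b\<in>B. (u x \<bullet> b) *\<^sub>R M x b)" if "x \<in> S" for x
    by (rule frame_linear[OF B assms(3)[OF that]])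
  have "C_k_on k (\<lambda>x. \<Sum>b\<in>B. (u x \<bullet> b) *\<^sub>R M x b) S"
    by (intro C_k_on_sum C_k_on_bilinear[OF _ bounded_bilinear_scaleR] assms
        C_k_on_bounded_linear[OF _ bounded_linear_inner_left])
  then show ?thesis using C_k_on_cong[OF assms(2) eq] by simp
qed

text \<open>The derivative of a composite is a linear family applied to a moving vector, which is
  why \<open>C_k_on_linear_family\<close>, and with it the dimension of the middle space, enters the
  induction.\<close>

lemma C_k_on_compose:
  fixes f :: "'x::real_normed_vector \<Rightarrow> 'a::real_inner" and g :: "'a \<Rightarrow> 'b::real_normed_vector"
  assumes "has_dimension TYPE('a) n" "open S" "open T" "f ` S \<subseteq> T" "C_k_on k f S" "C_k_on k g T"
  shows "C_k_on k (\<lambda>x. g (f x)) S"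
  using assms(5,6)
proof (induction k arbitrary: g)
  case 0
  then show ?case using assms(4) by (auto intro: continuous_on_compose2)
next
  case (Suc k)
  have fT: "f x \<in> T" if "x \<in> S" for x using assms(4) that by auto
  show ?case
  proof (rule C_k_on_Suc_I[OF assms(2)])
    fix x assume x: "x \<in> S"
    show "((\<lambda>x. g (f x)) has_derivative (\<lambda>v. fd g (f x) (fd f x v))) (at x)"
      by (rule has_derivative_compose[OF C_k_on_Suc_D(1)[OF Suc.prems(1) x] C_k_on_Suc_D(1)[OF Suc.prems(2) fT[OF x]]])
  next
    fix v
    show "C_k_on k (\<lambda>x. fd g (f x) (fd f x v)) S"
    proof (rule C_k_on_linear_family[OF assms(1,2)])
      show "linear (fd g (f x))" if "x \<in> S" for x
        using C_k_on_Suc_D(1)[OF Suc.prems(2) fT[OF that]] has_derivative_linear by blast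
      show "C_k_on k (\<lambda>x. fd g (f x) w) S" for w
        by (rule Suc.IH[OF C_k_on_SucD[OF Suc.prems(1)] C_k_on_Suc_D(2)[OF Suc.prems(2)]])
      show "C_k_on k (\<lambda>x. fd f x v) S" by (rule C_k_on_Suc_D(2)[OF Suc.prems(1)])
    qed
  qed
qed

lemma smooth_on_const: "smooth_on (\<lambda>x. c) S"
  and smooth_on_add: "open S \<Longrightarrow> smooth_on f S \<Longrightarrow> smooth_on g S \<Longrightarrow> smooth_on (\<lambda>x. f x + g x) S"
  and smooth_on_bounded_linear: "open S \<Longrightarrow> bounded_linear L \<Longrightarrow> smooth_on f S \<Longrightarrow> smooth_on (\<lambda>x. L (f x)) S"
  and smooth_on_bilinear: "open S \<Longrightarrow> bounded_bilinear pr \<Longrightarrow> smooth_on f S \<Longrightarrow> smooth_on h S \<Longrightarrow>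
    smooth_on (\<lambda>x. pr (f x) (h x)) S"
  by (simp_all add: smooth_on_def C_k_on_const C_k_on_add C_k_on_bounded_linear C_k_on_bilinear)

lemma smooth_on_sum:
  "open S \<Longrightarrow> (\<And>i. i \<in> I \<Longrightarrow> smooth_on (f i) S) \<Longrightarrow> smooth_on (\<lambda>x. \<Sum>i\<in>I. f i x) S"
  by (simp add: smooth_on_def C_k_on_sum)

lemma smooth_on_linear_family:
  fixes M :: "'x::real_normed_vector \<Rightarrow> 'a::real_inner \<Rightarrow> 'b::real_normed_vector"
  assumes "has_dimension TYPE('a) n" "open S" "\<And>x. x \<in> S \<Longrightarrow> linear (M x)"
    "\<And>v. smooth_on (\<lambda>x. M x v) S" "smooth_on u S"
  shows "smooth_on (\<lambda>x. M x (u x)) S"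
  using C_k_on_linear_family[OF assms(1-3)] assms(4,5) by (simp add: smooth_on_def)

lemma smooth_on_compose:
  fixes f :: "'x::real_normed_vector \<Rightarrow> 'a::real_inner" and g :: "'a \<Rightarrow> 'b::real_normed_vector"
  assumes "has_dimension TYPE('a) n" "open S" "open T" "f ` S \<subseteq> T" "smooth_on f S" "smooth_on g T"
  shows "smooth_on (\<lambda>x. g (f x)) S"
  unfolding smooth_on_def
proof
  fix k
  show "C_k_on k (\<lambda>x. g (f x)) S"
    by (rule C_k_on_compose[OF assms(1-4)]) (use assms(5,6) in \<open>auto simp: smooth_on_def\<close>)
qed

lemma smooth_on_id: "smooth_on (\<lambda>x. x) S"
proof -
  have "C_k_on k (\<lambda>x. x) UNIV" for k
    by (cases k) (auto intro: C_k_on_Suc_I[OF _ has_derivative_ident] C_k_on_const continuous_on_id)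
  then show ?thesis unfolding smooth_on_def using C_k_on_subset by blast
qed

lemma smooth_on_has_derivative: "smooth_on f S \<Longrightarrow> x \<in> S \<Longrightarrow> (f has_derivative fd f x) (at x)"
  using C_k_on_Suc_D(1)[of 0 f S x] by (simp add: smooth_on_def del: C_k_on.simps)

lemma smooth_on_linear_fd: "smooth_on f S \<Longrightarrow> x \<in> S \<Longrightarrow> linear (fd f x)"
  using smooth_on_has_derivative has_derivative_linear by blast

lemma smooth_on_fd: "smooth_on f S \<Longrightarrow> smooth_on (\<lambda>x. fd f x v) S"
  unfolding smooth_on_def using C_k_on_Suc_D(2) by blast

lemma smooth_on_continuous: "smooth_on f S \<Longrightarrow> continuous_on S f"
  unfolding smooth_on_def using C_k_on_continuous by blast

lemma smooth_on_mult_const: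
  fixes f :: "'x::real_normed_vector \<Rightarrow> complex"
  shows "open S \<Longrightarrow> smooth_on f S \<Longrightarrow> smooth_on (\<lambda>x. c * f x) S"
  by (rule smooth_on_bounded_linear[OF _ bounded_linear_mult_right])

section \<open>Symmetry of second derivatives\<close>

text \<open>The mean value theorem, applied first along \<open>v\<close> to a difference in
  direction \<open>w\<close>, then along \<open>w\<close> to the resulting derivative. The
  parallelogram has to lie in \<open>S\<close>.\<close>

lemma mixed_difference:
  fixes f :: "'a::real_normed_vector \<Rightarrow> real"
  assumes f: "smooth_on f S" and h: "0 < h"
    and sub: "\<And>s t. 0 \<le> s \<Longrightarrow> s \<le> h \<Longrightarrow> 0 \<le> t \<Longrightarrow> t \<le> h \<Longrightarrow> x + s *\<^sub>R v + t *\<^sub>R w \<in> S"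
  shows "\<exists>s t. 0 < s \<and> s < h \<and> 0 < t \<and> t < h \<and>
    f (x + h *\<^sub>R v + h *\<^sub>R w) - f (x + h *\<^sub>R v) - f (x + h *\<^sub>R w) + f x
      = h * h * fd (\<lambda>z. fd f z v) (x + s *\<^sub>R v + t *\<^sub>R w) w"
proof -
  have D: "((\<lambda>s. F (c + s *\<^sub>R e)) has_real_derivative (fd F (c + s *\<^sub>R e) e)) (at s)"
    if "smooth_on F S" "c + s *\<^sub>R e \<in> S" for F :: "'a \<Rightarrow> real" and c e s
  proof -
    have "((\<lambda>s. F (c + s *\<^sub>R e)) has_derivative (\<lambda>k. fd F (c + s *\<^sub>R e) (k *\<^sub>R e))) (at s)"
      by (rule has_derivative_compose[where f="\<lambda>s. c + s *\<^sub>R e" and g=F])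
        (auto intro!: derivative_eq_intros smooth_on_has_derivative[OF that])
    moreover have "(\<lambda>k. fd F (c + s *\<^sub>R e) (k *\<^sub>R e)) = (*) (fd F (c + s *\<^sub>R e) e)"
      using linear_cmul[OF smooth_on_linear_fd[OF that]] by (auto simp: mult.commute)
    ultimately show ?thesis by (simp add: has_field_derivative_def)
  qed
  define \<phi> where "\<phi> s = f ((x + h *\<^sub>R w) + s *\<^sub>R v) - f (x + s *\<^sub>R v)" for s
  define \<phi>' where "\<phi>' s = fd f ((x + h *\<^sub>R w) + s *\<^sub>R v) v - fd f (x + s *\<^sub>R v) v" for s
  have "(\<phi> has_real_derivative \<phi>' s) (at s)" if "0 \<le> s" "s \<le> h" for s
    unfolding \<phi>_def \<phi>'_def
    by (intro DERIV_diff D f) (use sub[OF that, of h] sub[OF that, of 0] h in \<open>auto simp: algebra_simps\<close>)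
  then obtain s where s: "0 < s" "s < h" "\<phi> h - \<phi> 0 = (h - 0) * \<phi>' s"
    using MVT2[OF h, of \<phi> \<phi>'] by blast
  define \<psi> where "\<psi> t = fd f ((x + s *\<^sub>R v) + t *\<^sub>R w) v" for t
  have "(\<psi> has_real_derivative fd (\<lambda>z. fd f z v) ((x + s *\<^sub>R v) + t *\<^sub>R w) w) (at t)" if "0 \<le> t" "t \<le> h" for t
    unfolding \<psi>_def
    by (rule D[OF smooth_on_fd[OF f]]) (use sub[of s t] that s in auto)
  then obtain t where t: "0 < t" "t < h"
    "\<psi> h - \<psi> 0 = (h - 0) * fd (\<lambda>z. fd f z v) ((x + s *\<^sub>R v) + t *\<^sub>R w) w"
    using MVT2[OF h, of \<psi> "\<lambda>t. fd (\<lambda>z. fd f z v) ((x + s *\<^sub>R v) + t *\<^sub>R w) w"] by blast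
  have "\<phi>' s = \<psi> h - \<psi> 0" by (simp add: \<phi>'_def \<psi>_def algebra_simps)
  then have "\<phi> h - \<phi> 0 = h * h * fd (\<lambda>z. fd f z v) (x + s *\<^sub>R v + t *\<^sub>R w) w"
    using s t by simp
  moreover have "\<phi> h - \<phi> 0 = f (x + h *\<^sub>R v + h *\<^sub>R w) - f (x + h *\<^sub>R v) - f (x + h *\<^sub>R w) + f x"
    by (simp add: \<phi>_def algebra_simps)
  ultimately show ?thesis using s t by metis
qed

text \<open>The second difference is symmetric in \<open>v\<close> and \<open>w\<close>, so by
  \<open>mixed_difference\<close> in both orders the two mixed derivatives agree at two nearby
  points. Were they different at \<open>x\<close>, continuity would keep them apart on a small
  enough parallelogram.\<close>

lemma fd_symmetric_real:
  fixes f :: "'a::real_normed_vector \<Rightarrow> real"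
  assumes "open S" and f: "smooth_on f S" and x: "x \<in> S"
  shows "fd (\<lambda>z. fd f z v) x w = fd (\<lambda>z. fd f z w) x v"
proof (rule ccontr)
  define P where "P z = fd (\<lambda>z. fd f z v) z w" for z
  define Q where "Q z = fd (\<lambda>z. fd f z w) z v" for z
  assume "\<not> ?thesis"
  then have ne: "P x \<noteq> Q x" by (simp add: P_def Q_def)
  define e where "e = dist (P x) (Q x) / 2"
  have e: "e > 0" using ne by (simp add: e_def)
  have PS: "continuous_on S P" unfolding P_def by (intro smooth_on_continuous smooth_on_fd f)
  have QS: "continuous_on S Q" unfolding Q_def by (intro smooth_on_continuous smooth_on_fd f)
  obtain d1 where d1: "d1 > 0" "ball x d1 \<subseteq> S" using assms(1) x open_contains_ball by blast
  obtain d2 where d2: "d2 > 0" "\<And>z. z \<in> S \<Longrightarrow> dist z x < d2 \<Longrightarrow> dist (P z) (P x) < e"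
    using PS x e unfolding continuous_on_iff by blast
  obtain d3 where d3: "d3 > 0" "\<And>z. z \<in> S \<Longrightarrow> dist z x < d3 \<Longrightarrow> dist (Q z) (Q x) < e"
    using QS x e unfolding continuous_on_iff by blast
  define d where "d = min d1 (min d2 d3)"
  have d: "d > 0" using d1 d2 d3 by (simp add: d_def)
  \<comment> \<open>The side is chosen so that the parallelogram stays within distance
    \<open>d\<close> of \<open>x\<close>; the summand 1 keeps the denominator positive when both
    vectors vanish.\<close>
  define h where "h = d / (2 * (norm v + norm w + 1))"
  have n0: "norm v + norm w + 1 > 0" by (smt (verit) norm_ge_zero)
  have h: "h > 0" using d n0 by (simp add: h_def)
  have near: "dist (x + s *\<^sub>R v + t *\<^sub>R w) x < d" if "0 \<le> s" "s \<le> h" "0 \<le> t" "t \<le> h" for s t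
  proof -
    have "dist (x + s *\<^sub>R v + t *\<^sub>R w) x = norm (s *\<^sub>R v + t *\<^sub>R w)"
      by (simp add: dist_norm algebra_simps)
    also have "\<dots> \<le> s * norm v + t * norm w" using that by (smt (verit) norm_triangle_ineq norm_scaleR abs_of_nonneg)
    also have "\<dots> \<le> h * norm v + h * norm w" using that by (intro add_mono mult_right_mono) auto
    also have "\<dots> < 2 * h * (norm v + norm w + 1)" 
    proof -
      have "0 \<le> h * norm v" "0 \<le> h * norm w" using h by auto
      then show ?thesis using h unfolding distrib_left by linarith
    qed
    also have "\<dots> = d" using n0 by (simp add: h_def field_simps)
    finally show ?thesis .
  qed
  have inS: "z \<in> S" if "dist z x < d" for z using that d1 by (auto simp: d_def dist_commute)
  obtain s t where st: "0 < s" "s < h" "0 < t" "t < h"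
    "f (x + h *\<^sub>R v + h *\<^sub>R w) - f (x + h *\<^sub>R v) - f (x + h *\<^sub>R w) + f x = h * h * P (x + s *\<^sub>R v + t *\<^sub>R w)"
    using mixed_difference[OF f h, of x v w] near inS unfolding P_def by blast
  have near': "dist (x + s *\<^sub>R w + t *\<^sub>R v) x < d" if "0 \<le> s" "s \<le> h" "0 \<le> t" "t \<le> h" for s t
    using near[of t s] that by (simp add: algebra_simps)
  obtain s' t' where st': "0 < s'" "s' < h" "0 < t'" "t' < h"
    "f (x + h *\<^sub>R w + h *\<^sub>R v) - f (x + h *\<^sub>R w) - f (x + h *\<^sub>R v) + f x = h * h * Q (x + s' *\<^sub>R w + t' *\<^sub>R v)"
    using mixed_difference[OF f h, of x w v] near' inS unfolding Q_def by blast
  have "h * h * P (x + s *\<^sub>R v + t *\<^sub>R w) = h * h * Q (x + s' *\<^sub>R w + t' *\<^sub>R v)"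
    using st(5) st'(5) by (simp add: algebra_simps)
  then have "P (x + s *\<^sub>R v + t *\<^sub>R w) = Q (x + s' *\<^sub>R w + t' *\<^sub>R v)" using h by simp
  moreover have "dist (P (x + s *\<^sub>R v + t *\<^sub>R w)) (P x) < e"
    using near[of s t] st inS by (intro d2) (auto simp: d_def)
  moreover have "dist (Q (x + s' *\<^sub>R w + t' *\<^sub>R v)) (Q x) < e"
    using near'[of s' t'] st' inS by (intro d3) (auto simp: d_def)
  ultimately show False unfolding e_def by (smt (verit) dist_commute dist_triangle2 field_sum_of_halves)
qed

lemma fd_compose_linear:
  assumes "bounded_linear L" "f differentiable at x"
  shows "fd (\<lambda>z. L (f z)) x = (\<lambda>v. L (fd f x v))"
  using frechet_derivative_at[OF bounded_linear.has_derivative[OF assms(1)]] assms(2)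
  unfolding frechet_derivative_works by metis

lemma fd_symmetric:
  fixes f :: "'a::real_normed_vector \<Rightarrow> 'b::real_inner"
  assumes S: "open S" and f: "smooth_on f S" and x: "x \<in> S"
  shows "fd (\<lambda>z. fd f z v) x w = fd (\<lambda>z. fd f z w) x v"
proof -
  have "fd (\<lambda>z. fd f z v) x w \<bullet> u = fd (\<lambda>z. fd f z w) x v \<bullet> u" for u
  proof -
    have *: "fd (\<lambda>z. fd f z v) x w \<bullet> u = fd (\<lambda>z. fd (\<lambda>y. f y \<bullet> u) z v) x w" for v w
    proof -
      have d: "(\<lambda>z. fd f z v) differentiable at x"
        using smooth_on_has_derivative[OF smooth_on_fd[OF f] x] by (auto simp: differentiable_def)
      have "fd (\<lambda>z. fd f z v \<bullet> u) x w = fd (\<lambda>z. fd f z v) x w \<bullet> u"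
        using fd_compose_linear[OF bounded_linear_inner_left d] by metis
      moreover have "fd (\<lambda>z. fd f z v \<bullet> u) x = fd (\<lambda>z. fd (\<lambda>y. f y \<bullet> u) z v) x"
      proof (rule frechet_derivative_transform_within_open[OF _ S x])
        show "(\<lambda>z. fd f z v \<bullet> u) differentiable at x"
          using bounded_linear.has_derivative[OF bounded_linear_inner_left] d unfolding differentiable_def by blast
        show "fd f z v \<bullet> u = fd (\<lambda>y. f y \<bullet> u) z v" if "z \<in> S" for z
          using fd_compose_linear[OF bounded_linear_inner_left[of u], of f z] differentiableI[OF smooth_on_has_derivative[OF f that]]
          by simp
      qed
      ultimately show ?thesis by simp
    qed
    have "smooth_on (\<lambda>y. f y \<bullet> u) S" by (rule smooth_on_bounded_linear[OF S bounded_linear_inner_left f])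
    then show ?thesis unfolding * by (rule fd_symmetric_real[OF S _ x])
  qed
  then have "(fd (\<lambda>z. fd f z v) x w - fd (\<lambda>z. fd f z w) x v) \<bullet> u = 0" for u
    by (simp add: inner_diff_left)
  from this[of "fd (\<lambda>z. fd f z v) x w - fd (\<lambda>z. fd f z w) x v"]
  show ?thesis by (simp only: inner_eq_zero_iff right_minus_eq)
qed

section \<open>Smooth families of inverse maps\<close>

lemma fd_eqI: "(f has_derivative f') (at x) \<Longrightarrow> fd f x v = f' v"
  by (simp add: frechet_derivative_at[symmetric])

lemma has_dimension_finite_basis:
  assumes "has_dimension TYPE('a::real_vector) n"
  obtains B :: "'a::real_vector set" where "finite B" "independent B" "span B = UNIV" "card B = n"
  using assms unfolding has_dimension_def by blast

lemma linear_inj_imp_bij: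
  fixes f :: "'a::real_vector \<Rightarrow> 'a"
  assumes "has_dimension TYPE('a) n" "linear f" "inj f"
  shows "bij f"
proof -
  obtain B :: "'a set" where B: "finite B" "independent B" "span B = UNIV" "card B = n"
    using has_dimension_finite_basis[OF assms(1)] .
  interpret V: finite_dimensional_vector_space "scaleR :: real \<Rightarrow> 'a \<Rightarrow> 'a" B
    using B by unfold_locales (simp_all add: dependent_raw_def[symmetric] span_raw_def[symmetric])
  have "Vector_Spaces.linear scaleR scaleR f" using assms(2) by (simp add: linear_def)
  then show ?thesis using V.linear_inj_imp_surj assms(3) by (simp add: bij_def)
qed

text \<open>A product rule in which the second factor is merely continuous; the vanishing of the
  first factor at \<open>x\<close> makes up for that. It serves to differentiate an inverse family
  of which only continuity is known yet.\<close>

lemma has_derivative_scaleR_zero: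
  fixes p :: "'a::real_normed_vector \<Rightarrow> real" and q :: "'a \<Rightarrow> 'b::real_normed_vector"
  assumes p: "(p has_derivative p') (at x)" and p0: "p x = 0" and q: "isCont q x"
  shows "((\<lambda>z. p z *\<^sub>R q z) has_derivative (\<lambda>h. p' h *\<^sub>R q x)) (at x)"
proof -
  have "((\<lambda>z. p z *\<^sub>R (q z - q x)) has_derivative (\<lambda>h. 0)) (at x)"
  proof -
    interpret bounded_linear p' using p by (rule has_derivative_bounded_linear)
    obtain K where K: "K > 0" "\<And>h. norm (p' h) \<le> norm h * K" using pos_bounded by blast
    have "((\<lambda>z. norm (p z - p x - p' (z - x)) / norm (z - x)) \<longlongrightarrow> 0) (at x)"
      using p tendsto_norm_zero[of "\<lambda>z. (p z - p x - p' (z - x)) /\<^sub>R norm (z - x)" "at x"]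
      unfolding has_derivative_at_within by (simp add: divide_inverse mult.commute abs_mult)
    then have "((\<lambda>z. (norm (p z - p x - p' (z - x)) / norm (z - x) + K) * norm (q z - q x)) \<longlongrightarrow> (0 + K) * 0) (at x)"
      using q unfolding isCont_def by (intro tendsto_intros) (auto simp: LIM_zero tendsto_norm_zero)
    then have lim: "((\<lambda>z. (norm (p z - p x - p' (z - x)) / norm (z - x) + K) * norm (q z - q x)) \<longlongrightarrow> 0) (at x)"
      by simp
    have "((\<lambda>z. (p z *\<^sub>R (q z - q x)) /\<^sub>R norm (z - x)) \<longlongrightarrow> 0) (at x)"
    proof (rule Lim_null_comparison[OF _ lim], rule always_eventually, rule allI)
      fix z
      have "norm (p z) \<le> norm (p z - p x - p' (z - x)) + norm (p' (z - x))" using p0 by simp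
      also have "\<dots> \<le> norm (p z - p x - p' (z - x)) + norm (z - x) * K" using K by simp
      finally have "norm (p z) / norm (z - x) \<le> (norm (p z - p x - p' (z - x)) + norm (z - x) * K) / norm (z - x)"
        by (intro divide_right_mono) auto
      also have "\<dots> \<le> norm (p z - p x - p' (z - x)) / norm (z - x) + K"
        using K by (simp add: add_divide_distrib)
      finally have "norm (p z) / norm (z - x) * norm (q z - q x)
          \<le> (norm (p z - p x - p' (z - x)) / norm (z - x) + K) * norm (q z - q x)"
        by (intro mult_right_mono) auto
      then show "norm ((p z *\<^sub>R (q z - q x)) /\<^sub>R norm (z - x))
          \<le> (norm (p z - p x - p' (z - x)) / norm (z - x) + K) * norm (q z - q x)"
        by (simp add: divide_inverse mult_ac abs_mult)
    qed
    then show ?thesis unfolding has_derivative_at_within by (simp add: p0)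
  qed
  moreover have "((\<lambda>z. p z *\<^sub>R q x) has_derivative (\<lambda>h. p' h *\<^sub>R q x)) (at x)"
    by (rule bounded_linear.has_derivative[OF bounded_linear_scaleR_left p])
  ultimately have "((\<lambda>z. p z *\<^sub>R q x + p z *\<^sub>R (q z - q x)) has_derivative (\<lambda>h. p' h *\<^sub>R q x + 0)) (at x)"
    by (rule has_derivative_add[rotated])
  then show ?thesis by (simp add: algebra_simps)
qed

lemma linear_family_norm_le:
  fixes M :: "'a::real_inner \<Rightarrow> 'b::real_normed_vector"
  assumes "frame B" "linear M"
  shows "norm (M u) \<le> norm u * (\<Sum>b\<in>B. norm b * norm (M b))"
proof -
  have "norm (M u) \<le> (\<Sum>b\<in>B. norm ((u \<bullet> b) *\<^sub>R M b))"
    using frame_linear[OF assms, of u] norm_sum by metis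
  also have "\<dots> \<le> (\<Sum>b\<in>B. norm u * (norm b * norm (M b)))"
    by (intro sum_mono) (simp add: Cauchy_Schwarz_ineq2 mult_right_mono flip: mult.assoc)
  finally show ?thesis by (simp add: sum_distrib_left)
qed

text \<open>Continuity for each fixed vector implies continuity in the operator norm, since finitely
  many frame vectors control a linear map.\<close>

lemma linear_family_near:
  fixes M :: "'x::real_normed_vector \<Rightarrow> 'a::real_inner \<Rightarrow> 'b::real_normed_vector"
  assumes dim: "has_dimension TYPE('a) n" and S: "open S" "x \<in> S" and lin: "\<And>z. z \<in> S \<Longrightarrow> linear (M z)"
    and cont: "\<And>v. continuous_on S (\<lambda>z. M z v)" and e: "e > 0"
  shows "\<exists>N. open N \<and> x \<in> N \<and> N \<subseteq> S \<and> (\<forall>z\<in>N. \<forall>u. norm (M z u - M x u) \<le> e * norm u)"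
proof -
  obtain B :: "'a set" where B: "frame B" using has_dimension_frame[OF dim] .
  define g where "g z = (\<Sum>b\<in>B. norm b * norm (M z b - M x b))" for z
  have "continuous_on S g" unfolding g_def by (intro continuous_intros cont)
  moreover have "g x = 0" by (simp add: g_def)
  ultimately have "isCont g x" using S continuous_on_eq_continuous_at by blast
  then have "eventually (\<lambda>z. dist (g z) (g x) < e) (at x)"
    using e unfolding isCont_def by (rule tendstoD)
  then have "eventually (\<lambda>z. g z < e) (nhds x)" using e \<open>g x = 0\<close>
    by (auto simp: eventually_at_filter dist_real_def elim!: eventually_mono)
  then obtain N where N: "open N" "x \<in> N" "\<And>z. z \<in> N \<Longrightarrow> g z < e" unfolding eventually_nhds by blast
  have "norm (M z u - M x u) \<le> e * norm u" if "z \<in> N \<inter> S" for z u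
  proof -
    have "linear (\<lambda>u. M z u - M x u)" using lin S that by (intro linear_compose_sub) auto
    from linear_family_norm_le[OF B this, of u] have "norm (M z u - M x u) \<le> norm u * g z"
      by (simp add: g_def)
    also have "\<dots> \<le> norm u * e" using N(3)[of z] that by (intro mult_left_mono) auto
    finally show ?thesis by (simp add: mult.commute)
  qed
  then show ?thesis using N S by (intro exI[of _ "N \<inter> S"]) auto
qed

context
  fixes M G :: "'x::real_normed_vector \<Rightarrow> 'w::real_inner \<Rightarrow> 'w" and S :: "'x set" and n :: nat
  assumes dim: "has_dimension TYPE('w) n" and S: "open S"
    and lin: "\<And>x. x \<in> S \<Longrightarrow> linear (M x)"
    and MG: "\<And>x w. x \<in> S \<Longrightarrow> M x (G x w) = w" and GM: "\<And>x w. x \<in> S \<Longrightarrow> G x (M x w) = w"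
    and sm: "\<And>w. smooth_on (\<lambda>x. M x w) S"
begin

lemma inverse_family_linear:
  assumes x: "x \<in> S"
  shows "linear (G x)"
proof (rule linearI)
  show "G x (a + b) = G x a + G x b" for a b
    using GM[OF x, of "G x a + G x b"] by (simp add: linear_add[OF lin[OF x]] MG[OF x])
  show "G x (c *\<^sub>R a) = c *\<^sub>R G x a" for c a
    using GM[OF x, of "c *\<^sub>R G x a"] by (simp add: linear_cmul[OF lin[OF x]] MG[OF x])
qed

text \<open>The resolvent identity for \<open>G z - G x\<close>, from which both continuity and the
  derivative of the inverse are read off.\<close>

lemma inverse_family_diff:
  assumes "x \<in> S" "z \<in> S"
  shows "G z w = G x w - G z (M z (G x w) - M x (G x w))"
  using linear_diff[OF inverse_family_linear[OF assms(2)]] GM MG assms by simp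

lemma inverse_family_isCont:
  assumes x: "x \<in> S"
  shows "isCont (\<lambda>z. G z w) x"
proof -
  have bl: "bounded_linear (G x)" by (rule linear_bounded_linear[OF dim inverse_family_linear[OF x]])
  then obtain K where K: "K > 0" "\<And>h. norm (G x h) \<le> norm h * K" using bounded_linear.pos_bounded by blast
  have cont: "continuous_on S (\<lambda>z. M z v)" for v by (rule smooth_on_continuous[OF sm])
  \<comment> \<open>With \<open>K\<close> bounding \<open>G x\<close>, a perturbation of
    \<open>M x\<close> of size \<open>1 / (2 * K)\<close> costs at most half of
    \<open>norm (G z h)\<close>. That half is absorbed on the left, leaving the uniform bound
    \<open>2 * K\<close> for \<open>G z\<close> near \<open>x\<close>.\<close>
  obtain N where N: "open N" "x \<in> N" "N \<subseteq> S"
    "\<And>z u. z \<in> N \<Longrightarrow> norm (M z u - M x u) \<le> (1 / (2 * K)) * norm u"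
    using linear_family_near[OF dim S x lin cont, of "1 / (2 * K)"] K by auto
  have bd: "norm (G z h) \<le> 2 * K * norm h" if "z \<in> N" for z h
  proof -
    have zS: "z \<in> S" using that N by auto
    have "norm (G z h) = norm (G x (M x (G z h)))" using GM[OF x] by simp
    also have "\<dots> \<le> norm (M x (G z h)) * K" by (rule K)
    also have "norm (M x (G z h)) \<le> norm (M z (G z h)) + norm (M z (G z h) - M x (G z h))"
      by (metis norm_minus_commute norm_triangle_sub)
    also have "\<dots> \<le> norm h + (1 / (2 * K)) * norm (G z h)" using N(4)[OF that, of "G z h"] MG[OF zS, of h] by simp
    finally have "norm (G z h) \<le> (norm h + (1 / (2 * K)) * norm (G z h)) * K" using K by simp
    also have "\<dots> = norm h * K + norm (G z h) / 2" using K by (simp add: field_simps)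
    finally have "norm (G z h) / 2 \<le> norm h * K" by linarith
    then show ?thesis by (simp add: mult_ac)
  qed
  have "((\<lambda>z. 2 * K * norm (M z (G x w) - M x (G x w))) \<longlongrightarrow> 2 * K * norm (M x (G x w) - M x (G x w))) (at x)"
    using cont[of "G x w"] x S by (intro tendsto_intros) (simp add: continuous_on_eq_continuous_at isCont_def)
  then have lim: "((\<lambda>z. 2 * K * norm (M z (G x w) - M x (G x w))) \<longlongrightarrow> 0) (at x)" by simp
  have "((\<lambda>z. G z w - G x w) \<longlongrightarrow> 0) (at x)"
  proof (rule Lim_null_comparison[OF _ lim])
    have "eventually (\<lambda>z. z \<in> N) (at x)" using N eventually_at_topological by blast
    then show "eventually (\<lambda>z. norm (G z w - G x w) \<le> 2 * K * norm (M z (G x w) - M x (G x w))) (at x)"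
    proof (rule eventually_mono)
      fix z assume z: "z \<in> N"
      then have "G z w - G x w = - G z (M z (G x w) - M x (G x w))"
        using inverse_family_diff[OF x, of z w] N by auto
      then show "norm (G z w - G x w) \<le> 2 * K * norm (M z (G x w) - M x (G x w))"
        using bd[OF z] by simp
    qed
  qed
  then show ?thesis unfolding isCont_def using Lim_null by blast
qed

text \<open>In the resolvent identity \<open>G z\<close> is applied to \<open>R z\<close>, which is
  differentiable and zero at \<open>x\<close>. Expanded in a frame, each summand is a differentiable
  scalar vanishing at \<open>x\<close> times the continuous \<open>G z b\<close>.\<close>

lemma inverse_family_has_derivative:
  assumes x: "x \<in> S"
  shows "((\<lambda>z. G z w) has_derivative (\<lambda>h. - G x (fd (\<lambda>z. M z (G x w)) x h))) (at x)"
proof -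
  obtain B :: "'w set" where B: "frame B" using has_dimension_frame[OF dim] .
  define R where "R z = M z (G x w) - M x (G x w)" for z
  define R' where "R' = fd (\<lambda>z. M z (G x w)) x"
  have R: "(R has_derivative R') (at x)" unfolding R_def R'_def
    using has_derivative_diff[OF smooth_on_has_derivative[OF sm x] has_derivative_const] by simp
  have "((\<lambda>z. \<Sum>b\<in>B. (R z \<bullet> b) *\<^sub>R G z b) has_derivative (\<lambda>h. \<Sum>b\<in>B. (R' h \<bullet> b) *\<^sub>R G x b)) (at x)"
    by (intro has_derivative_sum has_derivative_scaleR_zero
        bounded_linear.has_derivative[OF bounded_linear_inner_left R] inverse_family_isCont x)
      (simp add: R_def)
  moreover have e1: "(\<Sum>b\<in>B. (R z \<bullet> b) *\<^sub>R G z b) = G z (R z)" if "z \<in> S" for z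
    using frame_linear[OF B inverse_family_linear[OF that]] by metis
  moreover have "(\<Sum>b\<in>B. (R' h \<bullet> b) *\<^sub>R G x b) = G x (R' h)" for h
    using frame_linear[OF B inverse_family_linear[OF x]] by metis
  ultimately have "((\<lambda>z. \<Sum>b\<in>B. (R z \<bullet> b) *\<^sub>R G z b) has_derivative (\<lambda>h. G x (R' h))) (at x)"
    by simp
  from has_derivative_transform_within_open[OF this S x e1]
  have "((\<lambda>z. G z (R z)) has_derivative (\<lambda>h. G x (R' h))) (at x)" by simp
  then have "((\<lambda>z. G x w - G z (R z)) has_derivative (\<lambda>h. 0 - G x (R' h))) (at x)"
    by (intro has_derivative_diff has_derivative_const)
  then have "((\<lambda>z. G z w) has_derivative (\<lambda>h. 0 - G x (R' h))) (at x)"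
  proof (rule has_derivative_transform_within_open[OF _ S x])
    fix z assume "z \<in> S"
    then show "G x w - G z (R z) = G z w"
      using inverse_family_diff[OF x \<open>z \<in> S\<close>, of w] unfolding R_def by simp
  qed
  then show ?thesis by (simp add: R'_def)
qed

text \<open>Bootstrapping: the derivative of \<open>G\<close> is built from \<open>G\<close> and
  derivatives of \<open>M\<close>, so one order of differentiability of \<open>G\<close> yields the
  next.\<close>

lemma inverse_family_smooth: "smooth_on (\<lambda>x. G x w) S"
proof -
  have "C_k_on k (\<lambda>x. G x w) S" for k
  proof (induction k arbitrary: w)
    case 0
    show ?case using inverse_family_isCont S by (simp add: continuous_on_eq_continuous_at)
  next
    case (Suc k)
    show ?case
    proof (rule C_k_on_Suc_I[OF S inverse_family_has_derivative])
      fix v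
      have 1: "C_k_on k (\<lambda>x. fd (\<lambda>z. M z (G x w)) x v) S"
      proof (rule C_k_on_linear_family[OF dim S _ _ Suc.IH, where M="\<lambda>x u. fd (\<lambda>z. M z u) x v"])
        show "C_k_on k (\<lambda>x. fd (\<lambda>z. M z u) x v) S" for u
          using smooth_on_fd[OF sm] unfolding smooth_on_def by blast
        show "linear (\<lambda>u. fd (\<lambda>z. M z u) x v)" if x: "x \<in> S" for x
        proof (rule linearI)
          have dM: "((\<lambda>z. M z u) has_derivative fd (\<lambda>z. M z u) x) (at x)" for u
            by (rule smooth_on_has_derivative[OF sm x])
          show "fd (\<lambda>z. M z (a + b)) x v = fd (\<lambda>z. M z a) x v + fd (\<lambda>z. M z b) x v" for a b
          proof -
            have "((\<lambda>z. M z (a + b)) has_derivative (\<lambda>v. fd (\<lambda>z. M z a) x v + fd (\<lambda>z. M z b) x v)) (at x)"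
              by (rule has_derivative_transform_within_open[OF has_derivative_add[OF dM dM] S x])
                (simp add: lin linear_add)
            then show ?thesis by (rule fd_eqI)
          qed
          show "fd (\<lambda>z. M z (c *\<^sub>R a)) x v = c *\<^sub>R fd (\<lambda>z. M z a) x v" for c a
          proof -
            have "((\<lambda>z. M z (c *\<^sub>R a)) has_derivative (\<lambda>v. c *\<^sub>R fd (\<lambda>z. M z a) x v)) (at x)"
              by (rule has_derivative_transform_within_open[OF has_derivative_scaleR_right[OF dM] S x])
                (simp add: lin linear_cmul)
            then show ?thesis by (rule fd_eqI)
          qed
        qed
      qed
      have "C_k_on k (\<lambda>x. G x (fd (\<lambda>z. M z (G x w)) x v)) S"
        by (rule C_k_on_linear_family[OF dim S inverse_family_linear Suc.IH 1])
      then show "C_k_on k (\<lambda>x. - G x (fd (\<lambda>z. M z (G x w)) x v)) S"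
        by (rule C_k_on_bounded_linear[OF S bounded_linear_minus[OF bounded_linear_ident]])
    qed
  qed
  then show ?thesis by (simp add: smooth_on_def)
qed

end

text \<open>A fixed right inverse \<open>s\<close> of \<open>A x\<close> makes
  \<open>A z \<circ> s\<close> the identity at \<open>z = x\<close> and hence invertible nearby.
  Composing \<open>s\<close> with the inverse gives a section that is smooth in
  \<open>z\<close>.\<close>

lemma smooth_right_inverse:
  fixes A :: "'v::real_inner \<Rightarrow> 'v \<Rightarrow> 'w::real_inner"
  assumes dv: "has_dimension TYPE('v) m" and dw: "has_dimension TYPE('w) n" and S: "open S" and x: "x \<in> S"
    and lin: "\<And>x. x \<in> S \<Longrightarrow> linear (A x)" and sm: "\<And>v. smooth_on (\<lambda>x. A x v) S" and su: "surj (A x)"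
  obtains N \<sigma> where "open N" "x \<in> N" "N \<subseteq> S" "\<And>z. z \<in> N \<Longrightarrow> linear (\<sigma> z)"
    "\<And>z w. z \<in> N \<Longrightarrow> A z (\<sigma> z w) = w" "\<And>w. smooth_on (\<lambda>z. \<sigma> z w) N"
proof -
  obtain s where s: "linear s" "A x \<circ> s = id"
    using linear_surjective_right_inverse[OF lin[OF x] su] by blast
  define M where "M z w = A z (s w)" for z w
  have linM: "linear (M z)" if "z \<in> S" for z
    using linear_compose[OF s(1) lin[OF that]] by (simp add: M_def[abs_def] o_def)
  have smM: "smooth_on (\<lambda>z. M z w) S" for w unfolding M_def by (rule sm)
  have Mx: "M x w = w" for w using s(2) by (simp add: M_def fun_eq_iff)
  obtain N where N: "open N" "x \<in> N" "N \<subseteq> S" "\<And>z u. z \<in> N \<Longrightarrow> norm (M z u - M x u) \<le> (1/2) * norm u"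
    using linear_family_near[OF dw S x linM smooth_on_continuous[OF smM], of "1/2"] by auto
  have bij: "bij (M z)" if "z \<in> N" for z
  proof (rule linear_inj_imp_bij[OF dw])
    show l: "linear (M z)" using linM that N by blast
    show "inj (M z)" unfolding linear_injective_0[OF l]
    proof (intro allI impI)
      fix u assume "M z u = 0"
      then have "norm u \<le> (1/2) * norm u" using N(4)[OF that, of u] Mx by simp
      then show "u = 0" by simp
    qed
  qed
  define G where "G z = inv (M z)" for z
  have MG: "M z (G z w) = w" and GM: "G z (M z w) = w" if "z \<in> N" for z w
    using bij[OF that] by (simp_all add: G_def bij_is_surj surj_f_inv_f bij_is_inj)
  have linM': "linear (M z)" if "z \<in> N" for z using linM N that by blast
  have smM': "smooth_on (\<lambda>z. M z w) N" for w using smooth_on_subset[OF smM N(3)] .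
  have linG: "linear (G z)" if "z \<in> N" for z
    by (rule inverse_family_linear[OF dw N(1) linM' MG GM smM' that])
  have smG: "smooth_on (\<lambda>z. G z w) N" for w
    by (rule inverse_family_smooth[OF dw N(1) linM' MG GM smM'])
  show ?thesis
  proof (rule that[OF N(1-3), of "\<lambda>z w. s (G z w)"])
    show "linear (\<lambda>w. s (G z w))" if "z \<in> N" for z
      using linear_compose[OF linG[OF that] s(1)] by (simp add: o_def)
    show "A z (s (G z w)) = w" if "z \<in> N" for z w using MG[OF that] by (simp add: M_def)
    show "smooth_on (\<lambda>z. s (G z w)) N" for w
      by (rule smooth_on_bounded_linear[OF N(1) linear_bounded_linear[OF dw s(1)] smG])
  qed
qed

section \<open>Bump functions\<close>

text \<open>The family is closed under differentiation up to linear combinations, so a single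
  induction proves that all its members are smooth; \<open>flat 0\<close> is the usual flat
  function.\<close>

definition flat :: "nat \<Rightarrow> real \<Rightarrow> real" where
  "flat n x = (if x > 0 then exp (- inverse x) * inverse x ^ n else 0)"

lemma flat_tendsto: "((\<lambda>x. flat n x) \<longlongrightarrow> 0) (at_right 0)"
proof -
  have "((\<lambda>t::real. t ^ n / exp t) \<longlongrightarrow> 0) at_top" by (rule tendsto_power_div_exp_0)
  then have "((\<lambda>x::real. inverse x ^ n / exp (inverse x)) \<longlongrightarrow> 0) (at_right 0)"
    by (rule filterlim_compose[OF _ filterlim_inverse_at_top_right])
  then show ?thesis
  proof (rule Lim_transform_eventually)
    show "eventually (\<lambda>x. inverse x ^ n / exp (inverse x) = flat n x) (at_right 0)"
      by (auto simp: eventually_at_filter flat_def exp_minus field_simps intro!: always_eventually)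
  qed
qed

lemma flat_deriv: "(flat n has_real_derivative (flat (n + 2) x - n * flat (n + 1) x)) (at x)"
proof -
  consider "x > 0" | "x < 0" | "x = 0" by linarith
  then show ?thesis
  proof cases
    case 1
    have "((\<lambda>t. exp (- t) * t ^ n) has_real_derivative (n * t ^ (n - 1) - t ^ n) * exp (- t)) (at t)" for t :: real
      by (auto intro!: derivative_eq_intros simp: algebra_simps)
    from DERIV_chain2[OF this DERIV_inverse] 1
    have "((\<lambda>x. exp (- inverse x) * inverse x ^ n) has_real_derivative
      (n * inverse x ^ (n - 1) - inverse x ^ n) * exp (- inverse x) * - (inverse x ^ Suc (Suc 0))) (at x)"
      by simp
    also have "(n * inverse x ^ (n - 1) - inverse x ^ n) * exp (- inverse x) * - (inverse x ^ Suc (Suc 0))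
      = flat (n + 2) x - n * flat (n + 1) x"
      using 1 by (cases n) (simp_all add: flat_def algebra_simps del: power_inverse inverse_eq_divide)
    finally have "((\<lambda>x. exp (- inverse x) * inverse x ^ n) has_real_derivative (flat (n + 2) x - n * flat (n + 1) x)) (at x)" .
    then show ?thesis
      by (rule has_field_derivative_transform_within_open[of _ _ _ "{0<..}"]) (use 1 in \<open>auto simp: flat_def\<close>)
  next
    case 2
    have "((\<lambda>x. 0) has_real_derivative (flat (n + 2) x - n * flat (n + 1) x)) (at x)"
      using 2 by (auto simp: flat_def)
    then show ?thesis
      by (rule has_field_derivative_transform_within_open[of _ _ _ "{..<0}"]) (use 2 in \<open>auto simp: flat_def\<close>)
  next
    case 3
    \<comment> \<open>To the right of 0 the difference quotient of \<open>flat n\<close> is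
      \<open>flat (Suc n)\<close>, which tends to 0.\<close>
    have "((\<lambda>h. flat n h / h) \<longlongrightarrow> 0) (at_right 0)"
      by (rule Lim_transform_eventually[OF flat_tendsto[of "Suc n"]])
        (auto simp: eventually_at_filter flat_def field_simps intro!: always_eventually)
    moreover have "((\<lambda>h. flat n h / h) \<longlongrightarrow> 0) (at_left 0)"
      by (rule Lim_transform_eventually[OF tendsto_const])
        (auto simp: eventually_at_filter flat_def intro!: always_eventually)
    ultimately have "((\<lambda>h. flat n h / h) \<longlongrightarrow> 0) (at 0)" by (rule filterlim_split_at[rotated])
    then show ?thesis using 3 by (simp add: DERIV_def flat_def)
  qed
qed

lemma flat_smooth: "smooth_on (flat n) S"
proof -
  have "C_k_on k (flat n) UNIV" for k
  proof (induction k arbitrary: n)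
    case 0
    show ?case using flat_deriv by (auto simp: continuous_on_eq_continuous_at intro: DERIV_isCont)
  next
    case (Suc k)
    show ?case
    proof (rule C_k_on_Suc_I[OF open_UNIV])
      show "(flat n has_derivative (\<lambda>v. v * (flat (n + 2) x + (- real n) * flat (n + 1) x))) (at x)" for x
      proof -
        have "(\<lambda>v. v * (flat (n + 2) x + (- real n) * flat (n + 1) x)) = (*) (flat (n + 2) x - n * flat (n + 1) x)"
          by (auto simp: algebra_simps)
        then show ?thesis using flat_deriv[of n x] by (simp add: has_field_derivative_def)
      qed
      show "C_k_on k (\<lambda>x. v * (flat (n + 2) x + (- real n) * flat (n + 1) x)) UNIV" for v
        by (intro C_k_on_bounded_linear[OF open_UNIV bounded_linear_mult_right] C_k_on_add[OF open_UNIV] Suc.IH)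
    qed
  qed
  then show ?thesis unfolding smooth_on_def using C_k_on_subset by blast
qed

lemma bump_function:
  fixes x :: "'a::real_inner"
  assumes e: "e > 0"
  obtains \<phi> :: "'a::real_inner \<Rightarrow> real" where "smooth_on \<phi> UNIV" "\<phi> x = 1" "\<And>z. z \<notin> cball x e \<Longrightarrow> \<phi> z = 0"
proof -
  \<comment> \<open>The flat function of \<open>e\<^sup>2\<close> minus the squared distance,
    normalised at the centre; sums with negatives match the smoothness rules.\<close>
  define \<phi> where "\<phi> z = inverse (flat 0 (e\<^sup>2)) * flat 0 (e\<^sup>2 + - ((z + - x) \<bullet> (z + - x)))" for z :: 'a
  have "smooth_on (\<lambda>z::'a. e\<^sup>2 + - ((z + - x) \<bullet> (z + - x))) UNIV"
    by (intro smooth_on_add smooth_on_const smooth_on_id smooth_on_bilinear[OF open_UNIV bounded_bilinear_inner] open_UNIV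
        smooth_on_bounded_linear[OF _ bounded_linear_minus[OF bounded_linear_ident]])
  moreover have "has_dimension TYPE(real) 1" unfolding has_dimension_def
    by (rule exI[of _ "{1}"]) (auto simp: span_singleton intro!: image_eqI[where f="\<lambda>k. k *\<^sub>R (1::real)"])
  ultimately have "smooth_on (\<lambda>z. flat 0 (e\<^sup>2 + - ((z + - x) \<bullet> (z + - x)))) UNIV"
    by (intro smooth_on_compose[OF _ open_UNIV open_UNIV _ _ flat_smooth]) blast+
  then have "smooth_on \<phi> UNIV" unfolding \<phi>_def
    by (intro smooth_on_bounded_linear[OF open_UNIV bounded_linear_mult_right])
  moreover have "\<phi> x = 1" using e by (simp add: \<phi>_def flat_def)
  moreover have "\<phi> z = 0" if "z \<notin> cball x e" for z
  proof -
    have "e < norm (z - x)" using that by (simp add: dist_norm norm_minus_commute)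
    then have "e\<^sup>2 \<le> (norm (z - x))\<^sup>2" using e by (intro power_mono) auto
    then show ?thesis by (simp add: \<phi>_def flat_def dot_square_norm)
  qed
  ultimately show ?thesis using that by blast
qed

text \<open>Frame coefficients of a bounded vector are bounded, so a ball is a closed subset of a
  sum of finitely many compact segments.\<close>

lemma compact_cball_finite_dim:
  assumes "has_dimension TYPE('a::real_inner) n"
  shows "compact (cball (x::'a::real_inner) e)"
proof -
  obtain B :: "'a set" where B: "frame B" using has_dimension_frame[OF assms] .
  define box where "box C r = {\<Sum>b\<in>C. t b *\<^sub>R b | t :: 'a \<Rightarrow> real. \<forall>b\<in>C. \<bar>t b\<bar> \<le> r}" for C r
  have cb: "compact (box C r)" if "finite C" for C r
    using that
  proof (induction C rule: finite_induct)
    case empty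
    have "box {} r = {0}" by (auto simp: box_def)
    then show ?case by simp
  next
    case (insert b C)
    have "box (insert b C) r = {u + v | u v. u \<in> (\<lambda>t. t *\<^sub>R b) ` {-r..r} \<and> v \<in> box C r}"
    proof (intro set_eqI iffI)
      fix z assume "z \<in> box (insert b C) r"
      then obtain t where "z = (\<Sum>b\<in>insert b C. t b *\<^sub>R b)" "\<forall>b\<in>insert b C. \<bar>t b\<bar> \<le> r"
        by (auto simp: box_def)
      then show "z \<in> {u + v | u v. u \<in> (\<lambda>t. t *\<^sub>R b) ` {-r..r} \<and> v \<in> box C r}"
        using insert by (intro CollectI exI[of _ "t b *\<^sub>R b"] exI[of _ "\<Sum>b\<in>C. t b *\<^sub>R b"])
          (auto simp: box_def abs_le_iff)
    next
      fix z assume "z \<in> {u + v | u v. u \<in> (\<lambda>t. t *\<^sub>R b) ` {-r..r} \<and> v \<in> box C r}"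
      then obtain s t where s: "s \<in> {-r..r}" "z = s *\<^sub>R b + (\<Sum>b\<in>C. t b *\<^sub>R b)" "\<forall>b\<in>C. \<bar>t b\<bar> \<le> r"
        unfolding box_def by blast
      have "(\<Sum>c\<in>C. (t(b := s)) c *\<^sub>R c) = (\<Sum>b\<in>C. t b *\<^sub>R b)"
        by (rule sum.cong) (use insert in auto)
      then have "z = (\<Sum>c\<in>insert b C. (t(b := s)) c *\<^sub>R c)" using s insert by simp
      moreover have "\<forall>c\<in>insert b C. \<bar>(t(b := s)) c\<bar> \<le> r" using s by (auto simp: abs_le_iff)
      ultimately show "z \<in> box (insert b C) r" unfolding box_def by blast
    qed
    moreover have "compact ((\<lambda>t. t *\<^sub>R b) ` {-r..r})"
      by (intro compact_continuous_image continuous_intros) auto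
    ultimately show ?case using insert.IH compact_sums by simp
  qed
  have "cball 0 r \<subseteq> box B (r * (\<Sum>b\<in>B. norm b))" if "r \<ge> 0" for r
  proof
    fix z :: 'a assume z: "z \<in> cball 0 r"
    have "\<bar>z \<bullet> b\<bar> \<le> r * (\<Sum>b\<in>B. norm b)" if "b \<in> B" for b
    proof -
      have "\<bar>z \<bullet> b\<bar> \<le> norm z * norm b" by (rule Cauchy_Schwarz_ineq2)
      also have "\<dots> \<le> r * (\<Sum>b\<in>B. norm b)" using z \<open>r \<ge> 0\<close> member_le_sum[OF that, of norm] frame_finite[OF B]
        by (intro mult_mono) auto
      finally show ?thesis .
    qed
    then show "z \<in> box B (r * (\<Sum>b\<in>B. norm b))" unfolding box_def
      using frame_expand[OF B, of z] by (intro CollectI exI[of _ "\<lambda>b. z \<bullet> b"]) auto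
  qed
  then have "compact (cball (0::'a) r)" if "r \<ge> 0" for r
    using compact_Int_closed[OF cb[OF frame_finite[OF B]] closed_cball] that by (metis Int_absorb1)
  then have "compact ((+) x ` cball 0 e)" if "e \<ge> 0"
    using compact_translation that by blast
  then show ?thesis by (cases "e \<ge> 0") (simp_all add: cball_translation[symmetric])
qed

section \<open>Alternating forms and the exterior derivative in coordinates\<close>

lemma alternating_linear:
  assumes "alternating_form a"
  shows "linear (\<lambda>w. a (xs @ w # ys))"
proof -
  have "linear (\<lambda>w. a ((xs @ undefined # ys)[length xs := w]))"
    using assms unfolding alternating_form_def by (metis length_append length_Cons less_add_Suc1 add_Suc_right)
  then show ?thesis by simp
qed

lemma alternating_eq_0:
  assumes "alternating_form a" "i < j" "j < length vs" "vs ! i = vs ! j"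
  shows "a vs = 0"
  using assms unfolding alternating_form_def by blast

lemma alternating_swap:
  assumes "alternating_form a"
  shows "a (xs @ x # y # ys) = - a (xs @ y # x # ys)"
proof -
  note l = alternating_linear[OF assms]
  have z: "a (xs @ u # u # ys) = 0" for u
    by (rule alternating_eq_0[OF assms, of "length xs" "Suc (length xs)"]) (auto simp: nth_append)
  have "0 = a (xs @ (x + y) # (x + y) # ys)" by (rule z[symmetric])
  also have "\<dots> = a (xs @ x # (x + y) # ys) + a (xs @ y # (x + y) # ys)"
    by (rule linear_add[OF l])
  also have "a (xs @ x # (x + y) # ys) = a (xs @ x # y # ys)"
    using linear_add[OF l, of "xs @ [x]" x y ys] z by simp
  also have "a (xs @ y # (x + y) # ys) = a (xs @ y # x # ys)"
    using linear_add[OF l, of "xs @ [y]" x y ys] z by simp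
  finally show ?thesis by (simp add: eq_neg_iff_add_eq_0)
qed

text \<open>Stated for any function on lists that changes sign under adjacent swaps, since it is
  used both for the arguments of a form and for the factors of a wedge product.\<close>

lemma move_to_front:
  fixes F :: "'a list \<Rightarrow> complex"
  assumes "\<And>xs x y ys. F (xs @ x # y # ys) = - F (xs @ y # x # ys)"
  shows "F (xs @ x # ys) = (-1) ^ length xs * F (x # xs @ ys)"
proof (induction xs arbitrary: ys rule: rev_induct)
  case Nil
  then show ?case by simp
next
  case (snoc z xs)
  have "F ((xs @ [z]) @ x # ys) = - F (xs @ x # z # ys)" using assms[of xs z x ys] by simp
  also have "\<dots> = - ((-1) ^ length xs * F (x # xs @ z # ys))" using snoc by simp
  finally show ?case by simp
qed

lemma alternating_move:
  "alternating_form a \<Longrightarrow> a (xs @ x # ys) = (-1) ^ length xs * a (x # xs @ ys)"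
  by (rule move_to_front) (rule alternating_swap)

definition del_nth :: "nat \<Rightarrow> 'a list \<Rightarrow> 'a list" where
  "del_nth i vs = take i vs @ drop (Suc i) vs"

lemma length_del_nth: "i < length vs \<Longrightarrow> length (del_nth i vs) = length vs - 1"
  by (simp add: del_nth_def)

lemma map_del_nth: "map f (del_nth i vs) = del_nth i (map f vs)"
  by (simp add: del_nth_def take_map drop_map)

text \<open>The coface map of the simplicial calculus: the original position of the
  \<open>j\<close>-th entry that remains after position \<open>i\<close> has been deleted.\<close>

definition skip :: "nat \<Rightarrow> nat \<Rightarrow> nat" where
  "skip i j = (if j < i then j else Suc j)"

lemma nth_del_nth: "i < length vs \<Longrightarrow> j < length vs - 1 \<Longrightarrow> del_nth i vs ! j = vs ! skip i j"
  by (auto simp: del_nth_def skip_def nth_append min_def)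

lemma del_nth_del_nth: "i \<le> j \<Longrightarrow> del_nth j (del_nth i vs) = del_nth i (del_nth (Suc j) vs)"
proof (induction vs arbitrary: i j)
  case Nil
  then show ?case by (simp add: del_nth_def)
next
  case (Cons v vs)
  show ?case
  proof (cases i)
    case 0
    then show ?thesis by (simp add: del_nth_def)
  next
    case (Suc i')
    then obtain j' where j: "j = Suc j'" using Cons.prems by (cases j) auto
    have C: "del_nth (Suc k) (x # xs) = x # del_nth k xs" for k and x :: 'a and xs by (simp add: del_nth_def)
    show ?thesis using Cons.IH[of i' j'] Cons.prems Suc j by (simp add: C)
  qed
qed

text \<open>Deletion of two original positions in a form that is visibly symmetric, as the
  cancellation of double sums requires.\<close>

definition del2 :: "nat \<Rightarrow> nat \<Rightarrow> 'a list \<Rightarrow> 'a list" where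
  "del2 i j vs = del_nth (min i j) (del_nth (max i j) vs)"

lemma del2_commute: "del2 i j vs = del2 j i vs"
  by (simp add: del2_def min.commute max.commute)

lemma del_nth_del_nth_skip: "del_nth j (del_nth i vs) = del2 i (skip i j) vs"
  using del_nth_del_nth[of i j vs] by (cases "j < i") (simp_all add: del2_def skip_def min_def max_def)

lemma list_update_del_nth: "j < length vs \<Longrightarrow> vs[j := x] = take j vs @ x # drop (Suc j) vs"
  by (rule upd_conv_take_nth_drop)

lemma alternating_update:
  assumes "alternating_form a" "j < length vs"
  shows "a (vs[j := x]) = (-1) ^ j * a (x # del_nth j vs)"
  using alternating_move[OF assms(1), of "take j vs" x "drop (Suc j) vs"] assms(2)
  by (simp add: list_update_del_nth del_nth_def min_def)

lemma alternating_nth_front: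
  assumes "alternating_form a" "j < length vs"
  shows "a vs = (-1) ^ j * a (vs ! j # del_nth j vs)"
  using alternating_update[OF assms, of "vs ! j"] by simp

text \<open>The cancellation behind both \<open>d (d a) = 0\<close> and the naturality of \<open>d\<close>.\<close>

lemma alternating_double_sum:
  fixes G :: "nat \<Rightarrow> nat \<Rightarrow> complex"
  assumes sym: "\<And>i j. i < n \<Longrightarrow> j < n \<Longrightarrow> G i j = G j i"
  shows "(\<Sum>i<n. \<Sum>j<n - 1. (-1) ^ (i + j) * G i (skip i j)) = 0"
proof -
  \<comment> \<open>Passing from \<open>j\<close> to \<open>skip i j\<close> shifts the index by one
    beyond \<open>i\<close>, which flips the sign. Reindexed over the full square, the summand is
    antisymmetric with zero diagonal.\<close>
  define s where "s i j = (if j < i then 1 else if i < j then -1 else 0) * ((-1) ^ (i + j) * G i j)" for i j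
  have inner: "(\<Sum>j<n - 1. (-1) ^ (i + j) * G i (skip i j)) = (\<Sum>j<n. s i j)" if i: "i < n" for i
  proof -
    define f where "f j = (-1) ^ (i + j) * G i (skip i j)" for j
    have "(\<Sum>j<n - 1. f j) = (\<Sum>j=0..<i. f j) + (\<Sum>j=i..<n - 1. f j)"
      using i by (simp add: lessThan_atLeast0 sum.atLeastLessThan_concat)
    also have "(\<Sum>j=0..<i. f j) = (\<Sum>j=0..<i. s i j)"
      by (rule sum.cong) (auto simp: f_def s_def skip_def)
    also have "(\<Sum>j=i..<n - 1. f j) = (\<Sum>j=i..<n - 1. s i (Suc j))"
      by (rule sum.cong) (auto simp: f_def s_def skip_def)
    also have "\<dots> = (\<Sum>j=Suc i..<n. s i j)"
      using i sum.shift_bounds_Suc_ivl[of "s i" i "n - 1"] by simp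
    also have "\<dots> = (\<Sum>j=i..<n. s i j)"
      using i by (simp add: sum.atLeast_Suc_lessThan[of i n] s_def)
    also have "(\<Sum>j=0..<i. s i j) + (\<Sum>j=i..<n. s i j) = (\<Sum>j<n. s i j)"
      using i by (simp add: lessThan_atLeast0 sum.atLeastLessThan_concat)
    finally show ?thesis by (simp add: f_def)
  qed
  define T where "T = (\<Sum>i<n. \<Sum>j<n. s i j)"
  have "T = (\<Sum>i<n. \<Sum>j<n. s j i)" unfolding T_def by (rule sum.swap)
  also have "\<dots> = (\<Sum>i<n. \<Sum>j<n. - s i j)"
    by (intro sum.cong refl) (use sym in \<open>auto simp: s_def add.commute\<close>)
  also have "\<dots> = - T" by (simp add: T_def sum_negf)
  finally have "T = 0" by simp
  then show ?thesis using inner by (simp add: T_def)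
qed

section \<open>Product rules for multilinear families and the exterior derivative in one
  chart\<close>

lemma has_derivative_linear_family_linear:
  fixes M :: "'x::real_normed_vector \<Rightarrow> 'a::real_vector \<Rightarrow> 'b::real_normed_vector"
  assumes S: "open S" and x: "x \<in> S" and lin: "\<And>z. z \<in> S \<Longrightarrow> linear (M z)"
    and d: "\<And>w. ((\<lambda>z. M z w) has_derivative M' w) (at x)"
  shows "linear (\<lambda>w. M' w h)"
proof (rule linearI)
  show "M' (a + b) h = M' a h + M' b h" for a b
  proof -
    have "((\<lambda>z. M z (a + b)) has_derivative (\<lambda>h. M' a h + M' b h)) (at x)"
      by (rule has_derivative_transform_within_open[OF has_derivative_add[OF d d] S x])
        (simp add: lin linear_add)
    then show ?thesis using has_derivative_unique[OF d] by metis
  qed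
  show "M' (c *\<^sub>R a) h = c *\<^sub>R M' a h" for c a
  proof -
    have "((\<lambda>z. M z (c *\<^sub>R a)) has_derivative (\<lambda>h. c *\<^sub>R M' a h)) (at x)"
      by (rule has_derivative_transform_within_open[OF has_derivative_scaleR_right[OF d] S x])
        (simp add: lin linear_cmul)
    then show ?thesis using has_derivative_unique[OF d] by metis
  qed
qed

lemma has_derivative_linear_family:
  fixes M :: "'x::real_normed_vector \<Rightarrow> 'a::real_inner \<Rightarrow> 'b::real_normed_vector"
  assumes dim: "has_dimension TYPE('a) n" and S: "open S" and x: "x \<in> S"
    and lin: "\<And>z. z \<in> S \<Longrightarrow> linear (M z)"
    and d: "\<And>w. ((\<lambda>z. M z w) has_derivative M' w) (at x)" and u: "(u has_derivative u') (at x)"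
  shows "((\<lambda>z. M z (u z)) has_derivative (\<lambda>h. M' (u x) h + M x (u' h))) (at x)"
proof -
  obtain B :: "'a set" where B: "frame B" using has_dimension_frame[OF dim] .
  have "((\<lambda>z. \<Sum>b\<in>B. (u z \<bullet> b) *\<^sub>R M z b) has_derivative
      (\<lambda>h. \<Sum>b\<in>B. (u x \<bullet> b) *\<^sub>R M' b h + (u' h \<bullet> b) *\<^sub>R M x b)) (at x)"
    by (intro has_derivative_sum has_derivative_scaleR d
        bounded_linear.has_derivative[OF bounded_linear_inner_left u])
  moreover have "(\<Sum>b\<in>B. (u x \<bullet> b) *\<^sub>R M' b h + (u' h \<bullet> b) *\<^sub>R M x b) = M' (u x) h + M x (u' h)" for h
    using frame_linear[OF B has_derivative_linear_family_linear[OF S x lin d], of "u x" h]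
      frame_linear[OF B lin[OF x], of "u' h"] by (simp add: sum.distrib)
  ultimately have "((\<lambda>z. \<Sum>b\<in>B. (u z \<bullet> b) *\<^sub>R M z b) has_derivative (\<lambda>h. M' (u x) h + M x (u' h))) (at x)"
    by simp
  then show ?thesis
    by (rule has_derivative_transform_within_open[OF _ S x])
      (use frame_linear[OF B lin] in \<open>simp add: frame_linear[OF B lin, symmetric]\<close>)
qed

text \<open>The prefix \<open>pre\<close> holds arguments frozen at constants. The induction then
  lets one further argument vary at a time, using the product rule for a linear family.\<close>

lemma has_derivative_multilinear:
  fixes a :: "'x::real_normed_vector \<Rightarrow> 'w::real_inner list \<Rightarrow> complex"
  assumes dim: "has_dimension TYPE('w) n" and S: "open S" and x: "x \<in> S"
    and lin: "\<And>z xs ys. z \<in> S \<Longrightarrow> linear (\<lambda>w. a z (xs @ w # ys))"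
    and d: "\<And>ws. ((\<lambda>z. a z ws) has_derivative a' ws) (at x)"
    and u: "\<And>u u'. (u, u') \<in> set us \<Longrightarrow> (u has_derivative u') (at x)"
  shows "((\<lambda>z. a z (pre @ map (\<lambda>p. fst p z) us)) has_derivative
    (\<lambda>h. a' (pre @ map (\<lambda>p. fst p x) us) h
      + (\<Sum>j<length us. a x (pre @ (map (\<lambda>p. fst p x) us)[j := snd (us ! j) h])))) (at x)"
  using u
proof (induction us arbitrary: pre)
  case Nil
  then show ?case using d by simp
next
  case (Cons p us)
  have IH: "((\<lambda>z. a z (pre @ w # map (\<lambda>p. fst p z) us)) has_derivative
    (\<lambda>h. a' (pre @ w # map (\<lambda>p. fst p x) us) h
      + (\<Sum>j<length us. a x (pre @ w # (map (\<lambda>p. fst p x) us)[j := snd (us ! j) h])))) (at x)" for w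
    using Cons.IH[of "pre @ [w]"] Cons.prems by simp
  have p: "(fst p has_derivative snd p) (at x)" using Cons.prems[of "fst p" "snd p"] by simp
  have "((\<lambda>z. a z (pre @ fst p z # map (\<lambda>p. fst p z) us)) has_derivative
    (\<lambda>h. a' (pre @ fst p x # map (\<lambda>p. fst p x) us) h
      + (\<Sum>j<length us. a x (pre @ fst p x # (map (\<lambda>p. fst p x) us)[j := snd (us ! j) h]))
      + a x (pre @ snd p h # map (\<lambda>p. fst p x) us))) (at x)"
    by (rule has_derivative_linear_family[OF dim S x lin IH p])
  then show ?case unfolding length_Cons sum.lessThan_Suc_shift by (simp add: add_ac)
qed

lemma smooth_on_multilinear:
  fixes a :: "'x::real_normed_vector \<Rightarrow> 'w::real_inner list \<Rightarrow> complex"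
  assumes dim: "has_dimension TYPE('w) n" and S: "open S"
    and lin: "\<And>z xs ys. z \<in> S \<Longrightarrow> linear (\<lambda>w. a z (xs @ w # ys))"
    and d: "\<And>ws. smooth_on (\<lambda>z. a z ws) S"
    and u: "\<And>u. u \<in> set us \<Longrightarrow> smooth_on u S"
  shows "smooth_on (\<lambda>z. a z (pre @ map (\<lambda>u. u z) us)) S"
  using u
proof (induction us arbitrary: pre)
  case Nil
  then show ?case using d by simp
next
  case (Cons u us)
  have IH: "smooth_on (\<lambda>z. a z (pre @ w # map (\<lambda>u. u z) us)) S" for w
    using Cons.IH[of "pre @ [w]"] Cons.prems by simp
  have "smooth_on (\<lambda>z. a z (pre @ u z # map (\<lambda>u. u z) us)) S"
    by (rule smooth_on_linear_family[OF dim S lin IH]) (use Cons.prems in auto)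
  then show ?case by simp
qed

lemma smooth_on_multilinear_map:
  fixes a :: "'x::real_normed_vector \<Rightarrow> 'w::real_inner list \<Rightarrow> complex"
  assumes dim: "has_dimension TYPE('w) n" and S: "open S"
    and lin: "\<And>z. z \<in> S \<Longrightarrow> alternating_form (a z)"
    and d: "\<And>ws. smooth_on (\<lambda>z. a z ws) S"
    and A: "\<And>v. smooth_on (\<lambda>z. A z v) S"
  shows "smooth_on (\<lambda>z. a z (map (A z) vs)) S"
  using smooth_on_multilinear[OF dim S alternating_linear[OF lin] d, of "map (\<lambda>v z. A z v) vs" "[]"] A
  by (auto simp: o_def)

text \<open>The coordinate expression of the exterior derivative, freed from atlas and domain
  conditions, so that the calculus can be done on open sets of the model space.\<close>

definition dloc :: "('v::real_normed_vector \<Rightarrow> 'v list \<Rightarrow> complex) \<Rightarrow> 'v \<Rightarrow> 'v list \<Rightarrow> complex" where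
  "dloc a y vs = (\<Sum>i<length vs. (-1) ^ i * fd (\<lambda>z. a z (del_nth i vs)) y (vs ! i))"

lemma ext_d_dloc: "c \<in> A \<Longrightarrow> y \<in> snd c ` fst c \<Longrightarrow> ext_d A \<alpha> c y = dloc (\<alpha> c) y"
  by (simp add: ext_d_def dloc_def del_nth_def fun_eq_iff)

lemma smooth_on_dloc:
  assumes "open S" "\<And>vs. smooth_on (\<lambda>z. a z vs) S"
  shows "smooth_on (\<lambda>y. dloc a y vs) S"
  unfolding dloc_def by (intro smooth_on_sum smooth_on_mult_const smooth_on_fd assms)

lemma dloc_cong:
  assumes "open S" "y \<in> S" "\<And>z. z \<in> S \<Longrightarrow> a z = b z" "\<And>vs. smooth_on (\<lambda>z. a z vs) S"
  shows "dloc a y vs = dloc b y vs"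
proof -
  have "fd (\<lambda>z. a z ws) y = fd (\<lambda>z. b z ws) y" for ws
    by (rule frechet_derivative_transform_within_open[OF _ assms(1,2)])
      (use assms smooth_on_has_derivative differentiableI in \<open>blast, simp\<close>)
  then show ?thesis by (simp add: dloc_def)
qed

text \<open>Second derivatives are symmetric in the two directions, while the signs of the two
  deletions are antisymmetric.\<close>

lemma dloc_dloc:
  assumes S: "open S" "y \<in> S" and sm: "\<And>vs. smooth_on (\<lambda>z. a z vs) S"
  shows "dloc (dloc a) y vs = 0"
proof -
  define n where "n = length vs"
  have "fd (\<lambda>z. dloc a z (del_nth i vs)) y (vs ! i)
      = (\<Sum>j<n - 1. (-1) ^ j * fd (\<lambda>z. fd (\<lambda>z. a z (del2 i (skip i j) vs)) z (vs ! skip i j)) y (vs ! i))"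
    if i: "i < n" for i
  proof -
    have "((\<lambda>z. \<Sum>j<n - 1. (-1) ^ j * fd (\<lambda>z. a z (del2 i (skip i j) vs)) z (vs ! skip i j)) has_derivative
      (\<lambda>h. \<Sum>j<n - 1. (-1) ^ j * fd (\<lambda>z. fd (\<lambda>z. a z (del2 i (skip i j) vs)) z (vs ! skip i j)) y h)) (at y)"
      by (intro has_derivative_sum has_derivative_mult_right smooth_on_has_derivative[OF smooth_on_fd[OF sm] S(2)])
    moreover have "dloc a z (del_nth i vs) = (\<Sum>j<n - 1. (-1) ^ j * fd (\<lambda>z. a z (del2 i (skip i j) vs)) z (vs ! skip i j))" for z
      unfolding dloc_def using i by (intro sum.cong)
        (auto simp: length_del_nth n_def nth_del_nth del_nth_del_nth_skip)
    ultimately show ?thesis by (simp add: fd_eqI)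
  qed
  then have "dloc (dloc a) y vs = (\<Sum>i<n. \<Sum>j<n - 1. (-1) ^ (i + j) *
      fd (\<lambda>z. fd (\<lambda>z. a z (del2 i (skip i j) vs)) z (vs ! skip i j)) y (vs ! i))"
    unfolding dloc_def[of "dloc a"] by (simp add: n_def sum_distrib_left power_add mult.assoc)
  also have "\<dots> = 0"
    by (rule alternating_double_sum[where G="\<lambda>i j. fd (\<lambda>z. fd (\<lambda>z. a z (del2 i j vs)) z (vs ! j)) y (vs ! i)"])
      (simp add: fd_symmetric[OF S(1) sm S(2)] del2_commute)
  finally show ?thesis .
qed

text \<open>Differentiating the arguments \<open>fd g z v\<close> produces second derivatives of
  \<open>g\<close>, which are symmetric and cancel in the alternating sum. The coefficients
  \<open>a z\<close> depend on the source point, not necessarily through \<open>g\<close>; this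
  generality is what is needed for forms pulled back along the submersions.\<close>

lemma dloc_pullback:
  fixes g :: "'v::real_inner \<Rightarrow> 'w::real_inner"
  assumes dim: "has_dimension TYPE('w) n" and S: "open S" "y \<in> S" and g: "smooth_on g S"
    and alt: "\<And>z. z \<in> S \<Longrightarrow> alternating_form (a z)" and sm: "\<And>ws. smooth_on (\<lambda>z. a z ws) S"
    and eq: "\<And>z vs. z \<in> S \<Longrightarrow> \<alpha> z vs = a z (map (fd g z) vs)"
  shows "dloc \<alpha> y vs = (\<Sum>i<length vs. (-1) ^ i * fd (\<lambda>z. a z (del_nth i (map (fd g y) vs))) y (vs ! i))"
proof -
  define m where "m = length vs"
  define H where "H v w = fd (\<lambda>z. fd g z w) y v" for v w
  have Hsym: "H v w = H w v" for v w unfolding H_def by (rule fd_symmetric[OF S(1) g S(2)])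
  have D: "fd (\<lambda>z. \<alpha> z us) y h = fd (\<lambda>z. a z (map (fd g y) us)) y h
      + (\<Sum>j<length us. a y ((map (fd g y) us)[j := H h (us ! j)]))" for us h
  proof -
    have "((\<lambda>z. a z ([] @ map (\<lambda>p. fst p z) (map (\<lambda>u. (\<lambda>z. fd g z u, fd (\<lambda>z. fd g z u) y)) us))) has_derivative
      (\<lambda>h. fd (\<lambda>z. a z ([] @ map (\<lambda>p. fst p y) (map (\<lambda>u. (\<lambda>z. fd g z u, fd (\<lambda>z. fd g z u) y)) us))) y h
      + (\<Sum>j<length (map (\<lambda>u. (\<lambda>z. fd g z u, fd (\<lambda>z. fd g z u) y)) us).
          a y ([] @ (map (\<lambda>p. fst p y) (map (\<lambda>u. (\<lambda>z. fd g z u, fd (\<lambda>z. fd g z u) y)) us))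
            [j := snd (map (\<lambda>u. (\<lambda>z. fd g z u, fd (\<lambda>z. fd g z u) y)) us ! j) h])))) (at y)"
      by (rule has_derivative_multilinear[OF dim S alternating_linear[OF alt] smooth_on_has_derivative[OF sm S(2)]])
        (auto intro: smooth_on_has_derivative[OF smooth_on_fd[OF g] S(2)])
    then have "((\<lambda>z. a z (map (fd g z) us)) has_derivative
      (\<lambda>h. fd (\<lambda>z. a z (map (fd g y) us)) y h + (\<Sum>j<length us. a y ((map (fd g y) us)[j := H h (us ! j)])))) (at y)"
      by (simp add: o_def H_def)
    then have "((\<lambda>z. \<alpha> z us) has_derivative
      (\<lambda>h. fd (\<lambda>z. a z (map (fd g y) us)) y h + (\<Sum>j<length us. a y ((map (fd g y) us)[j := H h (us ! j)])))) (at y)"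
      by (rule has_derivative_transform_within_open[OF _ S]) (simp add: eq)
    then show ?thesis by (rule fd_eqI)
  qed
  define G where "G i j = a y (H (vs ! i) (vs ! j) # map (fd g y) (del2 i j vs))" for i j
  have "fd (\<lambda>z. \<alpha> z (del_nth i vs)) y (vs ! i) = fd (\<lambda>z. a z (del_nth i (map (fd g y) vs))) y (vs ! i)
      + (\<Sum>j<m - 1. (-1) ^ j * G i (skip i j))" if i: "i < m" for i
  proof -
    have "a y ((map (fd g y) (del_nth i vs))[j := H (vs ! i) (del_nth i vs ! j)]) = (-1) ^ j * G i (skip i j)"
      if "j < m - 1" for j
      using alternating_update[OF alt[OF S(2)], of j "map (fd g y) (del_nth i vs)" "H (vs ! i) (del_nth i vs ! j)"] i that
      by (simp add: m_def length_del_nth G_def nth_del_nth map_del_nth[symmetric] del_nth_del_nth_skip)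
    then show ?thesis using i by (simp add: D m_def length_del_nth map_del_nth)
  qed
  then have "dloc \<alpha> y vs = (\<Sum>i<m. (-1) ^ i * fd (\<lambda>z. a z (del_nth i (map (fd g y) vs))) y (vs ! i))
      + (\<Sum>i<m. \<Sum>j<m - 1. (-1) ^ (i + j) * G i (skip i j))"
    unfolding dloc_def by (simp add: m_def distrib_left sum.distrib sum_distrib_left power_add mult.assoc)
  also have "(\<Sum>i<m. \<Sum>j<m - 1. (-1) ^ (i + j) * G i (skip i j)) = 0"
    by (rule alternating_double_sum) (simp add: G_def Hsym del2_commute)
  finally show ?thesis by (simp add: m_def)
qed

lemma del_nth_update:
  "i < length vs \<Longrightarrow> del_nth i (vs[k := w]) = (if i = k then del_nth k vs else if i < k then (del_nth i vs)[k - 1 := w] else (del_nth i vs)[k := w])"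
  by (rule nth_equalityI) (auto simp: length_del_nth nth_del_nth nth_list_update skip_def)

text \<open>For a repeated argument, only the terms that delete one of the two copies survive.
  Moving the remaining copy to the front gives them opposite signs.\<close>

lemma alternating_dloc:
  fixes a :: "'v::real_inner \<Rightarrow> 'v list \<Rightarrow> complex"
  assumes S: "open S" "y \<in> S" and alt: "\<And>z. z \<in> S \<Longrightarrow> alternating_form (a z)"
    and sm: "\<And>ws. smooth_on (\<lambda>z. a z ws) S"
  shows "alternating_form (dloc a y)"
  unfolding alternating_form_def
proof (intro conjI allI impI)
  fix vs :: "'v list" and k assume k: "k < length vs"
  have "linear (\<lambda>w. (-1) ^ i * fd (\<lambda>z. a z (del_nth i (vs[k := w]))) y (vs[k := w] ! i))"
    if i: "i < length vs" for i
  proof (rule linear_compose[unfolded o_def, OF _ bounded_linear.linear[OF bounded_linear_mult_right]])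
    show "linear (\<lambda>w. fd (\<lambda>z. a z (del_nth i (vs[k := w]))) y (vs[k := w] ! i))"
    proof (cases "i = k")
      case True
      then show ?thesis using i smooth_on_linear_fd[OF sm S(2)] by (simp add: del_nth_update)
    next
      case False
      define k' where "k' = (if i < k then k - 1 else k)"
      have k': "k' < length (del_nth i vs)" using i k False by (auto simp: k'_def length_del_nth)
      have "linear (\<lambda>w. fd (\<lambda>z. a z ((del_nth i vs)[k' := w])) y (vs ! i))"
        by (rule has_derivative_linear_family_linear[OF S])
          (use alt k' smooth_on_has_derivative[OF sm S(2)] in \<open>auto simp: alternating_form_def\<close>)
      then show ?thesis using False i by (cases "i < k") (simp_all add: del_nth_update k'_def)
    qed
  qed
  then show "linear (\<lambda>w. dloc a y (vs[k := w]))" unfolding dloc_def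
    by (simp add: linear_compose_sum)
next
  fix vs :: "'v list" and j i assume j: "j < length vs" and i: "i < j" and e: "vs ! i = vs ! j"
  have "fd (\<lambda>z. a z (del_nth k vs)) y (vs ! k) = 0" if k: "k < length vs" "k \<noteq> i" "k \<noteq> j" for k
  proof -
    define i' where "i' = (if i < k then i else i - 1)"
    define j' where "j' = (if j < k then j else j - 1)"
    have "i = skip k i'" "j = skip k j'" "i' < j'" "j' < length (del_nth k vs)"
      using k i j by (auto simp: i'_def j'_def skip_def length_del_nth)
    then have z: "a z (del_nth k vs) = 0" if "z \<in> S" for z
      using alternating_eq_0[OF alt[OF that], of i' j' "del_nth k vs"] e k by (simp add: nth_del_nth length_del_nth)
    have "((\<lambda>z. a z (del_nth k vs)) has_derivative (\<lambda>h. 0)) (at y)"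
      by (rule has_derivative_transform_within_open[OF has_derivative_const S]) (simp add: z)
    then show ?thesis by (rule fd_eqI)
  qed
  then have "dloc a y vs = (\<Sum>k\<in>{i, j}. (-1) ^ k * fd (\<lambda>z. a z (del_nth k vs)) y (vs ! k))"
    unfolding dloc_def using i j by (intro sum.mono_neutral_right) auto
  also have "\<dots> = (-1) ^ i * fd (\<lambda>z. a z (del_nth i vs)) y (vs ! i) + (-1) ^ j * fd (\<lambda>z. a z (del_nth j vs)) y (vs ! j)"
    using i by simp
  also have "fd (\<lambda>z. a z (del_nth i vs)) y (vs ! i) = (-1) ^ (j - 1) * fd (\<lambda>z. a z (vs ! i # del2 i j vs)) y (vs ! i)"
  proof -
    have "j = skip i (j - 1)" "j - 1 < length (del_nth i vs)" using i j by (auto simp: skip_def length_del_nth)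
    then have "a z (del_nth i vs) = (-1) ^ (j - 1) * a z (vs ! i # del2 i j vs)" if "z \<in> S" for z
      using alternating_nth_front[OF alt[OF that], of "j - 1" "del_nth i vs"] e i j
      by (simp add: nth_del_nth length_del_nth del_nth_del_nth_skip)
    then have "((\<lambda>z. a z (del_nth i vs)) has_derivative (\<lambda>h. (-1) ^ (j - 1) * fd (\<lambda>z. a z (vs ! i # del2 i j vs)) y h)) (at y)"
      by (intro has_derivative_transform_within_open[OF has_derivative_mult_right[OF smooth_on_has_derivative[OF sm S(2)]] S]) simp
    then show ?thesis by (rule fd_eqI)
  qed
  also have "fd (\<lambda>z. a z (del_nth j vs)) y (vs ! j) = (-1) ^ i * fd (\<lambda>z. a z (vs ! i # del2 i j vs)) y (vs ! i)"
  proof -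
    have "i = skip j i" "i < length (del_nth j vs)" using i j by (auto simp: skip_def length_del_nth)
    then have "a z (del_nth j vs) = (-1) ^ i * a z (vs ! i # del2 i j vs)" if "z \<in> S" for z
      using alternating_nth_front[OF alt[OF that], of i "del_nth j vs"] e i j del2_commute[of i j vs]
      by (simp add: nth_del_nth length_del_nth del_nth_del_nth_skip)
    then have "((\<lambda>z. a z (del_nth j vs)) has_derivative (\<lambda>h. (-1) ^ i * fd (\<lambda>z. a z (vs ! i # del2 i j vs)) y h)) (at y)"
      by (intro has_derivative_transform_within_open[OF has_derivative_mult_right[OF smooth_on_has_derivative[OF sm S(2)]] S]) simp
    from fd_eqI[OF this] show ?thesis using e by simp
  qed
  finally have "dloc a y vs = ((-1) ^ i * (-1) ^ (j - 1) + (-1) ^ j * (-1) ^ i) * fd (\<lambda>z. a z (vs ! i # del2 i j vs)) y (vs ! i)"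
    by (simp add: algebra_simps)
  then show "dloc a y vs = 0" using i by (cases j) auto
qed

section \<open>Forms of type \<open>(r, s)\<close> on a complex vector space\<close>

lemma alternating_exchange:
  assumes a: "alternating_form a" and ij: "i < j" "j < length ws"
  shows "a (ws[i := ws ! j, j := ws ! i]) = - a ws"
proof -
  define L where "L u v = a (ws[i := u, j := v])" for u v
  have lin2: "linear (\<lambda>v. L u v)" for u
    using a ij unfolding alternating_form_def L_def by simp
  have lin1: "linear (\<lambda>u. L u v)" for v
  proof -
    have "linear (\<lambda>u. a ((ws[j := v])[i := u]))" using a ij unfolding alternating_form_def by simp
    then show ?thesis using ij by (simp add: L_def list_update_swap[of i j])
  qed
  have z: "L u u = 0" for u unfolding L_def
    by (rule alternating_eq_0[OF a ij(1)]) (use ij in auto)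
  have "L (u + v) (u + v) = L u u + L u v + (L v u + L v v)" for u v
    by (simp add: linear_add[OF lin1] linear_add[OF lin2])
  then have "L u v = - L v u" for u v using z by (simp add: eq_neg_iff_add_eq_0)
  from this[of "ws ! j" "ws ! i"] show ?thesis using ij by (simp add: L_def list_update_swap[of i j])
qed

lemma alternating_permute:
  assumes a: "alternating_form a" and p: "p permutes {..<length ws}"
  shows "a (permute_list p ws) = of_int (sign p) * a ws"
proof -
  have "\<forall>ws. length ws = n \<longrightarrow> a (permute_list p ws) = of_int (sign p) * a ws" if "p permutes {..<n}" for n
    using that finite_lessThan
  proof (induction rule: permutes_induct)
    case id
    then show ?case by simp
  next
    case (swap x y p)
    have tr: "Transposition.transpose x y permutes {..<n}" using swap by (intro permutes_swap_id) auto
    have "permutation (Transposition.transpose x y)" "permutation p"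
      using swap tr permutation_permutes by (metis finite_lessThan)+
    then have sg: "sign (Transposition.transpose x y \<circ> p) = - sign p"
      using swap by (simp add: sign_compose sign_swap_id)
    have ex: "a (permute_list (Transposition.transpose x y) ws) = - a ws" if l: "length ws = n" for ws
    proof -
      have *: "permute_list (Transposition.transpose u v) ws = ws[u := ws ! v, v := ws ! u]" if "u < v" "v < n" for u v
      proof (rule nth_equalityI)
        fix k assume "k < length (permute_list (Transposition.transpose u v) ws)"
        then have k: "k < n" using l by simp
        have "Transposition.transpose u v permutes {..<length ws}" using that l by (intro permutes_swap_id) auto
        then show "permute_list (Transposition.transpose u v) ws ! k = ws[u := ws ! v, v := ws ! u] ! k"
          using k l that by (auto simp: permute_list_nth nth_list_update Transposition.transpose_def)
      qed simp
      have "x < y \<or> y < x" using swap by auto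
      then show ?thesis
        using alternating_exchange[OF a, of x y ws] alternating_exchange[OF a, of y x ws] swap l
          *[of x y] *[of y x] by (auto simp: transpose_commute)
    qed
    show ?case
    proof (intro allI impI)
      fix ws :: "'a list" assume l: "length ws = n"
      have "a (permute_list (Transposition.transpose x y \<circ> p) ws) = a (permute_list p (permute_list (Transposition.transpose x y) ws))"
        using swap l by (simp add: permute_list_compose)
      also have "\<dots> = of_int (sign (Transposition.transpose x y \<circ> p)) * a ws"
        using swap l ex sg by simp
      finally show "a (permute_list (Transposition.transpose x y \<circ> p) ws) = of_int (sign (Transposition.transpose x y \<circ> p)) * a ws" .
    qed
  qed
  then show ?thesis using p by blast
qed

lemma multilinear_expand:
  fixes a :: "'w::real_inner list \<Rightarrow> complex"
  assumes a: "alternating_form a" and B: "frame B"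
  shows "a (pre @ ws) = (\<Sum>fs | set fs \<subseteq> B \<and> length fs = length ws.
    (\<Prod>i<length ws. of_real (ws ! i \<bullet> fs ! i)) * a (pre @ fs))"
proof (induction ws arbitrary: pre)
  case Nil
  have "{fs. set fs \<subseteq> B \<and> fs = []} = {[]}" by auto
  then show ?case by simp
next
  case (Cons w ws)
  let ?L = "{fs. set fs \<subseteq> B \<and> length fs = length ws}"
  have "a (pre @ w # ws) = (\<Sum>b\<in>B. (w \<bullet> b) *\<^sub>R a (pre @ b # ws))"
    by (rule frame_linear[OF B alternating_linear[OF a]])
  also have "\<dots> = (\<Sum>b\<in>B. \<Sum>fs\<in>?L. (\<Prod>i<Suc (length ws). of_real ((w # ws) ! i \<bullet> (b # fs) ! i)) * a (pre @ b # fs))"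
    using Cons.IH[of "pre @ [_]"]
    by (intro sum.cong refl) (simp only: scaleR_conv_of_real append.assoc append_Cons append_Nil
        sum_distrib_left prod.lessThan_Suc_shift nth_Cons_0 nth_Cons_Suc mult.assoc)
  also have "\<dots> = (\<Sum>(fs, b)\<in>?L \<times> B. (\<Prod>i<Suc (length ws). of_real ((w # ws) ! i \<bullet> (b # fs) ! i)) * a (pre @ b # fs))"
    by (subst sum.swap) (simp add: sum.cartesian_product)
  also have "\<dots> = (\<Sum>fs\<in>(\<lambda>(fs, b). b # fs) ` (?L \<times> B). (\<Prod>i<Suc (length ws). of_real ((w # ws) ! i \<bullet> fs ! i)) * a (pre @ fs))"
    by (subst sum.reindex) (auto simp: inj_on_def case_prod_unfold)
  finally show ?case by (simp only: length_Cons lists_length_Suc_eq)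
qed

lemma wedge_permute:
  assumes "q permutes {..<length ls}"
  shows "wedge (permute_list q ls) vs = of_int (sign q) * wedge ls vs"
proof (cases "length vs = length ls")
  case True
  let ?n = "length ls"
  let ?f = "\<lambda>p. of_int (sign p) * (\<Prod>i<?n. (permute_list q ls ! i) (vs ! p i)) :: complex"
  have "(\<Sum>p | p permutes {..<?n}. ?f p) = (\<Sum>p | p permutes {..<?n}. ?f (p \<circ> q))"
    by (rule sum_permutations_compose_right[OF assms])
  also have "\<dots> = (\<Sum>p | p permutes {..<?n}. of_int (sign q) * (of_int (sign p) * (\<Prod>i<?n. (ls ! i) (vs ! p i))))"
  proof (intro sum.cong refl)
    fix p assume "p \<in> {p. p permutes {..<?n}}"
    then have p: "p permutes {..<?n}" by simp
    have "permutation p" "permutation q" using p assms permutation_permutes by (metis finite_lessThan)+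
    then have "sign (p \<circ> q) = sign q * sign p" by (simp add: sign_compose)
    moreover have "(\<Prod>i<?n. (permute_list q ls ! i) (vs ! (p \<circ> q) i)) = (\<Prod>i<?n. (ls ! q i) (vs ! p (q i)))"
      by (intro prod.cong refl) (simp add: permute_list_nth[OF assms])
    moreover have "\<dots> = (\<Prod>i<?n. (ls ! i) (vs ! p i))"
      using prod.permute[OF assms, of "\<lambda>i. (ls ! i) (vs ! p i)"] by (simp add: o_def)
    ultimately show "?f (p \<circ> q) = of_int (sign q) * (of_int (sign p) * (\<Prod>i<?n. (ls ! i) (vs ! p i)))"
      by simp
  qed
  finally show ?thesis using True by (simp add: wedge_def sum_distrib_left)
next
  case False
  then show ?thesis by (simp add: wedge_def)
qed

lemma wedge_swap: "wedge (xs @ x # y # ys) vs = - wedge (xs @ y # x # ys) vs"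
proof -
  let ?k = "length xs" and ?l = "xs @ y # x # ys"
  have p: "Transposition.transpose ?k (Suc ?k) permutes {..<length ?l}" by (intro permutes_swap_id) auto
  have "permute_list (Transposition.transpose ?k (Suc ?k)) ?l = xs @ x # y # ys"
  proof (rule nth_equalityI)
    fix i assume "i < length (permute_list (Transposition.transpose ?k (Suc ?k)) ?l)"
    then have "i < length ?l" by simp
    then show "permute_list (Transposition.transpose ?k (Suc ?k)) ?l ! i = (xs @ x # y # ys) ! i"
      by (cases "i < ?k"; cases "i = ?k"; cases "i = Suc ?k")
        (auto simp: permute_list_nth[OF p] Transposition.transpose_def nth_append nth_Cons split: nat.split)
  qed simp
  then show ?thesis using wedge_permute[OF p, of vs] by (simp add: sign_swap_id)
qed

lemma wedge_move: "wedge (pre @ xs @ x # ys) vs = (-1) ^ length xs * wedge (pre @ x # xs @ ys) vs"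
proof (rule move_to_front[of "\<lambda>zs. wedge (pre @ zs) vs"])
  show "wedge (pre @ us @ x # y # zs) vs = - wedge (pre @ us @ y # x # zs) vs" for us x y zs
    using wedge_swap[of "pre @ us" x y zs vs] by simp
qed

lemma wedge_repeat: "wedge (xs @ x # ys @ x # zs) vs = 0"
proof -
  have "w = 0" if "w = - w" for w :: complex using that by (simp add: eq_neg_iff_add_eq_0)
  then have "wedge (xs @ x # x # ys @ zs) vs = 0" using wedge_swap[of xs x x "ys @ zs" vs] by blast
  then show ?thesis using wedge_move[of "xs @ [x]" ys x zs vs] by simp
qed

lemma wedge_sum:
  assumes "finite I"
  shows "wedge (xs @ (\<lambda>w. \<Sum>j\<in>I. c j * f j w) # ys) vs = (\<Sum>j\<in>I. c j * wedge (xs @ f j # ys) vs)"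
proof (cases "length vs = length xs + Suc (length ys)")
  case True
  let ?n = "length xs + Suc (length ys)" and ?k = "length xs"
  let ?l = "\<lambda>g. xs @ g # ys"
  \<comment> \<open>The factor in slot \<open>?k\<close> is pulled out of the product, so the
    remaining product may carry \<open>undefined\<close> in that slot.\<close>
  have pr: "(\<Prod>i<?n. (?l g ! i) (vs ! p i)) = g (vs ! p ?k) * (\<Prod>i\<in>{..<?n} - {?k}. ((xs @ undefined # ys) ! i) (vs ! p i))" for g p
  proof -
    have "(\<Prod>i<?n. (?l g ! i) (vs ! p i)) = (?l g ! ?k) (vs ! p ?k) * (\<Prod>i\<in>{..<?n} - {?k}. (?l g ! i) (vs ! p i))"
      by (rule prod.remove) auto
    also have "(\<Prod>i\<in>{..<?n} - {?k}. (?l g ! i) (vs ! p i)) = (\<Prod>i\<in>{..<?n} - {?k}. ((xs @ undefined # ys) ! i) (vs ! p i))"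
      by (intro prod.cong refl) (auto simp: nth_append nth_Cons split: nat.split)
    finally show ?thesis by simp
  qed
  have w: "wedge (?l g) vs = (\<Sum>p | p permutes {..<?n}. of_int (sign p) *
      (g (vs ! p ?k) * (\<Prod>i\<in>{..<?n} - {?k}. ((xs @ undefined # ys) ! i) (vs ! p i))))" for g
    using True by (simp add: wedge_def pr[simplified])
  show ?thesis unfolding w
    by (simp add: sum_distrib_left sum_distrib_right mult_ac sum.swap[of _ I])
next
  case False
  then show ?thesis by (simp add: wedge_def)
qed

lemma wedge_scale_args:
  assumes "\<And>i w. i < length ls \<Longrightarrow> (ls ! i) (f w) = c i * (ls ! i) w"
  shows "wedge ls (map f vs) = (\<Prod>i<length ls. c i) * wedge ls vs"
proof (cases "length vs = length ls")
  case True
  have "(\<Prod>i<length ls. (ls ! i) (map f vs ! p i)) = (\<Prod>i<length ls. c i) * (\<Prod>i<length ls. (ls ! i) (vs ! p i))"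
    if "p permutes {..<length ls}" for p
    unfolding prod.distrib[symmetric]
    by (intro prod.cong refl) (use True permutes_in_image[OF that] assms in simp)
  then have "(\<Sum>p | p permutes {..<length ls}. of_int (sign p) * (\<Prod>i<length ls. (ls ! i) (map f vs ! p i)))
    = (\<Sum>p | p permutes {..<length ls}. (\<Prod>i<length ls. c i) * (of_int (sign p) * (\<Prod>i<length ls. (ls ! i) (vs ! p i))))"
    by (intro sum.cong refl) (simp add: mult_ac)
  then show ?thesis using True by (simp add: wedge_def sum_distrib_left)
next
  case False
  then show ?thesis by (simp add: wedge_def)
qed

section \<open>Rotations by the complex structure and the projections onto types\<close>

definition rot :: "('w::real_vector \<Rightarrow> 'w) \<Rightarrow> real \<Rightarrow> 'w \<Rightarrow> 'w" where
  "rot J \<theta> w = cos \<theta> *\<^sub>R w + sin \<theta> *\<^sub>R J w"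

text \<open>
  The rotations act on forms of type \<open>(r, s)\<close> with the character \<open>\<theta> \<mapsto> cis ((r - s) * \<theta>)\<close>, so the
  projection onto them is a finite Fourier average.
\<close>

definition type_proj :: "('w::real_vector \<Rightarrow> 'w) \<Rightarrow> nat \<Rightarrow> nat \<Rightarrow> ('w list \<Rightarrow> complex) \<Rightarrow> 'w list \<Rightarrow> complex" where
  "type_proj J r s a ws = (if length ws = r + s then
     (\<Sum>m<Suc (r + s). (cis (- (real r - real s) * (pi * m / Suc (r + s))) / of_nat (Suc (r + s)))
        * a (map (rot J (pi * m / Suc (r + s))) ws))
   else 0)"

text \<open>Orthogonality of characters. In degree \<open>r + s\<close> the possible frequencies are
  \<open>2 * j - (r + s)\<close> with \<open>j \<le> r + s\<close>. They differ by even numbers, so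
  \<open>r + s + 1\<close> equidistant angles in half a turn are enough to separate them.\<close>

lemma cis_sum:
  fixes j r n :: nat
  assumes "j < n" "r < n"
  shows "(\<Sum>m<n. cis (2 * (real j - real r) * (pi * m / n))) = (if j = r then of_nat n else 0)"
proof (cases "j = r")
  case True
  then show ?thesis by simp
next
  case False
  define x where "x = 2 * pi * (real j - real r) / n"
  have n0: "n > 0" using assms by simp
  have "cis x \<noteq> 1"
  proof
    assume "cis x = 1"
    then have "cos x = 1" by (metis cis.simps(1) one_complex.simps(1))
    then obtain k :: int where k: "x = of_int k * 2 * pi" using cos_one_2pi_int[of x] by blast
    then have "2 * pi * (real j - real r) = 2 * pi * (of_int k * n)"
      using n0 by (simp add: x_def field_simps)
    then have "real j - real r = of_int k * n" by simp
    then have "real_of_int (int j - int r) = real_of_int (k * int n)" by simp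
    then have k': "int j - int r = k * int n" by (simp only: of_int_eq_iff)
    moreover have "k \<noteq> 0" using k' False by auto
    then have "\<bar>k * int n\<bar> \<ge> int n" by (simp add: abs_mult mult_le_cancel_right1) linarith
    ultimately show False using assms by linarith
  qed
  moreover have "cis x ^ n = 1"
  proof -
    have "cis x ^ n = cis (2 * pi * of_int (int j - int r))" using n0 by (simp add: Complex.DeMoivre x_def)
    also have "\<dots> = 1" by (rule cis_multiple_2pi) simp
    finally show ?thesis .
  qed
  ultimately have "(\<Sum>m<n. cis x ^ m) = 0" using geometric_sum[of "cis x" n] by simp
  moreover have "cis x ^ m = cis (2 * (real j - real r) * (pi * m / n))" for m
    by (simp add: Complex.DeMoivre x_def field_simps)
  ultimately show ?thesis using False by simp
qed

text \<open>Formulated for the value on a single list of vectors: it suffices to write the rotated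
  value as a combination of characters, without knowing that the coefficients \<open>E j\<close>
  come from forms.\<close>

lemma type_proj_eigen:
  assumes "length ws = r + s"
    and e: "\<And>\<theta>. a (map (rot J \<theta>) ws) = (\<Sum>j\<le>r + s. cis ((2 * real j - real (r + s)) * \<theta>) * E j)"
  shows "type_proj J r s a ws = E r"
proof -
  let ?n = "Suc (r + s)"
  have "type_proj J r s a ws = (\<Sum>m<?n. \<Sum>j<?n. (cis (2 * (real j - real r) * (pi * m / ?n)) / of_nat ?n) * E j)"
  proof -
    have c: "cis (- (real r - real s) * t) * cis ((2 * real j - real (r + s)) * t) = cis (2 * (real j - real r) * t)"
      for j t by (simp add: cis_mult algebra_simps)
    have "(cis (- (real r - real s) * t) / of_nat ?n) * (\<Sum>j\<le>r + s. cis ((2 * real j - real (r + s)) * t) * E j)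
        = (\<Sum>j<?n. (cis (2 * (real j - real r) * t) / of_nat ?n) * E j)" for t
      unfolding lessThan_Suc_atMost sum_distrib_left c[symmetric] by (intro sum.cong refl) simp
    then show ?thesis unfolding type_proj_def e using assms(1) by (simp only: refl if_True)
  qed
  also have "\<dots> = (\<Sum>j<?n. (\<Sum>m<?n. cis (2 * (real j - real r) * (pi * m / ?n))) / of_nat ?n * E j)"
    by (subst sum.swap) (simp only: sum_distrib_right sum_divide_distrib)
  also have "\<dots> = (\<Sum>j<?n. if j = r then E j else 0)"
  proof (intro sum.cong refl)
    fix j assume "j \<in> {..<?n}"
    then show "(\<Sum>m<?n. cis (2 * (real j - real r) * (pi * m / ?n))) / of_nat ?n * E j = (if j = r then E j else 0)"
      using cis_sum[of j ?n r] by (simp del: of_nat_Suc sum.lessThan_Suc)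
  qed
  also have "\<dots> = E r" by (simp del: sum.lessThan_Suc)
  finally show ?thesis .
qed

lemma type_proj_character:
  assumes "length ws = r + s" "\<And>\<theta>. a (map (rot J \<theta>) ws) = cis ((real r' - real s') * \<theta>) * a ws" "r' + s' = r + s"
  shows "type_proj J r s a ws = (if r' = r then a ws else 0)"
proof -
  have "type_proj J r s a ws = (\<lambda>j. if j = r' then a ws else 0) r"
  proof (rule type_proj_eigen[OF assms(1)])
    fix \<theta>
    have "(\<Sum>j\<le>r + s. cis ((2 * real j - real (r + s)) * \<theta>) * (if j = r' then a ws else 0))
        = (\<Sum>j\<le>r + s. if j = r' then cis ((2 * real j - real (r + s)) * \<theta>) * a ws else 0)"
      by (intro sum.cong) auto
    also have "\<dots> = cis ((2 * real r' - real (r + s)) * \<theta>) * a ws" using assms(3) by simp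
    also have "2 * real r' - real (r + s) = real r' - real s'" using assms(3) by linarith
    finally show "a (map (rot J \<theta>) ws) = (\<Sum>j\<le>r + s. cis ((2 * real j - real (r + s)) * \<theta>) * (if j = r' then a ws else 0))"
      using assms(2) by simp
  qed
  then show ?thesis by auto
qed

text \<open>The domain stays polymorphic, as the same scalar multiplication is used on functionals
  and on forms, that is on functions of lists.\<close>

interpretation cf: vector_space "\<lambda>(z::complex) (l::'a \<Rightarrow> complex) w. z * l w"
  by unfold_locales (auto simp: fun_eq_iff algebra_simps)

lemma sum_fun_apply: "(\<Sum>i\<in>I. f i) x = (\<Sum>i\<in>I. f i x)"
  by (induction I rule: infinite_finite_induct) simp_all

definition holf :: "('w::real_vector \<Rightarrow> 'w) \<Rightarrow> ('w \<Rightarrow> complex) set" where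
  "holf J = {l. linear l \<and> (\<forall>w. l (J w) = \<i> * l w)}"

definition antif :: "('w::real_vector \<Rightarrow> 'w) \<Rightarrow> ('w \<Rightarrow> complex) set" where
  "antif J = {l. linear l \<and> (\<forall>w. l (J w) = - \<i> * l w)}"

lemma type_forms_alt: "type_forms J r s = cf.span {wedge (ls @ ms) | ls ms. length ls = r \<and> length ms = s \<and>
    set ls \<subseteq> holf J \<and> set ms \<subseteq> antif J}"
proof -
  have "{wedge (ls @ ms) | ls ms. length ls = r \<and> length ms = s \<and> set ls \<subseteq> holf J \<and> set ms \<subseteq> antif J}
    = {wedge (ls @ ms) | ls ms. length ls = r \<and> length ms = s \<and>
        (\<forall>l \<in> set ls. linear l \<and> (\<forall>w. l (J w) = \<i> * l w)) \<and>
        (\<forall>m \<in> set ms. linear m \<and> (\<forall>w. m (J w) = - \<i> * m w))}"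
    unfolding holf_def antif_def subset_iff mem_Collect_eq Ball_def ..
  then show ?thesis unfolding type_forms_def by simp
qed

lemma holf_rot: "l \<in> holf J \<Longrightarrow> l (rot J \<theta> w) = cis \<theta> * l w"
  by (simp add: holf_def rot_def linear_add linear_cmul cis_conv_exp exp_Euler scaleR_conv_of_real
      cos_of_real sin_of_real algebra_simps)

lemma antif_rot: "l \<in> antif J \<Longrightarrow> l (rot J \<theta> w) = cis (- \<theta>) * l w"
  by (simp add: antif_def rot_def linear_add linear_cmul cis_conv_exp exp_Euler exp_minus_Euler scaleR_conv_of_real
      cos_of_real sin_of_real algebra_simps)

lemma type_forms_rot:
  assumes "b \<in> type_forms J r s"
  shows "b (map (rot J \<theta>) ws) = cis ((real r - real s) * \<theta>) * b ws"
  using assms unfolding type_forms_alt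
proof (induction rule: cf.span_induct_alt)
  case base
  then show ?case by simp
next
  case (step c x y)
  then obtain ls ms where x: "x = wedge (ls @ ms)" "length ls = r" "length ms = s"
    "set ls \<subseteq> holf J" "set ms \<subseteq> antif J" by blast
  have "x (map (rot J \<theta>) ws) = (\<Prod>i<length (ls @ ms). if i < r then cis \<theta> else cis (- \<theta>)) * x ws"
    unfolding x(1)
  proof (rule wedge_scale_args)
    fix i w assume "i < length (ls @ ms)"
    then show "((ls @ ms) ! i) (rot J \<theta> w) = (if i < r then cis \<theta> else cis (- \<theta>)) * ((ls @ ms) ! i) w"
      using x nth_mem[of i ls] nth_mem[of "i - r" ms]
      by (cases "i < r") (auto simp: nth_append intro!: holf_rot antif_rot dest: nth_mem)
  qed
  also have "(\<Prod>i<length (ls @ ms). if i < r then cis \<theta> else cis (- \<theta>)) = cis \<theta> ^ r * cis (- \<theta>) ^ s"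
  proof -
    have "(\<Prod>i<r + s. if i < r then cis \<theta> else cis (- \<theta>)) = cis \<theta> ^ r * cis (- \<theta>) ^ s"
      by (induction s) auto
    then show ?thesis using x by simp
  qed
  also have "\<dots> = cis ((real r - real s) * \<theta>)"
    unfolding Complex.DeMoivre cis_mult by (simp add: algebra_simps)
  finally show ?case using step by (simp add: algebra_simps)
qed

lemma type_forms_length:
  assumes "b \<in> type_forms J r s" "length ws \<noteq> r + s"
  shows "b ws = 0"
  using assms(1) unfolding type_forms_alt
proof (induction rule: cf.span_induct_alt)
  case base
  then show ?case by simp
next
  case (step c x y)
  then show ?case using assms(2) by (auto simp: wedge_def)
qed

lemma type_proj_type_forms:
  assumes b: "b \<in> type_forms J r' s'"
  shows "type_proj J r s b = (if r = r' \<and> s = s' then b else 0)"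
proof
  fix ws :: "'a list"
  consider "length ws = r + s" "r' + s' = r + s" | "length ws \<noteq> r + s" | "length ws = r + s" "r' + s' \<noteq> r + s" by blast
  then show "type_proj J r s b ws = (if r = r' \<and> s = s' then b else 0) ws"
  proof cases
    case 1
    then show ?thesis using type_proj_character[OF 1(1) type_forms_rot[OF b] 1(2)] by auto
  next
    case 2
    then show ?thesis using type_forms_length[OF b] by (auto simp: type_proj_def)
  next
    case 3
    then show ?thesis using type_forms_length[OF b] by (auto simp: type_proj_def)
  qed
qed

lemma type_proj_add: "type_proj J r s (a + b) = type_proj J r s a + type_proj J r s b"
  by (rule ext) (simp add: type_proj_def distrib_left sum.distrib del: sum.lessThan_Suc)

lemma type_proj_scale: "type_proj J r s (\<lambda>ws. c * a ws) = (\<lambda>ws. c * type_proj J r s a ws)"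
  by (rule ext) (simp add: type_proj_def sum_distrib_left mult_ac del: sum.lessThan_Suc)

lemma type_proj_zero: "type_proj J r s 0 = 0"
  by (rule ext) (simp add: type_proj_def)

lemma type_forms_subspace: "cf.subspace (type_forms J r s)"
  unfolding type_forms_alt by (rule cf.subspace_span)

subsection \<open>Vanishing above the complex dimension\<close>

text \<open>Through \<open>J\<close> the real space becomes a complex one. A complex independent set
  together with its image under \<open>J\<close> is real independent, so it has at most
  \<open>q\<close> elements; its coordinate functionals span the complex linear functionals.\<close>

lemma complex_basis:
  fixes J :: "'w::real_inner \<Rightarrow> 'w"
  assumes "complex_space q J"
  obtains D :: "('w::real_inner \<Rightarrow> complex) set" where "finite D" "card D \<le> q" "holf J \<subseteq> cf.span D"
proof -
  have J: "linear J" "\<And>w. J (J w) = - w" and dim: "has_dimension TYPE('w) (2 * q)"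
    using assms by (auto simp: complex_space_def)
  define cs where "cs z w = Re z *\<^sub>R w + Im z *\<^sub>R J w" for z w
  interpret cv: vector_space cs
    by unfold_locales
      (simp_all add: cs_def algebra_simps linear_add[OF J(1)] linear_cmul[OF J(1)] J(2))
  obtain Bc where Bc: "cv.independent Bc" "UNIV \<subseteq> cv.span Bc"
    using cv.maximal_independent_subset[of UNIV] by auto
  obtain R :: "'w set" where R: "finite R" "span R = UNIV" "card R = 2 * q"
    using has_dimension_finite_basis[OF dim] by metis
  have card: "card S \<le> q" if S: "S \<subseteq> Bc" "finite S" for S
  proof -
    have ind: "z b = 0" if "(\<Sum>b\<in>S. cs (z b) b) = 0" "b \<in> S" for z b
      using cv.independentD[OF Bc(1) S(2,1) that] .
    have disj: "S \<inter> J ` S = {}"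
    proof (rule ccontr)
      assume "S \<inter> J ` S \<noteq> {}"
      then obtain b c where bc: "b \<in> S" "c \<in> S" "b = J c" by auto
      define z :: "'w \<Rightarrow> complex" where "z x = (if x = b then 1 else 0) + (if x = c then - \<i> else 0)" for x
      have "(\<Sum>x\<in>S. cs (z x) x) = (\<Sum>x\<in>S. (if x = b then b else 0) + (if x = c then - J c else 0))"
        by (intro sum.cong refl) (auto simp: z_def cs_def)
      also have "\<dots> = b - J c" using bc S(2) by (simp add: sum.distrib)
      finally have "z b = 0" using ind[of z b] bc by simp
      then show False by (auto simp: z_def complex_eq_iff split: if_splits)
    qed
    have inj: "inj_on J S" by (rule inj_onI) (metis J(2) minus_equation_iff)
    have "independent (S \<union> J ` S)"
    proof (rule independent_if_scalars_zero)
      show "finite (S \<union> J ` S)" using S by simp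
      fix f x assume s: "(\<Sum>x\<in>S \<union> J ` S. f x *\<^sub>R x) = 0" and x: "x \<in> S \<union> J ` S"
      have "(\<Sum>x\<in>S \<union> J ` S. f x *\<^sub>R x) = (\<Sum>b\<in>S. f b *\<^sub>R b) + (\<Sum>b\<in>S. f (J b) *\<^sub>R J b)"
        using disj S inj by (simp add: sum.union_disjoint sum.reindex)
      also have "\<dots> = (\<Sum>b\<in>S. cs (Complex (f b) (f (J b))) b)"
        by (simp add: cs_def sum.distrib)
      finally have "Complex (f b) (f (J b)) = 0" if "b \<in> S" for b using ind[OF _ that, of "\<lambda>b. Complex (f b) (f (J b))"] s by simp
      then show "f x = 0" using x by (auto simp: complex_eq_iff)
    qed
    then have "card (S \<union> J ` S) \<le> card R" using independent_span_bound[OF R(1)] R(2) by auto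
    moreover have "card (S \<union> J ` S) = 2 * card S"
      using disj S inj by (simp add: card_Un_disjoint card_image)
    ultimately show ?thesis using R(3) by simp
  qed
  have fin: "finite Bc"
  proof (rule ccontr)
    assume "infinite Bc"
    then obtain S where "S \<subseteq> Bc" "finite S" "card S = Suc q" using infinite_arbitrarily_large by blast
    then show False using card[of S] by simp
  qed
  define dz where "dz b w = cv.representation Bc w b" for b w
  show ?thesis
  proof (rule that)
    show "finite (dz ` Bc)" using fin by simp
    show "card (dz ` Bc) \<le> q" using card_image_le[OF fin, of dz] card[OF subset_refl fin] by simp
    show "holf J \<subseteq> cf.span (dz ` Bc)"
    proof
      fix l assume l: "l \<in> holf J"
      have "l = (\<Sum>b\<in>Bc. (\<lambda>w. l b * dz b w))"
      proof
        fix w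
        have "w = (\<Sum>b\<in>Bc. cs (dz b w) b)"
          using cv.sum_representation_eq[OF Bc(1) _ fin subset_refl, of w] Bc(2)
          unfolding dz_def by (metis UNIV_I subsetD)
        then have "l w = l (\<Sum>b\<in>Bc. cs (dz b w) b)" by simp
        also have "\<dots> = (\<Sum>b\<in>Bc. l b * dz b w)" using l
          by (simp add: holf_def linear_sum cs_def linear_add linear_cmul scaleR_conv_of_real)
            (intro sum.cong refl, simp add: complex_eq_iff algebra_simps)
        finally show "l w = (\<Sum>b\<in>Bc. (\<lambda>w. l b * dz b w)) w" by (simp add: sum_fun_apply)
      qed
      also have "\<dots> \<in> cf.span (dz ` Bc)" by (intro cf.span_sum cf.span_scale cf.span_base) auto
      finally show "l \<in> cf.span (dz ` Bc)" .
    qed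
  qed
qed

text \<open>More than \<open>q\<close> complex linear functionals are either repeated or linearly
  dependent, and a wedge product vanishes in both cases. Repetitions are treated apart because
  dependence is a statement about the set of factors.\<close>

lemma wedge_holf_zero:
  fixes J :: "'w::real_inner \<Rightarrow> 'w"
  assumes J: "complex_space q J" and ls: "set ls \<subseteq> holf J" "q < length ls"
  shows "wedge (pre @ ls @ post) = 0"
proof (rule ext, simp)
  fix vs
  show "wedge (pre @ ls @ post) vs = 0"
  proof (cases "distinct ls")
    case False
    then obtain xs x ys zs where "ls = xs @ [x] @ ys @ [x] @ zs" using not_distinct_decomp by blast
    then show ?thesis using wedge_repeat[of "pre @ xs" x ys "zs @ post" vs] by simp
  next
    case True
    obtain D :: "('w \<Rightarrow> complex) set" where D: "finite D" "card D \<le> q" "holf J \<subseteq> cf.span D"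
      using complex_basis[OF J] .
    have "cf.dependent (set ls)"
      using cf.independent_span_bound[OF D(1), of "set ls"] D ls distinct_card[OF True] by force
    then obtain l where l: "l \<in> set ls" "l \<in> cf.span (set ls - {l})" unfolding cf.dependent_def by blast
    then obtain xs ys where e: "ls = xs @ l # ys" using split_list by metis
    have sub: "set ls - {l} \<subseteq> set xs \<union> set ys" using e by auto
    have "l \<in> cf.span (set xs \<union> set ys)" using l(2) cf.span_mono[OF sub] by blast
    then have "wedge (pre @ xs @ l # ys @ post) vs = 0"
    proof (induction rule: cf.span_induct_alt)
      case base
      show ?case using wedge_sum[of "{}" "pre @ xs" undefined undefined "ys @ post" vs] by (simp add: zero_fun_def)
    next
      case (step c x y)
      \<comment> \<open>The two summands are indexed by \<open>True\<close> and \<open>False\<close>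
        in order to apply linearity in one slot in the form \<open>wedge_sum\<close>.\<close>
      have "wedge ((pre @ xs) @ (\<lambda>w. \<Sum>j\<in>{True, False}. (if j then c else 1) * (if j then x else y) w) # (ys @ post)) vs
        = c * wedge ((pre @ xs) @ x # ys @ post) vs + wedge ((pre @ xs) @ y # ys @ post) vs"
        by (subst wedge_sum) auto
      moreover have "(\<lambda>w. \<Sum>j\<in>{True, False}. (if j then c else 1) * (if j then x else y) w) = (\<lambda>w. c * x w) + y"
        by (auto simp: fun_eq_iff)
      moreover have "wedge ((pre @ xs) @ x # ys @ post) vs = 0"
      proof -
        from step(1) consider us ws where "xs = us @ x # ws" | us ws where "ys = us @ x # ws"
          by (metis UnE split_list)
        then show ?thesis
          by cases (use wedge_repeat[of "pre @ _" x _ _ vs] wedge_repeat[of "pre @ xs" x _ _ vs] in auto)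
      qed
      ultimately show ?case using step by simp
    qed
    then show ?thesis using e by simp
  qed
qed

lemma type_forms_eq_zero:
  assumes J: "complex_space q J" and "q < r \<or> q < s"
  shows "type_forms J r s = {0}"
proof -
  \<comment> \<open>Antilinear functionals are complex linear for \<open>- J\<close>, so the bound
    on \<open>s\<close> follows from the one on \<open>r\<close>.\<close>
  have J': "complex_space q (\<lambda>w. - J w)"
    using J unfolding complex_space_def
    by (auto simp: linear_neg intro: linear_compose_neg)
  have anti: "antif J \<subseteq> holf (\<lambda>w. - J w)" by (auto simp: antif_def holf_def linear_neg)
  have "wedge (ls @ ms) = 0" if "length ls = r" "length ms = s" "set ls \<subseteq> holf J" "set ms \<subseteq> antif J" for ls ms
    using wedge_holf_zero[OF J that(3), of "[]" ms] wedge_holf_zero[OF J', of ms ls "[]"] that anti assms(2)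
    by auto
  then have "type_forms J r s \<subseteq> cf.span {0}" unfolding type_forms_alt by (intro cf.span_mono) auto
  moreover have "cf.span {0} = {0}" by simp
  ultimately show ?thesis using cf.subspace_0[OF type_forms_subspace, of J r s] by auto
qed

subsection \<open>The decomposition of alternating forms\<close>

definition type_gens :: "('w::real_vector \<Rightarrow> 'w) \<Rightarrow> ('w list \<Rightarrow> complex) set" where
  "type_gens J = {wedge (ls @ ms) | ls ms. set ls \<subseteq> holf J \<and> set ms \<subseteq> antif J}"

text \<open>Each real functional splits into its complex linear and its antilinear part. The
  induction moves the former to the front and appends the latter to the antilinear factors.\<close>

lemma wedge_real_span:
  fixes J :: "'w::real_inner \<Rightarrow> 'w"
  assumes J: "complex_space q J" and ls: "set ls \<subseteq> holf J" and ms: "set ms \<subseteq> antif J"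
  shows "wedge (ls @ ms @ map (\<lambda>b w. of_real (w \<bullet> b)) fs) \<in> cf.span (type_gens J)"
  using ls ms
proof (induction fs arbitrary: ls ms)
  case Nil
  then show ?case by (intro cf.span_base) (auto simp: type_gens_def)
next
  case (Cons b fs)
  have lJ: "linear J" and JJ: "\<And>w. J (J w) = - w" using J by (auto simp: complex_space_def)
  define lam where "lam w = (of_real (w \<bullet> b) - \<i> * of_real (J w \<bullet> b)) / 2" for w
  define bar where "bar w = (of_real (w \<bullet> b) + \<i> * of_real (J w \<bullet> b)) / 2" for w
  let ?R = "map (\<lambda>b w. complex_of_real (w \<bullet> b)) fs"
  have "linear lam" unfolding lam_def
    by (rule linearI) (simp_all add: linear_add[OF lJ] linear_cmul[OF lJ] inner_add_left complex_eq_iff scaleR_conv_of_real field_simps)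
  then have lam: "lam \<in> holf J" by (auto simp: holf_def lam_def JJ complex_eq_iff)
  have "linear bar" unfolding bar_def
    by (rule linearI) (simp_all add: linear_add[OF lJ] linear_cmul[OF lJ] inner_add_left complex_eq_iff scaleR_conv_of_real field_simps)
  then have bar: "bar \<in> antif J" by (auto simp: antif_def bar_def JJ complex_eq_iff)
  have eq: "wedge (ls @ ms @ map (\<lambda>b w. of_real (w \<bullet> b)) (b # fs))
      = (\<lambda>vs. (-1) ^ (length ls + length ms) * wedge ((lam # ls) @ ms @ ?R) vs) + wedge (ls @ (ms @ [bar]) @ ?R)"
  proof
    fix vs
    have "(\<lambda>w. complex_of_real (w \<bullet> b)) = (\<lambda>w. \<Sum>j\<in>{True, False}. 1 * (if j then lam else bar) w)"
      by (auto simp: lam_def bar_def field_simps)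
    then have "wedge (ls @ ms @ map (\<lambda>b w. of_real (w \<bullet> b)) (b # fs)) vs
      = wedge ((ls @ ms) @ lam # ?R) vs + wedge ((ls @ ms) @ bar # ?R) vs"
      using wedge_sum[of "{True, False}" "ls @ ms" "\<lambda>_. 1" "\<lambda>j. if j then lam else bar" ?R vs] by simp
    then show "wedge (ls @ ms @ map (\<lambda>b w. of_real (w \<bullet> b)) (b # fs)) vs
      = ((\<lambda>vs. (-1) ^ (length ls + length ms) * wedge ((lam # ls) @ ms @ ?R) vs) + wedge (ls @ (ms @ [bar]) @ ?R)) vs"
      using wedge_move[of "[]" "ls @ ms" lam ?R vs] by simp
  qed
  show ?case unfolding eq
    by (intro cf.span_add cf.span_scale Cons.IH) (use Cons.prems lam bar in auto)
qed

text \<open>Averaging over permutations and expanding in a frame writes an alternating form as a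
  combination of wedge products of real functionals. The sum runs over all words in the frame,
  unordered and with repetitions, hence the division by \<open>fact k\<close>.\<close>

lemma alternating_in_span:
  fixes a :: "'w::real_inner list \<Rightarrow> complex"
  assumes J: "complex_space q J" and a: "alternating_form a"
  shows "(\<lambda>ws. if length ws = k then a ws else 0) \<in> cf.span (type_gens J)"
proof -
  have dim: "has_dimension TYPE('w) (2 * q)" using J by (simp add: complex_space_def)
  obtain B :: "'w set" where B: "frame B" using has_dimension_frame[OF dim] .
  let ?L = "{fs. set fs \<subseteq> B \<and> length fs = k}"
  let ?e = "\<lambda>b w. complex_of_real (w \<bullet> b)"
  have "(\<lambda>ws. if length ws = k then a ws else 0) = (\<Sum>fs\<in>?L. (\<lambda>ws. (a fs / fact k) * wedge (map ?e fs) ws))"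
  proof
    fix ws
    show "(if length ws = k then a ws else 0) = (\<Sum>fs\<in>?L. (\<lambda>ws. (a fs / fact k) * wedge (map ?e fs) ws)) ws"
    proof (cases "length ws = k")
      case False
      then show ?thesis by (simp add: sum_fun_apply wedge_def)
    next
      case True
      have "fact k * a ws = (\<Sum>p | p permutes {..<k}. a ws)"
        using card_permutations[of "{..<k}" k] by simp
      also have "\<dots> = (\<Sum>p | p permutes {..<k}. of_int (sign p) * a (permute_list p ws))"
      proof (intro sum.cong refl)
        fix p assume "p \<in> {p. p permutes {..<k}}"
        then have "a (permute_list p ws) = of_int (sign p) * a ws" using alternating_permute[OF a] True by simp
        then show "a ws = of_int (sign p) * a (permute_list p ws)"
          by (simp add: mult.assoc[symmetric] of_int_mult[symmetric] del: of_int_mult)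
      qed
      also have "\<dots> = (\<Sum>p | p permutes {..<k}. of_int (sign p) *
          (\<Sum>fs\<in>?L. (\<Prod>i<k. of_real (ws ! p i \<bullet> fs ! i)) * a fs))"
      proof (intro sum.cong refl arg_cong2[where f="(*)"])
        fix p assume "p \<in> {p. p permutes {..<k}}"
        then show "a (permute_list p ws) = (\<Sum>fs\<in>?L. (\<Prod>i<k. of_real (ws ! p i \<bullet> fs ! i)) * a fs)"
          using multilinear_expand[OF a B, of "[]" "permute_list p ws"] True by (simp add: permute_list_nth)
      qed
      also have "\<dots> = (\<Sum>fs\<in>?L. a fs * (\<Sum>p | p permutes {..<k}. of_int (sign p) * (\<Prod>i<k. of_real (ws ! p i \<bullet> fs ! i))))"
        by (simp add: sum_distrib_left mult_ac) (rule sum.swap)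
      also have "\<dots> = (\<Sum>fs\<in>?L. a fs * wedge (map ?e fs) ws)"
        using True by (intro sum.cong refl) (auto simp: wedge_def)
      finally have "a ws = (\<Sum>fs\<in>?L. a fs * wedge (map ?e fs) ws) / fact k" by (simp add: field_simps)
      then show ?thesis using True by (simp add: sum_fun_apply sum_divide_distrib)
    qed
  qed
  also have "\<dots> \<in> cf.span (type_gens J)"
    by (intro cf.span_sum cf.span_scale) (use wedge_real_span[OF J, of "[]" "[]"] in simp)
  finally show ?thesis .
qed

lemma type_proj_gens:
  assumes J: "complex_space q J" and "f \<in> cf.span (type_gens J)"
  shows "(\<forall>r s. type_proj J r s f \<in> type_forms J r s) \<and> f = (\<Sum>r\<le>q. \<Sum>s\<le>q. type_proj J r s f)"
  using assms(2)
proof (induction rule: cf.span_induct_alt)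
  case base
  show ?case using cf.subspace_0[OF type_forms_subspace]
    by (simp only: type_proj_zero sum.neutral_const simp_thms) blast
next
  case (step c x y)
  then obtain ls ms where x: "x = wedge (ls @ ms)" "set ls \<subseteq> holf J" "set ms \<subseteq> antif J"
    by (auto simp: type_gens_def)
  let ?r = "length ls" and ?s = "length ms"
  have xt: "x \<in> type_forms J ?r ?s" unfolding type_forms_alt using x by (intro cf.span_base) blast
  have px: "type_proj J r s x = (if r = ?r \<and> s = ?s then x else 0)" for r s
    by (rule type_proj_type_forms[OF xt])
  have 1: "type_proj J r s ((\<lambda>vs. c * x vs) + y) = (\<lambda>vs. c * type_proj J r s x vs) + type_proj J r s y" for r s
    by (simp add: type_proj_add type_proj_scale)
  have sx: "x = (\<Sum>r\<le>q. \<Sum>s\<le>q. type_proj J r s x)"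
  proof (cases "?r \<le> q \<and> ?s \<le> q")
    case True
    have "(\<Sum>r\<le>q. \<Sum>s\<le>q. type_proj J r s x) = (\<Sum>r\<le>q. \<Sum>s\<le>q. if s = ?s then (if r = ?r then x else 0) else 0)"
      unfolding px by (intro sum.cong refl) auto
    then show ?thesis using True by simp
  next
    case False
    then have "x = 0" using type_forms_eq_zero[OF J, of ?r ?s] xt by auto
    then show ?thesis by (simp add: type_proj_zero)
  qed
  have "(\<lambda>vs. c * x vs) + y = (\<lambda>vs. c * (\<Sum>r\<le>q. \<Sum>s\<le>q. type_proj J r s x) vs) + (\<Sum>r\<le>q. \<Sum>s\<le>q. type_proj J r s y)"
    using step(2) sx by metis
  also have "\<dots> = (\<Sum>r\<le>q. \<Sum>s\<le>q. (\<lambda>vs. c * type_proj J r s x vs) + type_proj J r s y)"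
    by (rule ext) (simp add: sum_fun_apply sum_distrib_left sum.distrib)
  finally have sum: "(\<lambda>vs. c * x vs) + y = (\<Sum>r\<le>q. \<Sum>s\<le>q. (\<lambda>vs. c * type_proj J r s x vs) + type_proj J r s y)" .
  have mem: "type_proj J r s x \<in> type_forms J r s" for r s
    using xt cf.subspace_0[OF type_forms_subspace] unfolding px by (cases "r = ?r \<and> s = ?s") auto
  show ?case
  proof (intro conjI allI)
    show "type_proj J r s ((\<lambda>vs. c * x vs) + y) \<in> type_forms J r s" for r s
      unfolding 1 using step(2) mem
      by (intro cf.subspace_add[OF type_forms_subspace] cf.subspace_scale[OF type_forms_subspace]) blast+
    show "(\<lambda>vs. c * x vs) + y = (\<Sum>r\<le>q. \<Sum>s\<le>q. type_proj J r s ((\<lambda>vs. c * x vs) + y))"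
      unfolding 1 by (rule sum)
  qed
qed

lemma type_proj_cong: "(\<And>ws. length ws = r + s \<Longrightarrow> a ws = b ws) \<Longrightarrow> type_proj J r s a = type_proj J r s b"
  by (rule ext) (simp add: type_proj_def del: sum.lessThan_Suc)

lemma type_proj_in_type_forms:
  fixes a :: "'w::real_inner list \<Rightarrow> complex"
  assumes J: "complex_space q J" and a: "alternating_form a"
  shows "type_proj J r s a \<in> type_forms J r s"
proof -
  have "type_proj J r s a = type_proj J r s (\<lambda>ws. if length ws = r + s then a ws else 0)"
    by (rule type_proj_cong) simp
  then show ?thesis using type_proj_gens[OF J alternating_in_span[OF J a]] by simp
qed

text \<open>A form may have components of every degree; evaluating at one list involves only the
  degree equal to its length, where the span of generators applies.\<close>

lemma type_proj_decomposition:
  fixes a :: "'w::real_inner list \<Rightarrow> complex"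
  assumes J: "complex_space q J" and a: "alternating_form a"
  shows "a = (\<Sum>r\<le>q. \<Sum>s\<le>q. type_proj J r s a)"
proof
  fix ws :: "'w list"
  let ?f = "\<lambda>vs. if length vs = length ws then a vs else 0"
  have "a ws = ?f ws" by simp
  also have "\<dots> = (\<Sum>r\<le>q. \<Sum>s\<le>q. type_proj J r s ?f) ws"
    by (rule fun_cong[OF conjunct2[OF type_proj_gens[OF J alternating_in_span[OF J a, of "length ws"]]]])
  also have "\<dots> = (\<Sum>r\<le>q. \<Sum>s\<le>q. type_proj J r s a) ws"
    by (auto simp: sum_fun_apply type_proj_def intro!: sum.cong)
  finally show "a ws = (\<Sum>r\<le>q. \<Sum>s\<le>q. type_proj J r s a) ws" .
qed

lemma alternating_sum:
  assumes "\<And>i. i \<in> I \<Longrightarrow> alternating_form (f i)"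
  shows "alternating_form (\<lambda>ws. \<Sum>i\<in>I. c i * f i ws)"
  using assms unfolding alternating_form_def
  by (auto intro!: linear_compose_sum linear_compose[unfolded o_def, OF _ bounded_linear.linear[OF bounded_linear_mult_right]] sum.neutral)

lemma alternating_map:
  assumes a: "alternating_form a" and f: "linear f"
  shows "alternating_form (\<lambda>ws. a (map f ws))"
proof -
  have "linear (\<lambda>w. a ((map f vs)[i := f w]))" if "i < length vs" for vs i
    using a that linear_compose[OF f, of "\<lambda>w. a ((map f vs)[i := w])"] by (simp add: alternating_form_def o_def)
  then show ?thesis using a by (auto simp: alternating_form_def map_update)
qed

lemma linear_rot: "linear J \<Longrightarrow> linear (rot J \<theta>)"
  unfolding rot_def[abs_def] by (rule linearI) (simp_all add: linear_add linear_cmul algebra_simps)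

lemma linear_if_const: "(P \<Longrightarrow> linear f) \<Longrightarrow> linear (\<lambda>w. if P then f w else 0)"
  by (cases P) (simp_all add: linear_zero)

lemma alternating_restrict_length:
  "alternating_form a \<Longrightarrow> alternating_form (\<lambda>ws. if length ws = k then a ws else 0)"
  unfolding alternating_form_def by (auto intro!: linear_if_const)

lemma alternating_type_proj:
  assumes J: "linear J" and a: "alternating_form a"
  shows "alternating_form (type_proj J r s a)"
proof -
  have "alternating_form (\<lambda>ws. \<Sum>m<Suc (r + s). (cis (- (real r - real s) * (pi * m / Suc (r + s))) / of_nat (Suc (r + s)))
        * a (map (rot J (pi * m / Suc (r + s))) ws))"
    by (intro alternating_sum alternating_map a linear_rot J)
  then have "alternating_form (\<lambda>ws. if length ws = r + s then (\<Sum>m<Suc (r + s). (cis (- (real r - real s) * (pi * m / Suc (r + s))) / of_nat (Suc (r + s)))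
        * a (map (rot J (pi * m / Suc (r + s))) ws)) else 0)"
    by (rule alternating_restrict_length)
  then show ?thesis unfolding type_proj_def[abs_def] .
qed

section \<open>Charts\<close>

lemma chart_openin: "is_chart X c \<Longrightarrow> openin X (fst c)"
  by (simp add: is_chart_def)

lemma chart_subset: "is_chart X c \<Longrightarrow> fst c \<subseteq> topspace X"
  unfolding is_chart_def by (simp add: openin_subset)

lemma chart_topspace: "is_chart X c \<Longrightarrow> topspace (subtopology X (fst c)) = fst c"
  using chart_subset[of X c] by (auto simp: topspace_subtopology)

lemma chart_inj: "is_chart X c \<Longrightarrow> inj_on (snd c) (fst c)"
  using chart_topspace unfolding is_chart_def homeomorphic_map_def by metis

lemma chart_open_image:
  assumes c: "is_chart X c" and U: "openin X U" "U \<subseteq> fst c"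
  shows "open (snd c ` U)"
proof -
  have "open_map (subtopology X (fst c)) (top_of_set (snd c ` fst c)) (snd c)"
    using c homeomorphic_imp_open_map unfolding is_chart_def by blast
  moreover have "openin (subtopology X (fst c)) U"
    using U c unfolding is_chart_def by (simp add: openin_open_subtopology)
  ultimately have "openin (top_of_set (snd c ` fst c)) (snd c ` U)" unfolding open_map_def by blast
  then show ?thesis using c unfolding is_chart_def by (metis openin_open_eq)
qed

lemma chart_open: "is_chart X c \<Longrightarrow> open (snd c ` fst c)"
  by (simp add: is_chart_def)

lemma in_charts_apply: "is_chart X c \<Longrightarrow> x \<in> fst c \<Longrightarrow> in_charts c c' f (snd c x) = snd c' (f x)"
  by (simp add: in_charts_def inv_into_f_f chart_inj)

text \<open>A single chain rule for changes of chart on the manifold, on the transverse side, and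
  through the maps \<open>gam\<close>. The factorisation \<open>f2 = k \<circ> f\<close> is required
  only on an open set around the point.\<close>

lemma in_charts_compose_has_derivative:
  assumes c: "is_chart X c" and c': "is_chart Y c'" and U: "openin X U" "U \<subseteq> fst c" "x \<in> U"
    and f: "\<And>z. z \<in> U \<Longrightarrow> f z \<in> fst c'" and k: "\<And>z. z \<in> U \<Longrightarrow> f2 z = k (f z)"
    and D1: "(in_charts c c' f has_derivative D1) (at (snd c x))"
    and D2: "(in_charts c' c'' k has_derivative D2) (at (snd c' (f x)))"
  shows "(in_charts c c'' f2 has_derivative (\<lambda>v. D2 (D1 v))) (at (snd c x))"
proof -
  have x: "in_charts c c' f (snd c x) = snd c' (f x)" using in_charts_apply[OF c] U by blast
  have "((\<lambda>z. in_charts c' c'' k (in_charts c c' f z)) has_derivative (\<lambda>v. D2 (D1 v))) (at (snd c x))"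
    by (rule has_derivative_compose[OF D1]) (use D2 x in simp)
  then show ?thesis
  proof (rule has_derivative_transform_within_open[OF _ chart_open_image[OF c U(1,2)]])
    show "snd c x \<in> snd c ` U" using U by simp
    fix z assume "z \<in> snd c ` U"
    then obtain p where p: "p \<in> U" "z = snd c p" by blast
    then have pc: "p \<in> fst c" using U by blast
    show "in_charts c' c'' k (in_charts c c' f z) = in_charts c c'' f2 z"
      using in_charts_apply[OF c pc, of c' f] in_charts_apply[OF c' f[OF p(1)], of c'' k]
        in_charts_apply[OF c pc, of c'' f2] k[OF p(1)] p(2) by simp
  qed
qed

section \<open>Descending a horizontal form along a surjective linear map\<close>

text \<open>\<open>inv A\<close> picks arbitrary preimages: meaningful only for surjective \<open>A\<close> and horizontal \<open>b\<close>.\<close>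

definition desc :: "('v list \<Rightarrow> complex) \<Rightarrow> ('v \<Rightarrow> 'w) \<Rightarrow> 'w list \<Rightarrow> complex" where
  "desc b A ws = b (map (inv A) ws)"

definition horizontal :: "('v::real_vector list \<Rightarrow> complex) \<Rightarrow> ('v \<Rightarrow> 'w::real_vector) \<Rightarrow> bool" where
  "horizontal b A \<longleftrightarrow> alternating_form b \<and> linear A \<and> surj A \<and> (\<forall>v vs. A v = 0 \<longrightarrow> b (v # vs) = 0)"

text \<open>Arguments are replaced one at a time; each replacement changes an argument by a vector
  in the kernel.\<close>

lemma horizontal_eq:
  assumes h: "horizontal b A" and "map A vs = map A us"
  shows "b vs = b us"
proof -
  have "b (pre @ vs) = b (pre @ us)" for pre
    using assms(2)
  proof (induction vs arbitrary: us pre)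
    case Nil
    then show ?case by simp
  next
    case (Cons v vs)
    then obtain u us' where us: "us = u # us'" "A v = A u" "map A vs = map A us'" by (cases us) auto
    have alt: "alternating_form b" and lin: "linear A" using h by (auto simp: horizontal_def)
    have "A (v - u) = 0" using us(2) lin by (simp add: linear_diff)
    then have "b (pre @ (v - u) # vs) = 0"
      using alternating_move[OF alt, of pre "v - u" vs] h by (simp add: horizontal_def)
    then have "b (pre @ v # vs) = b (pre @ u # vs)"
      using linear_diff[OF alternating_linear[OF alt, of pre vs], of v u] by simp
    also have "\<dots> = b (pre @ u # us')" using Cons.IH[of us' "pre @ [u]"] us by simp
    finally show ?case using us by simp
  qed
  from this[of "[]"] show ?thesis by simp
qed

lemma desc_map: "horizontal b A \<Longrightarrow> desc b A (map A vs) = b vs"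
  unfolding desc_def by (rule horizontal_eq[of b A]) (auto simp: horizontal_def surj_f_inv_f)

text \<open>Any section may take the place of the arbitrary choice \<open>inv A\<close>. A linear
  one shows that \<open>desc\<close> is alternating, a smooth family of them that it is
  smooth.\<close>

lemma desc_section:
  assumes h: "horizontal b A" and "\<And>w. A (\<sigma> w) = w"
  shows "desc b A ws = b (map \<sigma> ws)"
  unfolding desc_def by (rule horizontal_eq[OF h]) (use assms in \<open>auto simp: horizontal_def surj_f_inv_f\<close>)

lemma surj_map: "surj A \<Longrightarrow> \<exists>vs. ws = map A vs"
  by (rule exI[of _ "map (inv A) ws"]) (simp add: surj_f_inv_f o_def)

lemma desc_unique:
  assumes "surj A" "\<And>vs. b vs = b' (map A vs)"
  shows "desc b A = b'"
  using assms by (auto simp: fun_eq_iff desc_def surj_f_inv_f o_def)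

lemma alternating_desc:
  assumes h: "horizontal b A"
  shows "alternating_form (desc b A)"
proof -
  obtain \<sigma> where \<sigma>: "linear \<sigma>" "A \<circ> \<sigma> = id"
    using linear_surjective_right_inverse[of A] h unfolding horizontal_def by blast
  then have "desc b A = (\<lambda>ws. b (map \<sigma> ws))" using desc_section[OF h, of \<sigma>] by (simp add: fun_eq_iff)
  then show ?thesis using alternating_map[OF _ \<sigma>(1), of b] h by (simp add: horizontal_def)
qed

text \<open>A complex linear map commutes with the rotations, hence with their averages. This makes
  types independent of the transverse coordinates.\<close>

lemma type_proj_map:
  assumes L: "linear L" and LJ: "\<And>w. L (J w) = J (L w)" and e: "\<And>ws. b1 ws = b2 (map L ws)"
  shows "type_proj J r s b2 (map L ws) = type_proj J r s b1 ws"
proof -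
  have "map (rot J \<theta>) (map L ws) = map L (map (rot J \<theta>) ws)" for \<theta>
    using LJ L by (simp add: rot_def linear_add linear_cmul)
  then show ?thesis unfolding type_proj_def e by (simp only: length_map)
qed

lemma horizontal_type_proj:
  assumes J: "linear J" and h: "horizontal b A"
  shows "horizontal (\<lambda>vs. type_proj J r s (desc b A) (map A vs)) A"
proof -
  have a: "alternating_form (type_proj J r s (desc b A))"
    by (rule alternating_type_proj[OF J alternating_desc[OF h]])
  have "type_proj J r s (desc b A) (0 # ws) = 0" for ws
    using linear_0[OF alternating_linear[OF a, of "[]" ws]] by simp
  then show ?thesis using h alternating_map[OF a, of A] unfolding horizontal_def by simp
qed

section \<open>Forms on a manifold\<close>

lemma formsD:
  assumes "\<alpha> \<in> forms A"
  shows "c \<notin> A \<or> y \<notin> snd c ` fst c \<Longrightarrow> \<alpha> c y = 0" "alternating_form (\<alpha> c y)"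
    "c \<in> A \<Longrightarrow> smooth_on (\<lambda>y. \<alpha> c y vs) (snd c ` fst c)"
    "c \<in> A \<Longrightarrow> c' \<in> A \<Longrightarrow> x \<in> fst c \<inter> fst c' \<Longrightarrow> \<alpha> c (snd c x) vs =
        \<alpha> c' (snd c' x) (map (fd (transition c c') (snd c x)) vs)"
  using assms unfolding forms_def by blast+

lemma alternating_zero: "alternating_form 0"
  unfolding alternating_form_def by (simp add: linear_zero)

lemma alternating_add: "alternating_form a \<Longrightarrow> alternating_form b \<Longrightarrow> alternating_form (a + b)"
  unfolding alternating_form_def by (simp add: linear_compose_add)

lemma alternating_scale: "alternating_form a \<Longrightarrow> alternating_form (\<lambda>ws. (c::complex) * a ws)"
  using alternating_sum[of "{()}" "\<lambda>_. a" "\<lambda>_. c"] by simp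

locale manifold_charts =
  fixes X :: "'m topology" and A :: "('m, 'v::real_inner) chart set" and n :: nat
  assumes mfd: "smooth_manifold n X A"
begin

lemma dim: "has_dimension TYPE('v) n"
  using mfd by (simp add: smooth_manifold_def)

lemma chart: "c \<in> A \<Longrightarrow> is_chart X c"
  using mfd by (simp add: smooth_manifold_def smooth_atlas_def)

lemma transition_smooth: "c \<in> A \<Longrightarrow> c' \<in> A \<Longrightarrow> smooth_on (transition c c') (snd c ` (fst c \<inter> fst c'))"
  using mfd by (simp add: smooth_manifold_def smooth_atlas_def)

lemma overlap_open: "c \<in> A \<Longrightarrow> c' \<in> A \<Longrightarrow> open (snd c ` (fst c \<inter> fst c'))"
  by (rule chart_open_image[OF chart]) (auto intro: openin_Int chart_openin chart)

lemma transition_has_derivative: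
  assumes "c \<in> A" "c' \<in> A" "x \<in> fst c \<inter> fst c'"
  shows "(transition c c' has_derivative fd (transition c c') (snd c x)) (at (snd c x))"
  by (rule smooth_on_has_derivative[OF transition_smooth[OF assms(1,2)]]) (use assms in auto)

lemma transition_fd_compose:
  assumes "c \<in> A" "c' \<in> A" "c'' \<in> A" "x \<in> fst c \<inter> fst c' \<inter> fst c''"
  shows "fd (transition c c'') (snd c x) v = fd (transition c' c'') (snd c' x) (fd (transition c c') (snd c x) v)"
proof -
  let ?U = "fst c \<inter> fst c'"
  have U: "openin X ?U" "?U \<subseteq> fst c" "x \<in> ?U" using assms by (auto intro: openin_Int chart_openin chart)
  have k: "\<And>z. z \<in> ?U \<Longrightarrow> id z \<in> fst c'" "\<And>z. z \<in> ?U \<Longrightarrow> id z = id (id z)" by auto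
  have D1: "(transition c c' has_derivative fd (transition c c') (snd c x)) (at (snd c x))"
    using assms by (intro transition_has_derivative) auto
  have D2: "(transition c' c'' has_derivative fd (transition c' c'') (snd c' x)) (at (snd c' (id x)))"
    using transition_has_derivative[OF assms(2,3), of x] assms(4) by simp
  from in_charts_compose_has_derivative[OF chart[OF assms(1)] chart[OF assms(2)] U k D1 D2]
  have "(transition c c'' has_derivative (\<lambda>v. fd (transition c' c'') (snd c' x) (fd (transition c c') (snd c x) v))) (at (snd c x))" .
  then show ?thesis by (rule fd_eqI)
qed

lemma transition_fd_id:
  assumes "c \<in> A" "x \<in> fst c"
  shows "fd (transition c c) (snd c x) v = v"
proof -
  have "((\<lambda>z. z) has_derivative (\<lambda>v. v)) (at (snd c x))" by (rule has_derivative_ident)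
  then have "(transition c c has_derivative (\<lambda>v. v)) (at (snd c x))"
    by (rule has_derivative_transform_within_open[OF _ chart_open[OF chart[OF assms(1)]]])
      (use assms in_charts_apply[OF chart[OF assms(1)], where c'=c and f=id] in auto)
  then show ?thesis by (rule fd_eqI)
qed

text \<open>The coordinate formula is compatible with changes of chart by
  \<open>dloc_pullback\<close>, followed by the chain rule for the coefficients; alternation and
  smoothness are local.\<close>

lemma ext_d_forms:
  assumes \<alpha>: "\<alpha> \<in> forms A"
  shows "ext_d A \<alpha> \<in> forms A"
  unfolding forms_def
proof (intro CollectI conjI allI ballI impI)
  fix c y assume "c \<notin> A \<or> y \<notin> snd c ` fst c"
  then show "ext_d A \<alpha> c y = 0" by (auto simp: ext_d_def fun_eq_iff)
next
  fix c y
  show "alternating_form (ext_d A \<alpha> c y)"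
  proof (cases "c \<in> A \<and> y \<in> snd c ` fst c")
    case True
    then have "alternating_form (dloc (\<alpha> c) y)"
      using formsD(3)[OF \<alpha>, of c] by (intro alternating_dloc[OF chart_open[OF chart[of c]]] formsD(2)[OF \<alpha>]) simp_all
    then show ?thesis using True by (simp add: ext_d_dloc)
  next
    case False
    then have "ext_d A \<alpha> c y = 0" by (auto simp: ext_d_def fun_eq_iff)
    then show ?thesis by (simp only: alternating_zero)
  qed
next
  fix c vs assume c: "c \<in> A"
  have "smooth_on (\<lambda>y. dloc (\<alpha> c) y vs) (snd c ` fst c)"
    by (rule smooth_on_dloc[OF chart_open[OF chart[OF c]] formsD(3)[OF \<alpha> c]])
  then show "smooth_on (\<lambda>y. ext_d A \<alpha> c y vs) (snd c ` fst c)"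
    using smooth_on_cong[OF chart_open[OF chart[OF c]], of "\<lambda>y. ext_d A \<alpha> c y vs" "\<lambda>y. dloc (\<alpha> c) y vs"]
    by (simp add: ext_d_dloc c)
next
  fix c c' x vs assume c: "c \<in> A" and c': "c' \<in> A" and x: "x \<in> fst c \<inter> fst c'"
  define S where "S = snd c ` (fst c \<inter> fst c')"
  define y where "y = snd c x"
  define \<phi> where "\<phi> = transition c c'"
  have S: "open S" "y \<in> S" unfolding S_def y_def using overlap_open[OF c c'] x by auto
  have sm: "smooth_on \<phi> S" unfolding \<phi>_def S_def by (rule transition_smooth[OF c c'])
  have \<phi>: "\<phi> (snd c z) = snd c' z" if "z \<in> fst c" for z
    unfolding \<phi>_def using in_charts_apply[OF chart[OF c] that, of c' id] by simp
  have img: "\<phi> ` S \<subseteq> snd c' ` fst c'" unfolding S_def using \<phi> by auto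
  have sm': "smooth_on (\<lambda>z. \<alpha> c' (\<phi> z) ws) S" for ws
    by (rule smooth_on_compose[OF dim S(1) chart_open[OF chart[OF c']] img sm formsD(3)[OF \<alpha> c']])
  have "dloc (\<alpha> c) y vs = (\<Sum>i<length vs. (-1) ^ i * fd (\<lambda>z. \<alpha> c' (\<phi> z) (del_nth i (map (fd \<phi> y) vs))) y (vs ! i))"
  proof (rule dloc_pullback[OF dim S sm])
    show "\<alpha> c z us = \<alpha> c' (\<phi> z) (map (fd \<phi> z) us)" if "z \<in> S" for z us
      using that formsD(4)[OF \<alpha> c c'] \<phi> unfolding S_def \<phi>_def by auto
  qed (use formsD(2)[OF \<alpha>] sm' in auto)
  also have "\<dots> = dloc (\<alpha> c') (\<phi> y) (map (fd \<phi> y) vs)"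
    unfolding dloc_def length_map
  proof (intro sum.cong refl arg_cong2[where f="(*)"])
    fix i assume i: "i \<in> {..<length vs}"
    have "((\<lambda>z. \<alpha> c' (\<phi> z) ws) has_derivative (\<lambda>v. fd (\<lambda>z. \<alpha> c' z ws) (\<phi> y) (fd \<phi> y v))) (at y)" for ws
      by (rule has_derivative_compose[OF smooth_on_has_derivative[OF sm S(2)]
            smooth_on_has_derivative[OF formsD(3)[OF \<alpha> c']]]) (use img S in blast)
    from fd_eqI[OF this]
    show "fd (\<lambda>z. \<alpha> c' (\<phi> z) (del_nth i (map (fd \<phi> y) vs))) y (vs ! i)
      = fd (\<lambda>z. \<alpha> c' z (del_nth i (map (fd \<phi> y) vs))) (\<phi> y) (map (fd \<phi> y) vs ! i)"
      using i by simp
  qed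
  finally show "ext_d A \<alpha> c (snd c x) vs
      = ext_d A \<alpha> c' (snd c' x) (map (fd (transition c c') (snd c x)) vs)"
    using c c' x \<phi>[of x] by (simp add: ext_d_dloc y_def \<phi>_def)
qed

lemma ext_d_ext_d:
  assumes \<alpha>: "\<alpha> \<in> forms A"
  shows "ext_d A (ext_d A \<alpha>) = 0"
proof (intro ext)
  fix c y vs
  show "ext_d A (ext_d A \<alpha>) c y vs = 0 c y vs"
  proof (cases "c \<in> A \<and> y \<in> snd c ` fst c")
    case True
    then have c: "c \<in> A" and y: "y \<in> snd c ` fst c" by auto
    note S = chart_open[OF chart[OF c]]
    have "dloc (ext_d A \<alpha> c) y vs = dloc (dloc (\<alpha> c)) y vs"
      by (rule dloc_cong[OF S y]) (use formsD(3)[OF ext_d_forms[OF \<alpha>] c] c in \<open>auto simp: ext_d_dloc\<close>)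
    also have "\<dots> = 0" by (rule dloc_dloc[OF S y formsD(3)[OF \<alpha> c]])
    finally show ?thesis using True by (simp add: ext_d_dloc)
  next
    case False
    then show ?thesis by (auto simp: ext_d_def)
  qed
qed

lemma ext_d_add:
  assumes "\<alpha> \<in> forms A" "\<beta> \<in> forms A"
  shows "ext_d A (\<alpha> + \<beta>) = ext_d A \<alpha> + ext_d A \<beta>"
proof (intro ext)
  fix c y vs
  show "ext_d A (\<alpha> + \<beta>) c y vs = (ext_d A \<alpha> + ext_d A \<beta>) c y vs"
  proof (cases "c \<in> A \<and> y \<in> snd c ` fst c")
    case True
    then have c: "c \<in> A" and y: "y \<in> snd c ` fst c" by auto
    have "fd (\<lambda>z. \<alpha> c z ws + \<beta> c z ws) y v = fd (\<lambda>z. \<alpha> c z ws) y v + fd (\<lambda>z. \<beta> c z ws) y v" for ws v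
      by (rule fd_eqI, rule has_derivative_add) (rule smooth_on_has_derivative[OF formsD(3)[OF _ c] y], rule assms)+
    then show ?thesis using True
      by (simp add: ext_d_def sum.distrib distrib_left)
  next
    case False
    then show ?thesis by (auto simp: ext_d_def)
  qed
qed

lemma ext_d_scale:
  assumes "\<alpha> \<in> forms A"
  shows "ext_d A (cscale k \<alpha>) = cscale k (ext_d A \<alpha>)"
proof (intro ext)
  fix c y vs
  show "ext_d A (cscale k \<alpha>) c y vs = cscale k (ext_d A \<alpha>) c y vs"
  proof (cases "c \<in> A \<and> y \<in> snd c ` fst c")
    case True
    then have c: "c \<in> A" and y: "y \<in> snd c ` fst c" by auto
    have "fd (\<lambda>z. k * \<alpha> c z ws) y v = k * fd (\<lambda>z. \<alpha> c z ws) y v" for ws v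
      by (rule fd_eqI, rule has_derivative_mult_right) (rule smooth_on_has_derivative[OF formsD(3)[OF assms c] y])
    then show ?thesis using True
      by (simp add: ext_d_def cscale_def sum_distrib_left mult_ac)
  next
    case False
    then show ?thesis by (auto simp: ext_d_def cscale_def)
  qed
qed

lemma forms_add:
  assumes "\<alpha> \<in> forms A" "\<beta> \<in> forms A"
  shows "\<alpha> + \<beta> \<in> forms A"
  unfolding forms_def
proof (intro CollectI conjI allI ballI impI)
  fix c y assume "c \<notin> A \<or> y \<notin> snd c ` fst c"
  then have "\<alpha> c y = 0" "\<beta> c y = 0" using formsD(1) assms by blast+
  then show "(\<alpha> + \<beta>) c y = 0" by simp
next
  fix c y
  show "alternating_form ((\<alpha> + \<beta>) c y)"
    using alternating_add[OF formsD(2)[OF assms(1)] formsD(2)[OF assms(2)]] by simp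
next
  fix c vs assume c: "c \<in> A"
  show "smooth_on (\<lambda>y. (\<alpha> + \<beta>) c y vs) (snd c ` fst c)"
    using smooth_on_add[OF chart_open[OF chart[OF c]] formsD(3)[OF assms(1) c] formsD(3)[OF assms(2) c]] by simp
next
  fix c c' x vs assume c: "c \<in> A" "c' \<in> A" "x \<in> fst c \<inter> fst c'"
  show "(\<alpha> + \<beta>) c (snd c x) vs = (\<alpha> + \<beta>) c' (snd c' x) (map (fd (transition c c') (snd c x)) vs)"
    using formsD(4)[OF assms(1) c] formsD(4)[OF assms(2) c] by simp
qed

lemma forms_scale:
  assumes "\<alpha> \<in> forms A"
  shows "cscale k \<alpha> \<in> forms A"
  unfolding forms_def
proof (intro CollectI conjI allI ballI impI)
  fix c y assume "c \<notin> A \<or> y \<notin> snd c ` fst c"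
  then have "\<alpha> c y = 0" using formsD(1) assms by blast
  then show "cscale k \<alpha> c y = 0" by (simp add: cscale_def fun_eq_iff)
next
  fix c y
  show "alternating_form (cscale k \<alpha> c y)"
    using alternating_scale[OF formsD(2)[OF assms]] by (simp add: cscale_def)
next
  fix c vs assume c: "c \<in> A"
  show "smooth_on (\<lambda>y. cscale k \<alpha> c y vs) (snd c ` fst c)"
    using smooth_on_mult_const[OF chart_open[OF chart[OF c]] formsD(3)[OF assms(1) c]] by (simp add: cscale_def)
next
  fix c c' x vs assume c: "c \<in> A" "c' \<in> A" "x \<in> fst c \<inter> fst c'"
  show "cscale k \<alpha> c (snd c x) vs = cscale k \<alpha> c' (snd c' x) (map (fd (transition c c') (snd c x)) vs)"
    using formsD(4)[OF assms(1) c] by (simp add: cscale_def)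
qed

lemma forms_zero: "0 \<in> forms A"
  unfolding forms_def by (auto simp: alternating_zero smooth_on_const)

text \<open>A field with compact support in one chart is carried to the other charts by the
  transition derivatives and extended by zero.\<close>

lemma vector_field_extension:
  assumes c0: "c0 \<in> A" and K: "compact K" "K \<subseteq> snd c0 ` fst c0"
    and Y: "smooth_on Y (snd c0 ` fst c0)" "\<And>z. z \<notin> K \<Longrightarrow> Y z = 0"
  obtains Z where "Z \<in> vector_fields A"
    "\<And>c x. c \<in> A \<Longrightarrow> x \<in> fst c \<Longrightarrow> Z c (snd c x) = (if x \<in> fst c0 then fd (transition c0 c) (snd c0 x) (Y (snd c0 x)) else 0)"
proof -
  define Z where "Z c z = (let x = inv_into (fst c) (snd c) z in
     if x \<in> fst c0 then fd (transition c0 c) (snd c0 x) (Y (snd c0 x)) else 0)" for c :: "('m, 'v) chart" and z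
  have Z: "Z c (snd c x) = (if x \<in> fst c0 then fd (transition c0 c) (snd c0 x) (Y (snd c0 x)) else 0)"
    if "c \<in> A" "x \<in> fst c" for c x
    using that by (simp add: Z_def inv_into_f_f chart_inj[OF chart])
  define P where "P = {x \<in> fst c0. snd c0 x \<in> K}"
  have homeo: "homeomorphic_map (subtopology X (fst c0)) (top_of_set (snd c0 ` fst c0)) (snd c0)"
    using chart[OF c0] by (simp add: is_chart_def)
  have "compactin X P"
  proof -
    have ts: "topspace (subtopology X (fst c0)) = fst c0" by (rule chart_topspace[OF chart[OF c0]])
    have "snd c0 ` P = K" using K by (auto simp: P_def)
    moreover have "compactin (top_of_set (snd c0 ` fst c0)) K" using K by (simp add: compactin_subtopology)
    ultimately have "compactin (subtopology X (fst c0)) P"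
      using homeomorphic_map_compactness[OF homeo, of P] ts by (auto simp: P_def)
    then show ?thesis using compactin_subtopology by blast
  qed
  \<comment> \<open>In a Hausdorff space the compact support is closed, so near a point outside the
    chart the extension vanishes identically.\<close>
  then have closed: "openin X (topspace X - P)"
    using mfd compactin_imp_closedin unfolding smooth_manifold_def by blast
  have "Z \<in> vector_fields A"
    unfolding vector_fields_def
  proof (intro CollectI conjI ballI)
    fix c assume c: "c \<in> A"
    show "smooth_on (Z c) (snd c ` fst c)"
    proof (rule smooth_on_local)
      fix z assume "z \<in> snd c ` fst c"
      then obtain x where x: "x \<in> fst c" "z = snd c x" by blast
      show "\<exists>N. open N \<and> z \<in> N \<and> smooth_on (Z c) N"
      proof (cases "x \<in> fst c0")
        case True
        define N where "N = snd c ` (fst c \<inter> fst c0)"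
        have N: "open N" "z \<in> N" unfolding N_def using overlap_open[OF c c0] x True by auto
        define \<tau> where "\<tau> = transition c c0"
        have sm: "smooth_on \<tau> N" unfolding \<tau>_def N_def by (rule transition_smooth[OF c c0])
        have \<tau>: "\<tau> (snd c p) = snd c0 p" if "p \<in> fst c" for p
          unfolding \<tau>_def using in_charts_apply[OF chart[OF c] that, of c0 id] by simp
        have img: "\<tau> ` N \<subseteq> snd c0 ` (fst c0 \<inter> fst c)" unfolding N_def using \<tau> by auto
        have lin: "linear (fd (transition c0 c) (\<tau> z))" if "z \<in> N" for z
          by (rule smooth_on_linear_fd[OF transition_smooth[OF c0 c]]) (use img that in blast)
        have "smooth_on (\<lambda>z. fd (transition c0 c) (\<tau> z) (Y (\<tau> z))) N"
        proof (rule smooth_on_linear_family[OF dim N(1) lin])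
          show "smooth_on (\<lambda>z. fd (transition c0 c) (\<tau> z) v) N" for v
            by (rule smooth_on_compose[OF dim N(1) overlap_open[OF c0 c] img sm smooth_on_fd[OF transition_smooth[OF c0 c]]])
          show "smooth_on (\<lambda>z. Y (\<tau> z)) N"
            by (rule smooth_on_compose[OF dim N(1) chart_open[OF chart[OF c0]] _ sm Y(1)]) (use img in blast)
        qed
        then have "smooth_on (Z c) N"
          by (subst smooth_on_cong[OF N(1)]) (use \<tau> Z[OF c] in \<open>auto simp: N_def\<close>)
        then show ?thesis using N by blast
      next
        case False
        define N where "N = snd c ` (fst c \<inter> (topspace X - P))"
        have N: "open N" unfolding N_def using chart[OF c] closed
          by (intro chart_open_image[OF chart[OF c]]) (auto simp: is_chart_def)
        have zN: "z \<in> N" unfolding N_def using False x chart_subset[OF chart[OF c]] by (auto simp: P_def)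
        have "Z c p = 0" if "p \<in> N" for p
        proof -
          obtain u where u: "u \<in> fst c" "u \<notin> P" "p = snd c u" using \<open>p \<in> N\<close> by (auto simp: N_def)
          have "fd (transition c0 c) (snd c0 u) 0 = 0" if "u \<in> fst c0"
            using linear_0[OF smooth_on_linear_fd[OF transition_smooth[OF c0 c], of "snd c0 u"]] that u by blast
          then show ?thesis using u Z[OF c u(1)] Y(2) by (auto simp: P_def)
        qed
        then have "smooth_on (Z c) N"
          using smooth_on_cong[OF N, of "Z c" "\<lambda>_. 0"] smooth_on_const by blast
        then show ?thesis using N zN by blast
      qed
    qed
  next
    fix c c' x assume c: "c \<in> A" "c' \<in> A" "x \<in> fst c \<inter> fst c'"
    have "fd (transition c c') (snd c x) 0 = 0"
      using linear_0[OF smooth_on_linear_fd[OF transition_smooth[OF c(1,2)], of "snd c x"]] c by blast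
    then show "Z c' (snd c' x) = fd (transition c c') (snd c x) (Z c (snd c x))"
      using c Z[of c x] Z[of c' x] transition_fd_compose[OF c0 c(1,2), of x] by auto
  qed
  then show ?thesis using that Z by blast
qed

end

section \<open>Basic forms on a transversely holomorphic foliation\<close>

locale holomorphic_foliation =
  fixes F :: "('m, 'v::real_inner, 't, 'w::real_inner, 'i) foliation_data" and n q :: nat
  assumes thf: "transversely_holomorphic_foliation n q F"
begin

abbreviation "J \<equiv> cmult_i F"
abbreviation "A \<equiv> man_atlas F"
abbreviation "B \<equiv> tman_atlas F"
abbreviation "H \<equiv> hol_atlas F"
abbreviation "I \<equiv> indices F"
text \<open>Submersions and tangency are stated in the charts of \<open>B\<close>, types in those of
  \<open>H i\<close>. The union is still a smooth atlas, so one set of lemmas covers both.\<close>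

abbreviation "K i \<equiv> B \<union> H i"
abbreviation "G i c c' \<equiv> in_charts c c' (subm F i)"

text \<open>The coordinate domain on which the local expression \<open>G i c c'\<close> of the
  submersion is meaningful.\<close>

definition sdom :: "'i \<Rightarrow> ('m, 'v) chart \<Rightarrow> ('t, 'w) chart \<Rightarrow> 'v set" where
  "sdom i c c' = snd c ` {x \<in> cov F i \<inter> fst c. subm F i x \<in> fst c'}"

lemma fol: "foliation n (2 * q) F"
  and cspace: "complex_space q J"
  using thf by (simp_all add: transversely_holomorphic_foliation_def)

lemma J_linear: "linear J" and J_J: "J (J w) = - w" and dimW: "has_dimension TYPE('w) (2 * q)"
  using cspace by (simp_all add: complex_space_def)

lemma holst: "i \<in> I \<Longrightarrow> complex_structure_on J (tman F) B (subm F i ` cov F i) (H i)"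
  using thf by (simp add: transversely_holomorphic_foliation_def)

sublocale M: manifold_charts "man F" A n
  using fol unfolding foliation_def by unfold_locales blast

lemma T: "i \<in> I \<Longrightarrow> manifold_charts (tman F) (K i) (2 * q)"
  using fol holst[of i]
  unfolding manifold_charts_def foliation_def smooth_manifold_def complex_structure_on_def by blast

lemma B_cover: "t \<in> topspace (tman F) \<Longrightarrow> \<exists>b\<in>B. t \<in> fst b"
  using fol by (auto simp: foliation_def smooth_manifold_def smooth_atlas_def)

lemma H_cover: "i \<in> I \<Longrightarrow> x \<in> cov F i \<Longrightarrow> \<exists>c'\<in>H i. subm F i x \<in> fst c'"
  using holst[of i] unfolding complex_structure_on_def by blast

lemma K_chart: "i \<in> I \<Longrightarrow> c' \<in> K i \<Longrightarrow> is_chart (tman F) c'"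
  by (rule manifold_charts.chart[OF T])

lemma subm_submersion: "i \<in> I \<Longrightarrow> submersion_on (man F) A (tman F) B (cov F i) (subm F i)"
  using fol by (simp add: foliation_def)

lemma cov_open: "i \<in> I \<Longrightarrow> openin (man F) (cov F i)"
  using fol by (simp add: foliation_def)

lemma preimage_open:
  assumes "i \<in> I" "c \<in> A" "openin (tman F) V"
  shows "openin (man F) {x \<in> cov F i \<inter> fst c. subm F i x \<in> V}"
proof -
  have c: "continuous_map (subtopology (man F) (cov F i)) (tman F) (subm F i)"
    using subm_submersion[OF assms(1)] by (simp add: submersion_on_def smooth_map_on_def)
  have ts: "topspace (subtopology (man F) (cov F i)) = cov F i"
    using openin_subset[OF cov_open[OF assms(1)]] by (auto simp: topspace_subtopology)
  have "openin (subtopology (man F) (cov F i)) {x \<in> cov F i. subm F i x \<in> V}"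
    using openin_continuous_map_preimage[OF c assms(3)] unfolding ts .
  then have "openin (man F) {x \<in> cov F i. subm F i x \<in> V}"
    using cov_open[OF assms(1)] by (simp add: openin_open_subtopology)
  then have "openin (man F) ({x \<in> cov F i. subm F i x \<in> V} \<inter> fst c)"
    by (intro openin_Int chart_openin M.chart assms)
  moreover have "{x \<in> cov F i. subm F i x \<in> V} \<inter> fst c = {x \<in> cov F i \<inter> fst c. subm F i x \<in> V}" by auto
  ultimately show ?thesis by simp
qed

lemma sdom_open:
  assumes "i \<in> I" "c \<in> A" "c' \<in> K i"
  shows "open (sdom i c c')"
  unfolding sdom_def
  by (rule chart_open_image[OF M.chart[OF assms(2)] preimage_open[OF assms(1,2) chart_openin[OF K_chart[OF assms(1,3)]]]]) auto

lemma sdom_subset: "sdom i c c' \<subseteq> snd c ` fst c"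
  by (auto simp: sdom_def)

lemma sdom_iff: "c \<in> A \<Longrightarrow> x \<in> fst c \<Longrightarrow> snd c x \<in> sdom i c c' \<longleftrightarrow> x \<in> cov F i \<and> subm F i x \<in> fst c'"
  using chart_inj[OF M.chart, of c] unfolding sdom_def inj_on_def by blast

lemma sdomE:
  assumes "y \<in> sdom i c c'"
  obtains x where "y = snd c x" "x \<in> cov F i" "x \<in> fst c" "subm F i x \<in> fst c'"
  using assms by (auto simp: sdom_def)

lemma sdom_cover:
  assumes "c \<in> A" "y \<in> snd c ` fst c"
  shows "\<exists>i\<in>I. \<exists>c'\<in>H i. y \<in> sdom i c c'"
proof -
  obtain x where x: "x \<in> fst c" "y = snd c x" using assms by blast
  then have "x \<in> topspace (man F)" using chart_subset[OF M.chart[OF assms(1)]] by blast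
  then obtain i where i: "i \<in> I" "x \<in> cov F i" using fol unfolding foliation_def by blast
  then obtain c' where "c' \<in> H i" "subm F i x \<in> fst c'" using H_cover by blast
  then show ?thesis using i x by (auto simp: sdom_def)
qed

text \<open>Smoothness is given for target charts in \<open>B\<close>; for a chart in
  \<open>H i\<close> it follows locally by composing with a transition from a chart of
  \<open>B\<close>.\<close>

lemma G_smooth:
  assumes i: "i \<in> I" and c: "c \<in> A" and c': "c' \<in> K i"
  shows "smooth_on (G i c c') (sdom i c c')"
proof (rule smooth_on_local)
  fix y assume "y \<in> sdom i c c'"
  then obtain x where x: "y = snd c x" "x \<in> cov F i" "x \<in> fst c" "subm F i x \<in> fst c'" by (rule sdomE)
  then obtain b where b: "b \<in> B" "subm F i x \<in> fst b"
    using B_cover chart_subset[OF K_chart[OF i c']] by blast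
  then have bK: "b \<in> K i" by simp
  interpret T: manifold_charts "tman F" "K i" "2 * q" by (rule T[OF i])
  define U where "U = {x \<in> cov F i \<inter> fst c. subm F i x \<in> fst b \<inter> fst c'}"
  have U: "openin (man F) U" unfolding U_def
    by (rule preimage_open[OF i c]) (intro openin_Int chart_openin K_chart[OF i] bK c')
  define N where "N = snd c ` U"
  have N: "open N" unfolding N_def by (rule chart_open_image[OF M.chart[OF c] U]) (auto simp: U_def)
  have yN: "y \<in> N" unfolding N_def U_def using x b by auto
  have b_smooth: "smooth_on (G i c b) N"
  proof (rule smooth_on_subset)
    show "smooth_on (G i c b) (sdom i c b)"
      using subm_submersion[OF i] c b by (simp add: submersion_on_def smooth_map_on_def sdom_def)
    show "N \<subseteq> sdom i c b" by (auto simp: N_def U_def sdom_def)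
  qed
  have Gb: "G i c b (snd c z) = snd b (subm F i z)" "G i c c' (snd c z) = snd c' (subm F i z)" if "z \<in> fst c" for z
    by (rule in_charts_apply[OF M.chart[OF c] that])+
  have "smooth_on (\<lambda>z. transition b c' (G i c b z)) N"
    by (rule smooth_on_compose[OF dimW N T.overlap_open[OF bK c'] _ b_smooth T.transition_smooth[OF bK c']])
      (auto simp: N_def U_def Gb)
  moreover have "transition b c' (G i c b z) = G i c c' z" if zN: "z \<in> N" for z
  proof -
    obtain p where p: "p \<in> U" "z = snd c p" using zN unfolding N_def by blast
    then show ?thesis using in_charts_apply[OF K_chart[OF i bK], of "subm F i p" c' id] by (simp add: U_def Gb)
  qed
  ultimately have "smooth_on (G i c c') N" using smooth_on_cong[OF N] by metis
  then show "\<exists>N. open N \<and> y \<in> N \<and> smooth_on (G i c c') N" using N yN by blast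
qed

lemma G_has_derivative:
  "i \<in> I \<Longrightarrow> c \<in> A \<Longrightarrow> c' \<in> K i \<Longrightarrow> y \<in> sdom i c c' \<Longrightarrow> (G i c c' has_derivative fd (G i c c') y) (at y)"
  by (rule smooth_on_has_derivative[OF G_smooth])

lemma G_linear: "i \<in> I \<Longrightarrow> c \<in> A \<Longrightarrow> c' \<in> K i \<Longrightarrow> y \<in> sdom i c c' \<Longrightarrow> linear (fd (G i c c') y)"
  by (rule smooth_on_linear_fd[OF G_smooth])

lemma G_chart_change:
  assumes i: "i \<in> I" and c: "c1 \<in> A" "c2 \<in> A" and c': "c' \<in> K i"
    and x: "x \<in> cov F i" "x \<in> fst c1 \<inter> fst c2" "subm F i x \<in> fst c'"
  shows "fd (G i c1 c') (snd c1 x) v = fd (G i c2 c') (snd c2 x) (fd (transition c1 c2) (snd c1 x) v)"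
proof -
  have U: "openin (man F) (fst c1 \<inter> fst c2)" "fst c1 \<inter> fst c2 \<subseteq> fst c1" "x \<in> fst c1 \<inter> fst c2"
    using x c by (auto intro: openin_Int chart_openin M.chart)
  have k: "\<And>z. z \<in> fst c1 \<inter> fst c2 \<Longrightarrow> id z \<in> fst c2" "\<And>z. z \<in> fst c1 \<inter> fst c2 \<Longrightarrow> subm F i z = subm F i (id z)" by auto
  have D1: "(transition c1 c2 has_derivative fd (transition c1 c2) (snd c1 x)) (at (snd c1 x))"
    by (rule M.transition_has_derivative[OF c x(2)])
  have D2: "(G i c2 c' has_derivative fd (G i c2 c') (snd c2 x)) (at (snd c2 (id x)))"
    using G_has_derivative[OF i c(2) c', of "snd c2 x"] sdom_iff[OF c(2), of x] x by simp
  from in_charts_compose_has_derivative[OF M.chart[OF c(1)] M.chart[OF c(2)] U k D1 D2]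
  show ?thesis by (rule fd_eqI)
qed

lemma G_transverse_change:
  assumes i: "i \<in> I" and j: "j \<in> I" and c: "c \<in> A" and c': "c' \<in> K i"
    and x: "x \<in> cov F i" "x \<in> cov F j" "x \<in> fst c" "subm F i x \<in> fst c'"
    and k: "\<And>z. z \<in> cov F i \<inter> cov F j \<Longrightarrow> subm F j z = k (subm F i z)"
    and D: "(in_charts c' c'' k has_derivative D) (at (snd c' (subm F i x)))"
  shows "fd (G j c c'') (snd c x) v = D (fd (G i c c') (snd c x) v)"
proof -
  define U where "U = {x \<in> cov F i \<inter> fst c. subm F i x \<in> fst c'} \<inter> cov F j"
  have U: "openin (man F) U" "U \<subseteq> fst c" "x \<in> U" unfolding U_def
    using x openin_Int[OF preimage_open[OF i c chart_openin[OF K_chart[OF i c']]] cov_open[OF j]] by auto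
  have k': "\<And>z. z \<in> U \<Longrightarrow> subm F i z \<in> fst c'" "\<And>z. z \<in> U \<Longrightarrow> subm F j z = k (subm F i z)"
    using k by (auto simp: U_def)
  have "snd c x \<in> sdom i c c'" using sdom_iff[OF c, of x] x by simp
  note D1 = G_has_derivative[OF i c c' this]
  from in_charts_compose_has_derivative[OF M.chart[OF c] K_chart[OF i c'] U k' D1 D]
  show ?thesis by (rule fd_eqI)
qed

lemma G_transition:
  assumes i: "i \<in> I" and c: "c \<in> A" and b: "b \<in> K i" and c': "c' \<in> K i"
    and x: "x \<in> cov F i" "x \<in> fst c" "subm F i x \<in> fst b \<inter> fst c'"
  shows "fd (G i c c') (snd c x) v = fd (transition b c') (snd b (subm F i x)) (fd (G i c b) (snd c x) v)"
proof (rule G_transverse_change[OF i i c b x(1) x(1) x(2)])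
  show "(transition b c' has_derivative fd (transition b c') (snd b (subm F i x))) (at (snd b (subm F i x)))"
    by (rule manifold_charts.transition_has_derivative[OF T[OF i] b c' x(3)])
qed (use x in auto)

lemma G_surj:
  assumes i: "i \<in> I" and c: "c \<in> A" and c': "c' \<in> K i" and y: "y \<in> sdom i c c'"
  shows "surj (fd (G i c c') y)"
proof -
  interpret T: manifold_charts "tman F" "K i" "2 * q" by (rule T[OF i])
  obtain x where x: "y = snd c x" "x \<in> cov F i" "x \<in> fst c" "subm F i x \<in> fst c'" using y by (rule sdomE)
  then obtain b where b: "b \<in> B" "subm F i x \<in> fst b"
    using B_cover chart_subset[OF K_chart[OF i c']] by blast
  then have bK: "b \<in> K i" by simp
  have su: "surj (fd (G i c b) y)"
    using subm_submersion[OF i] c b x by (simp add: submersion_on_def)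
  show ?thesis
  proof (rule surjI)
    fix w
    let ?t = "subm F i x"
    have "fd (G i c c') y (inv (fd (G i c b) y) (fd (transition c' b) (snd c' ?t) w))
        = fd (transition b c') (snd b ?t) (fd (transition c' b) (snd c' ?t) w)"
      using G_transition[OF i c bK c', of x] x b by (simp add: surj_f_inv_f[OF su[unfolded x(1)]])
    also have "\<dots> = w"
      using T.transition_fd_compose[OF c' bK c', of ?t w] T.transition_fd_id[OF c', of ?t w] x b by simp
    finally show "fd (G i c c') y (inv (fd (G i c b) y) (fd (transition c' b) (snd c' ?t) w)) = w" .
  qed
qed

lemma gam_eq: "i \<in> I \<Longrightarrow> j \<in> I \<Longrightarrow> x \<in> cov F i \<inter> cov F j \<Longrightarrow> subm F j x = gam F i j (subm F i x)"
  using fol unfolding foliation_def by blast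

lemma gam_holomorphic:
  "i \<in> I \<Longrightarrow> j \<in> I \<Longrightarrow> c \<in> H i \<Longrightarrow> c' \<in> H j \<Longrightarrow> holomorphic_wrt J (in_charts c c' (gam F i j))
    (snd c ` {t \<in> subm F i ` (cov F i \<inter> cov F j) \<inter> fst c. gam F i j t \<in> fst c'})"
  using thf unfolding transversely_holomorphic_foliation_def by blast

lemma gam_smooth:
  "i \<in> I \<Longrightarrow> j \<in> I \<Longrightarrow> b \<in> B \<Longrightarrow> b' \<in> B \<Longrightarrow> smooth_on (in_charts b b' (gam F i j))
    (snd b ` {t \<in> subm F i ` (cov F i \<inter> cov F j) \<inter> fst b. gam F i j t \<in> fst b'})"
  using fol unfolding foliation_def diffeomorphism_on_def smooth_map_on_def by blast

text \<open>Two transverse coordinate systems at the same point are related by \<open>gam\<close>,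
  also for \<open>i = j\<close>. Holomorphy makes the derivative of this change complex
  linear.\<close>

lemma G_hol_change:
  assumes i: "i \<in> I" and j: "j \<in> I" and c: "c \<in> A" and c': "c' \<in> H i" and c'': "c'' \<in> H j"
    and y: "y \<in> sdom i c c'" "y \<in> sdom j c c''"
  obtains L where "linear L" "\<And>w. L (J w) = J (L w)" "\<And>v. fd (G j c c'') y v = L (fd (G i c c') y v)"
proof -
  obtain x where x: "y = snd c x" "x \<in> cov F i" "x \<in> fst c" "subm F i x \<in> fst c'" using y(1) by (rule sdomE)
  have xj: "x \<in> cov F j" "subm F j x \<in> fst c''" using y(2) sdom_iff[OF c x(3)] x(1) by auto
  note gam_holomorphic[OF i j c' c'']
  moreover have "snd c' (subm F i x) \<in> snd c' ` {t \<in> subm F i ` (cov F i \<inter> cov F j) \<inter> fst c'. gam F i j t \<in> fst c''}"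
    using x xj gam_eq[OF i j, of x] by auto
  ultimately obtain D where D: "(in_charts c' c'' (gam F i j) has_derivative D) (at (snd c' (subm F i x)))"
    "\<And>w. D (J w) = J (D w)"
    unfolding holomorphic_wrt_def by blast
  show ?thesis
  proof (rule that)
    show "D (J w) = J (D w)" for w by (rule D(2))
    show "linear D" using D(1) has_derivative_linear by blast
    show "fd (G j c c'') y v = D (fd (G i c c') y v)" for v unfolding x(1)
      by (rule G_transverse_change[OF i j c _ x(2) xj(1) x(3,4) gam_eq[OF i j] D(1)]) (use c' in auto)
  qed
qed

lemma ker_same:
  assumes i: "i \<in> I" and c: "c \<in> A" and b: "b \<in> K i" and c': "c' \<in> K i"
    and y: "y \<in> sdom i c b" "y \<in> sdom i c c'" and v: "fd (G i c b) y v = 0"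
  shows "fd (G i c c') y v = 0"
proof -
  interpret T: manifold_charts "tman F" "K i" "2 * q" by (rule T[OF i])
  obtain x where x: "y = snd c x" "x \<in> cov F i" "x \<in> fst c" "subm F i x \<in> fst b" using y(1) by (rule sdomE)
  have xc: "subm F i x \<in> fst c'" using y(2) sdom_iff[OF c x(3)] x(1) by auto
  have "linear (fd (transition b c') (snd b (subm F i x)))"
    by (rule smooth_on_linear_fd[OF T.transition_smooth[OF b c']]) (use x xc in auto)
  then show ?thesis using G_transition[OF i c b c' x(2,3), of v] x xc v linear_0 by auto
qed

text \<open>The tangent space of the leaf does not depend on the submersion or on the transverse
  chart: passing between them only applies a linear map to the transverse derivative.\<close>

lemma ker_change:
  assumes i: "i \<in> I" and j: "j \<in> I" and c: "c \<in> A" and c': "c' \<in> K i" and c'': "c'' \<in> K j"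
    and y: "y \<in> sdom i c c'" "y \<in> sdom j c c''" and v: "fd (G i c c') y v = 0"
  shows "fd (G j c c'') y v = 0"
proof -
  obtain x where x: "y = snd c x" "x \<in> cov F i" "x \<in> fst c" "subm F i x \<in> fst c'" using y(1) by (rule sdomE)
  have xj: "x \<in> cov F j" "subm F j x \<in> fst c''" using y(2) sdom_iff[OF c x(3)] x(1) by auto
  obtain b where b: "b \<in> B" "subm F i x \<in> fst b"
    using B_cover chart_subset[OF K_chart[OF i c']] x by blast
  obtain b' where b': "b' \<in> B" "subm F j x \<in> fst b'"
    using B_cover chart_subset[OF K_chart[OF j c'']] xj by blast
  have yb: "y \<in> sdom i c b" "y \<in> sdom j c b'" using sdom_iff[OF c x(3)] x xj b b' by auto
  have vb: "fd (G i c b) y v = 0" by (rule ker_same[OF i c c' _ y(1) yb(1) v]) (use b in auto)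
  note sm = gam_smooth[OF i j b(1) b'(1)]
  have mem: "snd b (subm F i x) \<in> snd b ` {t \<in> subm F i ` (cov F i \<inter> cov F j) \<inter> fst b. gam F i j t \<in> fst b'}"
    using x xj b b' gam_eq[OF i j, of x] by auto
  have "fd (G j c b') y v = fd (in_charts b b' (gam F i j)) (snd b (subm F i x)) (fd (G i c b) y v)" unfolding x(1)
    by (rule G_transverse_change[OF i j c _ x(2) xj(1) x(3) b(2) gam_eq[OF i j] smooth_on_has_derivative[OF sm mem]])
      (use b in auto)
  also have "\<dots> = 0" using vb linear_0[OF smooth_on_linear_fd[OF sm mem]] by simp
  finally have "fd (G j c b') y v = 0" .
  then show ?thesis by (rule ker_same[OF j c _ c'' yb(2) y(2), rotated]) (use b' in auto)
qed

lemma local_section: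
  assumes i: "i \<in> I" and c: "c \<in> A" and c': "c' \<in> K i" and y: "y \<in> sdom i c c'"
  obtains N \<sigma> where "open N" "y \<in> N" "N \<subseteq> sdom i c c'" "\<And>z. z \<in> N \<Longrightarrow> linear (\<sigma> z)"
    "\<And>z w. z \<in> N \<Longrightarrow> fd (G i c c') z (\<sigma> z w) = w" "\<And>w. smooth_on (\<lambda>z. \<sigma> z w) N"
proof (rule smooth_right_inverse[OF M.dim dimW sdom_open[OF i c c'] y _ smooth_on_fd[OF G_smooth[OF i c c']] G_surj[OF i c c' y]])
  show "linear (fd (G i c c') x)" if "x \<in> sdom i c c'" for x by (rule G_linear[OF i c c' that])
qed (rule that)

subsection \<open>Horizontality of basic forms\<close>

lemma tangent_fields_ker:
  assumes X: "X \<in> tangent_fields F" and i: "i \<in> I" and c: "c \<in> A" and c': "c' \<in> H i" and y: "y \<in> sdom i c c'"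
  shows "fd (G i c c') y (X c y) = 0"
proof -
  have c'K: "c' \<in> K i" using c' by simp
  obtain x where x: "y = snd c x" "x \<in> cov F i" "x \<in> fst c" "subm F i x \<in> fst c'" using y by (rule sdomE)
  then obtain b where b: "b \<in> B" "subm F i x \<in> fst b"
    using B_cover chart_subset[OF K_chart[OF i c'K]] by blast
  have yb: "y \<in> sdom i c b" using sdom_iff[OF c x(3)] x b by auto
  have "fd (G i c b) y (X c y) = 0" using X i c b x by (auto simp: tangent_fields_def)
  then show ?thesis by (rule ker_same[OF i c _ c'K yb y, rotated]) (use b in auto)
qed

text \<open>Every vector tangent to a leaf is a value of a global tangent field. This turns the
  condition on basic forms, which quantifies over global fields, into a condition at each
  point.\<close>

lemma tangent_extension:
  assumes i: "i \<in> I" and c0: "c0 \<in> A" and c': "c' \<in> H i" and y0: "y0 \<in> sdom i c0 c'"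
    and v0: "fd (G i c0 c') y0 v0 = 0"
  obtains X where "X \<in> tangent_fields F" "X c0 y0 = v0"
proof -
  have c'K: "c' \<in> K i" using c' by simp
  obtain N \<sigma> where N: "open N" "y0 \<in> N" "N \<subseteq> sdom i c0 c'" and lin: "\<And>z. z \<in> N \<Longrightarrow> linear (\<sigma> z)"
    and sec: "\<And>z w. z \<in> N \<Longrightarrow> fd (G i c0 c') z (\<sigma> z w) = w" and sm: "\<And>w. smooth_on (\<lambda>z. \<sigma> z w) N"
    using local_section[OF i c0 c'K y0] by blast
  obtain e where e: "e > 0" "cball y0 e \<subseteq> N" using N open_contains_cball by blast
  obtain \<phi> where \<phi>: "smooth_on \<phi> UNIV" "\<phi> y0 = 1" "\<And>z. z \<notin> cball y0 e \<Longrightarrow> \<phi> z = (0::real)"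
    using bump_function[OF e(1)] by blast
  \<comment> \<open>Subtracting the lift of the transverse part makes the constant vector vertical
    at every nearby point; at \<open>y0\<close> nothing is subtracted.\<close>
  define P where "P z = v0 - \<sigma> z (fd (G i c0 c') z v0)" for z
  define Y where "Y z = (if z \<in> N then \<phi> z *\<^sub>R P z else 0)" for z
  have Y0: "Y z = 0" if "z \<notin> cball y0 e" for z using \<phi>(3)[OF that] by (simp add: Y_def)
  have smG: "smooth_on (\<lambda>z. fd (G i c0 c') z v) N" for v
    by (rule smooth_on_subset[OF smooth_on_fd[OF G_smooth[OF i c0 c'K]] N(3)])
  have smP: "smooth_on P N"
  proof -
    have "smooth_on (\<lambda>z. \<sigma> z (fd (G i c0 c') z v0)) N"
      by (rule smooth_on_linear_family[OF dimW N(1) lin sm smG])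
    then have "smooth_on (\<lambda>z. v0 + - \<sigma> z (fd (G i c0 c') z v0)) N"
      by (intro smooth_on_add[OF N(1)] smooth_on_const smooth_on_bounded_linear[OF N(1) bounded_linear_minus[OF bounded_linear_ident]])
    then show ?thesis by (simp add: P_def[abs_def])
  qed
  have smY: "smooth_on Y (snd c0 ` fst c0)"
  proof (rule smooth_on_local)
    fix z
    show "\<exists>N'. open N' \<and> z \<in> N' \<and> smooth_on Y N'"
    proof (cases "z \<in> N")
      case True
      have "smooth_on (\<lambda>z. \<phi> z *\<^sub>R P z) N"
        by (rule smooth_on_bilinear[OF N(1) bounded_bilinear_scaleR smooth_on_subset[OF \<phi>(1)] smP]) simp
      then have "smooth_on Y N" using smooth_on_cong[OF N(1), of Y "\<lambda>z. \<phi> z *\<^sub>R P z"] by (simp add: Y_def)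
      then show ?thesis using N(1) True by blast
    next
      case False
      have o: "open (- cball y0 e)" by (simp add: open_Compl)
      have "smooth_on Y (- cball y0 e)" using smooth_on_cong[OF o, of Y "\<lambda>_. 0"] Y0 smooth_on_const by auto
      then show ?thesis using o False e(2) by blast
    qed
  qed
  have sub: "cball y0 e \<subseteq> snd c0 ` fst c0" using e(2) N(3) sdom_subset by blast
  obtain X where X: "X \<in> vector_fields A"
    "\<And>c x. c \<in> A \<Longrightarrow> x \<in> fst c \<Longrightarrow> X c (snd c x) =
      (if x \<in> fst c0 then fd (transition c0 c) (snd c0 x) (Y (snd c0 x)) else 0)"
  proof (rule M.vector_field_extension[OF c0 compact_cball_finite_dim[OF M.dim] sub smY Y0])
    fix z assume "z \<notin> cball y0 e" then show "z \<notin> cball y0 e" .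
  next
    fix Z assume Z: "Z \<in> vector_fields A" "\<And>c x. c \<in> A \<Longrightarrow> x \<in> fst c \<Longrightarrow> Z c (snd c x) =
      (if x \<in> fst c0 then fd (transition c0 c) (snd c0 x) (Y (snd c0 x)) else 0)"
    show thesis
    proof (rule that)
      show "Z \<in> vector_fields A" by (rule Z(1))
    qed (rule Z(2))
  qed
  have kerY: "fd (G i c0 c') z (Y z) = 0" if "z \<in> N" for z
  proof -
    have l: "linear (fd (G i c0 c') z)" by (rule G_linear[OF i c0 c'K]) (use that N in auto)
    show ?thesis using that sec[OF that] by (simp add: Y_def P_def linear_cmul[OF l] linear_diff[OF l])
  qed
  have "X \<in> tangent_fields F"
    unfolding tangent_fields_def
  proof (intro CollectI conjI X(1) ballI impI)
    fix j c b x assume j: "j \<in> I" and c: "c \<in> A" and b: "b \<in> B" and x: "x \<in> cov F j \<inter> fst c" and fb: "subm F j x \<in> fst b"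
    have bK: "b \<in> K j" using b by simp
    have ydom: "snd c x \<in> sdom j c b" using sdom_iff[OF c, of x] x fb by simp
    have zero: "fd (G j c b) (snd c x) 0 = 0" by (rule linear_0[OF G_linear[OF j c bK ydom]])
    show "fd (G j c b) (snd c x) (X c (snd c x)) = 0"
    proof (cases "x \<in> fst c0")
      case False
      then show ?thesis using X(2)[OF c, of x] x zero by simp
    next
      case True
      have y': "snd c0 x \<in> sdom j c0 b" using sdom_iff[OF c0 True] x fb by simp
      have "fd (G j c b) (snd c x) (X c (snd c x)) = fd (G j c0 b) (snd c0 x) (Y (snd c0 x))"
        using G_chart_change[OF j c0 c bK, of x] X(2)[OF c, of x] x fb True by simp
      also have "\<dots> = 0"
      proof (cases "snd c0 x \<in> N")
        case True
        then show ?thesis using ker_change[OF i j c0 c'K bK _ y' kerY[OF True]] N(3) by blast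
      next
        case False
        then show ?thesis using linear_0[OF G_linear[OF j c0 bK y']] by (simp add: Y_def)
      qed
      finally show ?thesis .
    qed
  qed
  moreover have "X c0 y0 = v0"
  proof -
    obtain x where x: "y0 = snd c0 x" "x \<in> fst c0" using y0 by (rule sdomE)
    have "X c0 y0 = Y y0" using X(2)[OF c0 x(2)] M.transition_fd_id[OF c0 x(2)] x by simp
    also have "\<dots> = v0" using N(2) \<phi>(2) v0 linear_0[OF lin[OF N(2)]] by (simp add: Y_def P_def)
    finally show ?thesis .
  qed
  ultimately show ?thesis using that by blast
qed

lemma basic_forms_forms: "\<alpha> \<in> basic_forms F \<Longrightarrow> \<alpha> \<in> forms A"
  by (simp add: basic_forms_def)

lemma basic_horizontal:
  assumes \<alpha>: "\<alpha> \<in> basic_forms F" and i: "i \<in> I" and c: "c \<in> A" and c': "c' \<in> H i" and y: "y \<in> sdom i c c'"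
  shows "horizontal (\<alpha> c y) (fd (G i c c') y)" "horizontal (ext_d A \<alpha> c y) (fd (G i c c') y)"
proof -
  have c'K: "c' \<in> K i" using c' by simp
  have f: "\<alpha> \<in> forms A" using \<alpha> by (rule basic_forms_forms)
  have *: "\<alpha> c y (v # vs) = 0 \<and> ext_d A \<alpha> c y (v # vs) = 0" if v: "fd (G i c c') y v = 0" for v vs
  proof -
    obtain X where X: "X \<in> tangent_fields F" "X c y = v" using tangent_extension[OF i c c' y v] by blast
    then have "interior_product X \<alpha> = 0" "interior_product X (ext_d A \<alpha>) = 0"
      using \<alpha> unfolding basic_forms_def by blast+
    then have "interior_product X \<alpha> c y vs = 0" "interior_product X (ext_d A \<alpha>) c y vs = 0" by simp_all
    then show ?thesis by (simp add: interior_product_def X(2))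
  qed
  show "horizontal (\<alpha> c y) (fd (G i c c') y)" "horizontal (ext_d A \<alpha> c y) (fd (G i c c') y)"
    unfolding horizontal_def
    using * formsD(2)[OF f] formsD(2)[OF M.ext_d_forms[OF f]] G_linear[OF i c c'K y] G_surj[OF i c c'K y] by auto
qed

text \<open>The converse of \<open>basic_horizontal\<close>: it is enough to contract with vertical
  vectors at points.\<close>

lemma basicI:
  assumes f: "\<alpha> \<in> forms A"
    and h: "\<And>i c c' y v vs. i \<in> I \<Longrightarrow> c \<in> A \<Longrightarrow> c' \<in> H i \<Longrightarrow> y \<in> sdom i c c' \<Longrightarrow> fd (G i c c') y v = 0 \<Longrightarrow>
      \<alpha> c y (v # vs) = 0 \<and> ext_d A \<alpha> c y (v # vs) = 0"
  shows "\<alpha> \<in> basic_forms F"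
  unfolding basic_forms_def
proof (intro CollectI conjI ballI f)
  fix X assume X: "X \<in> tangent_fields F"
  have "\<alpha> c y (X c y # vs) = 0 \<and> ext_d A \<alpha> c y (X c y # vs) = 0" for c y vs
  proof (cases "c \<in> A \<and> y \<in> snd c ` fst c")
    case True
    then obtain i c' where "i \<in> I" "c' \<in> H i" "y \<in> sdom i c c'" using sdom_cover by blast
    then show ?thesis using h tangent_fields_ker[OF X] True by blast
  next
    case False
    then have "\<alpha> c y = 0" "ext_d A \<alpha> c y = 0" using formsD(1)[OF f] formsD(1)[OF M.ext_d_forms[OF f]] by blast+
    then show ?thesis by simp
  qed
  then show "interior_product X \<alpha> = 0" "interior_product X (ext_d A \<alpha>) = 0"
    by (auto simp: interior_product_def fun_eq_iff)
qed

lemma basic_ext_d: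
  assumes \<alpha>: "\<alpha> \<in> basic_forms F"
  shows "ext_d A \<alpha> \<in> basic_forms F"
proof (rule basicI[OF M.ext_d_forms[OF basic_forms_forms[OF \<alpha>]]])
  show "ext_d A \<alpha> c y (v # vs) = 0 \<and> ext_d A (ext_d A \<alpha>) c y (v # vs) = 0"
    if "i \<in> I" "c \<in> A" "c' \<in> H i" "y \<in> sdom i c c'" "fd (G i c c') y v = 0" for i c c' y v vs
    using basic_horizontal(2)[OF \<alpha> that(1-4)] that(5) M.ext_d_ext_d[OF basic_forms_forms[OF \<alpha>]]
    by (simp add: horizontal_def)
qed

lemma basic_add:
  assumes "\<alpha> \<in> basic_forms F" "\<beta> \<in> basic_forms F"
  shows "\<alpha> + \<beta> \<in> basic_forms F"
  using assms M.forms_add[of \<alpha> \<beta>] M.ext_d_add[of \<alpha> \<beta>]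
  by (auto simp: basic_forms_def interior_product_def fun_eq_iff)

lemma basic_scale:
  assumes "\<alpha> \<in> basic_forms F"
  shows "cscale k \<alpha> \<in> basic_forms F"
  using assms M.forms_scale[of \<alpha> k] M.ext_d_scale[of \<alpha> k]
  by (auto simp: basic_forms_def interior_product_def fun_eq_iff cscale_def)

lemma basic_zero: "0 \<in> basic_forms F"
proof -
  have "ext_d A 0 = (0 :: ('m, 'v) form)" by (auto simp: ext_d_def fun_eq_iff intro: sum.neutral)
  then show ?thesis using M.forms_zero by (auto simp: basic_forms_def interior_product_def fun_eq_iff)
qed

end

context holomorphic_foliation
begin

subsection \<open>Type components of basic forms\<close>

text \<open>The arbitrary preimages in \<open>desc\<close> depend on the point without any
  regularity; locally they are traded for a smooth section.\<close>

lemma desc_smooth: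
  assumes f: "\<alpha> \<in> forms A" and i: "i \<in> I" and c: "c \<in> A" and c': "c' \<in> K i"
    and h: "\<And>z. z \<in> sdom i c c' \<Longrightarrow> horizontal (\<alpha> c z) (fd (G i c c') z)"
  shows "smooth_on (\<lambda>z. desc (\<alpha> c z) (fd (G i c c') z) ws) (sdom i c c')"
proof (rule smooth_on_local)
  fix y assume y: "y \<in> sdom i c c'"
  obtain N \<sigma> where N: "open N" "y \<in> N" "N \<subseteq> sdom i c c'" and lin: "\<And>z. z \<in> N \<Longrightarrow> linear (\<sigma> z)"
    and sec: "\<And>z w. z \<in> N \<Longrightarrow> fd (G i c c') z (\<sigma> z w) = w" and sm: "\<And>w. smooth_on (\<lambda>z. \<sigma> z w) N"
    using local_section[OF i c c' y] by blast
  have "smooth_on (\<lambda>z. \<alpha> c z (map (\<sigma> z) ws)) N"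
    by (rule smooth_on_multilinear_map[OF M.dim N(1) formsD(2)[OF f] smooth_on_subset[OF formsD(3)[OF f c]] sm])
      (use N(3) sdom_subset in blast)
  moreover have "\<alpha> c z (map (\<sigma> z) ws) = desc (\<alpha> c z) (fd (G i c c') z) ws" if "z \<in> N" for z
    using desc_section[of "\<alpha> c z" "fd (G i c c') z" "\<sigma> z" ws] h[of z] sec[OF that] that N(3) by auto
  ultimately have "smooth_on (\<lambda>z. desc (\<alpha> c z) (fd (G i c c') z) ws) N"
    using smooth_on_cong[OF N(1), of "\<lambda>z. \<alpha> c z (map (\<sigma> z) ws)"] by simp
  then show "\<exists>N. open N \<and> y \<in> N \<and> smooth_on (\<lambda>z. desc (\<alpha> c z) (fd (G i c c') z) ws) N" using N by blast
qed

lemma ext_d_descended: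
  assumes i: "i \<in> I" and c: "c \<in> A" and c': "c' \<in> K i" and y: "y \<in> sdom i c c'"
    and alt: "\<And>z. z \<in> sdom i c c' \<Longrightarrow> alternating_form (a z)"
    and sm: "\<And>ws. smooth_on (\<lambda>z. a z ws) (sdom i c c')"
    and eq: "\<And>z vs. z \<in> sdom i c c' \<Longrightarrow> \<alpha> c z vs = a z (map (fd (G i c c') z) vs)"
  shows "ext_d A \<alpha> c y vs = (\<Sum>k<length vs. (-1) ^ k *
    fd (\<lambda>z. a z (del_nth k (map (fd (G i c c') y) vs))) y (vs ! k))"
proof -
  have "ext_d A \<alpha> c y = dloc (\<alpha> c) y" by (intro ext_d_dloc c subsetD[OF sdom_subset y])
  then show ?thesis
    using dloc_pullback[OF dimW sdom_open[OF i c c'] y G_smooth[OF i c c'] alt sm eq] by simp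
qed

text \<open>In the expansion of the exterior derivative all terms but the first have the zero vector
  as an argument. Hence contracting with a vertical vector differentiates the transverse
  coefficients along the leaf.\<close>

lemma ext_d_vertical:
  assumes i: "i \<in> I" and c: "c \<in> A" and c': "c' \<in> K i" and y: "y \<in> sdom i c c'"
    and alt: "\<And>z. z \<in> sdom i c c' \<Longrightarrow> alternating_form (a z)"
    and sm: "\<And>ws. smooth_on (\<lambda>z. a z ws) (sdom i c c')"
    and eq: "\<And>z vs. z \<in> sdom i c c' \<Longrightarrow> \<alpha> c z vs = a z (map (fd (G i c c') z) vs)"
    and v: "fd (G i c c') y v = 0"
  shows "ext_d A \<alpha> c y (v # vs) = fd (\<lambda>z. a z (map (fd (G i c c') y) vs)) y v"
proof -
  let ?D = "fd (G i c c') y"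
  have z: "fd (\<lambda>z. a z (0 # ws)) y u = 0" for ws u
  proof -
    have "a z (0 # ws) = 0" if "z \<in> sdom i c c'" for z
      using linear_0[OF alternating_linear[OF alt[OF that], of "[]" ws]] by simp
    then have "((\<lambda>z. a z (0 # ws)) has_derivative (\<lambda>h. 0)) (at y)"
      by (intro has_derivative_transform_within_open[OF has_derivative_const sdom_open[OF i c c'] y]) simp
    then show ?thesis by (rule fd_eqI)
  qed
  have d0: "del_nth 0 (x # xs) = xs" and dS: "del_nth (Suc k) (x # xs) = x # del_nth k xs" for k and x :: 'w and xs
    by (simp_all add: del_nth_def)
  show ?thesis
    by (subst ext_d_descended[where a=a and \<alpha>=\<alpha>, OF i c c' y alt sm eq])
      (simp_all only: length_Cons sum.lessThan_Suc_shift list.map v d0 dS z nth_Cons_0 nth_Cons_Suc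
        mult_zero_right sum.neutral_const add_0_right power_0 mult_1)
qed

text \<open>Some transverse derivative at the point; \<open>tcomp_eq\<close> shows that the type
  component does not depend on which.\<close>

definition chosen :: "('m, 'v) chart \<Rightarrow> 'v \<Rightarrow> 'v \<Rightarrow> 'w" where
  "chosen c y = (SOME D. \<exists>i\<in>I. \<exists>c'\<in>H i. y \<in> sdom i c c' \<and> D = fd (G i c c') y)"

text \<open>The explicit candidate for \<open>type_component\<close>: descend, project to the type
  on the model space, pull back.\<close>

definition tcomp :: "nat \<Rightarrow> nat \<Rightarrow> ('m, 'v) form \<Rightarrow> ('m, 'v) form" where
  "tcomp r s \<alpha> = (\<lambda>c y vs. if c \<in> A \<and> y \<in> snd c ` fst c
     then type_proj J r s (desc (\<alpha> c y) (chosen c y)) (map (chosen c y) vs) else 0)"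

lemma tcomp_outside: "\<not> (c \<in> A \<and> y \<in> snd c ` fst c) \<Longrightarrow> tcomp r s \<alpha> c y = 0"
  by (auto simp: tcomp_def fun_eq_iff)

text \<open>The derivative at hand and the chosen one differ by a complex linear map, under which
  the descended forms correspond and the projections are natural.\<close>

lemma tcomp_eq:
  assumes \<alpha>: "\<alpha> \<in> basic_forms F" and i: "i \<in> I" and c: "c \<in> A" and c': "c' \<in> H i" and y: "y \<in> sdom i c c'"
  shows "tcomp r s \<alpha> c y vs = type_proj J r s (desc (\<alpha> c y) (fd (G i c c') y)) (map (fd (G i c c') y) vs)"
proof -
  have "\<exists>i\<in>I. \<exists>c'\<in>H i. y \<in> sdom i c c' \<and> chosen c y = fd (G i c c') y"
    unfolding chosen_def
    by (rule someI_ex[where P="\<lambda>D. \<exists>i\<in>I. \<exists>c'\<in>H i. y \<in> sdom i c c' \<and> D = fd (G i c c') y"])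
      (use i c' y in blast)
  then obtain j c'' where j: "j \<in> I" "c'' \<in> H j" "y \<in> sdom j c c''" "chosen c y = fd (G j c c'') y" by blast
  obtain L where L: "linear L" "\<And>w. L (J w) = J (L w)" "\<And>v. fd (G j c c'') y v = L (fd (G i c c') y v)"
    using G_hol_change[OF i j(1) c c' j(2) y j(3)] by blast
  note hi = basic_horizontal(1)[OF \<alpha> i c c' y]
  note hj = basic_horizontal(1)[OF \<alpha> j(1) c j(2,3)]
  have "desc (\<alpha> c y) (fd (G i c c') y) ws = desc (\<alpha> c y) (chosen c y) (map L ws)" for ws
  proof -
    obtain vs where vs: "ws = map (fd (G i c c') y) vs" using surj_map hi unfolding horizontal_def by blast
    then have "map L ws = map (chosen c y) vs" using L(3) j(4) by simp
    then show ?thesis using desc_map[OF hi, of vs] desc_map[OF hj, of vs] vs j(4) by (simp only:)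
  qed
  then have "type_proj J r s (desc (\<alpha> c y) (chosen c y)) (map L (map (fd (G i c c') y) vs))
    = type_proj J r s (desc (\<alpha> c y) (fd (G i c c') y)) (map (fd (G i c c') y) vs)"
    using type_proj_map[of L J, OF L(1) L(2)] by blast
  moreover have "map L (map (fd (G i c c') y) vs) = map (chosen c y) vs" using L(3) j(4) by simp
  moreover have "c \<in> A \<and> y \<in> snd c ` fst c" using c y sdom_subset by blast
  ultimately show ?thesis unfolding tcomp_def by (simp only: simp_thms if_True)
qed

lemma type_proj_smooth:
  assumes S: "open S" and sm: "\<And>ws. smooth_on (\<lambda>z. a z ws) S"
  shows "smooth_on (\<lambda>z. type_proj J r s (a z) ws) S"
proof (cases "length ws = r + s")
  case True
  then show ?thesis unfolding type_proj_def by (simp only: True refl if_True) (intro smooth_on_sum smooth_on_mult_const S sm)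
next
  case False
  then show ?thesis by (simp add: type_proj_def smooth_on_const)
qed

lemma desc_basic_alternating:
  assumes "\<alpha> \<in> basic_forms F" "i \<in> I" "c \<in> A" "c' \<in> H i" "z \<in> sdom i c c'"
  shows "alternating_form (type_proj J r s (desc (\<alpha> c z) (fd (G i c c') z)))"
  by (rule alternating_type_proj[OF J_linear alternating_desc[OF basic_horizontal(1)[OF assms]]])

lemma desc_basic_smooth:
  assumes "\<alpha> \<in> basic_forms F" "i \<in> I" "c \<in> A" "c' \<in> H i"
  shows "smooth_on (\<lambda>z. desc (\<alpha> c z) (fd (G i c c') z) ws) (sdom i c c')"
  by (rule desc_smooth[OF basic_forms_forms[OF assms(1)] assms(2,3) _ basic_horizontal(1)[OF assms]])
    (use assms in auto)

lemma tcomp_forms: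
  assumes \<alpha>: "\<alpha> \<in> basic_forms F"
  shows "tcomp r s \<alpha> \<in> forms A"
  unfolding forms_def
proof (intro CollectI conjI allI ballI impI)
  fix c y assume "c \<notin> A \<or> y \<notin> snd c ` fst c"
  then show "tcomp r s \<alpha> c y = 0" by (intro tcomp_outside) blast
next
  fix c y
  show "alternating_form (tcomp r s \<alpha> c y)"
  proof (cases "c \<in> A \<and> y \<in> snd c ` fst c")
    case True
    then obtain i c' where ic: "i \<in> I" "c' \<in> H i" "y \<in> sdom i c c'" using sdom_cover by blast
    have "tcomp r s \<alpha> c y = (\<lambda>vs. type_proj J r s (desc (\<alpha> c y) (fd (G i c c') y)) (map (fd (G i c c') y) vs))"
      using tcomp_eq[OF \<alpha> ic(1) _ ic(2,3)] True by blast
    then show ?thesis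
      using horizontal_type_proj[OF J_linear basic_horizontal(1)[OF \<alpha> ic(1) _ ic(2,3)]] True
      by (simp add: horizontal_def)
  next
    case False
    then show ?thesis using tcomp_outside[OF False] alternating_zero by simp
  qed
next
  fix c vs assume c: "c \<in> A"
  show "smooth_on (\<lambda>y. tcomp r s \<alpha> c y vs) (snd c ` fst c)"
  proof (rule smooth_on_local)
    fix y assume "y \<in> snd c ` fst c"
    then obtain i c' where ic: "i \<in> I" "c' \<in> H i" "y \<in> sdom i c c'" using sdom_cover[OF c] by blast
    then have c'K: "c' \<in> K i" by simp
    note o = sdom_open[OF ic(1) c c'K]
    have "smooth_on (\<lambda>z. type_proj J r s (desc (\<alpha> c z) (fd (G i c c') z)) (map (fd (G i c c') z) vs)) (sdom i c c')"
      by (rule smooth_on_multilinear_map[OF dimW o desc_basic_alternating[OF \<alpha> ic(1) c ic(2)]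
            type_proj_smooth[OF o desc_basic_smooth[OF \<alpha> ic(1) c ic(2)]] smooth_on_fd[OF G_smooth[OF ic(1) c c'K]]])
    then have "smooth_on (\<lambda>y. tcomp r s \<alpha> c y vs) (sdom i c c')"
      using smooth_on_cong[OF o tcomp_eq[OF \<alpha> ic(1) c ic(2)]] by simp
    then show "\<exists>N. open N \<and> y \<in> N \<and> smooth_on (\<lambda>y. tcomp r s \<alpha> c y vs) N" using o ic(3) by blast
  qed
next
  fix c1 c2 x vs assume c1: "c1 \<in> A" and c2: "c2 \<in> A" and x: "x \<in> fst c1 \<inter> fst c2"
  obtain i c' where ic: "i \<in> I" "c' \<in> H i" "snd c1 x \<in> sdom i c1 c'" using sdom_cover[OF c1] x by blast
  then have c'K: "c' \<in> K i" by simp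
  have xi: "x \<in> cov F i" "subm F i x \<in> fst c'" using sdom_iff[OF c1, of x] ic x by auto
  then have y2: "snd c2 x \<in> sdom i c2 c'" using sdom_iff[OF c2, of x] x by auto
  let ?E = "fd (transition c1 c2) (snd c1 x)"
  let ?D1 = "fd (G i c1 c') (snd c1 x)" and ?D2 = "fd (G i c2 c') (snd c2 x)"
  have D: "?D1 v = ?D2 (?E v)" for v by (rule G_chart_change[OF ic(1) c1 c2 c'K xi(1) x xi(2)])
  note h1 = basic_horizontal(1)[OF \<alpha> ic(1) c1 ic(2,3)]
  note h2 = basic_horizontal(1)[OF \<alpha> ic(1) c2 ic(2) y2]
  have s1: "surj ?D1" using h1 by (simp add: horizontal_def)
  have "desc (\<alpha> c1 (snd c1 x)) ?D1 = desc (\<alpha> c2 (snd c2 x)) ?D2"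
  proof (rule desc_unique[OF s1])
    fix us
    have "\<alpha> c1 (snd c1 x) us = \<alpha> c2 (snd c2 x) (map ?E us)"
      by (rule formsD(4)[OF basic_forms_forms[OF \<alpha>] c1 c2 x])
    also have "\<dots> = desc (\<alpha> c2 (snd c2 x)) ?D2 (map ?D2 (map ?E us))" by (rule desc_map[OF h2, symmetric])
    also have "map ?D2 (map ?E us) = map ?D1 us" by (simp add: D)
    finally show "\<alpha> c1 (snd c1 x) us = desc (\<alpha> c2 (snd c2 x)) ?D2 (map ?D1 us)" .
  qed
  moreover have "map ?D2 (map ?E vs) = map ?D1 vs" by (simp add: D)
  ultimately show "tcomp r s \<alpha> c1 (snd c1 x) vs = tcomp r s \<alpha> c2 (snd c2 x) (map ?E vs)"
    using tcomp_eq[OF \<alpha> ic(1) c1 ic(2,3), of r s vs] tcomp_eq[OF \<alpha> ic(1) c2 ic(2) y2, of r s "map ?E vs"]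
    by (simp only:)
qed

lemma fd_type_proj_zero:
  assumes "open S" "y \<in> S" "\<And>ws. smooth_on (\<lambda>z. a z ws) S" "\<And>ws. fd (\<lambda>z. a z ws) y v = 0"
  shows "fd (\<lambda>z. type_proj J r s (a z) ws) y v = 0"
proof (cases "length ws = r + s")
  case True
  have "((\<lambda>z. \<Sum>m<Suc (r + s). (cis (- (real r - real s) * (pi * m / Suc (r + s))) / of_nat (Suc (r + s)))
        * a z (map (rot J (pi * m / Suc (r + s))) ws)) has_derivative
    (\<lambda>h. \<Sum>m<Suc (r + s). (cis (- (real r - real s) * (pi * m / Suc (r + s))) / of_nat (Suc (r + s)))
        * fd (\<lambda>z. a z (map (rot J (pi * m / Suc (r + s))) ws)) y h)) (at y)"
    by (intro has_derivative_sum has_derivative_mult_right smooth_on_has_derivative[OF assms(3,2)])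
  then have "((\<lambda>z. type_proj J r s (a z) ws) has_derivative
    (\<lambda>h. \<Sum>m<Suc (r + s). (cis (- (real r - real s) * (pi * m / Suc (r + s))) / of_nat (Suc (r + s)))
        * fd (\<lambda>z. a z (map (rot J (pi * m / Suc (r + s))) ws)) y h)) (at y)"
    unfolding type_proj_def using True by (simp only: refl if_True)
  from fd_eqI[OF this] show ?thesis by (simp only: assms(4) mult_zero_right sum.neutral_const)
next
  case False
  then show ?thesis by (simp add: type_proj_def)
qed

text \<open>By \<open>ext_d_vertical\<close>, being basic means that the transverse coefficients are
  stationary along the leaves. The projection is a fixed linear combination of values, so it keeps
  this property.\<close>

lemma tcomp_basic:
  assumes \<alpha>: "\<alpha> \<in> basic_forms F"
  shows "tcomp r s \<alpha> \<in> basic_forms F"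
proof (rule basicI[OF tcomp_forms[OF \<alpha>]])
  fix i c c' y v vs
  assume i: "i \<in> I" and c: "c \<in> A" and c': "c' \<in> H i" and y: "y \<in> sdom i c c'" and v: "fd (G i c c') y v = 0"
  have c'K: "c' \<in> K i" using c' by simp
  note o = sdom_open[OF i c c'K]
  note sm = desc_basic_smooth[OF \<alpha> i c c']
  define a where "a z = desc (\<alpha> c z) (fd (G i c c') z)" for z
  have smb: "smooth_on (\<lambda>z. type_proj J r s (a z) ws) (sdom i c c')" for ws
    unfolding a_def by (rule type_proj_smooth[OF o sm])
  have altb: "alternating_form (type_proj J r s (a z))" if "z \<in> sdom i c c'" for z
    unfolding a_def by (rule desc_basic_alternating[OF \<alpha> i c c' that])
  have eqb: "tcomp r s \<alpha> c z us = type_proj J r s (a z) (map (fd (G i c c') z) us)" if "z \<in> sdom i c c'" for z us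
    unfolding a_def by (rule tcomp_eq[OF \<alpha> i c c' that])
  have "type_proj J r s (a y) (map (fd (G i c c') y) (v # vs)) = 0"
    using horizontal_type_proj[OF J_linear basic_horizontal(1)[OF \<alpha> i c c' y], of r s] v
    unfolding horizontal_def a_def by blast
  then have "tcomp r s \<alpha> c y (v # vs) = 0" using eqb[OF y] by metis
  moreover have "ext_d A (tcomp r s \<alpha>) c y (v # vs) = 0"
  proof -
    have "fd (\<lambda>z. a z ws) y v = 0" for ws
    proof -
      obtain us where us: "ws = map (fd (G i c c') y) us" using surj_map G_surj[OF i c c'K y] by blast
      have "fd (\<lambda>z. a z (map (fd (G i c c') y) us)) y v = ext_d A \<alpha> c y (v # us)"
      proof (rule ext_d_vertical[OF i c c'K y _ _ _ v, symmetric])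
        show "alternating_form (a z)" if "z \<in> sdom i c c'" for z
          unfolding a_def by (rule alternating_desc[OF basic_horizontal(1)[OF \<alpha> i c c' that]])
        show "smooth_on (\<lambda>z. a z ws) (sdom i c c')" for ws unfolding a_def by (rule sm)
        show "\<alpha> c z vs = a z (map (fd (G i c c') z) vs)" if "z \<in> sdom i c c'" for z vs
          unfolding a_def by (rule desc_map[OF basic_horizontal(1)[OF \<alpha> i c c' that], symmetric])
      qed
      also have "\<dots> = 0" using basic_horizontal(2)[OF \<alpha> i c c' y] v by (simp add: horizontal_def)
      finally show ?thesis using us by simp
    qed
    then have "fd (\<lambda>z. type_proj J r s (a z) ws) y v = 0" for ws
      by (intro fd_type_proj_zero[OF o y]) (use sm in \<open>simp_all add: a_def\<close>)
    then show ?thesis using ext_d_vertical[where a="\<lambda>z. type_proj J r s (a z)" and \<alpha>="tcomp r s \<alpha>", OF i c c'K y altb smb eqb v, of vs] by simp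
  qed
  ultimately show "tcomp r s \<alpha> c y (v # vs) = 0 \<and> ext_d A (tcomp r s \<alpha>) c y (v # vs) = 0" by blast
qed

lemma tcomp_type:
  assumes \<alpha>: "\<alpha> \<in> basic_forms F"
  shows "tcomp r s \<alpha> \<in> basic_type_forms F r s"
  unfolding basic_type_forms_def
proof (intro CollectI conjI tcomp_basic[OF \<alpha>] ballI impI)
  fix i c c' x assume i: "i \<in> I" and c: "c \<in> A" and c': "c' \<in> H i" and x: "x \<in> cov F i \<inter> fst c" "subm F i x \<in> fst c'"
  have y: "snd c x \<in> sdom i c c'" using sdom_iff[OF c, of x] x by simp
  show "\<exists>b\<in>type_forms J r s. \<forall>vs. tcomp r s \<alpha> c (snd c x) vs = b (map (fd (G i c c') (snd c x)) vs)"
    using tcomp_eq[OF \<alpha> i c c' y, of r s]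
      type_proj_in_type_forms[OF cspace alternating_desc[OF basic_horizontal(1)[OF \<alpha> i c c' y]], of r s] by blast
qed

lemma basic_type_forms_basic: "\<beta> \<in> basic_type_forms F r s \<Longrightarrow> \<beta> \<in> basic_forms F"
  by (simp add: basic_type_forms_def)

lemma basic_type_desc:
  assumes \<beta>: "\<beta> \<in> basic_type_forms F r s" and i: "i \<in> I" and c: "c \<in> A" and c': "c' \<in> H i" and y: "y \<in> sdom i c c'"
  shows "desc (\<beta> c y) (fd (G i c c') y) \<in> type_forms J r s"
proof -
  obtain x where x: "y = snd c x" "x \<in> cov F i" "x \<in> fst c" "subm F i x \<in> fst c'" using y by (rule sdomE)
  have "\<exists>b\<in>type_forms J r s. \<forall>vs. \<beta> c y vs = b (map (fd (G i c c') y) vs)"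
    using \<beta> i c c' x unfolding basic_type_forms_def by blast
  then obtain b where b: "b \<in> type_forms J r s" "\<And>vs. \<beta> c y vs = b (map (fd (G i c c') y) vs)" by blast
  have "c' \<in> K i" using c' by simp
  from desc_unique[OF G_surj[OF i c this y], of "\<beta> c y" b] b show ?thesis by simp
qed

lemma basic_eqI:
  assumes "\<alpha> \<in> forms A" "\<beta> \<in> forms A"
    and "\<And>i c c' y. i \<in> I \<Longrightarrow> c \<in> A \<Longrightarrow> c' \<in> H i \<Longrightarrow> y \<in> sdom i c c' \<Longrightarrow> \<alpha> c y = \<beta> c y"
  shows "\<alpha> = \<beta>"
proof (intro ext)
  fix c y vs
  show "\<alpha> c y vs = \<beta> c y vs"
  proof (cases "c \<in> A \<and> y \<in> snd c ` fst c")
    case True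
    then show ?thesis using sdom_cover[of c y] assms(3) by metis
  next
    case False
    then show ?thesis using formsD(1)[OF assms(1), of c y] formsD(1)[OF assms(2), of c y] by auto
  qed
qed

lemma tcomp_type_forms:
  assumes \<beta>: "\<beta> \<in> basic_type_forms F r' s'"
  shows "tcomp r s \<beta> = (if r = r' \<and> s = s' then \<beta> else 0)"
proof -
  note b = basic_type_forms_basic[OF \<beta>]
  show ?thesis
  proof (rule basic_eqI[OF tcomp_forms[OF b]])
    show "(if r = r' \<and> s = s' then \<beta> else 0) \<in> forms A"
      using basic_forms_forms[OF b] M.forms_zero by simp
    fix i c c' y assume ic: "i \<in> I" "c \<in> A" "c' \<in> H i" "y \<in> sdom i c c'"
    show "tcomp r s \<beta> c y = (if r = r' \<and> s = s' then \<beta> else 0) c y"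
      using tcomp_eq[OF b ic, of r s] type_proj_type_forms[OF basic_type_desc[OF \<beta> ic], of r s]
        desc_map[OF basic_horizontal(1)[OF b ic]] by (auto simp: fun_eq_iff)
  qed
qed

lemma basic_type_forms_zero:
  assumes "q < r \<or> q < s" "\<beta> \<in> basic_type_forms F r s"
  shows "\<beta> = 0"
proof (rule basic_eqI[OF basic_forms_forms[OF basic_type_forms_basic[OF assms(2)]] M.forms_zero])
  fix i c c' y assume ic: "i \<in> I" "c \<in> A" "c' \<in> H i" "y \<in> sdom i c c'"
  have "desc (\<beta> c y) (fd (G i c c') y) = 0"
    using basic_type_desc[OF assms(2) ic] type_forms_eq_zero[OF cspace assms(1)] by simp
  then show "\<beta> c y = 0 c y"
    using desc_map[OF basic_horizontal(1)[OF basic_type_forms_basic[OF assms(2)] ic]] by (auto simp: fun_eq_iff)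
qed

lemma desc_add: "desc (a + b) D = desc a D + desc b D"
  by (simp add: desc_def fun_eq_iff)

lemma tcomp_add: "tcomp r s (\<alpha> + \<beta>) = tcomp r s \<alpha> + tcomp r s \<beta>"
  by (auto simp: tcomp_def fun_eq_iff desc_add type_proj_add)

lemma tcomp_scale: "tcomp r s (cscale k \<alpha>) = cscale k (tcomp r s \<alpha>)"
  using type_proj_scale[of J r s k] by (auto simp: tcomp_def fun_eq_iff cscale_def desc_def[abs_def])

lemma basic_sum: "(\<And>i. i \<in> S \<Longrightarrow> f i \<in> basic_forms F) \<Longrightarrow> (\<Sum>i\<in>S. f i) \<in> basic_forms F"
  by (induction S rule: infinite_finite_induct) (simp_all add: basic_zero basic_add)

lemma tcomp_zero: "tcomp r s 0 = 0"
  by (auto simp: tcomp_def fun_eq_iff type_proj_def desc_def)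

lemma tcomp_sum: "tcomp r s (\<Sum>i\<in>S. f i) = (\<Sum>i\<in>S. tcomp r s (f i))"
  by (induction S rule: infinite_finite_induct) (simp_all only: sum.infinite sum.empty sum.insert tcomp_zero tcomp_add not_False_eq_True)

lemma tcomp_decomposition:
  assumes \<alpha>: "\<alpha> \<in> basic_forms F"
  shows "\<alpha> = (\<Sum>r\<le>q. \<Sum>s\<le>q. tcomp r s \<alpha>)"
proof (rule basic_eqI[OF basic_forms_forms[OF \<alpha>] basic_forms_forms])
  show "(\<Sum>r\<le>q. \<Sum>s\<le>q. tcomp r s \<alpha>) \<in> basic_forms F" by (intro basic_sum tcomp_basic \<alpha>)
  fix i c c' y assume ic: "i \<in> I" "c \<in> A" "c' \<in> H i" "y \<in> sdom i c c'"
  note h = basic_horizontal(1)[OF \<alpha> ic]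
  show "\<alpha> c y = (\<Sum>r\<le>q. \<Sum>s\<le>q. tcomp r s \<alpha>) c y"
  proof
    fix vs
    let ?a = "desc (\<alpha> c y) (fd (G i c c') y)" and ?ws = "map (fd (G i c c') y) vs"
    have "\<alpha> c y vs = ?a ?ws" by (rule desc_map[OF h, symmetric])
    also have "\<dots> = (\<Sum>r\<le>q. \<Sum>s\<le>q. type_proj J r s ?a) ?ws"
      using type_proj_decomposition[OF cspace alternating_desc[OF h]] by (rule fun_cong)
    also have "\<dots> = (\<Sum>r\<le>q. \<Sum>s\<le>q. tcomp r s \<alpha>) c y vs"
      by (simp add: sum_fun_apply tcomp_eq[OF \<alpha> ic])
    finally show "\<alpha> c y vs = (\<Sum>r\<le>q. \<Sum>s\<le>q. tcomp r s \<alpha>) c y vs" .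
  qed
qed

lemma tcomp_unique:
  assumes b: "\<And>r s. b r s \<in> basic_type_forms F r s" and \<alpha>: "\<alpha> = (\<Sum>r\<le>q. \<Sum>s\<le>q. b r s)"
  shows "b r s = tcomp r s \<alpha>"
proof -
  have "tcomp r s \<alpha> = (\<Sum>r'\<le>q. \<Sum>s'\<le>q. if s' = s then (if r' = r then b r s else 0) else 0)"
    unfolding \<alpha> tcomp_sum by (intro sum.cong refl) (auto simp: tcomp_type_forms[OF b])
  also have "\<dots> = (if r \<le> q \<and> s \<le> q then b r s else 0)" by (cases "s \<le> q"; cases "r \<le> q") simp_all
  also have "\<dots> = b r s" using basic_type_forms_zero[OF _ b, of r s] by auto
  finally show ?thesis by simp
qed

text \<open>The definite description is met by \<open>tcomp\<close>: existence is the decomposition,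
  uniqueness holds because \<open>tcomp\<close> isolates each summand of any decomposition.\<close>

lemma type_component_eq:
  assumes \<alpha>: "\<alpha> \<in> basic_forms F"
  shows "type_component q F r s \<alpha> = tcomp r s \<alpha>"
  unfolding type_component_def
proof (rule the_equality)
  show "\<exists>b. (\<forall>r s. b r s \<in> basic_type_forms F r s) \<and> \<alpha> = (\<Sum>r\<le>q. \<Sum>s\<le>q. b r s) \<and> tcomp r s \<alpha> = b r s"
    using tcomp_type[OF \<alpha>] tcomp_decomposition[OF \<alpha>] by (intro exI[of _ "\<lambda>r s. tcomp r s \<alpha>"]) blast
  show "\<beta> = tcomp r s \<alpha>" if "\<exists>b. (\<forall>r s. b r s \<in> basic_type_forms F r s) \<and> \<alpha> = (\<Sum>r\<le>q. \<Sum>s\<le>q. b r s) \<and> \<beta> = b r s" for \<beta>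
    using that tcomp_unique by blast
qed

text \<open>The coefficients of a form of type \<open>(r, s)\<close> rotate with frequency
  \<open>r - s\<close>, and so do their derivatives because \<open>J\<close> is the same at all
  points. The direction of differentiation contributes the frequencies 1 and -1. Thus only the
  characters of types \<open>(r + 1, s)\<close> and \<open>(r, s + 1)\<close> occur.\<close>

lemma tcomp_ext_d:
  assumes \<alpha>: "\<alpha> \<in> basic_type_forms F r s"
    and rs: "\<not> (r' = Suc r \<and> s' = s)" "\<not> (r' = r \<and> s' = Suc s)"
  shows "tcomp r' s' (ext_d A \<alpha>) = 0"
proof -
  note b = basic_type_forms_basic[OF \<alpha>]
  note db = basic_ext_d[OF b]
  show ?thesis
  proof (rule basic_eqI[OF tcomp_forms[OF db] M.forms_zero], intro ext)
    fix i c c' y vs assume i: "i \<in> I" and c: "c \<in> A" and c': "c' \<in> H i" and y: "y \<in> sdom i c c'"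
    have c'K: "c' \<in> K i" using c' by simp
    note o = sdom_open[OF i c c'K]
    define a where "a z = desc (\<alpha> c z) (fd (G i c c') z)" for z
    define D where "D = fd (G i c c') y"
    define e where "e = desc (ext_d A \<alpha> c y) D"
    have sm: "smooth_on (\<lambda>z. a z ws) (sdom i c c')" for ws
      unfolding a_def by (rule desc_basic_smooth[OF b i c c'])
    have typed: "a z \<in> type_forms J r s" if "z \<in> sdom i c c'" for z
      unfolding a_def by (rule basic_type_desc[OF \<alpha> i c c' that])
    have alt: "alternating_form (a z)" if "z \<in> sdom i c c'" for z
      unfolding a_def by (rule alternating_desc[OF basic_horizontal(1)[OF b i c c' that]])
    have eq: "\<alpha> c z vs = a z (map (fd (G i c c') z) vs)" if "z \<in> sdom i c c'" for z vs
      unfolding a_def by (rule desc_map[OF basic_horizontal(1)[OF b i c c' that], symmetric])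
    obtain \<sigma> where \<sigma>: "linear \<sigma>" "D \<circ> \<sigma> = id"
      using linear_surjective_right_inverse[OF G_linear[OF i c c'K y] G_surj[OF i c c'K y]] unfolding D_def by blast
    then have D\<sigma>: "D (\<sigma> w) = w" for w by (simp add: fun_eq_iff)
    \<comment> \<open>The derivative of the transverse coefficients in a transverse direction,
      lifted to the manifold by a linear section.\<close>
    define E where "E w us = fd (\<lambda>z. a z us) y (\<sigma> w)" for w us
    have Elin: "linear (\<lambda>w. E w us)" for us
      unfolding E_def using linear_compose[OF \<sigma>(1) smooth_on_linear_fd[OF sm y]] by (simp add: o_def)
    have ee: "e ws = (\<Sum>k<length ws. (-1) ^ k * E (ws ! k) (del_nth k ws))" for ws
    proof -
      have "e ws = ext_d A \<alpha> c y (map \<sigma> ws)"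
        unfolding e_def D_def by (rule desc_section[OF basic_horizontal(2)[OF b i c c' y]]) (use D\<sigma> in \<open>simp add: D_def\<close>)
      also have "\<dots> = (\<Sum>k<length (map \<sigma> ws). (-1) ^ k * fd (\<lambda>z. a z (del_nth k (map D (map \<sigma> ws)))) y (map \<sigma> ws ! k))"
        unfolding D_def by (rule ext_d_descended[where a=a and \<alpha>=\<alpha>, OF i c c'K y alt sm eq])
      also have "map D (map \<sigma> ws) = ws" by (simp add: D\<sigma> o_def)
      finally show ?thesis by (simp add: E_def)
    qed
    have Elen: "E w us = 0" if "length us \<noteq> r + s" for w us
    proof -
      have "((\<lambda>z. a z us) has_derivative (\<lambda>h. 0)) (at y)"
        by (rule has_derivative_transform_within_open[OF has_derivative_const o y])
          (simp add: type_forms_length[OF typed that])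
      then show ?thesis unfolding E_def by (rule fd_eqI)
    qed
    have Erot: "E w (map (rot J \<theta>) us) = cis ((real r - real s) * \<theta>) * E w us" for w us \<theta>
    proof -
      have "((\<lambda>z. a z (map (rot J \<theta>) us)) has_derivative (\<lambda>h. cis ((real r - real s) * \<theta>) * fd (\<lambda>z. a z us) y h)) (at y)"
        by (rule has_derivative_transform_within_open[OF has_derivative_mult_right[OF smooth_on_has_derivative[OF sm y]] o y])
          (simp add: type_forms_rot[OF typed])
      then show ?thesis unfolding E_def by (rule fd_eqI)
    qed
    have "type_proj J r' s' e ws = 0" for ws
    proof (cases "length ws = r' + s' \<and> r' + s' = Suc (r + s)")
      case False
      show ?thesis
      proof (cases "length ws = r' + s'")
        case True
        then have "length ws \<noteq> Suc (r + s)" using False by simp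
        then have "e us = 0" if "length us = length ws" for us
          unfolding ee using that by (intro sum.neutral) (auto simp: Elen length_del_nth)
        then show ?thesis unfolding type_proj_def by simp
      next
        case False
        then show ?thesis by (simp add: type_proj_def)
      qed
    next
      case True
      define e' where "e' = (\<Sum>k<length ws. (-1) ^ k * E (J (ws ! k)) (del_nth k ws))"
      \<comment> \<open>With \<open>e'\<close> the same sum for directions multiplied by
        \<open>J\<close>, the combination \<open>cos \<theta> * e ws + sin \<theta> * e'\<close> has
        these halves as its coefficients at \<open>cis \<theta>\<close> and
        \<open>cis (- \<theta>)\<close>.\<close>
      define Q where "Q j = (if j = Suc r then (e ws - \<i> * e') / 2 else if j = r then (e ws + \<i> * e') / 2 else 0)" for j
      have "type_proj J r' s' e ws = Q r'"
      proof (rule type_proj_eigen)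
        show "length ws = r' + s'" using True by simp
        fix \<theta>
        let ?c = "cis ((real r - real s) * \<theta>)"
        have "e (map (rot J \<theta>) ws) = (\<Sum>k<length ws. (-1) ^ k * (?c * (of_real (cos \<theta>) * E (ws ! k) (del_nth k ws)
            + of_real (sin \<theta>) * E (J (ws ! k)) (del_nth k ws))))"
          unfolding ee length_map
        proof (intro sum.cong refl arg_cong2[where f="(*)"])
          fix k assume k: "k \<in> {..<length ws}"
          have "E (map (rot J \<theta>) ws ! k) (del_nth k (map (rot J \<theta>) ws)) = ?c * E (rot J \<theta> (ws ! k)) (del_nth k ws)"
            using k by (simp add: map_del_nth[symmetric] Erot)
          also have "E (rot J \<theta> (ws ! k)) (del_nth k ws) = of_real (cos \<theta>) * E (ws ! k) (del_nth k ws)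
              + of_real (sin \<theta>) * E (J (ws ! k)) (del_nth k ws)"
            by (simp add: rot_def linear_add[OF Elin] linear_cmul[OF Elin] scaleR_conv_of_real)
          finally show "E (map (rot J \<theta>) ws ! k) (del_nth k (map (rot J \<theta>) ws)) = ?c * (of_real (cos \<theta>) * E (ws ! k) (del_nth k ws)
            + of_real (sin \<theta>) * E (J (ws ! k)) (del_nth k ws))" .
        qed
        also have "\<dots> = ?c * (of_real (cos \<theta>) * e ws + of_real (sin \<theta>) * e')"
          unfolding ee e'_def by (simp add: sum_distrib_left sum.distrib distrib_left mult_ac)
        also have "of_real (cos \<theta>) * e ws + of_real (sin \<theta>) * e'
            = cis \<theta> * ((e ws - \<i> * e') / 2) + cis (- \<theta>) * ((e ws + \<i> * e') / 2)"
          by (simp add: complex_eq_iff field_simps)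
        also have "?c * (cis \<theta> * ((e ws - \<i> * e') / 2) + cis (- \<theta>) * ((e ws + \<i> * e') / 2))
            = cis ((2 * real (Suc r) - real (r' + s')) * \<theta>) * Q (Suc r) + cis ((2 * real r - real (r' + s')) * \<theta>) * Q r"
        proof -
          have k: "real (r' + s') = real r + real s + 1" using True by simp
          have "?c * cis \<theta> = cis ((2 * real (Suc r) - real (r' + s')) * \<theta>)"
            unfolding cis_mult k by (simp add: algebra_simps)
          moreover have "?c * cis (- \<theta>) = cis ((2 * real r - real (r' + s')) * \<theta>)"
            unfolding cis_mult k by (simp add: algebra_simps)
          ultimately show ?thesis by (simp only: distrib_left mult.assoc[symmetric]) (simp add: Q_def)
        qed
        also have "\<dots> = (\<Sum>j\<in>{r, Suc r}. cis ((2 * real j - real (r' + s')) * \<theta>) * Q j)" by (simp add: add.commute)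
        also have "\<dots> = (\<Sum>j\<le>r' + s'. cis ((2 * real j - real (r' + s')) * \<theta>) * Q j)"
          by (rule sum.mono_neutral_left) (use True in \<open>auto simp: Q_def\<close>)
        finally show "e (map (rot J \<theta>) ws) = (\<Sum>j\<le>r' + s'. cis ((2 * real j - real (r' + s')) * \<theta>) * Q j)" .
      qed
      also have "\<dots> = 0" using rs True by (auto simp: Q_def)
      finally show ?thesis .
    qed
    then show "tcomp r' s' (ext_d A \<alpha>) c y vs = 0 c y vs"
      using tcomp_eq[OF db i c c' y, of r' s' vs] by (simp add: e_def D_def)
  qed
qed

lemma tcomp_length: "length vs \<noteq> r + s \<Longrightarrow> tcomp r s \<alpha> c y vs = 0"
  by (simp add: tcomp_def type_proj_def)

lemma tcomp_homogeneous:
  assumes "\<alpha> \<in> homogeneous k" "r + s \<noteq> k"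
  shows "tcomp r s \<alpha> = 0"
proof (intro ext)
  fix c y vs
  show "tcomp r s \<alpha> c y vs = 0 c y vs"
  proof (cases "length vs = r + s")
    case True
    have "desc (\<alpha> c y) (chosen c y) ws = 0" if "length ws = r + s" for ws
      using assms that unfolding homogeneous_def desc_def mem_Collect_eq by (metis length_map)
    then show ?thesis using True by (simp add: tcomp_def type_proj_def)
  next
    case False
    then show ?thesis by (simp add: tcomp_length)
  qed
qed

end

section \<open>The basic Dolbeault double complex\<close>

context holomorphic_foliation
begin

abbreviation "Vb \<equiv> basic_forms F"
abbreviation "Tb \<equiv> basic_type_forms F"

lemma Tb_eq: "\<beta> \<in> Tb r s \<longleftrightarrow> \<beta> \<in> Vb \<and> tcomp r s \<beta> = \<beta>"
  using tcomp_type_forms[of \<beta> r s r s] tcomp_type[of \<beta> r s] basic_type_forms_basic[of \<beta> r s] by auto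

lemma subspace_Vb: "fs.subspace Vb"
  by (rule fs.subspaceI[OF basic_zero basic_add basic_scale])

lemma subspace_Tb: "fs.subspace (Tb r s)"
  by (rule fs.subspaceI; simp only: Tb_eq)
    (use basic_zero basic_add basic_scale tcomp_zero tcomp_add tcomp_scale in \<open>auto\<close>)

lemma tcomp_lin: "lin_on Vb (tcomp r s)"
  using subspace_Vb by (simp only: lin_on_def tcomp_add tcomp_scale) simp

lemma ext_d_lin: "lin_on Vb (ext_d A)"
  using subspace_Vb M.ext_d_add M.ext_d_scale basic_forms_forms by (simp only: lin_on_def) blast

lemma lin_on_compose:
  assumes "lin_on Vb f" "lin_on Vb g" "\<And>x. x \<in> Vb \<Longrightarrow> f x \<in> Vb"
  shows "lin_on Vb (\<lambda>x. g (f x))"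
  using assms unfolding lin_on_def by simp

lemma lin_on_sumI:
  assumes "\<And>i. i \<in> S \<Longrightarrow> lin_on Vb (f i)"
  shows "lin_on Vb (\<lambda>x. \<Sum>i\<in>S. f i x)"
  using assms subspace_Vb unfolding lin_on_def by (simp add: sum.distrib fs.scale_sum_right)

lemma lin_on_eqI:
  assumes f: "lin_on Vb f" and g: "lin_on Vb g" and eq: "\<And>r s x. x \<in> Tb r s \<Longrightarrow> f x = g x" and x: "x \<in> Vb"
  shows "f x = g x"
proof -
  have e: "h x = (\<Sum>r\<le>q. \<Sum>s\<le>q. h (tcomp r s x))" if h: "lin_on Vb h" for h
  proof -
    have "h x = h (\<Sum>r\<le>q. \<Sum>s\<le>q. tcomp r s x)" using tcomp_decomposition[OF x] by simp
    also have "\<dots> = (\<Sum>r\<le>q. h (\<Sum>s\<le>q. tcomp r s x))"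
      by (rule lin_on_sum'[OF h]) (intro basic_sum tcomp_basic x)
    also have "\<dots> = (\<Sum>r\<le>q. \<Sum>s\<le>q. h (tcomp r s x))"
      by (intro sum.cong refl lin_on_sum'[OF h] tcomp_basic x)
    finally show ?thesis .
  qed
  show ?thesis unfolding e[OF f] e[OF g] by (intro sum.cong refl eq[OF tcomp_type[OF x]])
qed

text \<open>Copies of the two operators with the definite descriptions replaced by
  \<open>tcomp\<close>; they agree with the originals on basic forms, which is all that kernels and
  images see.\<close>

definition del' :: "('m, 'v) form \<Rightarrow> ('m, 'v) form" where
  "del' \<alpha> = (\<Sum>r\<le>q. \<Sum>s\<le>q. tcomp (Suc r) s (ext_d A (tcomp r s \<alpha>)))"

definition delbar' :: "('m, 'v) form \<Rightarrow> ('m, 'v) form" where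
  "delbar' \<alpha> = (\<Sum>r\<le>q. \<Sum>s\<le>q. tcomp r (Suc s) (ext_d A (tcomp r s \<alpha>)))"

lemma del_eq: "\<alpha> \<in> Vb \<Longrightarrow> del q F \<alpha> = del' \<alpha>"
  unfolding del_def del'_def by (simp add: type_component_eq basic_ext_d tcomp_basic)

lemma delbar_eq: "\<alpha> \<in> Vb \<Longrightarrow> delbar q F \<alpha> = delbar' \<alpha>"
  unfolding delbar_def delbar'_def by (simp add: type_component_eq basic_ext_d tcomp_basic)

lemma comp_lin: "lin_on Vb (\<lambda>\<alpha>. tcomp r' s' (ext_d A (tcomp r s \<alpha>)))"
  by (intro lin_on_compose[OF _ tcomp_lin] lin_on_compose[OF tcomp_lin ext_d_lin] tcomp_basic basic_ext_d)

lemma del'_lin: "lin_on Vb del'" and delbar'_lin: "lin_on Vb delbar'"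
  unfolding del'_def[abs_def] delbar'_def[abs_def] by (intro lin_on_sumI comp_lin)+

lemma ext_d_zero: "ext_d A 0 = 0"
  by (rule lin_on_zero[OF ext_d_lin])

lemma comp_sum_Tb:
  assumes x: "x \<in> Tb r s"
  shows "(\<Sum>r'\<le>q. \<Sum>s'\<le>q. tcomp (g r') (h s') (ext_d A (tcomp r' s' x))) = tcomp (g r) (h s) (ext_d A x)"
proof -
  have "(\<Sum>r'\<le>q. \<Sum>s'\<le>q. tcomp (g r') (h s') (ext_d A (tcomp r' s' x)))
    = (\<Sum>r'\<le>q. \<Sum>s'\<le>q. if s' = s then (if r' = r then tcomp (g r) (h s) (ext_d A x) else 0) else 0)"
    by (intro sum.cong refl) (auto simp: tcomp_type_forms[OF x] ext_d_zero tcomp_zero)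
  also have "\<dots> = (if r \<le> q \<and> s \<le> q then tcomp (g r) (h s) (ext_d A x) else 0)"
    by (cases "s \<le> q"; cases "r \<le> q") simp_all
  also have "\<dots> = tcomp (g r) (h s) (ext_d A x)"
    using basic_type_forms_zero[OF _ x] by (auto simp: ext_d_zero tcomp_zero)
  finally show ?thesis .
qed

lemma del'_Tb: "x \<in> Tb r s \<Longrightarrow> del' x = tcomp (Suc r) s (ext_d A x)"
  unfolding del'_def by (rule comp_sum_Tb)

lemma delbar'_Tb: "x \<in> Tb r s \<Longrightarrow> delbar' x = tcomp r (Suc s) (ext_d A x)"
  unfolding delbar'_def by (rule comp_sum_Tb)

lemma del'_type: "x \<in> Tb r s \<Longrightarrow> del' x \<in> Tb (Suc r) s"
  by (simp add: del'_Tb tcomp_type basic_ext_d basic_type_forms_basic)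

lemma delbar'_type: "x \<in> Tb r s \<Longrightarrow> delbar' x \<in> Tb r (Suc s)"
  by (simp add: delbar'_Tb tcomp_type basic_ext_d basic_type_forms_basic)

lemma del'_basic: "x \<in> Vb \<Longrightarrow> del' x \<in> Vb" and delbar'_basic: "x \<in> Vb \<Longrightarrow> delbar' x \<in> Vb"
  unfolding del'_def delbar'_def by (intro basic_sum tcomp_basic basic_ext_d; assumption)+

lemma ext_d_split_Tb:
  assumes x: "x \<in> Tb r s"
  shows "ext_d A x = del' x + delbar' x"
proof -
  note dx = basic_ext_d[OF basic_type_forms_basic[OF x]]
  have t1: "tcomp (Suc r) s (ext_d A x) \<in> Tb (Suc r) s" and t2: "tcomp r (Suc s) (ext_d A x) \<in> Tb r (Suc s)"
    by (rule tcomp_type[OF dx])+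
  have z: "tcomp r' s' (ext_d A x) = tcomp r' s' (del' x + delbar' x)" for r' s'
    unfolding del'_Tb[OF x] delbar'_Tb[OF x] tcomp_add tcomp_type_forms[OF t1] tcomp_type_forms[OF t2]
    using tcomp_ext_d[OF x, of r' s'] by auto
  have v: "del' x + delbar' x \<in> Vb" by (intro basic_add del'_basic delbar'_basic basic_type_forms_basic[OF x])
  have "ext_d A x = (\<Sum>r\<le>q. \<Sum>s\<le>q. tcomp r s (ext_d A x))" by (rule tcomp_decomposition[OF dx])
  also have "\<dots> = (\<Sum>r\<le>q. \<Sum>s\<le>q. tcomp r s (del' x + delbar' x))" by (simp only: z)
  also have "\<dots> = del' x + delbar' x" by (rule tcomp_decomposition[OF v, symmetric])
  finally show ?thesis .
qed

lemma lin_on_plus: "lin_on Vb f \<Longrightarrow> lin_on Vb g \<Longrightarrow> lin_on Vb (\<lambda>x. f x + g x)"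
  unfolding lin_on_def by (simp add: fs.scale_right_distrib add_ac)

lemma lin_on_const_zero: "lin_on Vb (\<lambda>x. 0)"
  using subspace_Vb by (simp add: lin_on_def)

lemma ext_d_split: "x \<in> Vb \<Longrightarrow> ext_d A x = del' x + delbar' x"
  by (rule lin_on_eqI[OF ext_d_lin lin_on_plus[OF del'_lin delbar'_lin]]) (rule ext_d_split_Tb)

text \<open>The three expressions add up to \<open>d (d x) = 0\<close> and have different bidegrees,
  so each of them vanishes.\<close>

lemma dd_components:
  assumes x: "x \<in> Tb r s"
  shows "del' (del' x) = 0" "delbar' (delbar' x) = 0" "del' (delbar' x) + delbar' (del' x) = 0"
proof -
  note xv = basic_type_forms_basic[OF x]
  define a where "a = del' (del' x)"
  define b where "b = del' (delbar' x) + delbar' (del' x)"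
  define c where "c = delbar' (delbar' x)"
  have t: "a \<in> Tb (Suc (Suc r)) s" "b \<in> Tb (Suc r) (Suc s)" "c \<in> Tb r (Suc (Suc s))"
    unfolding a_def b_def c_def by (intro del'_type delbar'_type x fs.subspace_add[OF subspace_Tb])+
  have "0 = ext_d A (ext_d A x)" using M.ext_d_ext_d[OF basic_forms_forms[OF xv]] by simp
  also have "\<dots> = del' (ext_d A x) + delbar' (ext_d A x)" by (rule ext_d_split[OF basic_ext_d[OF xv]])
  also have "del' (ext_d A x) = del' (del' x) + del' (delbar' x)"
    using del'_lin del'_basic[OF xv] delbar'_basic[OF xv] unfolding ext_d_split[OF xv] lin_on_def by blast
  also have "delbar' (ext_d A x) = delbar' (del' x) + delbar' (delbar' x)"
    using delbar'_lin del'_basic[OF xv] delbar'_basic[OF xv] unfolding ext_d_split[OF xv] lin_on_def by blast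
  also have "del' (del' x) + del' (delbar' x) + (delbar' (del' x) + delbar' (delbar' x)) = a + b + c"
    by (simp only: a_def b_def c_def add.assoc)
  finally have s: "a + b + c = 0" by (rule sym)
  have "tcomp r' s' a + tcomp r' s' b + tcomp r' s' c = 0" for r' s'
    using arg_cong[OF s, of "tcomp r' s'"] by (simp only: tcomp_add tcomp_zero)
  note e = this[unfolded tcomp_type_forms[OF t(1)] tcomp_type_forms[OF t(2)] tcomp_type_forms[OF t(3)]]
  have "a = 0" using e[of "Suc (Suc r)" s] by simp
  moreover have "b = 0" using e[of "Suc r" "Suc s"] by simp
  moreover have "c = 0" using e[of r "Suc (Suc s)"] by simp
  ultimately show "del' (del' x) = 0" "delbar' (delbar' x) = 0" "del' (delbar' x) + delbar' (del' x) = 0"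
    by (simp_all only: a_def b_def c_def)
qed

lemma del_delbar_complex: "double_complex Vb Tb tcomp del' delbar' q"
proof
  show "fs.subspace Vb" "fs.subspace (Tb r s)" "Tb r s \<subseteq> Vb" for r s
    using subspace_Vb subspace_Tb basic_type_forms_basic by auto
  show "lin_on Vb (tcomp r s)" "lin_on Vb del'" "lin_on Vb delbar'" for r s
    by (rule tcomp_lin del'_lin delbar'_lin)+
  show "tcomp r s x = (if r = r' \<and> s = s' then x else 0)" if "x \<in> Tb r' s'" for x r s r' s'
    by (rule tcomp_type_forms[OF that])
  show "del' (del' x) = 0" if "x \<in> Vb" for x
    by (rule lin_on_eqI[OF lin_on_compose[OF del'_lin del'_lin del'_basic] lin_on_const_zero dd_components(1) that])
  show "delbar' (delbar' x) = 0" if "x \<in> Vb" for x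
    by (rule lin_on_eqI[OF lin_on_compose[OF delbar'_lin delbar'_lin delbar'_basic] lin_on_const_zero dd_components(2) that])
  show "del' (delbar' x) + delbar' (del' x) = 0" if "x \<in> Vb" for x
    by (rule lin_on_eqI[OF lin_on_plus[OF lin_on_compose[OF delbar'_lin del'_lin delbar'_basic]
          lin_on_compose[OF del'_lin delbar'_lin del'_basic]] lin_on_const_zero dd_components(3) that])
qed (rule tcomp_type tcomp_decomposition del'_type delbar'_type; assumption)+

sublocale C: double_complex Vb Tb tcomp del' delbar' q
  by (rule del_delbar_complex)

text \<open>The degree by number of arguments agrees with the degree by type, since
  \<open>tcomp r s\<close> is supported on lists of length \<open>r + s\<close>.\<close>

lemma homogeneous_Hm: "Vb \<inter> homogeneous k = C.Hm k"
proof (intro set_eqI iffI)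
  fix x assume "x \<in> Vb \<inter> homogeneous k"
  then show "x \<in> C.Hm k" unfolding C.Hm_def using tcomp_homogeneous[of x k] by auto
next
  fix x assume x: "x \<in> C.Hm k"
  then have xv: "x \<in> Vb" by (rule C.Hm_V)
  have "x c y vs = 0" if "length vs \<noteq> k" for c y vs
  proof -
    have "tcomp r s x c y vs = 0" for r s
    proof (cases "r + s = k")
      case True
      then show ?thesis using that by (simp add: tcomp_length)
    next
      case False
      then have "tcomp r s x = 0" using x unfolding C.Hm_def by blast
      then show ?thesis by simp
    qed
    then have "(\<Sum>r\<le>q. \<Sum>s\<le>q. tcomp r s x) c y vs = 0" by (simp add: sum_fun_apply)
    then show ?thesis using tcomp_decomposition[OF xv] by simp
  qed
  then show "x \<in> Vb \<inter> homogeneous k" using xv by (auto simp: homogeneous_def)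
qed

lemma Ker_ext_d: "basic_Ker F (basic_d F) = C.Z"
  unfolding basic_Ker_def C.Z_def C.d_def using ext_d_split by auto

lemma Im_ext_d: "basic_Im F (basic_d F) = C.Bd"
  unfolding basic_Im_def C.Bd_def C.d_def using ext_d_split by auto

lemma Ker_del: "basic_Ker F (del q F) = C.K1"
  unfolding basic_Ker_def C.K1_def using del_eq by auto

lemma Ker_delbar: "basic_Ker F (delbar q F) = C.K2"
  unfolding basic_Ker_def C.K2_def using delbar_eq by auto

lemma del_delbar_eq: "x \<in> Vb \<Longrightarrow> (del q F \<circ> delbar q F) x = del' (delbar' x)"
  by (simp add: delbar_eq del_eq delbar'_basic)

lemma Ker_del_delbar: "basic_Ker F (del q F \<circ> delbar q F) = C.K12"
  unfolding basic_Ker_def C.K12_def using del_delbar_eq by auto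

lemma Im_del: "basic_Im F (del q F) = C.I1"
  unfolding basic_Im_def C.I1_def by (intro image_cong refl del_eq)

lemma Im_delbar: "basic_Im F (delbar q F) = C.I2"
  unfolding basic_Im_def C.I2_def by (intro image_cong refl delbar_eq)

lemma Im_del_delbar: "basic_Im F (del q F \<circ> delbar q F) = C.I12"
  unfolding basic_Im_def C.I12_def by (intro image_cong refl del_delbar_eq)

lemma dim_basic_eq: "dim_basic F k = C.betti k"
proof -
  have "C.Z \<inter> homogeneous k = C.Z \<inter> C.Hm k"
    unfolding homogeneous_Hm[symmetric] by (auto simp: C.Z_def)
  moreover have "C.Bd \<inter> homogeneous k = C.Bd \<inter> C.Hm k"
    unfolding homogeneous_Hm[symmetric] using C.d_V by (auto simp: C.Bd_def)
  ultimately show ?thesis unfolding dim_basic_def C.betti_def Ker_ext_d Im_ext_d by simp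
qed

lemma dim_Dolbeault_eq: "dim_Dolbeault q F r s = C.h2 r s"
  unfolding dim_Dolbeault_def C.h2_def Ker_delbar Im_delbar ..

lemma dim_Bott_Chern_eq: "dim_Bott_Chern q F r s = C.bc r s"
  unfolding dim_Bott_Chern_def C.bc_def Ker_del Ker_delbar Im_del_delbar ..

lemma dim_Aeppli_eq: "dim_Aeppli q F r s = C.ae r s"
  unfolding dim_Aeppli_def C.ae_def ssum_def Ker_del_delbar Im_del Im_delbar ..

lemma deldelbar_lemma_eq: "deldelbar_lemma q F \<longleftrightarrow> C.K1 \<inter> C.K2 \<inter> C.Bd = C.I12"
  unfolding deldelbar_lemma_def Ker_del Ker_delbar Im_ext_d Im_del_delbar ..

end

section \<open>Conclusion for transversely holomorphic foliations\<close>

lemma sum_antidiagonal: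
  fixes f :: "nat \<Rightarrow> nat \<Rightarrow> 'a::comm_monoid_add"
  shows "(\<Sum>(r, s) | r + s = k. f r s) = (\<Sum>p<Suc k. f p (k - p))"
  by (rule sum.reindex_bij_witness[of _ "\<lambda>p. (p, k - p)" fst]) auto

theorem theorem3p3:
  fixes F :: "('m, 'v::real_inner, 't, 'w::real_inner, 'i) foliation_data"
    and n q :: nat
  assumes "transversely_holomorphic_foliation n q F"
    and "\<forall>r s. dim_Dolbeault q F r s < \<infinity>"
  shows "(\<forall>k. (\<Sum>(r, s) | r + s = k. dim_Bott_Chern q F r s + dim_Aeppli q F r s)
                \<ge> 2 * dim_basic F k) \<and>
         ((\<forall>k. (\<Sum>(r, s) | r + s = k. dim_Bott_Chern q F r s + dim_Aeppli q F r s)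
                = 2 * dim_basic F k)
          \<longleftrightarrow> deldelbar_lemma q F)"
proof -
  interpret holomorphic_foliation F n q by unfold_locales (rule assms(1))
  show ?thesis
    unfolding sum_antidiagonal dim_Bott_Chern_eq dim_Aeppli_eq dim_basic_eq deldelbar_lemma_eq
    using C.bott_chern_inequality C.bott_chern_equality assms(2) unfolding dim_Dolbeault_eq by blast
qed

end
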